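(* Let $n\geq 1$, and let $\mathbf a=(i,\alpha)$ and $\mathbf b=(j,\beta)$ be two elements of $\mathcal{P}_n^\Phi$ with $q=\mathrm{rank}\,\alpha$, $r=\mathrm{rank}\,\beta$, where $q>r$, or $q=r$ and $i\leq j$. Then the principal congruence $(\mathbf a,\mathbf b)^\sharp$ on $\mathcal{P}_n^\Phi$ is as follows. (In each item, all matrix entries $M_{sl}$ not explicitly specified are equal to $\Delta$, and all $\theta_s$ not explicitly specified are equal to $\Delta_{\mathbb N}$.) (i) If $\alpha=\beta$ and $i=j$, then $(\mathbf a,\mathbf b)^\sharp=\Delta_{\mathcal{P}_n^\Phi}=\mathrm{cg}(\Theta,M)$, with all $M_{sl}=\Delta$ and all $\theta_s=\Delta_{\mathbb N}$. (ii) If $\alpha=\beta$ and $i<j$, then $(\mathbf a,\mathbf b)^\sharp=\mathrm{cg}(\Theta,M)$, where all $M_{sl}=\Delta$ and $\theta_s=(i,j)^\sharp$ for $0\le s\le q$. (iii) If $q\geq 2$ and $(\alpha,\beta)\notin\mathscr H$, then $(\mathbf a,\mathbf b)^\sharp=R_{I_{qi}\cup I_{rj}}=\mathrm{cg}(\Theta,M)$, where $M_{sl}=R$ precisely when $D_{sl}\subseteq I_{qi}\cup I_{rj}$ (and $M_{sl}=\Delta$ otherwise), and $\theta_s=(m_s,m_s+1)^\sharp$ for $0\leq s\leq q$, where $m_s$ is the first index of an $R$-entry in row $s$. (iv) If $q\geq3$, $i=j$, $(\alpha,\beta)\in\mathscr H$ and $\alpha\ne\beta$, then with $N$ the normal closure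 of $\partial(\alpha,\beta)$ in $\mathcal S_q$, $(\mathbf a,\mathbf b)^\sharp=\mathrm{cg}(\Theta,M)$, where $M_{ql}=N$ for $l\ge i$; $M_{sl}=R$ for $0\le s<q$, $l\ge i$; $\theta_q=\Delta_{\mathbb N}$; $\theta_s=(i,i+1)^\sharp$ for $0\le s<q$. (v) If $q\geq3$, $i<j$, $(\alpha,\beta)\in\mathscr H$ and $\partial(\alpha,\beta)\in\mathcal A_q\setminus\{\mathrm{id}_q\}$, then with $N$ the normal closure of $\partial(\alpha,\beta)$ in $\mathcal S_q$, $(\mathbf a,\mathbf b)^\sharp=\mathrm{cg}(\Theta,M)$, where $M_{ql}=N$ for $l\ge i$; $M_{sl}=R$ for $0\le s<q$, $l\ge i$; $\theta_q=(i,j)^\sharp$; $\theta_s=(i,i+1)^\sharp$ for $0\le s<q$. (vi) If $q\geq3$, $i<j$, $(\alpha,\beta)\in\mathscr H$ and $\partial(\alpha,\beta)\notin\mathcal A_q$, then with $d=j-i$, $(\mathbf a,\mathbf b)^\sharp=\mathrm{cgx}(\Theta,M)$ with exceptional row $q$, where $M_{ql}=\mathcal A_q$ for $l\ge i$; $M_{sl}=R$ for $0\le s<q$, $l\ge i$; $\theta_q=(i,i+2d)^\sharp$; $\theta_s=(i,i+1)^\sharp$ for $0\le s<q$. (vii) If $q=2$, $i=j$, $(\alpha,\beta)\in\mathscr H$ and $\alpha\neq\beta$, then $(\mathbf a,\mathbf b)^\sharp=\mathrm{cg}(\Theta,M)$, where $M_{2l}=\mathcal S_2$ and $M_{1l}=M_{0l}=\mu$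 for $l\ge i$, and all $\theta_s=\Delta_{\mathbb N}$. (viii) If $q=2$, $i<j$, $(\alpha,\beta)\in\mathscr H$ and $\alpha\neq\beta$, then with $d=j-i$, $(\mathbf a,\mathbf b)^\sharp=\mathrm{cgx}(\Theta,M)$ with exceptional row $2$, where $M_{1l}=M_{0l}=\mu$ for $l\ge i$ (and row $2$ consists of $\Delta$s); $\theta_2=(i,i+2d)^\sharp$; $\theta_1=\theta_0=(i,i+d)^\sharp$. (ix) If $q=1$ and $i\leq j$, and if $(\alpha,\beta)$ belongs to $R_{I_1}\setminus(\lambda_1\cup\rho_1)$, $\lambda_1\setminus\mu_1$ or $\rho_1\setminus\mu_1$, then with $\xi=R$, $\lambda$ or $\rho$ respectively, $(\mathbf a,\mathbf b)^\sharp=\mathrm{cg}(\Theta,M)$, where $M_{1l}=M_{0l}=\xi$ for $l\ge i$ and $\theta_0=\theta_1=(i,i+1)^\sharp$. (x) If $q=1$, $r=0$ and $i>j$, and if $(\alpha,\beta)$ belongs to $R_{I_1}\setminus(\lambda_1\cup\rho_1)$, $\lambda_1\setminus\mu_1$ or $\rho_1\setminus\mu_1$, then with $\xi=R$, $\lambda$ or $\rho$ respectively, $(\mathbf a,\mathbf b)^\sharp=\mathrm{cg}(\Theta,M)$, where $M_{1l}=\xi$ for $l\ge i$, $M_{0l}=\xi$ for $l\ge j$, $\theta_1=(i,i+1)^\sharp$ and $\theta_0=(j,j+1)^\sharp$. (xi) If $q=0$ and $i\leq j$, and if $(\alpha,\beta)$ belongs to $R_{I_0}\setminus(\lambda_0\cup\rho_0)$,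 $\lambda_0\setminus\Delta_{D_0}$ or $\rho_0\setminus\Delta_{D_0}$, then with $\xi=R$, $\lambda$ or $\rho$ respectively, $(\mathbf a,\mathbf b)^\sharp=\mathrm{cg}(\Theta,M)$, where $M_{0l}=\xi$ for $l\ge i$ and $\theta_0=(i,i+1)^\sharp$. (xii) If $q=r=1$ and $i=j$, and if $(\alpha,\beta)$ belongs to $\mu_1\setminus(\mu^\uparrow\cup\mu^\downarrow)$, $\mu^\uparrow\setminus\Delta_{D_1}$ or $\mu^\downarrow\setminus\Delta_{D_1}$, then with $\zeta=\mu$, $\mu^\uparrow$ or $\mu^\downarrow$ respectively, $(\mathbf a,\mathbf b)^\sharp=\mathrm{cg}(\Theta,M)$, where $M_{1i}=\zeta$, $M_{1l}=\mu$ for $l>i$, $M_{0l}=\mu$ for $l\ge i$, and all $\theta_s=\Delta_{\mathbb N}$. (xiii) If $q=r=1$, $i<j$ and $(\alpha,\beta)\in\mu_1\setminus\Delta_{D_1}$, then $(\mathbf a,\mathbf b)^\sharp=\mathrm{cg}(\Theta,M)$, where $M_{1l}=M_{0l}=\mu$ for $l\ge i$ and $\theta_0=\theta_1=(i,j)^\sharp$. (xiv) If $q=1$, $r=0$, $i\leq j$ and $\widehat\alpha=\beta$, then $(\mathbf a,\mathbf b)^\sharp=\mathrm{cg}(\Theta,M)$, where $M_{1l}=M_{0l}=\mu$ for $l\ge i$ and $\theta_0=\theta_1=(i,j+1)^\sharp$. (xv) If $q=1$, $r=0$, $i=j+1$ and $\widehat\alpha=\beta$, then $(\mathbf a,\mathbf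 b)^\sharp=\mathrm{cg}(\Theta,M)$, where $M_{1l}=\mu$ for $l\ge i$, $M_{0l}=\mu$ for $l\ge j$, and all $\theta_s=\Delta_{\mathbb N}$. (xvi) If $q=1$, $r=0$, $i>j+1$ and $\widehat\alpha=\beta$, then with $d=i-j-1$, $(\mathbf a,\mathbf b)^\sharp=\mathrm{cg}(\Theta,M)$, where $M_{1l}=\mu$ for $l\ge i$, $M_{0l}=\mu$ for $l\ge j$, $\theta_1=(i+1,i+1+d)^\sharp$ and $\theta_0=(j+1,j+1+d)^\sharp$. The congruences described in items (i)–(xvi) exhaust all principal congruences on $\mathcal{P}_n^\Phi$.
   Context: **Monoids.** Let $\mathbb{N}=\{0,1,2,\dots\}$, $[n]=\{1,\dots,n\}$, with disjoint copies $[n]'$, $[n]''$. The partition monoid $\mathcal{P}_n$ consists of all set partitions of $[n]\cup[n]'$. For $\alpha,\beta\in\mathcal{P}_n$ the product graph $\Gamma(\alpha,\beta)$ has vertex set $[n]\cup[n]''\cup[n]'$; two vertices of $[n]\cup[n]''$ are joined when they lie in a common block of $\alpha$ after renaming each $x'$ of $\alpha$ to $x''$, and two vertices of $[n]''\cup[n]'$ are joined when they lie in a common block of $\beta$ after renaming each $x$ of $\beta$ to $x''$. In $\alpha\beta$, $x,y\in[n]\cup[n]'$ are in the same block iff they are in the same component of $\Gamma(\alpha,\beta)$; $\Phi(\alpha,\beta)$ is the number of components of $\Gamma(\alpha,\beta)$ contained in $[n]''$. The twisted partition monoid is $\mathcal{P}_n^\Phi=\mathbb{N}\times\mathcal{P}_n$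 with $(i,\alpha)(j,\beta)=(i+j+\Phi(\alpha,\beta),\alpha\beta)$. **Notation in $\mathcal P_n$.** A transversal of $\alpha$ is a block meeting both $[n]$ and $[n]'$; $\mathrm{rank}\,\alpha$ is the number of transversals. $\mathscr L,\mathscr R,\mathscr H$ are Green's relations on $\mathcal{P}_n$. Let $D_q=\{\alpha:\mathrm{rank}\,\alpha=q\}$, $I_q=\{\alpha:\mathrm{rank}\,\alpha\le q\}$; in $\mathcal{P}_n^\Phi$ let $D_{qi}=\{i\}\times D_q$ and $I_{qi}=\{i,i+1,\dots\}\times I_q$. $\widehat\alpha\in D_0$ is obtained from $\alpha$ by splitting each transversal $A\cup B'$ into the two blocks $A$ and $B'$. If $\alpha\mathrel{\mathscr H}\beta$ have rank $q\geq 2$, and $\alpha$ has transversals $A_k\cup B_k'$ ($1\le k\le q$), then $\beta$ has transversals $A_k\cup B_{k\pi}'$ for some $\pi\in\mathcal S_q$ and otherwise the same blocks; put $\partial(\alpha,\beta)=\pi$ (well defined up to conjugacy in $\mathcal S_q$). $\mathcal S_q,\mathcal A_q$ are the symmetric and alternating groups. $\Delta_X$ is the equality relation on $X$. For an ideal $I$ of a monoid $S$, $R_I=\Delta_S\cup(I\times I)$. For $q\in\{0,1\}$: $\lambda_q=\{(\alpha,\beta)\in I_q\times I_q:\widehat\alpha\mathrel{\mathscr L}\widehat\beta\}\cup\Delta_{\mathcal P_n}$, $\rho_q=\{(\alpha,\beta)\in I_q\times I_q:\widehat\alpha\mathrel{\mathscr R}\widehat\beta\}\cup\Delta_{\mathcal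 P_n}$, $\mu_q=\{(\alpha,\beta)\in I_q\times I_q:\widehat\alpha=\widehat\beta\}\cup\Delta_{\mathcal P_n}$. Also $\mu^\uparrow=\{(\alpha,\beta)\in D_1\times D_1:\widehat\alpha=\widehat\beta,\ \alpha\mathrel{\mathscr R}\beta\}$ and $\mu^\downarrow=\{(\alpha,\beta)\in D_1\times D_1:\widehat\alpha=\widehat\beta,\ \alpha\mathrel{\mathscr L}\beta\}$. **Congruences.** For a monoid $S$ and $x,y\in S$, $(x,y)^\sharp$ is the congruence on $S$ generated by $(x,y)$ (a principal congruence). For $\theta=(m,m+d)^\sharp$ on the additive monoid $\mathbb N$ ($d\ge1$) put $\min\theta=m$; put $\min\Delta_{\mathbb N}=\infty$. **Congruence of a pair $(\Theta,M)$.** Here $\Theta=(\theta_0,\dots,\theta_n)$ is a chain $\theta_0\supseteq\dots\supseteq\theta_n$ of congruences on $\mathbb{N}$, and $M=(M_{qi})_{0\le q\le n,\ i\in\mathbb N}$ is a matrix with entries from the symbols $\Delta,\mu^\uparrow,\mu^\downarrow,\mu,\lambda,\rho,R$ and, in rows $q\ge2$, non-trivial normal subgroups $N$ of $\mathcal S_q$. For the pairs appearing in the theorem, $\mathrm{cg}(\Theta,M)$ is the set of pairs $((i,\alpha),(j,\beta))$ such that, with $q=\mathrm{rank}\,\alpha$, $r=\mathrm{rank}\,\beta$, one of the following holds: (C1) $M_{qi}=M_{rj}=\Delta$, $(i,j)\in\theta_q$, $\alpha=\beta$; (C2) $M_{qi}=M_{rj}=R$; (C3) $M_{qi}=M_{rj}=N$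 (a normal subgroup), $(i,j)\in\theta_q$, $\alpha\mathrel{\mathscr H}\beta$, $\partial(\alpha,\beta)\in N$; (C4) $M_{qi}=M_{rj}=\lambda$, $\widehat\alpha\mathrel{\mathscr L}\widehat\beta$; (C5) $M_{qi}=M_{rj}=\rho$, $\widehat\alpha\mathrel{\mathscr R}\widehat\beta$; (C6) $M_{qi}=M_{rj}=\mu^\downarrow$, $\widehat\alpha=\widehat\beta$, $\alpha\mathrel{\mathscr L}\beta$; (C7) $M_{qi}=M_{rj}=\mu^\uparrow$, $\widehat\alpha=\widehat\beta$, $\alpha\mathrel{\mathscr R}\beta$; (C8) $M_{qi}=M_{rj}=\mu$, $\widehat\alpha=\widehat\beta$, and either $q=r$ and $(i,j)\in\theta_q$; or $q\ne r$, $(i+r,j+q)\in\theta_0$, $i<\min\theta_q$ and $j<\min\theta_r$; or $q\neq r$, $(i+r,j+q)\in\theta_0$, $i\ge\min\theta_q$ and $j\geq\min\theta_r$. When $(\Theta,M)$ has exceptional row $q\ge 2$ (as specified in the theorem), with $\theta_q=(m,m+2d)^\sharp$, put $\theta_q^{\mathsf x}=(m,m+d)^\sharp$; then $\mathrm{cgx}(\Theta,M)$ is $\mathrm{cg}(\Theta,M)$ together with all pairs $((i,\alpha),(j,\beta))$ such that $\alpha,\beta\in D_q$ and (C9) $(i,j)\in\theta_q^{\mathsf x}\setminus\theta_q$, $\alpha\mathrel{\mathscr H}\beta$ and $\partial(\alpha,\beta)\in\mathcal S_q\setminus\mathcal A_q$. *)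

theory Defs
  imports
    "HOL-Algebra.Sym_Groups"
    "HOL-Library.Disjoint_Sets"
    "HOL-Library.Extended_Nat"
begin

definition congruence :: "('a, 'b) monoid_scheme \<Rightarrow> ('a \<times> 'a) set \<Rightarrow> bool" where
  "congruence S \<sigma> \<longleftrightarrow> equiv (carrier S) \<sigma> \<and>
     (\<forall>(x, y) \<in> \<sigma>. \<forall>s \<in> carrier S.
        (s \<otimes>\<^bsub>S\<^esub> x, s \<otimes>\<^bsub>S\<^esub> y) \<in> \<sigma> \<and> (x \<otimes>\<^bsub>S\<^esub> s, y \<otimes>\<^bsub>S\<^esub> s) \<in> \<sigma>)"

definition principal_cong :: "('a, 'b) monoid_scheme \<Rightarrow> 'a \<Rightarrow> 'a \<Rightarrow> ('a \<times> 'a) set" where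
  "principal_cong S x y = \<Inter> {\<sigma>. congruence S \<sigma> \<and> (x, y) \<in> \<sigma>}"

definition rees_cong :: "('a, 'b) monoid_scheme \<Rightarrow> 'a set \<Rightarrow> ('a \<times> 'a) set" where
  "rees_cong S I = Id_on (carrier S) \<union> I \<times> I"

text \<open>In a monoid \<open>S\<close> the principal left and right ideals of \<open>a\<close> are \<open>Sa\<close> and \<open>aS\<close>.\<close>

definition green_L :: "('a, 'b) monoid_scheme \<Rightarrow> ('a \<times> 'a) set" where
  "green_L S = {(a, b) \<in> carrier S \<times> carrier S.
     (\<lambda>s. s \<otimes>\<^bsub>S\<^esub> a) ` carrier S = (\<lambda>s. s \<otimes>\<^bsub>S\<^esub> b) ` carrier S}"

definition green_R :: "('a, 'b) monoid_scheme \<Rightarrow> ('a \<times> 'a) set" where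
  "green_R S = {(a, b) \<in> carrier S \<times> carrier S.
     (\<lambda>s. a \<otimes>\<^bsub>S\<^esub> s) ` carrier S = (\<lambda>s. b \<otimes>\<^bsub>S\<^esub> s) ` carrier S}"

definition green_H :: "('a, 'b) monoid_scheme \<Rightarrow> ('a \<times> 'a) set" where
  "green_H S = green_L S \<inter> green_R S"

definition normal_closure :: "('a, 'b) monoid_scheme \<Rightarrow> 'a \<Rightarrow> 'a set" where
  "normal_closure G x = \<Inter> {N. N \<lhd> G \<and> x \<in> N}"

definition nat_add_monoid :: "nat monoid" where
  "nat_add_monoid = \<lparr>carrier = UNIV, mult = (+), one = 0\<rparr>"

abbreviation nat_cong :: "nat \<Rightarrow> nat \<Rightarrow> (nat \<times> nat) set" where
  "nat_cong \<equiv> principal_cong nat_add_monoid"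

definition min_cong :: "(nat \<times> nat) set \<Rightarrow> enat" where
  "min_cong \<theta> = (if \<theta> = Id then \<infinity> else enat (THE m. \<exists>d\<ge>1. \<theta> = nat_cong m (m + d)))"

text \<open>\<open>Upper x\<close>, \<open>Middle x\<close> and \<open>Lower x\<close> stand for \<open>x\<close>, \<open>x''\<close> and \<open>x'\<close>.\<close>

datatype vertex = Upper nat | Middle nat | Lower nat

type_synonym partition = "vertex set set"

definition uppers :: "nat \<Rightarrow> vertex set" where
  "uppers n = Upper ` {1..n}"

definition middles :: "nat \<Rightarrow> vertex set" where
  "middles n = Middle ` {1..n}"

definition lowers :: "nat \<Rightarrow> vertex set" where
  "lowers n = Lower ` {1..n}"

definition partitions :: "nat \<Rightarrow> partition set" where
  "partitions n = {\<alpha>. partition_on (uppers n \<union> lowers n) \<alpha>}"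

primrec lower_to_middle :: "vertex \<Rightarrow> vertex" where
  "lower_to_middle (Upper x) = Upper x"
| "lower_to_middle (Middle x) = Middle x"
| "lower_to_middle (Lower x) = Middle x"

primrec upper_to_middle :: "vertex \<Rightarrow> vertex" where
  "upper_to_middle (Upper x) = Middle x"
| "upper_to_middle (Middle x) = Middle x"
| "upper_to_middle (Lower x) = Lower x"

text \<open>The edge relation of the product graph (symmetric, with loops); its reflexive transitive
  closure is the relation of lying in the same component.\<close>

definition product_edges :: "partition \<Rightarrow> partition \<Rightarrow> (vertex \<times> vertex) set" where
  "product_edges \<alpha> \<beta> =
     (\<Union>A\<in>\<alpha>. lower_to_middle ` A \<times> lower_to_middle ` A) \<union>
     (\<Union>B\<in>\<beta>. upper_to_middle ` B \<times> upper_to_middle ` B)"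

definition product_components :: "nat \<Rightarrow> partition \<Rightarrow> partition \<Rightarrow> vertex set set" where
  "product_components n \<alpha> \<beta> = (uppers n \<union> middles n \<union> lowers n) // (product_edges \<alpha> \<beta>)\<^sup>*"

definition part_mult :: "nat \<Rightarrow> partition \<Rightarrow> partition \<Rightarrow> partition" where
  "part_mult n \<alpha> \<beta> = (uppers n \<union> lowers n) //
     {(x, y) \<in> (uppers n \<union> lowers n) \<times> (uppers n \<union> lowers n). (x, y) \<in> (product_edges \<alpha> \<beta>)\<^sup>*}"

definition floating :: "nat \<Rightarrow> partition \<Rightarrow> partition \<Rightarrow> nat" where
  "floating n \<alpha> \<beta> = card {C \<in> product_components n \<alpha> \<beta>. C \<subseteq> middles n}"

definition part_one :: "nat \<Rightarrow> partition" where
  "part_one n = (\<lambda>k. {Upper k, Lower k}) ` {1..n}"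

definition part_monoid :: "nat \<Rightarrow> partition monoid" where
  "part_monoid n = \<lparr>carrier = partitions n, mult = part_mult n, one = part_one n\<rparr>"

definition twisted_monoid :: "nat \<Rightarrow> (nat \<times> partition) monoid" where
  "twisted_monoid n =
     \<lparr>carrier = UNIV \<times> partitions n,
      mult = (\<lambda>(i, \<alpha>) (j, \<beta>). (i + j + floating n \<alpha> \<beta>, part_mult n \<alpha> \<beta>)),
      one = (0, part_one n)\<rparr>"

definition transversals :: "partition \<Rightarrow> vertex set set" where
  "transversals \<alpha> = {A \<in> \<alpha>. A \<inter> range Upper \<noteq> {} \<and> A \<inter> range Lower \<noteq> {}}"

definition rank :: "partition \<Rightarrow> nat" where
  "rank \<alpha> = card (transversals \<alpha>)"

definition D_class :: "nat \<Rightarrow> nat \<Rightarrow> partition set" where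
  "D_class n q = {\<alpha> \<in> partitions n. rank \<alpha> = q}"

definition I_ideal :: "nat \<Rightarrow> nat \<Rightarrow> partition set" where
  "I_ideal n q = {\<alpha> \<in> partitions n. rank \<alpha> \<le> q}"

definition D_twisted :: "nat \<Rightarrow> nat \<Rightarrow> nat \<Rightarrow> (nat \<times> partition) set" where
  "D_twisted n q i = {i} \<times> D_class n q"

definition I_twisted :: "nat \<Rightarrow> nat \<Rightarrow> nat \<Rightarrow> (nat \<times> partition) set" where
  "I_twisted n q i = {i..} \<times> I_ideal n q"

text \<open>Intersecting every block with the upper and with the lower points changes the transversals
  only.\<close>

definition hat :: "partition \<Rightarrow> partition" where
  "hat \<alpha> = (\<Union>A\<in>\<alpha>. {A \<inter> range Upper, A \<inter> range Lower}) - {{}}"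

text \<open>\<open>is_diff_perm \<alpha> \<beta> \<pi>\<close>: with respect to some enumeration \<open>T 1, \<dots>, T q\<close> of the transversals of
  \<open>\<alpha>\<close>, where \<open>T k = A\<^sub>k \<union> B\<^sub>k'\<close>, the transversals of \<open>\<beta>\<close> are the sets \<open>A\<^sub>k \<union> B\<^sub>\<pi>\<^sub>k'\<close>, and the other blocks
  of \<open>\<alpha>\<close> and \<open>\<beta>\<close> agree.  The permutation depends on the enumeration, but only up to conjugacy, so
  that \<open>diff_perm\<close> picks an arbitrary representative.\<close>

definition is_diff_perm :: "partition \<Rightarrow> partition \<Rightarrow> (nat \<Rightarrow> nat) \<Rightarrow> bool" where
  "is_diff_perm \<alpha> \<beta> \<pi> \<longleftrightarrow> \<pi> permutes {1..rank \<alpha>} \<and>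
     \<alpha> - transversals \<alpha> = \<beta> - transversals \<beta> \<and>
     (\<exists>T. bij_betw T {1..rank \<alpha>} (transversals \<alpha>) \<and>
        transversals \<beta> = (\<lambda>k. (T k \<inter> range Upper) \<union> (T (\<pi> k) \<inter> range Lower)) ` {1..rank \<alpha>})"

definition diff_perm :: "partition \<Rightarrow> partition \<Rightarrow> (nat \<Rightarrow> nat)" where
  "diff_perm \<alpha> \<beta> = (SOME \<pi>. is_diff_perm \<alpha> \<beta> \<pi>)"

abbreviation Sym :: "nat \<Rightarrow> (nat \<Rightarrow> nat) set" where
  "Sym q \<equiv> carrier (sym_group q)"

abbreviation Alt :: "nat \<Rightarrow> (nat \<Rightarrow> nat) set" where
  "Alt q \<equiv> carrier (alt_group q)"

definition lambda_rel :: "nat \<Rightarrow> nat \<Rightarrow> (partition \<times> partition) set" where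
  "lambda_rel n q =
     {(\<alpha>, \<beta>) \<in> I_ideal n q \<times> I_ideal n q. (hat \<alpha>, hat \<beta>) \<in> green_L (part_monoid n)}
     \<union> Id_on (partitions n)"

definition rho_rel :: "nat \<Rightarrow> nat \<Rightarrow> (partition \<times> partition) set" where
  "rho_rel n q =
     {(\<alpha>, \<beta>) \<in> I_ideal n q \<times> I_ideal n q. (hat \<alpha>, hat \<beta>) \<in> green_R (part_monoid n)}
     \<union> Id_on (partitions n)"

definition mu_rel :: "nat \<Rightarrow> nat \<Rightarrow> (partition \<times> partition) set" where
  "mu_rel n q =
     {(\<alpha>, \<beta>) \<in> I_ideal n q \<times> I_ideal n q. hat \<alpha> = hat \<beta>} \<union> Id_on (partitions n)"

definition mu_up_rel :: "nat \<Rightarrow> (partition \<times> partition) set" where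
  "mu_up_rel n =
     {(\<alpha>, \<beta>) \<in> D_class n 1 \<times> D_class n 1. hat \<alpha> = hat \<beta> \<and> (\<alpha>, \<beta>) \<in> green_R (part_monoid n)}"

definition mu_down_rel :: "nat \<Rightarrow> (partition \<times> partition) set" where
  "mu_down_rel n =
     {(\<alpha>, \<beta>) \<in> D_class n 1 \<times> D_class n 1. hat \<alpha> = hat \<beta> \<and> (\<alpha>, \<beta>) \<in> green_L (part_monoid n)}"

datatype entry =
    E_Delta | E_mu_up | E_mu_down | E_mu | E_lambda | E_rho | E_R
  | E_N "(nat \<Rightarrow> nat) set"

text \<open>A chain \<open>(\<theta>\<^sub>0, \<dots>, \<theta>\<^sub>n)\<close> and a matrix with rows \<open>0, \<dots>, n\<close> are total functions here; their
  values at row indices above \<open>n\<close> are irrelevant, since ranks are at most \<open>n\<close>.\<close>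

type_synonym chain = "nat \<Rightarrow> (nat \<times> nat) set"
type_synonym entry_matrix = "nat \<Rightarrow> nat \<Rightarrow> entry"

definition cg ::
  "nat \<Rightarrow> chain \<Rightarrow> entry_matrix \<Rightarrow> ((nat \<times> partition) \<times> (nat \<times> partition)) set" where
  "cg n \<Theta> M = {((i, \<alpha>), (j, \<beta>)). \<alpha> \<in> partitions n \<and> \<beta> \<in> partitions n \<and>
     (let q = rank \<alpha>; r = rank \<beta> in
        (M q i = E_Delta \<and> M r j = E_Delta \<and> (i, j) \<in> \<Theta> q \<and> \<alpha> = \<beta>)
      \<or> (M q i = E_R \<and> M r j = E_R)
      \<or> (\<exists>N. M q i = E_N N \<and> M r j = E_N N \<and> (i, j) \<in> \<Theta> q \<and>
            (\<alpha>, \<beta>) \<in> green_H (part_monoid n) \<and> diff_perm \<alpha> \<beta> \<in> N)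
      \<or> (M q i = E_lambda \<and> M r j = E_lambda \<and> (hat \<alpha>, hat \<beta>) \<in> green_L (part_monoid n))
      \<or> (M q i = E_rho \<and> M r j = E_rho \<and> (hat \<alpha>, hat \<beta>) \<in> green_R (part_monoid n))
      \<or> (M q i = E_mu_down \<and> M r j = E_mu_down \<and> hat \<alpha> = hat \<beta> \<and>
            (\<alpha>, \<beta>) \<in> green_L (part_monoid n))
      \<or> (M q i = E_mu_up \<and> M r j = E_mu_up \<and> hat \<alpha> = hat \<beta> \<and>
            (\<alpha>, \<beta>) \<in> green_R (part_monoid n))
      \<or> (M q i = E_mu \<and> M r j = E_mu \<and> hat \<alpha> = hat \<beta> \<and>
            ((q = r \<and> (i, j) \<in> \<Theta> q)
           \<or> (q \<noteq> r \<and> (i + r, j + q) \<in> \<Theta> 0 \<and>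
                enat i < min_cong (\<Theta> q) \<and> enat j < min_cong (\<Theta> r))
           \<or> (q \<noteq> r \<and> (i + r, j + q) \<in> \<Theta> 0 \<and>
                enat i \<ge> min_cong (\<Theta> q) \<and> enat j \<ge> min_cong (\<Theta> r)))))}"

text \<open>For \<open>\<theta> = (m, m+2d)\<^sup>\<sharp>\<close> this is \<open>(m, m+d)\<^sup>\<sharp>\<close>; \<open>m\<close> and \<open>d\<close> are determined by \<open>\<theta>\<close>.\<close>

definition exceptional_cong :: "(nat \<times> nat) set \<Rightarrow> (nat \<times> nat) set" where
  "exceptional_cong \<theta> =
     (THE \<psi>. \<exists>m d. d \<ge> 1 \<and> \<theta> = nat_cong m (m + 2 * d) \<and> \<psi> = nat_cong m (m + d))"

text \<open>The parameter \<open>x\<close> is the exceptional row.\<close>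

definition cgx ::
  "nat \<Rightarrow> nat \<Rightarrow> chain \<Rightarrow> entry_matrix \<Rightarrow> ((nat \<times> partition) \<times> (nat \<times> partition)) set" where
  "cgx n x \<Theta> M = cg n \<Theta> M \<union>
     {((i, \<alpha>), (j, \<beta>)). \<alpha> \<in> D_class n x \<and> \<beta> \<in> D_class n x \<and>
        (i, j) \<in> exceptional_cong (\<Theta> x) - \<Theta> x \<and>
        (\<alpha>, \<beta>) \<in> green_H (part_monoid n) \<and> diff_perm \<alpha> \<beta> \<in> Sym x - Alt x}"

end

theory Submission
  imports Defs
begin

text \<open>A partition is handled through its three relations on points: upper-upper, upper-lower and lower-lower.
  The lower bounds come from multiplying the given pair by suitable partitions: a pair of rank at least \<open>2\<close> that
  is not \<open>\<H>\<close>-related is pushed to a pair of different ranks and then collapses the whole ideal, and for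
  \<open>\<H>\<close>-related pairs the permutations that relate elements of rank \<open>q\<close> on levels \<open>i\<close> and \<open>j\<close> form sets closed under
  composition, inversion and conjugation, so that their commutators produce the alternating group.
  On ranks \<open>0\<close> and \<open>1\<close> everything depends on the hats and on the weight \<open>l + 1 - q\<close> of an element of level \<open>l\<close>
  and rank \<open>q\<close>, because multiplication shifts this weight by the number of floating components of the hat.
  The upper bounds are congruences of the same three shapes, checked on the right and transferred to the left by the
  anti-automorphism that exchanges upper and lower points.\<close>

text \<open>Floating components raise the level, so a witness is useful only if its float counts
  with both members of the pair are known. Hence points that have no place in a construction are
  hung on some transversal, and many lemmas assert a float count of zero. Conversely, a factor that
  floats over only one member links different levels. Small ranks need care. Removing a transversal
  from an H-related pair of rank \<open>q\<close> leaves a pair of rank \<open>q - 1\<close> that is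
  not H-related: for \<open>q >= 3\<close> everything below collapses, for \<open>q = 2\<close> only
  \<open>mu\<close> relations arise. Commutators yield the alternating group except for a double
  transposition in degree 4, which is a commutator itself; the normal closure covers both outcomes.
  An odd permutation from level \<open>i\<close> to \<open>i + d\<close>, followed by its shifted
  inverse, links \<open>i\<close> with \<open>i + 2 * d\<close>, whence the doubled period of the
  exceptional row. Every congruence is written as \<open>reln n P\<close> with an explicit predicate
  \<open>P\<close>, and the relations given by chains and matrices are compared with
  \<open>P\<close>.\<close>

notation (input) iff  (infixr "<->" 25)

subsection \<open>Partitions as equivalence relations\<close>

definition verts :: "nat => vertex set" where
 "verts n = uppers n \<union> lowers n"

lemma verts_iff [simp]:
 "Upper x : verts n <-> x : {1..n}" "Lower x : verts n <-> x : {1..n}" "Middle x ~: verts n"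
 by (auto simp: verts_def uppers_def lowers_def)

lemma vertsE:
 assumes "v : verts n"
 obtains x where "v = Upper x" "x : {1..n}" | x where "v = Lower x" "x : {1..n}"
 using assms by (auto simp: verts_def uppers_def lowers_def)

lemma finite_verts [simp]: "finite (verts n)"
 by (simp add: verts_def uppers_def lowers_def)

definition rel :: "partition => vertex => vertex => bool" where
 "rel al v w <-> (EX A:al. v : A & w : A)"

abbreviation uu :: "partition => nat => nat => bool" where
 "uu al x y == rel al (Upper x) (Upper y)"

abbreviation ul :: "partition => nat => nat => bool" where
 "ul al x y == rel al (Upper x) (Lower y)"

abbreviation ll :: "partition => nat => nat => bool" where
 "ll al x y == rel al (Lower x) (Lower y)"

lemma rel_sym: "rel al v w ==> rel al w v"
 by (auto simp: rel_def)

lemma rel_lower_upper [simp]: "rel al (Lower y) (Upper x) <-> ul al x y"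
 by (auto simp: rel_def)

lemma partitionsD:
 assumes "al : partitions n"
 shows "\<Union>al = verts n" "{} ~: al" "!!A B v. [|A : al; B : al; v : A; v : B|] ==> A = B"
 using assms unfolding partitions_def partition_on_def disjoint_def verts_def by blast+

lemma rel_verts:
 assumes "al : partitions n" "rel al v w"
 shows "v : verts n" "w : verts n"
 using assms partitionsD(1)[OF assms(1)] unfolding rel_def by blast+

lemma rel_refl [simp]: "al : partitions n ==> rel al v v <-> v : verts n"
 using partitionsD(1)[of al n] unfolding rel_def by blast

lemma rel_trans: "[|al : partitions n; rel al u v; rel al v w|] ==> rel al u w"
 using partitionsD(3)[of al n] unfolding rel_def by metis

lemma uu_range: "[|al : partitions n; uu al x y|] ==> x : {1..n} & y : {1..n}"
 using rel_verts[of al n "Upper x" "Upper y"] by simp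

lemma ul_range: "[|al : partitions n; ul al x y|] ==> x : {1..n} & y : {1..n}"
 using rel_verts[of al n "Upper x" "Lower y"] by simp

lemma ll_range: "[|al : partitions n; ll al x y|] ==> x : {1..n} & y : {1..n}"
 using rel_verts[of al n "Lower x" "Lower y"] by simp

definition blk :: "partition => vertex => vertex set" where
 "blk al v = {w. rel al v w}"

lemma mem_blk [simp]: "w : blk al v <-> rel al v w"
 by (simp add: blk_def)

lemma blk_eq_block: "[|al : partitions n; A : al; v : A|] ==> blk al v = A"
 using partitionsD(3)[of al n] unfolding blk_def rel_def by blast

lemma partition_eq_blks: "al : partitions n ==> al = blk al ` verts n"
proof (intro equalityI subsetI)
 fix A assume a: "al : partitions n" "A : al"
 then obtain v where v: "v : A" using partitionsD(2) by (metis all_not_in_conv)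
 then have "v : verts n" using a partitionsD(1)[OF a(1)] by blast
 then show "A : blk al ` verts n" using blk_eq_block[OF a v] by blast
next
 fix A assume a: "al : partitions n" "A : blk al ` verts n"
 then obtain v where v: "v : verts n" "A = blk al v" by blast
 then obtain B where "B : al" "v : B" using partitionsD(1)[OF a(1)] by blast
 then show "A : al" using blk_eq_block[OF a(1)] v(2) by metis
qed

lemma blk_in: "[|al : partitions n; v : verts n|] ==> blk al v : al"
 using partition_eq_blks[of al n] by blast

lemma blk_eq_iff:
 "[|al : partitions n; w : verts n|] ==> blk al v = blk al w <-> rel al v w"
 using rel_trans[of al n] rel_sym[of al] rel_refl[of al n w] unfolding blk_def set_eq_iff mem_Collect_eq
 by metis

lemma partition_eqI:
 assumes "al : partitions n" "be : partitions n"
  "!!x y. uu al x y <-> uu be x y" "!!x y. ul al x y <-> ul be x y" "!!x y. ll al x y <-> ll be x y"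
 shows "al = be"
proof -
 have "rel al v w = rel be v w" if "v : verts n" for v w
 proof (cases "w : verts n")
  case True
  with that assms(3-5) show ?thesis by (cases v; cases w) simp_all
 next
  case False
  then show ?thesis using rel_verts[OF assms(1)] rel_verts[OF assms(2)] by blast
 qed
 then have "blk al ` verts n = blk be ` verts n"
  unfolding blk_def by (intro image_cong) auto
 then show ?thesis using partition_eq_blks assms(1,2) by metis
qed

text \<open>\<open>verts n\<close> contains no middle vertex, so \<open>lab\<close> never reaches
  the last equation.\<close>

primrec vlab :: "(nat => 'a) => (nat => 'a) => vertex => 'a" where
 "vlab f g (Upper x) = f x"
| "vlab f g (Lower x) = g x"
| "vlab f g (Middle x) = undefined"

text \<open>The blocks of \<open>lab n f g\<close> are the fibres of the labelling that maps \<open>x\<close> to \<open>f x\<close> and \<open>x'\<close> to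
 \<open>g x\<close>.\<close>

definition lab :: "nat => (nat => 'a) => (nat => 'a) => partition" where
 "lab n f g = (%v. {w : verts n. vlab f g w = vlab f g v}) ` verts n"

lemma lab_in [simp, intro]: "lab n f g : partitions n"
 unfolding partitions_def lab_def mem_Collect_eq verts_def[symmetric]
 by (rule partition_onI) (auto simp: disjnt_def)

lemma rel_lab: "rel (lab n f g) v w <-> v : verts n & w : verts n & vlab f g v = vlab f g w"
 unfolding rel_def lab_def by auto

lemma rel_lab_simps [simp]:
 "uu (lab n f g) x y <-> x : {1..n} & y : {1..n} & f x = f y"
 "ul (lab n f g) x y <-> x : {1..n} & y : {1..n} & f x = g y"
 "ll (lab n f g) x y <-> x : {1..n} & y : {1..n} & g x = g y"
 by (simp_all add: rel_lab)

subsection \<open>Products\<close>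

lemma edge_iff:
 "(v, w) : product_edges al be <->
  (EX v' w'. rel al v' w' & v = lower_to_middle v' & w = lower_to_middle w') |
  (EX v' w'. rel be v' w' & v = upper_to_middle v' & w = upper_to_middle w')"
 unfolding product_edges_def rel_def by blast

text \<open>The relation that \<open>al\<close> and \<open>be\<close> induce on the middle row of the product graph.\<close>

definition mid :: "partition => partition => (nat \<times> nat) set" where
 "mid al be = {(u, v). ll al u v | uu be u v}\<^sup>*"

text \<open>A labelling whose fibres are the components of the middle row. Products can then be
  computed with whatever labels the factors come with, without unfolding the closure in
  \<open>mid\<close>.\<close>

definition midh :: "nat => partition => partition => (nat => 'a) => bool" where
 "midh n al be h <-> (ALL u:{1..n}. ALL v:{1..n}. (u, v) : mid al be <-> h u = h v)"

lemma mid_refl [simp]: "(u, u) : mid al be"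
 by (simp add: mid_def)

lemma mid_sym: "(u, v) : mid al be ==> (v, u) : mid al be"
 unfolding mid_def by (rule symD[OF sym_rtrancl]) (auto simp: sym_def intro: rel_sym)

lemma mid_trans: "[|(u, v) : mid al be; (v, w) : mid al be|] ==> (u, w) : mid al be"
 unfolding mid_def by (rule rtrancl_trans)

lemma mid_ll: "ll al u v ==> (u, v) : mid al be"
 and mid_uu: "uu be u v ==> (u, v) : mid al be"
 by (auto simp: mid_def)

text \<open>The middle points through which a vertex enters the middle row.\<close>

primrec entry :: "partition => partition => vertex => nat => bool" where
 "entry al be (Upper x) u <-> ul al x u"
| "entry al be (Middle m) u <-> u = m"
| "entry al be (Lower y) u <-> ul be u y"

text \<open>A normal form of paths: since blocks are transitive already, a path either passes
  through the middle row in one stretch or stays inside one block of an outer row.\<close>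

definition conn :: "partition => partition => vertex => vertex => bool" where
 "conn al be v w <-> (EX u u'. entry al be v u & (u, u') : mid al be & entry al be w u') |
  (EX x x'. v = Upper x & w = Upper x' & uu al x x') |
  (EX y y'. v = Lower y & w = Lower y' & ll be y y')"

lemma sym_edges: "sym (product_edges al be)"
 by (auto simp: product_edges_def sym_def)

text \<open>Each of the seven kinds of edges is absorbed by the normal form: edges at outer points
  by transitivity within a factor, edges between middle points by \<open>mid\<close>.\<close>

lemma conn_step:
 assumes ab: "al : partitions n" "be : partitions n" and c: "conn al be v w" and e: "(w, w') : product_edges al be"
 shows "conn al be v w'"
proof -
 note t = rel_trans[OF ab(1)] rel_trans[OF ab(2)] rel_sym mid_trans mid_ll mid_uu
 from e consider
  (uu) x y where "w = Upper x" "w' = Upper y" "uu al x y"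
 | (um) x y where "w = Upper x" "w' = Middle y" "ul al x y"
 | (mu) x y where "w = Middle y" "w' = Upper x" "ul al x y"
 | (mm) x y where "w = Middle x" "w' = Middle y" "(x, y) : mid al be"
 | (ml) x y where "w = Middle x" "w' = Lower y" "ul be x y"
 | (lm) x y where "w = Lower y" "w' = Middle x" "ul be x y"
 | (ll) x y where "w = Lower x" "w' = Lower y" "ll be x y"
  unfolding edge_iff
  apply (elim disjE exE conjE)
  subgoal for v' w' using rel_verts[OF ab(1), of v' w']
   by (cases v'; cases w') (auto intro: mid_ll)
  subgoal for v' w' using rel_verts[OF ab(2), of v' w']
   by (cases v'; cases w') (auto intro: mid_uu)
  done
 then show ?thesis
 proof cases
  case uu
  from c uu(1) consider u u' where "entry al be v u" "(u, u') : mid al be" "ul al x u'"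
   | x0 where "v = Upper x0" "uu al x0 x"
   unfolding conn_def by auto
  then show ?thesis
  proof cases
   case 1
   moreover have "ul al y u'" using 1(3) uu(3) t(1,3) by blast
   ultimately show ?thesis unfolding conn_def uu(2) by auto
  next
   case 2
   then show ?thesis unfolding conn_def uu(2) using t(1) uu(3) by blast
  qed
 next
  case um
  from c um(1) consider u u' where "entry al be v u" "(u, u') : mid al be" "ul al x u'"
   | x0 where "v = Upper x0" "uu al x0 x"
   unfolding conn_def by auto
  then show ?thesis
  proof cases
   case 1
   moreover have "ll al u' y" using 1(3) um(3) t(1,3) by blast
   ultimately show ?thesis unfolding conn_def um(2) using mid_trans mid_ll by (metis entry.simps(2))
  next
   case 2
   then have "ul al x0 y" using t(1) um(3) by blast
   then show ?thesis unfolding conn_def um(2) 2(1) using mid_refl by (metis entry.simps(1,2))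
  qed
 next
  case mu
  from c mu(1) obtain u where "entry al be v u" "(u, y) : mid al be" unfolding conn_def by auto
  then show ?thesis unfolding conn_def mu(2) using mu(3) by auto
 next
  case mm
  from c mm(1) obtain u where "entry al be v u" "(u, x) : mid al be" unfolding conn_def by auto
  then show ?thesis unfolding conn_def mm(2) using mm(3) mid_trans by (metis entry.simps(2))
 next
  case ml
  from c ml(1) obtain u where "entry al be v u" "(u, x) : mid al be" unfolding conn_def by auto
  then show ?thesis unfolding conn_def ml(2) using ml(3) by auto
 next
  case lm
  from c lm(1) consider u u' where "entry al be v u" "(u, u') : mid al be" "ul be u' y"
   | y0 where "v = Lower y0" "ll be y0 y"
   unfolding conn_def by auto
  then show ?thesis
  proof cases
   case 1
   moreover have "uu be u' x" using 1(3) lm(3) t(2,3) by blast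
   ultimately show ?thesis unfolding conn_def lm(2) using mid_trans mid_uu by (metis entry.simps(2))
  next
   case 2
   then have "ul be x y0" using t(2,3) lm(3) by blast
   then show ?thesis unfolding conn_def lm(2) 2(1) using mid_refl by (metis entry.simps(2,3))
  qed
 next
  case ll
  from c ll(1) consider u u' where "entry al be v u" "(u, u') : mid al be" "ul be u' x"
   | y0 where "v = Lower y0" "ll be y0 x"
   unfolding conn_def by auto
  then show ?thesis
  proof cases
   case 1
   moreover have "ul be u' y" using 1(3) ll(3) t(2,3) by blast
   ultimately show ?thesis unfolding conn_def ll(2) by auto
  next
   case 2
   then show ?thesis unfolding conn_def ll(2) using t(2) ll(3) by blast
  qed
 qed
qed

text \<open>\<open>v\<close> is confined to the graph because the closure is reflexive everywhere,
  \<open>conn\<close> only there.\<close>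

lemma component_iff:
 assumes ab: "al : partitions n" "be : partitions n" and v: "v : uppers n \<union> middles n \<union> lowers n"
 shows "(v, w) : (product_edges al be)\<^sup>* <-> conn al be v w"
proof
 assume "(v, w) : (product_edges al be)\<^sup>*"
 then show "conn al be v w"
 proof (induction rule: rtrancl_induct)
  case base
  show ?case using v ab by (auto simp: conn_def uppers_def middles_def lowers_def intro: mid_refl)
 next
  case (step y z)
  then show ?case using conn_step[OF ab] by blast
 qed
next
 let ?E = "(product_edges al be)\<^sup>*"
 have e: "(x, Middle u) : ?E" if "entry al be x u" for x u
 proof (cases x)
  case (Upper x')
  then have "(x, Middle u) : product_edges al be"
   using that unfolding edge_iff by (metis entry.simps(1) lower_to_middle.simps(1,3))
  then show ?thesis by auto
 next
  case (Lower x')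
  then have "(x, Middle u) : product_edges al be"
   using that unfolding edge_iff by (metis entry.simps(3) rel_sym upper_to_middle.simps(1,3))
  then show ?thesis by auto
 qed (use that in auto)
 have m: "(Middle u, Middle u') : ?E" if "(u, u') : mid al be" for u u'
  using that unfolding mid_def
 proof (induction rule: rtrancl_induct)
  case (step y z)
  then have "(Middle y, Middle z) : product_edges al be"
   unfolding edge_iff by (metis (mono_tags) case_prodD lower_to_middle.simps(3) mem_Collect_eq upper_to_middle.simps(1))
  with step show ?case by auto
 qed auto
 assume "conn al be v w"
 then consider u u' where "entry al be v u" "(u, u') : mid al be" "entry al be w u'"
  | x x' where "v = Upper x" "w = Upper x'" "uu al x x'"
  | y y' where "v = Lower y" "w = Lower y'" "ll be y y'"
  unfolding conn_def by blast
 then show "(v, w) : ?E"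
 proof cases
  case 1
  then show ?thesis using e m symD[OF sym_rtrancl[OF sym_edges]] by (meson rtrancl_trans)
 next
  case 2
  then have "(v, w) : product_edges al be" unfolding edge_iff by (metis lower_to_middle.simps(1))
  then show ?thesis by auto
 next
  case 3
  then have "(v, w) : product_edges al be" unfolding edge_iff by (metis upper_to_middle.simps(3))
  then show ?thesis by auto
 qed
qed

lemma equiv_components: "equiv UNIV ((product_edges al be)\<^sup>*)"
 by (intro equivI refl_rtrancl sym_rtrancl sym_edges trans_rtrancl) simp

lemma equiv_part_mult:
 "equiv (verts n) {(x, y) : verts n \<times> verts n. (x, y) : (product_edges al be)\<^sup>*}"
proof (rule equivI)
 show "sym {(x, y) : verts n \<times> verts n. (x, y) : (product_edges al be)\<^sup>*}"
  using symD[OF sym_rtrancl[OF sym_edges]] by (auto intro!: symI)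
 show "trans {(x, y) : verts n \<times> verts n. (x, y) : (product_edges al be)\<^sup>*}"
  by (rule transI) (auto intro: rtrancl_trans)
qed (auto intro: refl_onI)

lemma part_mult_in [simp, intro]: "part_mult n al be : partitions n"
 unfolding part_mult_def partitions_def mem_Collect_eq verts_def[symmetric]
 by (rule partition_on_quotient[OF equiv_part_mult])

lemma rel_part_mult:
 "rel (part_mult n al be) v w <-> v : verts n & w : verts n & (v, w) : (product_edges al be)\<^sup>*"
proof -
 define R where "R = {(x, y) : verts n \<times> verts n. (x, y) : (product_edges al be)\<^sup>*}"
 have R: "equiv (verts n) R" unfolding R_def by (rule equiv_part_mult)
 have "rel (part_mult n al be) v w <-> (EX A:verts n // R. v : A & w : A)"
  by (simp add: rel_def part_mult_def verts_def R_def)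
 also have "\<dots> <-> (v, w) : R"
 proof
  assume "EX A:verts n // R. v : A & w : A"
  then obtain u where "(u, v) : R" "(u, w) : R" unfolding quotient_def by blast
  then show "(v, w) : R" using R unfolding equiv_def by (meson symD transD)
 next
  assume a: "(v, w) : R"
  then have v: "v : verts n" unfolding R_def by blast
  then have "v : R `` {v}" "w : R `` {v}" "R `` {v} : verts n // R"
   using a equiv_class_self[OF R] by (auto intro: quotientI)
  then show "EX A:verts n // R. v : A & w : A" by blast
 qed
 finally show ?thesis unfolding R_def by blast
qed

text \<open>Labellings with the same fibres take equally many values; counts of blocks and of
  components thus become counts of labels.\<close>

lemma card_image_eq:
 assumes "!!u v. [|u : F; v : F|] ==> f u = f v <-> g u = g v"
 shows "card (f ` F) = card (g ` F)"
proof -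
 have k: "inv_into F f (f u) : F" "f (inv_into F f (f u)) = f u" if "u : F" for u
  using that by (auto intro: inv_into_into f_inv_into_f)
 then have k': "g (inv_into F f (f u)) = g u" if "u : F" for u
  using that assms by blast
 have "bij_betw (%y. g (inv_into F f y)) (f ` F) (g ` F)"
  unfolding bij_betw_def
 proof
  show "inj_on (%y. g (inv_into F f y)) (f ` F)"
   using k' assms by (auto intro!: inj_onI)
  have "(%y. g (inv_into F f y)) ` f ` F = (%u. g (inv_into F f (f u))) ` F" by (simp add: image_image)
  also have "\<dots> = g ` F" using k' by (rule image_cong[OF refl])
  finally show "(%y. g (inv_into F f y)) ` f ` F = g ` F" .
 qed
 then show ?thesis by (rule bij_betw_same_card)
qed

lemma prod_rel:
 assumes ab: "al : partitions n" "be : partitions n" and h: "midh n al be h"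
 shows "uu (part_mult n al be) x y <-> uu al x y | (EX u v. ul al x u & ul al y v & h u = h v)"
  and "ul (part_mult n al be) x y <-> (EX u v. ul al x u & ul be v y & h u = h v)"
  and "ll (part_mult n al be) x y <-> ll be x y | (EX u v. ul be u x & ul be v y & h u = h v)"
  and "floating n al be = card (h ` {u : {1..n}. ALL v:{1..n}. h v = h u --> (ALL x. ~ul al x v & ~ul be v x)})"
proof -
 have h': "(u, v) : mid al be <-> h u = h v" if "u : {1..n}" "v : {1..n}" for u v
  using h that unfolding midh_def by blast
 have c: "rel (part_mult n al be) v w <-> v : verts n & w : verts n & conn al be v w" for v w
  unfolding rel_part_mult verts_def using component_iff[OF ab, of v w] by blast
 note r = ul_range[OF ab(1)] ul_range[OF ab(2)] uu_range[OF ab(1)] ll_range[OF ab(2)]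
 have "(EX u u'. ul al x u & (u, u') : mid al be & ul al y u') <-> (EX u v. ul al x u & ul al y v & h u = h v)"
  using h' r(1) by blast
 then show "uu (part_mult n al be) x y <-> uu al x y | (EX u v. ul al x u & ul al y v & h u = h v)"
  unfolding c conn_def verts_iff using r by simp blast
 have "(EX u u'. ul al x u & (u, u') : mid al be & ul be u' y) <-> (EX u v. ul al x u & ul be v y & h u = h v)"
  using h' r(1,2) by blast
 then show "ul (part_mult n al be) x y <-> (EX u v. ul al x u & ul be v y & h u = h v)"
  unfolding c conn_def verts_iff using r by simp blast
 have "(EX u u'. ul be u x & (u, u') : mid al be & ul be u' y) <-> (EX u v. ul be u x & ul be v y & h u = h v)"
  using h' r(2) by blast
 then show "ll (part_mult n al be) x y <-> ll be x y | (EX u v. ul be u x & ul be v y & h u = h v)"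
  unfolding c conn_def verts_iff using r by simp blast
 let ?F = "{u : {1..n}. ALL v:{1..n}. h v = h u --> (ALL x. ~ul al x v & ~ul be v x)}"
 let ?E = "(product_edges al be)\<^sup>*"
 have ce: "conn al be (Middle u) w <-> (EX u'. (u, u') : mid al be & entry al be w u')" for u w
  unfolding conn_def by auto
 have comp: "?E `` {Middle u} = {w. EX u'. (u, u') : mid al be & entry al be w u'}" if "u : {1..n}" for u
  using component_iff[OF ab, of "Middle u"] that ce by (auto simp: middles_def)
 have midr: "u' : {1..n}" if "(u, u') : mid al be" "u : {1..n}" for u u'
  using that unfolding mid_def
  by (induction rule: rtrancl_induct) (use ll_range[OF ab(1)] uu_range[OF ab(2)] in blast)+
 have sub: "?E `` {Middle u} \<subseteq> middles n <-> u : ?F" if u: "u : {1..n}" for u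
 proof
  assume s: "?E `` {Middle u} \<subseteq> middles n"
  have "~ul al x v & ~ul be v x" if "v : {1..n}" "h v = h u" for v x
  proof -
   have m: "(u, v) : mid al be" using h' u that by auto
   have "Upper x ~: ?E `` {Middle u}" "Lower x ~: ?E `` {Middle u}" using s by (auto simp: middles_def)
   then show ?thesis unfolding comp[OF u] using m by auto
  qed
  then show "u : ?F" using u by auto
 next
  assume f: "u : ?F"
  show "?E `` {Middle u} \<subseteq> middles n"
  proof
   fix w assume "w : ?E `` {Middle u}"
   then obtain u' where u': "(u, u') : mid al be" "entry al be w u'" unfolding comp[OF u] by blast
   then have "u' : {1..n}" using midr u by blast
   then have "u' : {1..n}" "h u' = h u" using h'[OF u] u'(1) by metis+
   then show "w : middles n" using f u'(2) by (cases w) (auto simp: middles_def)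
  qed
 qed
 have "{C : product_components n al be. C \<subseteq> middles n} = (%u. ?E `` {Middle u}) ` ?F"
 proof (intro equalityI subsetI)
  fix C assume "C : {C : product_components n al be. C \<subseteq> middles n}"
  then obtain v where v: "v : uppers n \<union> middles n \<union> lowers n" "C = ?E `` {v}" "C \<subseteq> middles n"
   unfolding product_components_def quotient_def by auto
  then have "v : middles n" by auto
  then obtain u where "v = Middle u" "u : {1..n}" unfolding middles_def by auto
  then show "C : (%u. ?E `` {Middle u}) ` ?F" using v sub by blast
 next
  fix C assume "C : (%u. ?E `` {Middle u}) ` ?F"
  then obtain u where u: "u : ?F" "C = ?E `` {Middle u}" by blast
  then have "Middle u : uppers n \<union> middles n \<union> lowers n" "u : {1..n}" by (auto simp: middles_def)
  then show "C : {C : product_components n al be. C \<subseteq> middles n}"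
   using u sub unfolding product_components_def by (auto intro: quotientI)
 qed
 moreover have "?E `` {Middle u} = ?E `` {Middle v} <-> h u = h v" if "u : ?F" "v : ?F" for u v
 proof -
  have "?E `` {Middle u} = ?E `` {Middle v} <-> (Middle u, Middle v) : ?E"
   using equiv_components[of al be] by (simp add: eq_equiv_class_iff)
  also have "\<dots> <-> (u, v) : mid al be"
   using component_iff[OF ab, of "Middle u" "Middle v"] that ce by (auto simp: middles_def)
  finally show ?thesis using h' that by auto
 qed
 then have "card ((%u. ?E `` {Middle u}) ` ?F) = card (h ` ?F)"
  by (intro card_image_eq) blast
 ultimately show "floating n al be = card (h ` ?F)"
  unfolding floating_def by simp
qed

lemma midhI:
 assumes "!!u v. ll al u v ==> h u = h v" "!!u v. uu be u v ==> h u = h v"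
  "!!u v. [|u : {1..n}; v : {1..n}; h u = h v|] ==> (u, v) : mid al be"
 shows "midh n al be h"
proof -
 have "h u = h v" if "(u, v) : mid al be" for u v
  using that unfolding mid_def by (induction rule: rtrancl_induct) (auto dest: assms(1,2))
 then show ?thesis unfolding midh_def using assms(3) by blast
qed

lemma mid_classes_iff: "mid al be `` {u} = mid al be `` {v} <-> (u, v) : mid al be"
proof
 assume "mid al be `` {u} = mid al be `` {v}"
 then show "(u, v) : mid al be" using mid_refl[of v al be] by blast
next
 assume "(u, v) : mid al be"
 then show "mid al be `` {u} = mid al be `` {v}" using mid_sym mid_trans by blast
qed

lemma midh_classes: "midh n al be (%u. mid al be `` {u})"
 unfolding midh_def by (simp add: mid_classes_iff)

definition udom :: "partition => nat set" where
 "udom al = {x. EX y. ul al x y}"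

definition ldom :: "partition => nat set" where
 "ldom al = {y. EX x. ul al x y}"

lemma mem_udom: "x : udom al <-> (EX y. ul al x y)"
 by (simp add: udom_def)

lemma mem_ldom: "y : ldom al <-> (EX x. ul al x y)"
 by (simp add: ldom_def)

lemma udom_sub: "al : partitions n ==> udom al \<subseteq> {1..n}"
 unfolding udom_def using ul_range by blast

lemma ldom_sub: "al : partitions n ==> ldom al \<subseteq> {1..n}"
 unfolding ldom_def using ul_range by blast

lemma finite_udom [simp]: "al : partitions n ==> finite (udom al)"
 using udom_sub finite_subset by blast

lemma finite_ldom [simp]: "al : partitions n ==> finite (ldom al)"
 using ldom_sub finite_subset by blast

lemma uu_ul: "[|al : partitions n; uu al x y; ul al x z|] ==> ul al y z"
 using rel_trans rel_sym by blast

lemma ll_ul: "[|al : partitions n; ll al y z; ul al x y|] ==> ul al x z"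
 using rel_trans rel_sym by blast

lemma ul_uu: "[|al : partitions n; ul al x z; ul al y z|] ==> uu al x y"
 using rel_trans rel_sym by blast

lemma ul_ll: "[|al : partitions n; ul al x y; ul al x z|] ==> ll al y z"
 using rel_trans rel_sym by blast

lemma uu_udom: "[|al : partitions n; uu al x y|] ==> x : udom al <-> y : udom al"
 unfolding mem_udom using uu_ul rel_sym by blast

lemma ll_ldom: "[|al : partitions n; ll al x y|] ==> x : ldom al <-> y : ldom al"
 unfolding mem_ldom using ll_ul rel_sym by blast

text \<open>Middle points with equal \<open>f\<close> are already joined inside
  \<open>lab n f g\<close>, and \<open>al\<close> adds no further joins if \<open>f\<close> is
  constant on its lower blocks. So \<open>f\<close> itself labels the components of the middle
  row.\<close>

lemma right_mult:
 assumes a: "al : partitions n" and f: "ALL u v. ll al u v --> f u = f v"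
 shows "uu (part_mult n al (lab n f g)) x y <-> uu al x y | (EX u v. ul al x u & ul al y v & f u = f v)"
  and "ul (part_mult n al (lab n f g)) x y <-> y : {1..n} & (EX u. ul al x u & f u = g y)"
  and "ll (part_mult n al (lab n f g)) x y <-> x : {1..n} & y : {1..n} & g x = g y"
  and "floating n al (lab n f g) = card (f ` {u : {1..n}. f u ~: g ` {1..n} & (ALL v:ldom al. f v ~= f u)})"
proof -
 have m: "midh n al (lab n f g) f" by (rule midhI) (auto dest: f[rule_format] intro: mid_uu)
 note p = prod_rel[OF a lab_in m]
 show "uu (part_mult n al (lab n f g)) x y <-> uu al x y | (EX u v. ul al x u & ul al y v & f u = f v)"
  by (rule p)
 show "ul (part_mult n al (lab n f g)) x y <-> y : {1..n} & (EX u. ul al x u & f u = g y)"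
  unfolding p rel_lab_simps using ul_range[OF a] by metis
 show "ll (part_mult n al (lab n f g)) x y <-> x : {1..n} & y : {1..n} & g x = g y"
  unfolding p rel_lab_simps by metis
 have "{u : {1..n}. ALL v:{1..n}. f v = f u --> (ALL x. ~ul al x v & ~ul (lab n f g) v x)}
   = {u : {1..n}. f u ~: g ` {1..n} & (ALL v:ldom al. f v ~= f u)}" (is "?A = ?B")
 proof (intro equalityI subsetI)
  fix u assume u: "u : ?A"
  then have "f u ~= g x" if "x : {1..n}" for x using that unfolding rel_lab_simps by blast
  moreover have "f v ~= f u" if "v : ldom al" for v using that u ul_range[OF a] unfolding mem_ldom by blast
  ultimately show "u : ?B" using u by blast
 next
  fix u assume u: "u : ?B"
  then have "~ul al x v" if "f v = f u" for v x using that unfolding mem_ldom[symmetric] by (auto simp: mem_ldom)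
  moreover have "~ul (lab n f g) v x" if "f v = f u" for v x using that u unfolding rel_lab_simps by force
  ultimately show "u : ?A" using u by blast
 qed
 then show "floating n al (lab n f g) = card (f ` {u : {1..n}. f u ~: g ` {1..n} & (ALL v:ldom al. f v ~= f u)})"
  using p(4) by simp
qed

subsection \<open>The flip anti-involution\<close>

primrec flipv :: "vertex => vertex" where
 "flipv (Upper x) = Lower x"
| "flipv (Middle x) = Middle x"
| "flipv (Lower x) = Upper x"

definition flip :: "partition => partition" where
 "flip al = (image flipv) ` al"

lemma flipv_flipv [simp]: "flipv (flipv v) = v"
 by (cases v) auto

lemma inj_flipv: "inj flipv"
 by (metis flipv_flipv injI)

lemma mem_flipv_image: "v : flipv ` A <-> flipv v : A"
 using image_iff flipv_flipv by metis

lemma flip_flip [simp]: "flip (flip al) = al"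
 by (simp add: flip_def image_image)

lemma rel_flip: "rel (flip al) v w <-> rel al (flipv v) (flipv w)"
 by (simp add: rel_def flip_def mem_flipv_image)

lemma rel_flip_simps [simp]:
 "uu (flip al) x y <-> ll al x y" "ul (flip al) x y <-> ul al y x" "ll (flip al) x y <-> uu al x y"
 by (simp_all add: rel_flip)

lemma udom_flip [simp]: "udom (flip al) = ldom al" and ldom_flip [simp]: "ldom (flip al) = udom al"
 by (simp_all add: udom_def ldom_def)

lemma flip_in [simp, intro]:
 assumes "al : partitions n" shows "flip al : partitions n"
proof -
 have "flipv ` verts n = verts n"
  by (auto simp: verts_def uppers_def lowers_def image_Un image_image)
 moreover have "partition_on (flipv ` verts n) (image flipv ` al - {{}})"
  using assms inj_flipv unfolding partitions_def verts_def[symmetric]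
  by (intro partition_on_inj_image) (auto intro: inj_on_subset)
 moreover have "image flipv ` al - {{}} = flip al"
  using partitionsD(2)[OF assms] unfolding flip_def by auto
 ultimately show ?thesis unfolding partitions_def verts_def by simp
qed

lemma flip_in_iff [simp]: "flip al : partitions n <-> al : partitions n"
 using flip_in flip_flip by metis

lemma mid_flip: "mid (flip be) (flip al) = mid al be"
 unfolding mid_def by (simp add: disj_commute)

lemma flip_mult:
 assumes "al : partitions n" "be : partitions n"
 shows "flip (part_mult n al be) = part_mult n (flip be) (flip al)"
  and "floating n (flip be) (flip al) = floating n al be"
proof -
 have m: "midh n (flip be) (flip al) (%u. mid al be `` {u})"
  using midh_classes[of n al be] unfolding midh_def mid_flip .
 note p = prod_rel[OF flip_in[OF assms(2)] flip_in[OF assms(1)] m] and p' = prod_rel[OF assms midh_classes]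
 show "flip (part_mult n al be) = part_mult n (flip be) (flip al)"
  by (rule partition_eqI[of _ n]) (auto simp: p p')
 show "floating n (flip be) (flip al) = floating n al be"
  unfolding p p' by (simp add: conj_commute)
qed

lemma flip_mult':
 assumes "al : partitions n" "be : partitions n"
 shows "part_mult n al be = flip (part_mult n (flip be) (flip al))"
 using flip_mult(1)[OF assms] flip_flip by metis

lemma flip_lab: "flip (lab n f g) = lab n g f"
 by (rule partition_eqI[of _ n]) auto

text \<open>The mirror image of \<open>right_mult\<close> under \<open>flip\<close>, which exchanges
  the two labellings of \<open>lab\<close>.\<close>

lemma left_mult:
 assumes a: "al : partitions n" and g: "ALL u v. uu al u v --> g u = g v"
 shows "uu (part_mult n (lab n f g) al) x y <-> x : {1..n} & y : {1..n} & f x = f y"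
  and "ul (part_mult n (lab n f g) al) x y <-> x : {1..n} & (EX u. ul al u y & g u = f x)"
  and "ll (part_mult n (lab n f g) al) x y <-> ll al x y | (EX u v. ul al u x & ul al v y & g u = g v)"
  and "floating n (lab n f g) al = card (g ` {u : {1..n}. g u ~: f ` {1..n} & (ALL v:udom al. g v ~= g u)})"
proof -
 have g': "ALL u v. ll (flip al) u v --> g u = g v" using g by simp
 note e = flip_mult'[OF lab_in a, of f g, unfolded flip_lab] flip_mult(2)[OF lab_in a, of f g, unfolded flip_lab, symmetric]
 note r = right_mult[of "flip al" n g f, OF flip_in[OF a] g']
 show "uu (part_mult n (lab n f g) al) x y <-> x : {1..n} & y : {1..n} & f x = f y"
  using r(3)[of x y] by (simp add: e)
 show "ul (part_mult n (lab n f g) al) x y <-> x : {1..n} & (EX u. ul al u y & g u = f x)"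
  using r(2)[of y x] by (simp add: e)
 show "ll (part_mult n (lab n f g) al) x y <-> ll al x y | (EX u v. ul al u x & ul al v y & g u = g v)"
  using r(1)[of x y] by (simp add: e)
 show "floating n (lab n f g) al = card (g ` {u : {1..n}. g u ~: f ` {1..n} & (ALL v:udom al. g v ~= g u)})"
  using r(4) by (simp add: e)
qed

subsection \<open>The monoids\<close>

lemma part_one_eq_lab: "part_one n = lab n id id"
proof -
 have 1: "{w : verts n. vlab id id w = k} = {Upper k, Lower k}" if "k : {1..n}" for k
  using that by (auto elim: vertsE)
 have "lab n id id = (%k. {w : verts n. vlab id id w = k}) ` vlab id id ` verts n"
  by (simp add: lab_def image_image)
 also have "vlab id id ` verts n = {1..n}"
 proof (intro equalityI subsetI)
  fix x assume "x : {1..n}"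
  then show "x : vlab id id ` verts n" by (intro image_eqI[of _ _ "Upper x"]) auto
 qed (auto elim: vertsE)
 also have "(%k. {w : verts n. vlab id id w = k}) ` {1..n} = (%k. {Upper k, Lower k}) ` {1..n}"
  using 1 by (rule image_cong[OF refl])
 finally show ?thesis unfolding part_one_def by (rule sym)
qed

lemma part_one_in [simp]: "part_one n : partitions n"
 by (simp add: part_one_eq_lab)

lemma mult_part_one:
 assumes a: "al : partitions n"
 shows "part_mult n al (part_one n) = al" "floating n al (part_one n) = 0"
proof -
 \<comment> \<open>The identity joins nothing new in the middle row, so its components are the lower
   blocks of \<open>al\<close>.\<close>
 have m: "midh n al (lab n id id) (%u. blk al (Lower u))"
  using blk_eq_iff[OF a] ll_range[OF a] by (intro midhI) (auto intro: mid_ll)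
 have b: "blk al (Lower u) = blk al (Lower v) <-> ll al u v" if "v : {1..n}" for u v
  using blk_eq_iff[OF a] that by simp
 note p = prod_rel[OF a lab_in m]
 show "part_mult n al (part_one n) = al" unfolding part_one_eq_lab
 proof (rule partition_eqI[of _ n])
  show "uu (part_mult n al (lab n id id)) x y = uu al x y" for x y
   unfolding p using b ul_range[OF a] ll_ul[OF a] ul_uu[OF a] by metis
  show "ul (part_mult n al (lab n id id)) x y = ul al x y" for x y
   unfolding p rel_lab_simps id_apply using b ul_range[OF a] ll_ul[OF a] by metis
  show "ll (part_mult n al (lab n id id)) x y = ll al x y" for x y
   unfolding p rel_lab_simps id_apply using b ll_range[OF a] rel_refl[OF a] verts_iff by metis
 qed (use a in auto)
 have "{u : {1..n}. ALL v:{1..n}. blk al (Lower v) = blk al (Lower u) --> (ALL x. ~ul al x v & ~ul (lab n id id) v x)} = {}"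
  unfolding rel_lab_simps by fastforce
 then show "floating n al (part_one n) = 0"
  unfolding part_one_eq_lab p(4) by (simp only: image_empty card.empty)
qed

text \<open>Partitions are determined by the \<open>0\<close>-\<open>1\<close> labellings that are constant on blocks; in these terms
 the product is composition of relations.\<close>

definition sat :: "partition => (nat => bool) => (nat => bool) => bool" where
 "sat al a c <-> (ALL x y. uu al x y --> a x = a y) & (ALL x y. ul al x y --> a x = c y) & (ALL x y. ll al x y --> c x = c y)"

lemma sat_mult:
 assumes ab: "al : partitions n" "be : partitions n"
 shows "sat (part_mult n al be) a c <-> (EX b. sat al a b & sat be b c)"
proof -
 note p = prod_rel[OF ab midh_classes, unfolded mid_classes_iff]
 show ?thesis
 proof
  assume s: "sat (part_mult n al be) a c"
  \<comment> \<open>The middle colouring is forced: a component takes the colour of the outer points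
    attached to it. Components that touch no true point are coloured false.\<close>
  define b where "b u <-> (EX x v. (u, v) : mid al be & ul al x v & a x) | (EX y v. (u, v) : mid al be & ul be v y & c y)" for u
  have bm: "b u = b v" if "(u, v) : mid al be" for u v
   unfolding b_def using that mid_trans mid_sym by meson
  have 1: "a x = b y" if "ul al x y" for x y
  proof
   assume "a x" then show "b y" unfolding b_def using that mid_refl by blast
  next
   assume "b y"
   then consider x' v where "(y, v) : mid al be" "ul al x' v" "a x'" | y' v where "(y, v) : mid al be" "ul be v y'" "c y'"
    unfolding b_def by blast
   then show "a x"
   proof cases
    case 1 then have "uu (part_mult n al be) x x'" unfolding p using that by blast
    then show ?thesis using s 1 unfolding sat_def by blast
   next
    case 2 then have "ul (part_mult n al be) x y'" unfolding p using that by blast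
    then show ?thesis using s 2 unfolding sat_def by blast
   qed
  qed
  have 2: "b u = c y" if "ul be u y" for u y
  proof
   assume "c y" then show "b u" unfolding b_def using that mid_refl by blast
  next
   assume "b u"
   then consider x' v where "(u, v) : mid al be" "ul al x' v" "a x'" | y' v where "(u, v) : mid al be" "ul be v y'" "c y'"
    unfolding b_def by blast
   then show "c y"
   proof cases
    case 1 then have "ul (part_mult n al be) x' y" unfolding p using that mid_sym by blast
    then show ?thesis using s 1 unfolding sat_def by blast
   next
    case 2 then have "ll (part_mult n al be) y y'" unfolding p using that by blast
    then show ?thesis using s 2 unfolding sat_def by blast
   qed
  qed
  have "sat al a b" unfolding sat_def using s 1 bm mid_ll p(1) unfolding sat_def by blast
  moreover have "sat be b c" unfolding sat_def using s 2 bm mid_uu p(3) unfolding sat_def by blast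
  ultimately show "EX b. sat al a b & sat be b c" by blast
 next
  assume "EX b. sat al a b & sat be b c"
  then obtain b where b: "sat al a b" "sat be b c" by blast
  have bm: "b u = b v" if "(u, v) : mid al be" for u v
   using that unfolding mid_def
   by (induction rule: rtrancl_induct) (use b in \<open>auto simp: sat_def\<close>)
  show "sat (part_mult n al be) a c"
   using b bm unfolding sat_def p by (intro conjI allI impI; elim disjE exE conjE; metis)
 qed
qed

lemma partition_eq_sat:
 assumes ab: "al : partitions n" "be : partitions n" and s: "!!a c. sat al a c <-> sat be a c"
 shows "al = be"
proof -
 have "(uu al x y --> uu be x y) & (ul al x y --> ul be x y) & (ll al x y --> ll be x y)"
  if ab: "al : partitions n" "be : partitions n" and s: "!!a c. sat be a c ==> sat al a c" for al be x y
 proof -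
  \<comment> \<open>The indicator colourings of the block of \<open>Upper x\<close> and of the block
    of \<open>Lower x\<close> are compatible with \<open>be\<close>. As they are compatible with
    \<open>al\<close> too, a block of \<open>al\<close> cannot leave a block of
    \<open>be\<close>.\<close>
  have "sat be (%y. uu be x y) (%y. ul be x y)" "sat be (%z. ul be z x) (%z. ll be x z)"
   unfolding sat_def using rel_trans[OF ab(2)] rel_sym by blast+
  then have 1: "sat al (%y. uu be x y) (%y. ul be x y)" "sat al (%z. ul be z x) (%z. ll be x z)"
   using s by blast+
  have "uu be x x" if "uu al x y | ul al x y" using that ab ul_range uu_range by fastforce
  moreover have "ll be x x" if "ll al x y" using that ab ll_range by fastforce
  ultimately show ?thesis using 1 unfolding sat_def by blast
 qed
 from this[OF ab] this[OF ab(2,1)] s show ?thesis by (intro partition_eqI[OF ab]) blast+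
qed

text \<open>Through \<open>sat\<close> this is the associativity of relational composition.\<close>

lemma part_mult_assoc:
 assumes "al : partitions n" "be : partitions n" "gm : partitions n"
 shows "part_mult n (part_mult n al be) gm = part_mult n al (part_mult n be gm)"
 by (rule partition_eq_sat[of _ n]) (use assms in \<open>auto simp: sat_mult\<close>)

subsection \<open>Ranks\<close>

lemma transversals_eq:
 assumes a: "al : partitions n"
 shows "transversals al = (%x. blk al (Upper x)) ` udom al"
proof (intro equalityI subsetI)
 fix A assume "A : transversals al"
 then obtain x y where A: "A : al" "Upper x : A" "Lower y : A" unfolding transversals_def by auto
 then have "ul al x y" "A = blk al (Upper x)" using blk_eq_block[OF a] by (auto simp: rel_def)
 then show "A : (%x. blk al (Upper x)) ` udom al" unfolding udom_def by blast
next
 fix A assume "A : (%x. blk al (Upper x)) ` udom al"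
 then obtain x y where A: "A = blk al (Upper x)" "ul al x y" unfolding udom_def by blast
 then have "x : {1..n}" using ul_range[OF a] by blast
 then have "A : al" "Upper x : A" "Lower y : A" using A blk_in[OF a] a by auto
 then show "A : transversals al" unfolding transversals_def by blast
qed

lemma rank_eq_card:
 assumes a: "al : partitions n" and h: "!!x y. [|x : udom al; y : udom al|] ==> h x = h y <-> uu al x y"
 shows "rank al = card (h ` udom al)"
 unfolding rank_def transversals_eq[OF a]
proof (rule card_image_eq)
 fix u v assume "u : udom al" "v : udom al"
 moreover then have "Upper v : verts n" using udom_sub[OF a] by auto
 ultimately show "(blk al (Upper u) = blk al (Upper v)) = (h u = h v)" using blk_eq_iff[OF a] h by simp
qed

lemma rank_0_iff: "al : partitions n ==> rank al = 0 <-> udom al = {}"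
 unfolding rank_def transversals_eq by simp

lemma rank_0_ul: "al : partitions n ==> rank al = 0 ==> ~ul al x y"
 using rank_0_iff unfolding udom_def by blast

lemma rank_0_ldom: "al : partitions n ==> rank al = 0 <-> ldom al = {}"
 using rank_0_iff unfolding udom_def ldom_def by blast

lemma rank_le_1_iff: "al : partitions n ==> rank al <= 1 <-> (ALL x:udom al. ALL y:udom al. uu al x y)"
proof -
 assume a: "al : partitions n"
 have "rank al <= 1 <-> (ALL A:transversals al. ALL B:transversals al. A = B)"
  unfolding rank_def using card_le_Suc0_iff_eq[of "transversals al"] transversals_eq[OF a] a by simp
 also have "\<dots> <-> (ALL x:udom al. ALL y:udom al. blk al (Upper x) = blk al (Upper y))"
  unfolding transversals_eq[OF a] by blast
 also have "\<dots> <-> (ALL x:udom al. ALL y:udom al. uu al x y)"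
 proof (intro ball_cong refl)
  fix x y assume "y : udom al"
  then have "Upper y : verts n" using udom_sub[OF a] by auto
  then show "(blk al (Upper x) = blk al (Upper y)) = uu al x y" by (rule blk_eq_iff[OF a])
 qed
 finally show ?thesis .
qed

text \<open>The transversals of \<open>al\<close>, indexed by \<open>K\<close>: the one with index \<open>k\<close> consists of the upper points that
 \<open>t\<close> maps to \<open>k\<close> and of the lower points that \<open>s\<close> maps to \<open>k\<close>.\<close>

definition coords :: "nat => partition => nat set => (nat => nat) => (nat => nat) => bool" where
 "coords n al K t s <-> (ALL x:{1..n}. ALL y:{1..n}. ul al x y <-> t x = s y & t x : K) &
   K \<subseteq> t ` {1..n} & K \<subseteq> s ` {1..n}"

lemma coords_ul: "[|al : partitions n; coords n al K t s|] ==>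
  ul al x y <-> x : {1..n} & y : {1..n} & t x = s y & t x : K"
 unfolding coords_def using ul_range by blast

lemma coords_udom:
 assumes a: "al : partitions n" and c: "coords n al K t s"
 shows "x : udom al <-> x : {1..n} & t x : K"
proof
 assume "x : udom al" then show "x : {1..n} & t x : K" unfolding mem_udom coords_ul[OF a c] by blast
next
 assume x: "x : {1..n} & t x : K"
 then obtain y where "y : {1..n}" "s y = t x" using c unfolding coords_def by (metis (no_types, lifting) image_iff subsetD)
 then show "x : udom al" unfolding mem_udom coords_ul[OF a c] using x by metis
qed

lemma coords_flip: "coords n al K t s ==> coords n (flip al) K s t"
 unfolding coords_def by auto

lemma coords_ldom: "[|al : partitions n; coords n al K t s|] ==> y : ldom al <-> y : {1..n} & s y : K"
 using coords_udom[OF flip_in coords_flip] by simp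

lemma coords_uu:
 assumes a: "al : partitions n" and c: "coords n al K t s" and x: "x : udom al" and y: "y : {1..n}"
 shows "uu al x y <-> t x = t y"
proof -
 obtain z where z: "ul al x z" using x unfolding mem_udom by blast
 then have "uu al x y <-> ul al y z" using uu_ul[OF a] ul_uu[OF a] by blast
 then show ?thesis using z y unfolding coords_ul[OF a c] by auto
qed

lemma coords_ll: "[|al : partitions n; coords n al K t s; x : ldom al; y : {1..n}|] ==> ll al x y <-> s x = s y"
 using coords_uu[OF flip_in coords_flip] by simp

lemma coords_rank:
 assumes a: "al : partitions n" and c: "coords n al K t s"
 shows "rank al = card K"
proof -
 have "rank al = card (t ` udom al)"
  by (rule rank_eq_card[OF a]) (use coords_uu[OF a c] udom_sub[OF a] in blast)
 moreover have "t ` udom al = K"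
  unfolding set_eq_iff image_iff Bex_def coords_udom[OF a c] using c unfolding coords_def by blast
 ultimately show ?thesis by simp
qed

text \<open>The index 0 is the default for vertices off the transversals, so the index set has to
  avoid it.\<close>

lemma coords_enum:
 assumes a: "al : partitions n" and T: "bij_betw T K (transversals al)" and K: "K \<subseteq> {1..}"
 defines "idx == %v. if EX k:K. v : T k then (THE k. k : K & v : T k) else 0"
 shows "coords n al K (%x. idx (Upper x)) (%y. idx (Lower y))" "!!v k. k : K ==> v : T k <-> idx v = k"
proof -
 have Tt: "T k : transversals al" if "k : K" for k using T that unfolding bij_betw_def by blast
 have Ta: "T k : al" if "k : K" for k using Tt[OF that] unfolding transversals_def by blast
 have u: "k = k'" if "k : K" "k' : K" "v : T k" "v : T k'" for k k' v
  using partitionsD(3)[OF a Ta Ta] that T unfolding bij_betw_def inj_on_def by metis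
 have i: "idx v = k" if "k : K" "v : T k" for v k
 proof -
  have "(THE k. k : K & v : T k) = k" using that u by (intro the_equality) blast+
  then show ?thesis unfolding idx_def using that by auto
 qed
 show iff: "v : T k <-> idx v = k" if k: "k : K" for v k
 proof
  assume e: "idx v = k"
  have "k ~= 0" using k K by auto
  then obtain k' where "k' : K" "v : T k'" using e unfolding idx_def by (auto split: if_splits)
  then show "v : T k" using i e by blast
 qed (use i k in blast)
 have ul: "ul al x y <-> idx (Upper x) = idx (Lower y) & idx (Upper x) : K" for x y
 proof
  assume "ul al x y"
  then obtain A where A: "A : al" "Upper x : A" "Lower y : A" unfolding rel_def by blast
  then have "A : transversals al" unfolding transversals_def by blast
  then obtain k where "k : K" "A = T k" using T unfolding bij_betw_def by blast
  then show "idx (Upper x) = idx (Lower y) & idx (Upper x) : K" using A i by metis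
 next
  assume "idx (Upper x) = idx (Lower y) & idx (Upper x) : K"
  then show "ul al x y" using iff Ta unfolding rel_def by metis
 qed
 moreover have "k : (%x. idx (Upper x)) ` {1..n} & k : (%y. idx (Lower y)) ` {1..n}" if k: "k : K" for k
 proof -
  obtain x y where "Upper x : T k" "Lower y : T k" using Tt[OF k] unfolding transversals_def by auto
  moreover then have "ul al x y" using ul i k by metis
  ultimately show ?thesis using ul_range[OF a] i[OF k] by blast
 qed
 ultimately show "coords n al K (%x. idx (Upper x)) (%y. idx (Lower y))" unfolding coords_def by blast
qed

lemma coords_exist:
 assumes a: "al : partitions n"
 obtains t s where "coords n al {1..rank al} t s"
proof -
 have "finite (transversals al)" unfolding transversals_eq[OF a] using a by simp
 then obtain T where "bij_betw T {1..rank al} (transversals al)"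
  unfolding rank_def using ex_bij_betw_nat_finite_1 by blast
 from coords_enum(1)[OF a this] that show ?thesis by auto
qed

lemma rank_flip [simp]:
 assumes "al : partitions n" shows "rank (flip al) = rank al"
proof -
 obtain t s where "coords n al {1..rank al} t s" using coords_exist[OF assms] .
 from coords_rank[OF flip_in[OF assms] coords_flip[OF this]] show ?thesis by simp
qed

lemma rank_le_n:
 assumes a: "al : partitions n" shows "rank al <= n"
proof -
 have "rank al <= card (udom al)" unfolding rank_def transversals_eq[OF a] using a by (simp add: card_image_le)
 also have "\<dots> <= n" using card_mono[OF _ udom_sub[OF a]] by simp
 finally show ?thesis .
qed

lemma udom_mult:
 assumes ab: "al : partitions n" "be : partitions n"
 shows "udom (part_mult n al be) \<subseteq> udom al" "ldom (part_mult n al be) \<subseteq> ldom be"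
 unfolding udom_def ldom_def using prod_rel(2)[OF ab midh_classes] by blast+

lemma uu_mult: "[|al : partitions n; be : partitions n; uu al x y|] ==> uu (part_mult n al be) x y"
 using prod_rel(1)[OF _ _ midh_classes] by blast

text \<open>The upper part of each transversal of \<open>al\<close> lies in one block of the
  product, and all transversals of the product arise in this way. Equality of ranks therefore makes
  this map of blocks injective and leaves no transversal behind.\<close>

lemma rank_mult:
 assumes ab: "al : partitions n" "be : partitions n"
 shows "rank (part_mult n al be) <= rank al"
  and "rank (part_mult n al be) = rank al ==> udom (part_mult n al be) = udom al"
  and "[|rank (part_mult n al be) = rank al; x : udom al; y : udom al; uu (part_mult n al be) x y|] ==> uu al x y"
proof -
 let ?p = "part_mult n al be"
 let ?T = "%x. blk ?p (Upper x)" and ?S = "%x. blk al (Upper x)"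
 \<comment> \<open>The induced map on blocks. It is independent of the chosen point because the
   product only coarsens the upper kernel of \<open>al\<close>.\<close>
 define k where "k = (%S. ?T (SOME x. x : udom al & ?S x = S))"
 have k: "k (?S x) = ?T x" if x: "x : udom al" for x
 proof -
  let ?y = "SOME y. y : udom al & ?S y = ?S x"
  have y: "?y : udom al & ?S ?y = ?S x" by (rule someI[of _ x]) (use x in auto)
  have "uu al ?y x" using y x blk_eq_iff[OF ab(1)] udom_sub[OF ab(1)] by (metis subsetD verts_iff(1))
  then have "uu ?p ?y x" using uu_mult[OF ab] by blast
  then show ?thesis unfolding k_def using blk_eq_iff[OF part_mult_in[of n al be]] x udom_sub[OF ab(1)]
   by (metis subsetD verts_iff(1))
 qed
 then have e: "?T ` udom al = k ` ?S ` udom al" by (simp add: image_image)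
 have fin: "finite (udom al)" using ab(1) by simp
 have c1: "card (?T ` udom al) <= card (?S ` udom al)" unfolding e using fin by (simp add: card_image_le)
 have c2: "card (?T ` udom ?p) <= card (?T ` udom al)"
  using fin udom_mult(1)[OF ab] by (intro card_mono) auto
 have r: "rank al = card (?S ` udom al)" "rank ?p = card (?T ` udom ?p)"
  unfolding rank_def transversals_eq[OF ab(1)] transversals_eq[OF part_mult_in] by simp_all
 show "rank ?p <= rank al" using c1 c2 r by linarith
 show "udom ?p = udom al" if "rank ?p = rank al"
 proof
  have "card (?T ` udom ?p) = card (?T ` udom al)" using c1 c2 r that by linarith
  then have im: "?T ` udom ?p = ?T ` udom al" using fin udom_mult(1)[OF ab] by (intro card_subset_eq) auto
  show "udom al \<subseteq> udom ?p"
  proof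
   fix x assume x: "x : udom al"
   then obtain x' where x': "x' : udom ?p" "?T x' = ?T x" using im by (metis (no_types, lifting) imageE imageI)
   then have "uu ?p x' x" using blk_eq_iff[OF part_mult_in] x udom_sub[OF ab(1)] by (metis subsetD verts_iff(1))
   then show "x : udom ?p" using uu_udom[OF part_mult_in] x'(1) by blast
  qed
 qed (rule udom_mult(1)[OF ab])
 assume a: "rank ?p = rank al" "x : udom al" "y : udom al" "uu ?p x y"
 have "card (k ` ?S ` udom al) = card (?S ` udom al)" using c1 c2 r a(1) e by simp
 then have inj: "inj_on k (?S ` udom al)" using fin by (intro eq_card_imp_inj_on) auto
 have "?T x = ?T y" using a(2-4) blk_eq_iff[OF part_mult_in] udom_sub[OF ab(1)] by (metis subsetD verts_iff(1))
 then have "?S x = ?S y" using k a(2,3) inj by (metis (no_types, lifting) image_eqI inj_onD)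
 then show "uu al x y" using a(3) blk_eq_iff[OF ab(1)] udom_sub[OF ab(1)] by (metis subsetD verts_iff(1))
qed

lemma rank_mult_right:
 assumes ab: "al : partitions n" "be : partitions n"
 shows "rank (part_mult n al be) <= rank be"
  and "rank (part_mult n al be) = rank be ==> ldom (part_mult n al be) = ldom be"
  and "[|rank (part_mult n al be) = rank be; x : ldom be; y : ldom be; ll (part_mult n al be) x y|] ==> ll be x y"
 using rank_mult[OF flip_in[OF ab(2)] flip_in[OF ab(1)]]
 by (auto simp: ab rank_flip[OF ab(2)] rank_flip[OF part_mult_in] flip_mult(1)[OF ab, symmetric])

subsection \<open>Splitting the transversals\<close>

lemma rel_hat:
 "rel (hat al) v w <-> rel al v w & (v : range Upper & w : range Upper | v : range Lower & w : range Lower)"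
proof -
 have h: "A : hat al <-> A ~= {} & (EX B:al. A = B \<inter> range Upper | A = B \<inter> range Lower)" for A
  unfolding hat_def by auto
 show ?thesis
 proof
  assume "rel (hat al) v w"
  then show "rel al v w & (v : range Upper & w : range Upper | v : range Lower & w : range Lower)"
   unfolding rel_def Bex_def h by (elim exE conjE disjE bexE) blast+
 next
  assume r: "rel al v w & (v : range Upper & w : range Upper | v : range Lower & w : range Lower)"
  then obtain B where B: "B : al" "v : B" "w : B" unfolding rel_def by blast
  from r consider "v : range Upper" "w : range Upper" | "v : range Lower" "w : range Lower" by blast
  then show "rel (hat al) v w"
  proof cases
   case 1
   have "B \<inter> range Upper ~= {}" using IntI[OF B(2) 1(1)] by (metis empty_iff)
   then have m: "B \<inter> range Upper : hat al" unfolding h using B(1) by metis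
   show ?thesis unfolding rel_def by (intro bexI[OF _ m] conjI IntI B 1)
  next
   case 2
   have "B \<inter> range Lower ~= {}" using IntI[OF B(2) 2(1)] by (metis empty_iff)
   then have m: "B \<inter> range Lower : hat al" unfolding h using B(1) by metis
   show ?thesis unfolding rel_def by (intro bexI[OF _ m] conjI IntI B 2)
  qed
 qed
qed

lemma rel_hat_simps [simp]:
 "uu (hat al) x y <-> uu al x y" "~ul (hat al) x y" "ll (hat al) x y <-> ll al x y"
 by (auto simp: rel_hat)

lemma hat_in [simp, intro]:
 assumes a: "al : partitions n" shows "hat al : partitions n"
 unfolding partitions_def verts_def[symmetric] mem_Collect_eq
proof (rule partition_onI)
 have "v : \<Union>(hat al) <-> rel (hat al) v v" for v by (auto simp: rel_def)
 moreover have "rel (hat al) v v <-> v : verts n" for v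
  unfolding rel_hat rel_refl[OF a] by (cases v) auto
 ultimately show "\<Union>(hat al) = verts n" by blast
 fix p q assume pq: "p : hat al" "q : hat al" "p ~= q"
 have "p = q" if v: "v : p" "v : q" for v
 proof -
  obtain A where A: "A : al" "p = A \<inter> range Upper | p = A \<inter> range Lower" using pq(1) unfolding hat_def by blast
  obtain B where B: "B : al" "q = B \<inter> range Upper | q = B \<inter> range Lower" using pq(2) unfolding hat_def by blast
  have "A = B" using partitionsD(3)[OF a A(1) B(1)] A(2) B(2) v by blast
  then show ?thesis using A(2) B(2) v by auto
 qed
 then show "disjnt p q" using pq(3) unfolding disjnt_def by blast
qed (auto simp: hat_def)

lemma udom_hat [simp]: "udom (hat al) = {}" and ldom_hat [simp]: "ldom (hat al) = {}"
 by (simp_all add: udom_def ldom_def)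

lemma rank_hat [simp]: "al : partitions n ==> rank (hat al) = 0"
 by (simp add: rank_0_iff[OF hat_in])

lemma hat_eq_iff:
 assumes "al : partitions n" "be : partitions n"
 shows "hat al = hat be <-> (ALL x y. uu al x y <-> uu be x y) & (ALL x y. ll al x y <-> ll be x y)"
proof
 assume "hat al = hat be"
 then show "(ALL x y. uu al x y <-> uu be x y) & (ALL x y. ll al x y <-> ll be x y)"
  using rel_hat_simps(1,3) by metis
next
 assume "(ALL x y. uu al x y <-> uu be x y) & (ALL x y. ll al x y <-> ll be x y)"
 then show "hat al = hat be"
  by (intro partition_eqI[OF hat_in[OF assms(1)] hat_in[OF assms(2)]]) simp_all
qed

lemma hat_rank_0: "[|al : partitions n; rank al = 0|] ==> hat al = al"
 by (rule partition_eqI[of _ n]) (auto simp: rank_0_ul)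

lemma hat_hat [simp]: "al : partitions n ==> hat (hat al) = hat al"
 by (rule partition_eqI[of _ n]) auto

lemma flip_hat: "al : partitions n ==> flip (hat al) = hat (flip al)"
 by (rule partition_eqI[of _ n]) auto

text \<open>For \<open>rank al \<le> 1\<close> the float count of a product with left factor \<open>al\<close> is determined by \<open>hat al\<close> up to the drop in rank; this
 makes \<open>i - rank al\<close> the invariant of \<open>(i, al)\<close> that governs the \<open>\<mu>\<close>-type congruences.\<close>

lemma low_rank_mult:
 assumes a: "al : partitions n" and c: "gm : partitions n" and r: "rank al <= 1"
 shows "hat (part_mult n al gm) = part_mult n (hat al) gm"
  and "floating n (hat al) gm + rank (part_mult n al gm) = floating n al gm + rank al"
proof -
 define h where "h = (%u. mid al gm `` {u})"
 have h: "midh n al gm h" unfolding h_def by (rule midh_classes)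
 moreover have "mid (hat al) gm = mid al gm" unfolding mid_def by simp
 ultimately have m: "midh n (hat al) gm h" unfolding midh_def by simp
 note p = prod_rel[OF a c h] and p' = prod_rel[OF hat_in[OF a] c m]
 have r': "uu al x y" if "x : udom al" "y : udom al" for x y using r rank_le_1_iff[OF a] that by blast
 show "hat (part_mult n al gm) = part_mult n (hat al) gm"
 proof (rule partition_eqI[of _ n])
  show "uu (hat (part_mult n al gm)) x y = uu (part_mult n (hat al) gm) x y" for x y
  proof -
   have "uu al x y" if "ul al x u" "ul al y v" for u v using r' that unfolding mem_udom by blast
   then show ?thesis unfolding rel_hat_simps(1) p p' by (simp only: rel_hat_simps) blast
  qed
 qed (auto simp: p p')
 define F where "F = {u : {1..n}. ALL v:{1..n}. h v = h u --> (ALL x. ~ul al x v & ~ul gm v x)}"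
 define G where "G = {u : {1..n}. ALL v:{1..n}. h v = h u --> (ALL x. ~ul gm v x)}"
 have fF: "floating n al gm = card (h ` F)" unfolding p(4) F_def ..
 have fG: "floating n (hat al) gm = card (h ` G)" unfolding p'(4) G_def by simp
 have fin: "finite (h ` F)" unfolding F_def by simp
 show "floating n (hat al) gm + rank (part_mult n al gm) = floating n al gm + rank al"
 proof (cases "rank al = 0")
  case True
  then have "rank (part_mult n al gm) = 0" using rank_mult(1)[OF a c] by simp
  then show ?thesis using True hat_rank_0[OF a] by simp
 next
  case False
  then have r1: "rank al = 1" using r by simp
  from False obtain x where "x : udom al" using rank_0_iff[OF a] by fastforce
  then obtain u where xu: "ul al x u" unfolding mem_udom by blast
  have un: "u : {1..n}" using xu ul_range[OF a] by blast
  have hu: "h v = h u" if "ul al y v" for y v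
  proof -
   have "uu al x y" using r' xu that unfolding mem_udom by blast
   then have "ll al u v" using xu that uu_ul[OF a] ul_ll[OF a] by blast
   then show ?thesis unfolding h_def mid_classes_iff using mid_ll mid_sym by blast
  qed
  \<comment> \<open>The transversal of \<open>al\<close> meets a single middle component; this is
    the only one on which the float counts over \<open>al\<close> and over \<open>hat al\<close> can
    differ.\<close>
  have FG: "F = {w : G. h w ~= h u}"
  proof (intro equalityI subsetI)
   fix w assume "w : F"
   then have w: "w : {1..n}" "!!v. [|v : {1..n}; h v = h w|] ==> ALL x. ~ul al x v & ~ul gm v x"
    unfolding F_def by blast+
   then have "h w ~= h u" using xu un by metis
   then show "w : {w : G. h w ~= h u}" using w unfolding G_def by blast
  next
   fix w assume w: "w : {w : G. h w ~= h u}"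
   then have "~ul al x v" if "h v = h w" for x v using hu that by force
   then show "w : F" using w unfolding F_def G_def by blast
  qed
  show ?thesis
  proof (cases "u : G")
   \<comment> \<open>Here \<open>gm\<close> does not continue the component of the transversal: it
     floats over \<open>hat al\<close>, whereas over \<open>al\<close> the rank drops to 0
     instead.\<close>
   case True
   then have "h ` G = insert (h u) (h ` F)" unfolding FG by blast
   moreover have "h u ~: h ` F" unfolding FG by auto
   ultimately have f: "floating n (hat al) gm = Suc (floating n al gm)"
    unfolding fF fG using fin by simp
   have g: "~ul gm v z" if "h v = h u" for v z
    using True that ul_range[OF c] unfolding G_def by blast
   have "~ul (part_mult n al gm) y z" for y z
    unfolding p using g hu by metis
   then have "rank (part_mult n al gm) = 0" unfolding rank_0_iff[OF part_mult_in] udom_def by blast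
   then show ?thesis using f r1 by simp
  next
   case False
   have "h w ~= h u" if "w : G" for w using False that un unfolding G_def by auto
   then have "G = F" unfolding FG by blast
   then have f: "floating n (hat al) gm = floating n al gm" unfolding fF fG by simp
   from False un obtain v z where "h v = h u" "ul gm v z" unfolding G_def by auto
   then have "ul (part_mult n al gm) x z" unfolding p using xu by metis
   then have "rank (part_mult n al gm) ~= 0" using rank_0_ul[OF part_mult_in] by blast
   then show ?thesis using f r1 rank_mult(1)[OF a c] by simp
  qed
 qed
qed

subsection \<open>Green's relations\<close>

text \<open>Right multiplication can only enlarge the upper kernel and shrink the domain, so
  R-related elements share both. Conversely, equal kernels and domains allow a right factor that
  leads each transversal of \<open>al\<close> to the lower block prescribed by
  \<open>be\<close>.\<close>

lemma green_R_iff: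
 "(al, be) : green_R (part_monoid n) <-> al : partitions n & be : partitions n &
   (ALL x y. uu al x y <-> uu be x y) & udom al = udom be"
proof -
 let ?I = "%al. part_mult n al ` partitions n"
 have G: "(al, be) : green_R (part_monoid n) <-> al : partitions n & be : partitions n & ?I al = ?I be"
  unfolding green_R_def part_monoid_def by simp
 have 1: "(uu be x y --> uu al x y) & udom al \<subseteq> udom be"
  if ab: "al : partitions n" "be : partitions n" "?I al = ?I be" for al be x y
 proof -
  have "al : ?I al" using mult_part_one(1)[OF ab(1)] part_one_in by (metis imageI)
  then have "al : ?I be" unfolding ab(3) .
  then obtain gm where g: "gm : partitions n" "al = part_mult n be gm" by (rule imageE) simp
  show ?thesis unfolding g(2) using udom_mult(1)[OF ab(2) g(1)] uu_mult[OF ab(2) g(1)] by blast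
 qed
 have 2: "?I be \<subseteq> ?I al" if ab: "al : partitions n" "be : partitions n"
  and uu: "!!x y. uu al x y <-> uu be x y" and d: "udom al = udom be" for al be
 proof -
  \<comment> \<open>A lower point on a transversal of \<open>al\<close> gets the block of
    \<open>be\<close> that contains the upper part of this transversal. The label \<open>{}\<close>
    of the other points is no block of \<open>be\<close> and attaches them to nothing.\<close>
  define f where "f u = (if u : ldom al then blk be (Upper (SOME x. ul al x u)) else {})" for u
  have fu: "f u = blk be (Upper x)" if "ul al x u" for x u
  proof -
   have "ul al (SOME x. ul al x u) u" using that by (rule someI)
   then have "uu be (SOME x. ul al x u) x" using that ul_uu[OF ab(1)] uu by blast
   moreover have "x : {1..n}" using that ul_range[OF ab(1)] by blast
   ultimately show ?thesis unfolding f_def using that blk_eq_iff[OF ab(2)] mem_ldom by (metis verts_iff(1))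
  qed
  have f: "f u = f v" if "ll al u v" for u v
  proof (cases "u : ldom al")
   case True
   then obtain x where "ul al x u" unfolding mem_ldom by blast
   then show ?thesis using fu ll_ul[OF ab(1) that] by metis
  next
   case False
   then show ?thesis unfolding f_def using ll_ldom[OF ab(1) that] by simp
  qed
  let ?g = "%y. blk be (Lower y)"
  have fa: "ALL u v. ll al u v --> f u = f v" using f by blast
  note p = right_mult[OF ab(1) fa, of ?g]
  have "part_mult n al (lab n f ?g) = be"
  proof (rule partition_eqI[OF part_mult_in ab(2)])
   fix x y
   have b: "blk be (Upper x) = blk be (Upper y) <-> uu be x y" if "y : {1..n}" for x y
    using blk_eq_iff[OF ab(2)] that by simp
   have b2: "blk be (Upper x) = blk be (Lower y) <-> ul be x y" if "y : {1..n}" for x y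
    using blk_eq_iff[OF ab(2)] that by simp
   have "uu be x y" if "ul al x u" "ul al y v" "f u = f v" for u v
    using fu[OF that(1)] fu[OF that(2)] b[of y x] that ul_range[OF ab(1) that(2)] by simp
   then show "uu (part_mult n al (lab n f ?g)) x y = uu be x y"
    unfolding p(1) using uu[of x y] by blast
   show "ul (part_mult n al (lab n f ?g)) x y = ul be x y"
   proof
    assume "ul (part_mult n al (lab n f ?g)) x y"
    then obtain u where "y : {1..n}" "ul al x u" "f u = blk be (Lower y)" unfolding p(2) by blast
    then show "ul be x y" using fu b2 by metis
   next
    assume l: "ul be x y"
    then have "x : udom al" unfolding d mem_udom by blast
    then obtain u where "ul al x u" unfolding mem_udom by blast
    moreover have "y : {1..n}" using ul_range[OF ab(2) l] by blast
    ultimately show "ul (part_mult n al (lab n f ?g)) x y" unfolding p(2) using fu b2 l by metis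
   qed
   have "ll be x y ==> x : {1..n} & y : {1..n}" by (rule ll_range[OF ab(2)])
   moreover have "y : {1..n} ==> blk be (Lower x) = blk be (Lower y) <-> ll be x y"
    using blk_eq_iff[OF ab(2), of "Lower y"] by simp
   ultimately show "ll (part_mult n al (lab n f ?g)) x y = ll be x y"
    unfolding p(3) by blast
  qed
  then have e: "be = part_mult n al (lab n f ?g)" ..
  show ?thesis
  proof
   fix de assume "de : ?I be"
   then obtain gm where "gm : partitions n" "de = part_mult n be gm" by (rule imageE) simp
   then have "de = part_mult n al (part_mult n (lab n f ?g) gm)"
    using e part_mult_assoc[OF ab(1) lab_in] by metis
   then show "de : ?I al" using part_mult_in by (metis imageI)
  qed
 qed
 show ?thesis unfolding G
 proof (intro iffI conjI; (elim conjE)?)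
  assume a: "al : partitions n" "be : partitions n" "?I al = ?I be"
  show "ALL x y. uu al x y <-> uu be x y"
   using 1[OF a] 1[OF a(2,1) a(3)[symmetric]] by metis
  show "udom al = udom be"
   using 1[OF a, of 0 0] 1[OF a(2,1) a(3)[symmetric], of 0 0] by (intro equalityI) (elim conjE, assumption)+
 next
  assume a: "al : partitions n" "be : partitions n" "ALL x y. uu al x y <-> uu be x y" "udom al = udom be"
  show "?I al = ?I be" using 2[OF a(1,2) _ a(4)] 2[OF a(2,1) _ a(4)[symmetric]] a(3) by (intro equalityI) simp_all
 qed
qed

lemma green_L_flip:
 "(al, be) : green_L (part_monoid n) <-> (flip al, flip be) : green_R (part_monoid n)"
proof -
 have e: "(%s. part_mult n (flip gm) s) ` partitions n = flip ` (%s. part_mult n s gm) ` partitions n"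
  if that: "gm : partitions n" for gm
 proof (intro equalityI subsetI)
  fix de assume "de : (%s. part_mult n (flip gm) s) ` partitions n"
  then obtain s where "s : partitions n" "de = part_mult n (flip gm) s" by blast
  then have "de = flip (part_mult n (flip s) gm)" "flip s : partitions n"
   using flip_mult(1)[OF flip_in that, of s] by auto
  then show "de : flip ` (%s. part_mult n s gm) ` partitions n" by blast
 qed (use that flip_mult(1)[OF _ that] in auto)
 have i: "inj flip" using flip_flip by (metis injI)
 show ?thesis
 proof (cases "al : partitions n & be : partitions n")
  case True
  then show ?thesis
   using e[of al] e[of be] inj_image_eq_iff[OF i] unfolding green_L_def green_R_def part_monoid_def by simp
 next
  case False
  then show ?thesis unfolding green_L_def green_R_def part_monoid_def by auto
 qed
qed

lemma green_L_iff:
 "(al, be) : green_L (part_monoid n) <-> al : partitions n & be : partitions n &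
   (ALL x y. ll al x y <-> ll be x y) & ldom al = ldom be"
 unfolding green_L_flip green_R_iff by simp

lemma green_H_iff:
 "(al, be) : green_H (part_monoid n) <-> al : partitions n & be : partitions n &
   (ALL x y. uu al x y <-> uu be x y) & udom al = udom be &
   (ALL x y. ll al x y <-> ll be x y) & ldom al = ldom be"
 unfolding green_H_def Int_iff green_L_iff green_R_iff by blast

lemma green_R_rank: "(al, be) : green_R (part_monoid n) ==> rank al = rank be"
 unfolding green_R_iff using rank_eq_card[of be n "%x. blk al (Upper x)"] rank_eq_card[of al n "%x. blk al (Upper x)"]
 by (metis blk_eq_iff subsetD udom_sub verts_iff(1))

subsection \<open>Congruences on the additive monoid of natural numbers\<close>

lemma congruence_nat_iff:
 "congruence nat_add_monoid \<sigma> <-> equiv UNIV \<sigma> & (ALL a b c. (a, b) : \<sigma> --> (a + c, b + c) : \<sigma>)"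
 unfolding congruence_def nat_add_monoid_def by (auto simp: add.commute)

lemma principal_cong_sub: "[|congruence S \<sigma>; (x, y) : \<sigma>|] ==> principal_cong S x y \<subseteq> \<sigma>"
 unfolding principal_cong_def by blast

lemma principal_cong_eqI:
 assumes "congruence S \<tau>" "(x, y) : \<tau>" "!!\<sigma>. [|congruence S \<sigma>; (x, y) : \<sigma>|] ==> \<tau> \<subseteq> \<sigma>"
 shows "principal_cong S x y = \<tau>"
 using assms unfolding principal_cong_def by blast

lemma nat_cong_iff:
 assumes d: "d >= 1"
 shows "(a, b) : nat_cong m (m + d) <-> a = b | m <= a & m <= b & a mod d = b mod d"
proof -
 let ?\<tau> = "{(a, b). a = b | m <= a & m <= b & a mod d = b mod d}"
 have "nat_cong m (m + d) = ?\<tau>"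
 proof (rule principal_cong_eqI)
  show "congruence nat_add_monoid ?\<tau>" unfolding congruence_nat_iff
  proof (intro conjI allI impI)
   show "equiv UNIV ?\<tau>" by (auto intro!: equivI refl_onI symI transI)
  qed (auto intro: mod_add_cong)
  show "(m, m + d) : ?\<tau>" by simp
  fix \<sigma> assume s: "congruence nat_add_monoid \<sigma>" "(m, m + d) : \<sigma>"
  then have e: "equiv UNIV \<sigma>" and sh: "!!a b c. (a, b) : \<sigma> ==> (a + c, b + c) : \<sigma>"
   unfolding congruence_nat_iff by blast+
  have k: "(a, a + k * d) : \<sigma>" if "m <= a" for a k
  proof (induction k)
   case 0
   then show ?case using e by (simp add: equiv_def refl_on_def)
  next
   case (Suc k)
   have "(a + k * d, a + Suc k * d) : \<sigma>"
    using sh[OF s(2), of "a + k * d - m"] that by (simp add: algebra_simps)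
   with Suc show ?case using e by (meson equivE transD)
  qed
  have "(a, b) : \<sigma>" if "m <= a" "a <= b" "a mod d = b mod d" for a b
  proof -
   have "d dvd b - a" using that mod_eq_dvd_iff_nat[of a b d] by (simp add: that(3))
   then obtain c where "b - a = d * c" ..
   then have "b = a + c * d" using that by (simp add: algebra_simps)
   then show ?thesis using k[OF that(1)] by simp
  qed note le = this
  show "?\<tau> \<subseteq> \<sigma>"
  proof (clarify)
   fix a b assume ab: "a = b | m <= a & m <= b & a mod d = b mod d"
   show "(a, b) : \<sigma>"
   proof (cases "a = b")
    case True
    then show ?thesis using e by (simp add: equiv_def refl_on_def)
   next
    case False
    then show ?thesis using ab le[of a b] le[of b a] e by (metis equivE nat_le_linear symD)
   qed
  qed
 qed
 then show ?thesis by simp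
qed

lemma nat_cong_iff':
 assumes "i < j"
 shows "(a, b) : nat_cong i j <-> a = b | i <= a & i <= b & a mod (j - i) = b mod (j - i)"
 using nat_cong_iff[of "j - i" a b i] assms by simp

lemma nat_cong_1: "(a, b) : nat_cong m (m + 1) <-> a = b | m <= a & m <= b"
 using nat_cong_iff[of 1] by simp

text \<open>Minimum and period can be recovered from the congruence, so the definite descriptions in
  \<open>min_cong\<close> and \<open>exceptional_cong\<close> are meaningful.\<close>

lemma nat_cong_period:
 assumes "d >= 1" "d' >= 1" "nat_cong m (m + d) = nat_cong m' (m' + d')"
 shows "m = m' & d = d'"
proof -
 have le: "m' <= m & d' dvd d" if "d >= 1" "d' >= 1" "nat_cong m (m + d) = nat_cong m' (m' + d')" for m m' d d' :: nat
 proof -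
  have "(m, m + d) : nat_cong m' (m' + d')" using nat_cong_iff[OF that(1), of m "m + d" m] unfolding that(3) by simp
  then have "m' <= m" "m mod d' = (m + d) mod d'" unfolding nat_cong_iff[OF that(2)] using that(1) by auto
  then show ?thesis using mod_eq_dvd_iff_nat[of m "m + d" d'] by simp
 qed
 from le[OF assms] le[OF assms(2,1) assms(3)[symmetric]] show ?thesis by (simp add: dvd_antisym)
qed

lemma min_cong_nat_cong:
 assumes "d >= 1" shows "min_cong (nat_cong m (m + d)) = enat m"
proof -
 have "nat_cong m (m + d) ~= Id" using nat_cong_iff[OF assms, of m "m + d" m] assms by auto
 moreover have "(THE m'. EX d'>=1. nat_cong m (m + d) = nat_cong m' (m' + d')) = m"
  by (rule the_equality) (use assms nat_cong_period in blast)+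
 ultimately show ?thesis unfolding min_cong_def by simp
qed

lemma min_cong_Id [simp]: "min_cong Id = \<infinity>"
 by (simp add: min_cong_def)

lemma exceptional_cong_nat_cong:
 assumes "d >= 1" shows "exceptional_cong (nat_cong m (m + 2 * d)) = nat_cong m (m + d)"
 unfolding exceptional_cong_def
proof (rule the_equality)
 fix \<psi> assume "EX m' d'. d' >= 1 & nat_cong m (m + 2 * d) = nat_cong m' (m' + 2 * d') & \<psi> = nat_cong m' (m' + d')"
 then obtain m' d' where "d' >= 1" "nat_cong m (m + 2 * d) = nat_cong m' (m' + 2 * d')" "\<psi> = nat_cong m' (m' + d')" by blast
 then show "\<psi> = nat_cong m (m + d)" using nat_cong_period[of "2 * d" "2 * d'" m m'] assms by simp
qed (use assms in blast)

subsection \<open>Congruences on the twisted monoid\<close>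

lemma congruence_twisted_iff:
 "congruence (twisted_monoid n) \<sigma> <-> equiv (UNIV \<times> partitions n) \<sigma> &
  (ALL i al j be k gm. ((i, al), (j, be)) : \<sigma> --> gm : partitions n -->
   ((k + i + floating n gm al, part_mult n gm al), (k + j + floating n gm be, part_mult n gm be)) : \<sigma> &
   ((i + k + floating n al gm, part_mult n al gm), (j + k + floating n be gm, part_mult n be gm)) : \<sigma>)"
 unfolding congruence_def twisted_monoid_def by (auto simp: split_beta)

text \<open>An arbitrary congruence. What is derived here from a related pair holds in every
  congruence containing that pair, hence in the principal one.\<close>

locale tcong =
 fixes n :: nat and \<sigma> :: "((nat \<times> partition) \<times> (nat \<times> partition)) set"
 assumes n: "n >= 1" and cong: "congruence (twisted_monoid n) \<sigma>"
begin

definition E :: "nat => partition => nat => partition => bool" where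
 "E i al j be <-> ((i, al), (j, be)) : \<sigma>"

lemma eqv: "equiv (UNIV \<times> partitions n) \<sigma>"
 using cong unfolding congruence_twisted_iff by blast

lemma E_in: "E i al j be ==> al : partitions n" "E i al j be ==> be : partitions n"
 using equiv_type[OF eqv] unfolding E_def by blast+

lemma E_refl: "al : partitions n ==> E i al i al"
 using eqv unfolding E_def equiv_def refl_on_def by blast

lemma E_sym: "E i al j be ==> E j be i al"
 using eqv unfolding E_def equiv_def by (meson symD)

lemma E_trans [trans]: "[|E i al j be; E j be k gm|] ==> E i al k gm"
 using eqv unfolding E_def equiv_def by (meson transD)

lemma E_left:
 "[|E i al j be; gm : partitions n|] ==> E (i + floating n gm al) (part_mult n gm al) (j + floating n gm be) (part_mult n gm be)"
 using cong unfolding congruence_twisted_iff E_def by (metis add_0)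

lemma E_right:
 "[|E i al j be; gm : partitions n|] ==> E (i + floating n al gm) (part_mult n al gm) (j + floating n be gm) (part_mult n be gm)"
 using cong unfolding congruence_twisted_iff E_def by (metis add_0_right)

text \<open>Multiplication by the element of level \<open>k\<close> over \<open>part_one n\<close>,
  which neither changes the partition nor creates floats.\<close>

lemma E_shift:
 assumes "E i al j be" shows "E (i + k) al (j + k) be"
proof -
 have "((i + k + floating n al (part_one n), part_mult n al (part_one n)),
   (j + k + floating n be (part_one n), part_mult n be (part_one n))) : \<sigma>"
  using cong assms part_one_in[of n] unfolding congruence_twisted_iff E_def by blast
 then show ?thesis using mult_part_one E_in[OF assms] unfolding E_def by simp
qed

lemma E_shift_to: "[|E i al j be; i <= l|] ==> E l al (j + (l - i)) be"
 using E_shift[of i al j be "l - i"] by simp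

lemma E_sandwich:
 "[|E i al j be; de : partitions n; ep : partitions n|] ==>
  E (i + floating n de al + floating n (part_mult n de al) ep) (part_mult n (part_mult n de al) ep)
   (j + floating n de be + floating n (part_mult n de be) ep) (part_mult n (part_mult n de be) ep)"
 by (intro E_right E_left)

text \<open>The pairs of levels at which \<open>gm\<close> is related to itself form a congruence on
  the natural numbers, which must contain the one generated by \<open>(i, j)\<close>.\<close>

lemma E_level:
 assumes "E i gm j gm" "(a, b) : nat_cong i j" shows "E a gm b gm"
proof -
 have "gm : partitions n" using E_in assms(1) by blast
 then have "congruence nat_add_monoid {(a, b). E a gm b gm}"
  unfolding congruence_nat_iff equiv_def refl_on_def
  by (auto intro: E_refl E_sym E_trans E_shift intro!: symI transI)
 then show ?thesis using principal_cong_sub[of nat_add_monoid "{(a, b). E a gm b gm}" i j] assms by blast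
qed

lemma E_levels:
 assumes "E i gm (i + 1) gm" "i <= a" "i <= b" shows "E a gm b gm"
 using E_level[OF assms(1)] nat_cong_1 assms(2,3) by blast

text \<open>Interpreting the locale a second time with this congruence turns every result about
  upper points into one about lower points.\<close>

lemma tcong_flip: "tcong n {((i, al), (j, be)). E i (flip al) j (flip be)}"
proof
 show "congruence (twisted_monoid n) {((i, al), (j, be)). E i (flip al) j (flip be)}"
  unfolding congruence_twisted_iff
 proof (intro conjI allI impI)
  show "equiv (UNIV \<times> partitions n) {((i, al), (j, be)). E i (flip al) j (flip be)}"
   by (rule equivI) (auto dest: E_in intro: E_refl E_sym E_trans intro!: refl_onI symI transI)
  fix i al j be k gm assume "((i, al), (j, be)) : {((i, al), (j, be)). E i (flip al) j (flip be)}" and c: "gm : partitions n"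
  then have e: "E i (flip al) j (flip be)" by blast
  then have ab: "al : partitions n" "be : partitions n" using E_in[OF e] by simp_all
  from E_right[OF e flip_in[OF c]] have "E (i + floating n gm al) (flip (part_mult n gm al)) (j + floating n gm be) (flip (part_mult n gm be))"
   using flip_mult[OF c ab(1)] flip_mult[OF c ab(2)] by simp
  from E_shift[OF this, of k] show "((k + i + floating n gm al, part_mult n gm al), k + j + floating n gm be, part_mult n gm be)
    : {((i, al), (j, be)). E i (flip al) j (flip be)}" by (simp add: algebra_simps)
  from E_left[OF e flip_in[OF c]] have "E (i + floating n al gm) (flip (part_mult n al gm)) (j + floating n be gm) (flip (part_mult n be gm))"
   using flip_mult[OF ab(1) c] flip_mult[OF ab(2) c] by simp
  from E_shift[OF this, of k] show "((i + k + floating n al gm, part_mult n al gm), j + k + floating n be gm, part_mult n be gm)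
    : {((i, al), (j, be)). E i (flip al) j (flip be)}" by (simp add: algebra_simps)
 qed
qed (rule n)

end

section \<open>Reaching prescribed elements by two-sided multiplication without floats\<close>

lemma coords_surj:
 assumes "coords n al K t s" "k : K"
 shows "EX x:{1..n}. t x = k" "EX y:{1..n}. s y = k"
 using assms unfolding coords_def by blast+

text \<open>Upper points outside the domain of \<open>gm\<close> keep their blocks; all points off the transversals of
 the middle factor are attached to its first transversal, so that nothing floats.\<close>

lemma transport_exact:
 fixes S :: "nat set"
 assumes S: "S = {1..s0}" "1 <= s0" "s0 <= q" and p: "\<pi> permutes S" "\<pi> = id | s0 = q"
  and k: "ka : partitions n" "coords n ka {1..q} (\<pi> o t) s"
  and g: "gm : partitions n"
  and z: "ze : partitions n" "coords n ze S (\<pi> o t') s'"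
   "!!x y. uu ze x y <-> uu gm x y" "!!x y. ll ze x y <-> ll gm x y"
 defines "de == lab n (%x. if t' x : S then Inl (t' x) else Inr (blk gm (Upper x))) (%y. Inl (if t y : S then t y else 1))"
  and "ep == lab n (%u. Inl (if s u : S then s u else 1)) (%y. if s' y : S then Inl (s' y) else Inr (blk gm (Lower y)))"
 shows "part_mult n (part_mult n de ka) ep = ze" "floating n de ka = 0" "floating n (part_mult n de ka) ep = 0"
proof -
 define F :: "nat => nat + vertex set" where "F x = (if t' x : S then Inl (t' x) else Inr (blk gm (Upper x)))" for x
 define G :: "nat => nat + vertex set" where "G y = (if s' y : S then Inl (s' y) else Inr (blk gm (Lower y)))" for y
 define lbl where "lbl k = (if k : S then k else 1)" for k
 have lS: "lbl k : S" for k using S unfolding lbl_def by auto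
 have d: "de = lab n F (%y. Inl (lbl (t y)))" unfolding de_def F_def lbl_def ..
 have e: "ep = lab n (%u. Inl (lbl (s u))) G" unfolding ep_def G_def lbl_def ..
 have pS: "\<pi> x : S <-> x : S" for x using p(1) by (simp add: permutes_in_image)
 have pq: "\<pi> x : {1..q} <-> x : {1..q}" for x
  using pS[of x] p(1) S by (cases "x : S") (auto simp: permutes_not_in)
 have inj: "\<pi> x = \<pi> y <-> x = y" for x y using permutes_inj[OF p(1)] by (simp add: inj_eq)
 \<comment> \<open>\<open>lbl\<close> sends surplus indices to 1. It commutes with
   \<open>\<pi>\<close> since either there are none (\<open>s0 = q\<close>) or \<open>\<pi>\<close>
   is the identity.\<close>
 have lp: "lbl (\<pi> k) = \<pi> (lbl k)" if "k : {1..q}" for k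
  using p(2)
 proof
  assume "s0 = q"
  then have "k : S" using that S by simp
  then show ?thesis unfolding lbl_def using pS by simp
 qed simp
 have kul: "ul ka x y <-> x : {1..n} & y : {1..n} & \<pi> (t x) = s y & t x : {1..q}" for x y
  using coords_ul[OF k] pq by simp
 have tn: "EX x:{1..n}. t x = i" if "i : {1..q}" for i
 proof -
  have "\<pi> i : {1..q}" using pq that by blast
  from coords_surj(1)[OF k(2) this] show ?thesis using inj by simp
 qed
 note sn = coords_surj(2)[OF k(2)]
 have tn': "EX x:{1..n}. t' x = i" if "i : S" for i
 proof -
  have "\<pi> i : S" using pS that by blast
  from coords_surj(1)[OF z(2) this] show ?thesis using inj by simp
 qed
 note sn' = coords_surj(2)[OF z(2)]
 have Fr: "Inl i : F ` {1..n}" if i: "i : S" for i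
 proof -
  obtain x where "x : {1..n}" "t' x = i" using tn'[OF i] by blast
  then have "Inl i = F x" "x : {1..n}" using i unfolding F_def by simp_all
  then show ?thesis by (rule image_eqI)
 qed
 have Gr: "Inl i : G ` {1..n}" if i: "i : S" for i
 proof -
  obtain x where "x : {1..n}" "s' x = i" using sn'[OF i] by blast
  then have "Inl i = G x" "x : {1..n}" using i unfolding G_def by simp_all
  then show ?thesis by (rule image_eqI)
 qed
 have Fz: "F x = F y <-> uu ze x y" if xy: "x : {1..n}" "y : {1..n}" for x y
 proof (cases "t' x : S")
  case True
  then have "x : udom ze" using coords_udom[OF z(1,2)] pS xy by simp
  then have "uu ze x y <-> t' x = t' y" using coords_uu[OF z(1,2) _ xy(2)] inj by simp
  then show ?thesis using True unfolding F_def by auto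
 next
  case False
  then have nx: "x ~: udom ze" using coords_udom[OF z(1,2)] pS by simp
  show ?thesis
  proof (cases "t' y : S")
   case True
   then have "y : udom ze" using coords_udom[OF z(1,2)] pS xy by simp
   then have "~uu ze x y" using nx uu_udom[OF z(1)] by blast
   then show ?thesis using True False unfolding F_def by auto
  next
   case F: False
   then show ?thesis using False blk_eq_iff[OF g, of "Upper y" "Upper x"] xy z(3) unfolding F_def by simp
  qed
 qed
 have Gz: "G x = G y <-> ll ze x y" if xy: "x : {1..n}" "y : {1..n}" for x y
 proof (cases "s' x : S")
  case True
  then have "x : ldom ze" using coords_ldom[OF z(1,2)] xy by simp
  then have "ll ze x y <-> s' x = s' y" using coords_ll[OF z(1,2) _ xy(2)] by simp
  then show ?thesis using True unfolding G_def by auto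
 next
  case False
  then have nx: "x ~: ldom ze" using coords_ldom[OF z(1,2)] by simp
  show ?thesis
  proof (cases "s' y : S")
   case True
   then have "y : ldom ze" using coords_ldom[OF z(1,2)] xy by simp
   then have "~ll ze x y" using nx ll_ldom[OF z(1)] by blast
   then show ?thesis using True False unfolding G_def by auto
  next
   case F: False
   then show ?thesis using False blk_eq_iff[OF g, of "Lower y" "Lower x"] xy z(4) unfolding G_def by simp
  qed
 qed
 have Finl: "F x = Inl i <-> t' x : S & t' x = i" for x i unfolding F_def by auto
 have Ginl: "G x = Inl i <-> s' x : S & s' x = i" for x i unfolding G_def by auto
 have g1: "ALL u v. uu ka u v --> (Inl (lbl (t u)) :: nat + vertex set) = Inl (lbl (t v))"
 proof (intro allI impI)
  fix u v assume uv: "uu ka u v"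
  then have r: "u : {1..n}" "v : {1..n}" using uu_range[OF k(1)] by blast+
  show "(Inl (lbl (t u)) :: nat + vertex set) = Inl (lbl (t v))"
  proof (cases "u : udom ka")
   case True
   then show ?thesis using coords_uu[OF k True r(2)] uv inj by simp
  next
   case False
   then have "v ~: udom ka" using uu_udom[OF k(1) uv] by blast
   then have "t u ~: {1..q}" "t v ~: {1..q}" using False coords_udom[OF k] r pq by auto
   then show ?thesis using S unfolding lbl_def by auto
  qed
 qed
 note L = left_mult[OF k(1) g1, of F, folded d]
 \<comment> \<open>Every label on the middle row is \<open>Inl k\<close> with \<open>k\<close> in
   \<open>S\<close>, and some upper point carries it; hence no component floats.\<close>
 have 0: "{u : {1..n}. (Inl (lbl (t u)) :: nat + vertex set) ~: F ` {1..n} & (ALL v:udom ka. (Inl (lbl (t v)) :: nat + vertex set) ~= Inl (lbl (t u)))} = {}"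
  using Fr lS by blast
 show "floating n de ka = 0" unfolding L(4) 0 by simp
 let ?m = "part_mult n de ka"
 have mul: "ul ?m x y <-> x : {1..n} & t' x : S & (EX u. ul ka u y & lbl (t u) = t' x)" for x y
  unfolding L(2) using Finl by (metis (full_types))
 have ms: "lbl (s y) = \<pi> (t' x)" if "ul ?m x y" for x y
  using that lp unfolding mul kul by metis
 have mex: "EX y. ul ?m x y" if "x : {1..n}" "t' x : S" for x
 proof -
  have q: "t' x : {1..q}" using that S by auto
  obtain w where w: "w : {1..n}" "t w = t' x" using tn[OF q] by blast
  obtain y where "y : {1..n}" "s y = \<pi> (t' x)" using sn[of "\<pi> (t' x)"] pq q by blast
  then have "ul ka w y" unfolding kul using w q by simp
  moreover have "lbl (t w) = t' x" using w that unfolding lbl_def by simp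
  ultimately show ?thesis unfolding mul using that by blast
 qed
 have f1: "ALL u v. ll ?m u v --> (Inl (lbl (s u)) :: nat + vertex set) = Inl (lbl (s v))"
 proof (intro allI impI)
  fix u v assume "ll ?m u v"
  then consider "ll ka u v" | w w' where "ul ka w u" "ul ka w' v" "lbl (t w) = lbl (t w')"
   unfolding L(3) by auto
  then show "(Inl (lbl (s u)) :: nat + vertex set) = Inl (lbl (s v))"
  proof cases
   case 1
   then have r: "u : {1..n}" "v : {1..n}" using ll_range[OF k(1)] by blast+
   show ?thesis
   proof (cases "u : ldom ka")
    case True
    then show ?thesis using coords_ll[OF k True r(2)] 1 by simp
   next
    case False
    then have "v ~: ldom ka" using ll_ldom[OF k(1) 1] by blast
    then have "s u ~: {1..q}" "s v ~: {1..q}" using False coords_ldom[OF k] r by auto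
    then show ?thesis using S unfolding lbl_def by auto
   qed
  next
   case 2
   then show ?thesis using lp unfolding kul by metis
  qed
 qed
 note R = right_mult[OF part_mult_in[of n de ka] f1, of G, folded e]
 have 0: "{u : {1..n}. (Inl (lbl (s u)) :: nat + vertex set) ~: G ` {1..n} & (ALL v:ldom ?m. (Inl (lbl (s v)) :: nat + vertex set) ~= Inl (lbl (s u)))} = {}"
  using Gr lS by blast
 show "floating n ?m ep = 0" unfolding R(4) 0 by simp
 show "part_mult n ?m ep = ze"
 proof (rule partition_eqI[OF part_mult_in z(1)])
  fix x y
  have "F x = F y" if "ul ?m x u" "ul ?m y v" "lbl (s u) = lbl (s v)" for u v
   using that ms[OF that(1)] ms[OF that(2)] inj unfolding mul F_def by auto
  moreover have "ul ?m x u ==> x : {1..n}" for x u unfolding mul by blast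
  ultimately have "uu (part_mult n ?m ep) x y <-> x : {1..n} & y : {1..n} & F x = F y"
   unfolding R(1) L(1) by blast
  then show "uu (part_mult n ?m ep) x y = uu ze x y" using Fz uu_range[OF z(1)] by blast
  show "ll (part_mult n ?m ep) x y = ll ze x y" unfolding R(3) using Gz ll_range[OF z(1)] by blast
  have "ul (part_mult n ?m ep) x y <-> y : {1..n} & s' y : S & (EX u. ul ?m x u & s' y = lbl (s u))"
   unfolding R(2) using Ginl by metis
  also have "\<dots> <-> x : {1..n} & y : {1..n} & t' x : S & \<pi> (t' x) = s' y"
   using ms mex mul pS by metis
  also have "\<dots> <-> ul ze x y" unfolding coords_ul[OF z(1,2)] using pS by auto
  finally show "ul (part_mult n ?m ep) x y = ul ze x y" .
 qed
qed

text \<open>A right factor with a single upper block fuses the middle row, so the product shows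
  nothing of \<open>al\<close> but its upper kernel and its domain.\<close>

lemma right_full:
 assumes a: "al : partitions n"
 shows "uu (part_mult n al (lab n (%_. c) g)) x y <-> uu al x y | x : udom al & y : udom al"
  and "ul (part_mult n al (lab n (%_. c) g)) x y <-> x : udom al & y : {1..n} & g y = c"
  and "ll (part_mult n al (lab n (%_. c) g)) x y <-> x : {1..n} & y : {1..n} & g x = g y"
  and "n >= 1 ==> floating n al (lab n (%_. c) g) = (if c : g ` {1..n} | udom al ~= {} then 0 else 1)"
proof -
 have f: "ALL u v. ll al u v --> (%_. c) u = (%_. c) v" by simp
 note R = right_mult[OF a f, of g]
 show "uu (part_mult n al (lab n (%_. c) g)) x y <-> uu al x y | x : udom al & y : udom al"
  unfolding R mem_udom by simp
 show "ul (part_mult n al (lab n (%_. c) g)) x y <-> x : udom al & y : {1..n} & g y = c"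
  unfolding R mem_udom by auto
 show "ll (part_mult n al (lab n (%_. c) g)) x y <-> x : {1..n} & y : {1..n} & g x = g y"
  unfolding R ..
 assume n: "n >= 1"
 have "ldom al = {} <-> udom al = {}" unfolding ldom_def udom_def by blast
 then have "{u : {1..n}. c ~: g ` {1..n} & (ALL v:ldom al. c ~= c)} = (if c : g ` {1..n} | udom al ~= {} then {} else {1..n})"
  by auto
 then show "floating n al (lab n (%_. c) g) = (if c : g ` {1..n} | udom al ~= {} then 0 else 1)"
  unfolding R using n by (simp add: image_constant_conv)
qed

text \<open>Rank 0 is treated separately: \<open>transport_exact\<close> hangs all stray points on a
  transversal of its target, and such a target has none.\<close>

lemma factor_exact:
 assumes n: "n >= 1" and a: "al : partitions n" and g: "gm : partitions n" and r: "rank gm <= rank al"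
 obtains de ep where "de : partitions n" "ep : partitions n" "part_mult n (part_mult n de al) ep = gm"
  "floating n de al = 0" "floating n (part_mult n de al) ep = 0"
proof (cases "rank gm = 0")
 case False
 obtain t s where c: "coords n al {1..rank al} t s" using coords_exist[OF a] .
 obtain t' s' where c': "coords n gm {1..rank gm} t' s'" using coords_exist[OF g] .
 have "coords n al {1..rank al} (id o t) s" "coords n gm {1..rank gm} (id o t') s'" using c c' by simp_all
 from transport_exact[OF refl _ r permutes_id _ a this(1) g g this(2)] False that show ?thesis by auto
next
 case True
 \<comment> \<open>Since \<open>gm\<close> has no transversal, the middle row is hung on the upper
   block of the point 1.\<close>
 let ?d = "lab n (%x. blk gm (Upper x)) (%_. blk gm (Upper 1))"
 have c: "ALL u v. uu al u v --> (%_. blk gm (Upper 1)) u = (%_. blk gm (Upper 1)) v" by simp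
 note L = left_mult[OF a c, of "%x. blk gm (Upper x)"]
 have n1: "(1::nat) : {1..n}" using n by simp
 have "{u : {1..n}. blk gm (Upper 1) ~: (%x. blk gm (Upper x)) ` {1..n} & (ALL v:udom al. blk gm (Upper 1) ~= blk gm (Upper 1))} = {}"
  using n1 by blast
 then have f0: "floating n ?d al = 0" unfolding L(4) by simp
 let ?m = "part_mult n ?d al"
 have bu: "blk gm (Upper x) = blk gm (Upper y) <-> uu gm x y" if "y : {1..n}" for x y
  using blk_eq_iff[OF g, of "Upper y"] that by simp
 have bl: "blk gm (Lower x) = blk gm (Lower y) <-> ll gm x y" if "y : {1..n}" for x y
  using blk_eq_iff[OF g, of "Lower y"] that by simp
 have muu: "uu ?m x y <-> uu gm x y" for x y
  unfolding L(1) using bu[of y x] uu_range[OF g, of x y] by blast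
 have mud: "x : udom ?m <-> uu gm 1 x & rank al ~= 0" for x
 proof -
  have "x : udom ?m <-> x : {1..n} & blk gm (Upper 1) = blk gm (Upper x) & udom al ~= {}"
   unfolding mem_udom L(2) by (auto simp: udom_def)
  also have "\<dots> <-> uu gm 1 x & udom al ~= {}"
   using bu[of x 1] uu_range[OF g, of 1 x] by metis
  finally show ?thesis unfolding rank_0_iff[OF a] .
 qed
 have muu': "uu gm x y" if "x : udom ?m" "y : udom ?m" for x y
 proof -
  have "uu gm 1 x" "uu gm 1 y" using that unfolding mud by simp_all
  from rel_trans[OF g rel_sym[OF this(1)] this(2)] show ?thesis .
 qed
 \<comment> \<open>If \<open>al\<close> has rank 0, nothing from above reaches the second middle
   row, which is hung on the lower block of 1 to keep it from floating. Otherwise it already hangs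
   on an upper block, and the label \<open>{}\<close> prevents a transversal.\<close>
 define c where "c = (if rank al = 0 then blk gm (Lower 1) else {})"
 let ?g = "%y. blk gm (Lower y)"
 have nb: "?g y ~= {}" if "y : {1..n}" for y
 proof -
  have "Lower y : ?g y" using that g by simp
  then show ?thesis by blast
 qed
 note R = right_full[OF part_mult_in[of n ?d al], of c ?g]
 have "uu gm 1 1" using n1 g by simp
 then have "rank al ~= 0 ==> 1 : udom ?m" unfolding mud by blast
 moreover have "rank al = 0 ==> c = ?g 1" unfolding c_def by simp
 ultimately have "c : ?g ` {1..n} | udom ?m ~= {}" using n1 by blast
 then have f1: "floating n ?m (lab n (%_. c) ?g) = 0" using R(4)[OF n] by simp
 have "part_mult n ?m (lab n (%_. c) ?g) = gm"
 proof (rule partition_eqI[OF part_mult_in g])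
  fix x y
  show "uu (part_mult n ?m (lab n (%_. c) ?g)) x y = uu gm x y" unfolding R(1) muu using muu'[of x y] by blast
  show "ul (part_mult n ?m (lab n (%_. c) ?g)) x y = ul gm x y"
   unfolding R(2) mud unfolding c_def using nb rank_0_ul[OF g True] by auto
  show "ll (part_mult n ?m (lab n (%_. c) ?g)) x y = ll gm x y" unfolding R(3) using bl[of y x] ll_range[OF g, of x y] by blast
 qed
 then show ?thesis using that[OF lab_in lab_in _ f0 f1] by blast
qed

context tcong
begin

text \<open>The level of the first member stays exactly \<open>i\<close>. The floats over
  \<open>be\<close> are not controlled, hence the unspecified larger level of the second.\<close>

lemma E_factor:
 assumes e: "E i al j be" and g: "gm : partitions n" and r: "rank gm <= rank al"
 shows "EX j' ze. j <= j' & ze : partitions n & rank ze <= rank be & E i gm j' ze"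
proof -
 obtain de ep where d: "de : partitions n" "ep : partitions n" "part_mult n (part_mult n de al) ep = gm"
  "floating n de al = 0" "floating n (part_mult n de al) ep = 0" using factor_exact[OF n E_in(1)[OF e] g r] .
 have "rank (part_mult n (part_mult n de be) ep) <= rank be"
  using rank_mult(1)[OF part_mult_in d(2)] rank_mult_right(1)[OF d(1) E_in(2)[OF e]] by (meson le_trans)
 moreover have "E i gm (j + floating n de be + floating n (part_mult n de be) ep) (part_mult n (part_mult n de be) ep)"
  using E_sandwich[OF e d(1,2)] d(3-5) by simp
 moreover have "j <= j + floating n de be + floating n (part_mult n de be) ep" by simp
 ultimately show ?thesis using part_mult_in by blast
qed

lemma E_factor_same:
 assumes e: "E i al j al" and g: "gm : partitions n" and r: "rank gm <= rank al"
 shows "E i gm j gm"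
proof -
 obtain de ep where d: "de : partitions n" "ep : partitions n" "part_mult n (part_mult n de al) ep = gm"
  "floating n de al = 0" "floating n (part_mult n de al) ep = 0" using factor_exact[OF n E_in(1)[OF e] g r] .
 then show ?thesis using E_sandwich[OF e d(1,2)] by simp
qed

end

subsection \<open>Pairs of rank at most one\<close>

lemma udom_rank_1:
 assumes "al : partitions n" "rank al = 1"
 shows "udom al ~= {}" "!!x y. x : udom al ==> y : udom al <-> uu al x y"
proof -
 show "udom al ~= {}" using rank_0_iff[OF assms(1)] assms(2) by simp
 have "rank al <= 1" using assms(2) by simp
 then show "!!x y. x : udom al ==> y : udom al <-> uu al x y"
  using rank_le_1_iff[OF assms(1)] uu_udom[OF assms(1)] by meson
qed

lemma ul_rank_1:
 assumes a: "al : partitions n" and r: "rank al <= 1"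
 shows "ul al x y <-> x : udom al & y : ldom al"
proof
 assume "x : udom al & y : ldom al"
 then obtain x' where x': "ul al x' y" "x : udom al" unfolding mem_ldom by blast
 then have "x' : udom al" unfolding mem_udom by blast
 then have "uu al x' x" using r rank_le_1_iff[OF a] x'(2) by blast
 then show "ul al x y" using uu_ul[OF a _ x'(1)] by blast
qed (auto simp: mem_udom mem_ldom)

lemma ldom_rank_1:
 assumes "al : partitions n" "rank al = 1"
 shows "ldom al ~= {}" "!!x y. x : ldom al ==> y : ldom al <-> ll al x y"
 using udom_rank_1[OF flip_in[OF assms(1)]] assms by simp_all

lemma rank_1_eqI:
 assumes "al : partitions n" "be : partitions n" "rank al <= 1" "rank be <= 1"
  "!!x y. uu al x y = uu be x y" "!!x y. ll al x y = ll be x y" "udom al = udom be" "ldom al = ldom be"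
 shows "al = be"
 by (rule partition_eqI[OF assms(1,2)]) (simp_all add: assms ul_rank_1[OF assms(1,3)] ul_rank_1[OF assms(2,4)])

text \<open>The shared label \<open>None\<close> joins the upper and the lower block of the point 1.
  In this way the tests below, formulated for rank 1, speak about all elements of rank 0.\<close>

lemma rank_1_cover:
 assumes n: "n >= 1" and z: "ze0 : partitions n" "rank ze0 = 0"
 obtains ze where "ze : partitions n" "rank ze = 1" "hat ze = ze0"
proof -
 define u where "u x = (if uu ze0 1 x then None else Some (blk ze0 (Upper x)))" for x
 define l where "l x = (if ll ze0 1 x then None else Some (blk ze0 (Lower x)))" for x
 let ?z = "lab n u l"
 have 1: "uu ze0 1 1" "ll ze0 1 1" using n z by auto
 note t = rel_trans[OF z(1)] rel_sym
 have uu: "u x = u y <-> uu ze0 x y" if "x : {1..n}" "y : {1..n}" for x y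
  using blk_eq_iff[OF z(1), of "Upper y" "Upper x"] that t(1)[of "Upper 1" "Upper x" "Upper y"] t(1)[of "Upper 1" "Upper y" "Upper x"]
   t(1)[of "Upper x" "Upper 1" "Upper y"] t(2)[of ze0 "Upper x" "Upper y"] t(2)[of ze0 "Upper 1" "Upper x"]
  unfolding u_def by auto
 have ll: "l x = l y <-> ll ze0 x y" if "x : {1..n}" "y : {1..n}" for x y
  using blk_eq_iff[OF z(1), of "Lower y" "Lower x"] that t(1)[of "Lower 1" "Lower x" "Lower y"] t(1)[of "Lower 1" "Lower y" "Lower x"]
   t(1)[of "Lower x" "Lower 1" "Lower y"] t(2)[of ze0 "Lower x" "Lower y"] t(2)[of ze0 "Lower 1" "Lower x"]
  unfolding l_def by auto
 have ul: "u x = l y <-> uu ze0 1 x & ll ze0 1 y" if xy: "x : {1..n}" "y : {1..n}" for x y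
 proof -
  have "blk ze0 (Upper x) ~= blk ze0 (Lower y)"
   using blk_eq_iff[OF z(1), of "Lower y" "Upper x"] xy rank_0_ul[OF z] by simp
  then show ?thesis unfolding u_def l_def by auto
 qed
 have ud: "x : udom ?z <-> uu ze0 1 x" for x
  unfolding mem_udom rel_lab_simps using ul 1 uu_range[OF z(1)] ll_range[OF z(1)] by blast
 have "rank ?z <= 1" unfolding rank_le_1_iff[OF lab_in]
 proof (intro ballI)
  fix x y assume "x : udom ?z" "y : udom ?z"
  then have "uu ze0 x y" "x : {1..n}" "y : {1..n}"
   unfolding ud using t(1)[OF t(2)] uu_range[OF z(1)] by blast+
  then show "uu ?z x y" using uu by simp
 qed
 moreover have "rank ?z ~= 0" unfolding rank_0_iff[OF lab_in] using ud 1(1) by blast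
 moreover have "hat ?z = ze0"
 proof (rule partition_eqI[OF hat_in[OF lab_in] z(1)])
  fix x y
  show "uu (hat ?z) x y = uu ze0 x y" using uu uu_range[OF z(1), of x y] by auto
  show "ll (hat ?z) x y = ll ze0 x y" using ll ll_range[OF z(1), of x y] by auto
  show "ul (hat ?z) x y = ul ze0 x y" using rank_0_ul[OF z] by simp
 qed
 ultimately show ?thesis using that[of ?z] by simp
qed

definition saturated :: "partition => nat set => bool" where
 "saturated ka S <-> (ALL u v. uu ka u v --> (u : S <-> v : S))"

text \<open>If an upper block of \<open>ka\<close> crosses the boundary of \<open>S\<close>, the two
  blocks of the left factor fuse and the whole middle row is attached to the transversal, hence
  \<open>UNIV\<close>.\<close>

definition test_part :: "partition => nat set => bool => partition => partition" where
 "test_part ka S c ze = (if udom ka \<inter> (if saturated ka S then S else UNIV) ~= {} & c then ze else hat ze)"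

text \<open>The first summand counts the points outside \<open>S\<close>, which float as one
  component if no transversal of \<open>ka\<close> meets them. The second concerns the fused middle
  row of the right factor, which floats if it is attached neither above nor below.\<close>

definition test_floats :: "nat => partition => nat set => bool => nat" where
 "test_floats n ka S c = (if saturated ka S & udom ka \<subseteq> S & ~{1..n} \<subseteq> S then 1 else 0) +
   (if c | udom ka \<inter> (if saturated ka S then S else UNIV) ~= {} then 0 else 1)"

text \<open>The two-block test: the left factor attaches the middle points of \<open>S\<close> to the upper part of the
 transversal of \<open>ze\<close> and leaves the other middle points in one block of their own; the right factor
 attaches all middle points to the lower part of the transversal of \<open>ze\<close> (if \<open>c\<close>) or to nothing.\<close>

lemma two_block_test:
 fixes S :: "nat set" and c :: bool
 assumes n: "n >= 1" and z: "ze : partitions n" "rank ze = 1"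
 shows "EX de:partitions n. EX ep:partitions n. ALL ka:partitions n.
  part_mult n (part_mult n de ka) ep = test_part ka S c ze &
  floating n de ka + floating n (part_mult n de ka) ep = test_floats n ka S c"
proof -
 obtain x0 where x0: "x0 : udom ze" using udom_rank_1(1)[OF z] by blast
 obtain y0 where y0: "ul ze x0 y0" using x0 unfolding mem_udom by blast
 have r: "x0 : {1..n}" "y0 : {1..n}" using ul_range[OF z(1) y0] by simp_all
 have z1: "rank ze <= 1" using z(2) by simp
 define f where "f x = blk ze (Upper x)" for x
 define g where "g x = blk ze (Lower x)" for x
 define a where "a = blk ze (Upper x0)"
 \<comment> \<open>The empty set is the label of no block of \<open>ze\<close>; it stands for points
   attached to nothing.\<close>
 define cc where "cc = (if c then a else {})"
 define d where "d u = (if u : S then a else {})" for u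
 have ag: "a = g y0" unfolding a_def g_def using blk_eq_iff[OF z(1), of "Lower y0"] y0 r by simp
 have fne: "f x ~= {}" "g x ~= {}" if "x : {1..n}" for x
 proof -
  have "Upper x : f x" "Lower x : g x" using that z unfolding f_def g_def by auto
  then show "f x ~= {}" "g x ~= {}" by blast+
 qed
 have ff: "f x = f y <-> uu ze x y" "g x = g y <-> ll ze x y" if "x : {1..n}" "y : {1..n}" for x y
  using blk_eq_iff[OF z(1), of "Upper y" "Upper x"] blk_eq_iff[OF z(1), of "Lower y" "Lower x"] that unfolding f_def g_def by simp_all
 have fa: "f x = a <-> x : udom ze" if x: "x : {1..n}" for x
  using ff(1)[OF r(1) x] udom_rank_1(2)[OF z x0, of x] unfolding a_def f_def by auto
 have y0l: "y0 : ldom ze" using y0 unfolding mem_ldom by blast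
 have ga: "g x = a <-> x : ldom ze" if x: "x : {1..n}" for x
  using ff(2)[OF r(2) x] ldom_rank_1(2)[OF z y0l, of x] unfolding ag by auto
 have af: "a : f ` {1..n}" "a : g ` {1..n}" "a ~= {}" using r fne unfolding ag using a_def ag f_def by auto
 have nf: "{} ~: f ` {1..n}" "{} ~: g ` {1..n}" using fne by (metis imageE)+
 let ?d = "lab n f d" and ?e = "lab n (%_. cc) g"
 have ccg: "cc : g ` {1..n} <-> c" unfolding cc_def using af nf by auto
 have res: "part_mult n \<mu> ?e = (if udom \<mu> ~= {} & c then ze else hat ze) &
   floating n \<mu> ?e = (if c | udom \<mu> ~= {} then 0 else 1)"
  if m: "\<mu> : partitions n" "!!x y. uu \<mu> x y <-> uu ze x y" "udom \<mu> = udom ze | udom \<mu> = {}" for \<mu>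
 proof
  note R = right_full[OF m(1), of cc g]
  show "floating n \<mu> ?e = (if c | udom \<mu> ~= {} then 0 else 1)"
   unfolding R(4)[OF n] ccg ..
  have ull: "uu (part_mult n \<mu> ?e) x y <-> uu ze x y" "ll (part_mult n \<mu> ?e) x y <-> ll ze x y" for x y
  proof -
   have "uu ze x y" if "x : udom \<mu>" "y : udom \<mu>" using that m(3) udom_rank_1(2)[OF z] by auto
   then show "uu (part_mult n \<mu> ?e) x y <-> uu ze x y" unfolding R(1) m(2) by blast
   show "ll (part_mult n \<mu> ?e) x y <-> ll ze x y" unfolding R(3) using ff(2)[of x y] ll_range[OF z(1), of x y] by blast
  qed
  show "part_mult n \<mu> ?e = (if udom \<mu> ~= {} & c then ze else hat ze)"
  proof (cases "udom \<mu> ~= {} & c")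
   case True
   then have "udom \<mu> = udom ze" "cc = a" using m(3) unfolding cc_def by auto
   then have "ul (part_mult n \<mu> ?e) x y <-> ul ze x y" for x y
    unfolding R(2) ul_rank_1[OF z(1) z1] using ga[of y] ldom_sub[OF z(1)] by auto
   then have "part_mult n \<mu> ?e = ze" using ull by (intro partition_eqI[OF part_mult_in z(1)])
   then show ?thesis using True by simp
  next
   case False
   then have "udom \<mu> = {} | cc = {}" unfolding cc_def by auto
   then have "~ul (part_mult n \<mu> ?e) x y" for x y unfolding R(2) using fne(2)[of y] by auto
   then have "part_mult n \<mu> ?e = hat ze" using ull by (intro partition_eqI[OF part_mult_in hat_in[OF z(1)]]) simp_all
   then show ?thesis unfolding if_not_P[OF False] .
  qed
 qed
 show ?thesis
 proof (rule bexI[of _ ?d], rule bexI[of _ ?e], rule ballI)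
  fix ka assume k: "ka : partitions n"
  show "part_mult n (part_mult n ?d ka) ?e = test_part ka S c ze &
   floating n ?d ka + floating n (part_mult n ?d ka) ?e = test_floats n ka S c"
  proof (cases "saturated ka S")
  case sat: True
  have s': "ALL u v. uu ka u v --> d u = d v" using sat unfolding d_def saturated_def by simp
  note L = left_mult[OF k s', of f]
  let ?m = "part_mult n ?d ka"
  have "uu ?m x y <-> uu ze x y" for x y unfolding L(1) using ff(1)[of x y] uu_range[OF z(1), of x y] by blast
  moreover have ud: "x : udom ?m <-> x : udom ze & udom ka \<inter> S ~= {}" for x
  proof -
   have "x : udom ?m <-> x : {1..n} & (EX u:udom ka. d u = f x)"
    unfolding Bex_def mem_udom L(2) by blast
   also have "\<dots> <-> x : {1..n} & (EX u:udom ka. u : S & f x = a)"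
    unfolding d_def using fne(1)[of x] by (auto split: if_splits)
   also have "\<dots> <-> x : udom ze & udom ka \<inter> S ~= {}" using fa[of x] subsetD[OF udom_sub[OF z(1)], of x] by auto
   finally show ?thesis .
  qed
  moreover have ue: "udom ?m ~= {} <-> udom ka \<inter> S ~= {}" using ud x0 by blast
  moreover have "udom ?m = udom ze | udom ?m = {}" using ud by blast
  ultimately have 1: "part_mult n ?m ?e = (if udom ka \<inter> S ~= {} & c then ze else hat ze) &
   floating n ?m ?e = (if c | udom ka \<inter> S ~= {} then 0 else 1)" using res[OF part_mult_in, of ?d ka] by simp
  have "d u ~: f ` {1..n} <-> u ~: S" for u unfolding d_def using af nf by auto
  moreover have "d v = d u <-> v ~: S" if "u ~: S" for u v unfolding d_def using af(3) that by auto
  ultimately have "d u ~: f ` {1..n} & (ALL v:udom ka. d v ~= d u) <-> u ~: S & udom ka \<subseteq> S" for u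
   by (cases "u : S") auto
  then have se: "{u : {1..n}. d u ~: f ` {1..n} & (ALL v:udom ka. d v ~= d u)} = (if udom ka \<subseteq> S then {u : {1..n}. u ~: S} else {})"
   by simp
  have ie: "d ` {u : {1..n}. u ~: S} = (if {1..n} \<subseteq> S then {} else {{}})" unfolding d_def by auto
  have "floating n ?d ka = (if udom ka \<subseteq> S & ~{1..n} \<subseteq> S then 1 else 0)"
  proof (cases "udom ka \<subseteq> S")
   case True
   show ?thesis unfolding L(4) se if_P[OF True] ie using True by simp
  next
   case False
   show ?thesis unfolding L(4) se if_not_P[OF False] using False by simp
  qed
  with 1 show ?thesis unfolding test_part_def test_floats_def using sat by simp
 next
  case False
  \<comment> \<open>An upper block of \<open>ka\<close> joins a point of \<open>S\<close> to a point
    outside, so the two lower blocks of the left factor become one component of the middle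
    row.\<close>
  then obtain u0 v0 where uv: "uu ka u0 v0" "u0 : S" "v0 ~: S" unfolding saturated_def using rel_sym by blast
  have r0: "u0 : {1..n}" "v0 : {1..n}" using uu_range[OF k uv(1)] by blast+
  have mid: "(u, u0) : mid ?d ka" if u: "u : {1..n}" for u
  proof (cases "u : S")
   case True
   then have "ll ?d u u0" using u r0 uv unfolding rel_lab_simps d_def by simp
   then show ?thesis by (rule mid_ll)
  next
   case False
   then have "ll ?d u v0" using u r0 uv unfolding rel_lab_simps d_def by simp
   then show ?thesis using mid_ll mid_sym[OF mid_uu[OF uv(1)]] mid_trans by blast
  qed
  have h: "midh n ?d ka (%_. ())"
   unfolding midh_def using mid_trans[OF mid mid_sym[OF mid]] by simp
  note p = prod_rel[OF lab_in k h, unfolded rel_lab_simps]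
  let ?m = "part_mult n ?d ka"
  have fd: "f x = d u <-> u : S & x : udom ze" if "x : {1..n}" for x u
   using fa[OF that] fne(1)[OF that] unfolding d_def by auto
  have "uu ze x y" if "x : {1..n}" "y : {1..n}" "f x = d u" "f y = d v" for x y u v
  proof -
   have "x : udom ze" "y : udom ze" using that fd by simp_all
   then show ?thesis using udom_rank_1(2)[OF z, of x y] by blast
  qed
  then have "uu ?m x y <-> uu ze x y" for x y unfolding p(1) using ff(1)[of x y] uu_range[OF z(1), of x y] by blast
  moreover have ud: "x : udom ?m <-> x : udom ze & udom ka ~= {}" for x
  proof
   assume "x : udom ?m"
   then show "x : udom ze & udom ka ~= {}" unfolding mem_udom p(2) using fd[of x] by (auto simp: udom_def)
  next
   assume a: "x : udom ze & udom ka ~= {}"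
   then have "x : {1..n}" using udom_sub[OF z(1)] by blast
   moreover then have "f x = d u0" using fd a uv(2) by blast
   moreover obtain v y where "ul ka v y" using a unfolding udom_def by blast
   ultimately show "x : udom ?m" unfolding mem_udom p(2) using r0 by blast
  qed
  moreover have ue: "udom ?m ~= {} <-> udom ka ~= {}" using ud x0 by blast
  moreover have "udom ?m = udom ze | udom ?m = {}" using ud by blast
  ultimately have 1: "part_mult n ?m ?e = (if udom ka ~= {} & c then ze else hat ze) &
   floating n ?m ?e = (if c | udom ka ~= {} then 0 else 1)" using res[OF part_mult_in, of ?d ka] by simp
  have "f x0 = d u0" using fd[OF r(1)] x0 uv(2) by blast
  then have "~(ALL v:{1..n}. () = () --> (ALL x. ~(x : {1..n} & v : {1..n} & f x = d v) & ~ul ka v x))"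
   using r r0 by blast
  then have "{u : {1..n}. ALL v:{1..n}. () = () --> (ALL x. ~(x : {1..n} & v : {1..n} & f x = d v) & ~ul ka v x)} = {}"
   by (simp only: simp_thms Collect_const if_False)
  then have "floating n ?d ka = 0" unfolding p(4) by (simp only: image_empty card.empty)
  with 1 show ?thesis unfolding test_part_def test_floats_def using False by simp
  qed
 qed auto
qed

section \<open>Elements of rank zero, merging of kernels, and tests on related pairs\<close>

definition zero :: "nat => (nat => 'a) => (nat => 'b) => partition" where
 "zero n f g = lab n (%x. Inl (f x)) (%y. Inr (g y))"

lemma zero_in [simp, intro]: "zero n f g : partitions n"
 by (simp add: zero_def)

lemma rel_zero [simp]:
 "uu (zero n f g) x y <-> x : {1..n} & y : {1..n} & f x = f y" "~ul (zero n f g) x y"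
 "ll (zero n f g) x y <-> x : {1..n} & y : {1..n} & g x = g y"
 by (simp_all add: zero_def)

lemma rank_zero [simp]: "rank (zero n f g) = 0"
 unfolding rank_0_iff[OF zero_in] udom_def by simp

lemma zero_eqI:
 assumes "!!x y. [|x : {1..n}; y : {1..n}|] ==> f x = f y <-> f' x = f' y"
  "!!x y. [|x : {1..n}; y : {1..n}|] ==> g x = g y <-> g' x = g' y"
 shows "zero n f g = zero n f' g'"
 by (rule partition_eqI[OF zero_in zero_in]) (use assms in auto)

lemma rank_0_eq_zero:
 assumes "ze : partitions n" "rank ze = 0"
 shows "ze = zero n (%x. {z. uu ze x z}) (%x. {z. ll ze x z})"
proof -
 have e: "{z. rel ze v (F z)} = {z. rel ze (F y) (F z)} <-> rel ze v (F y)" if "F y : verts n" for v y and F :: "nat => vertex"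
 proof
  assume "{z. rel ze v (F z)} = {z. rel ze (F y) (F z)}"
  moreover have "rel ze (F y) (F y)" using that assms(1) by simp
  ultimately show "rel ze v (F y)" by blast
 next
  assume r: "rel ze v (F y)"
  show "{z. rel ze v (F z)} = {z. rel ze (F y) (F z)}"
   using rel_trans[OF assms(1) rel_sym[OF r]] rel_trans[OF assms(1) r] by blast
 qed
 show ?thesis
 proof (rule partition_eqI[OF assms(1) zero_in])
  fix x y
  show "uu ze x y = uu (zero n (%x. {z. uu ze x z}) (%x. {z. ll ze x z})) x y"
   using e[of Upper y "Upper x"] uu_range[OF assms(1), of x y] unfolding rel_zero verts_iff by blast
  show "ll ze x y = ll (zero n (%x. {z. uu ze x z}) (%x. {z. ll ze x z})) x y"
   using e[of Lower y "Lower x"] ll_range[OF assms(1), of x y] unfolding rel_zero verts_iff by blast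
  show "ul ze x y = ul (zero n (%x. {z. uu ze x z}) (%x. {z. ll ze x z})) x y"
   using rank_0_ul[OF assms] by simp
 qed
qed

text \<open>Two upper blocks (with labels \<open>a\<close> and \<open>b\<close>) of a partition of rank zero get merged by the
 second middle factor, but not by the first.\<close>

lemma merge_test:
 fixes f :: "nat => 'a" and g :: "nat => 'b" and a b :: 'a
 assumes X: "X : partitions n" "rank X <= 1" "saturated X S" and Y: "Y : partitions n" "uu Y u0 v0" "u0 : S" "v0 ~: S"
 defines "de == lab n f (%u. if u : S then a else b)" and "ep == lab n (%_. None) (%y. Some (g y))"
 shows "part_mult n (part_mult n de X) ep = zero n f g"
  and "part_mult n (part_mult n de Y) ep = zero n (%x. if f x = b then a else f x) g"
proof -
 let ?d = "%u. if u : S then a else b"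
 have res: "part_mult n \<mu> ep = zero n h g" if m: "\<mu> : partitions n" "!!x y. uu \<mu> x y <-> x : {1..n} & y : {1..n} & h x = h y"
  "!!x y. [|x : udom \<mu>; y : udom \<mu>|] ==> h x = h y" for \<mu> and h :: "nat => 'a"
  unfolding ep_def
 proof (rule partition_eqI[OF part_mult_in zero_in])
  note R = right_full[OF m(1), of None "%y. Some (g y)"]
  fix x y
  show "uu (part_mult n \<mu> (lab n (%_. None) (%y. Some (g y)))) x y = uu (zero n h g) x y"
   unfolding R(1) rel_zero m(2) using m(3)[of x y] udom_sub[OF m(1)] by blast
  show "ul (part_mult n \<mu> (lab n (%_. None) (%y. Some (g y)))) x y = ul (zero n h g) x y"
   unfolding R(2) by simp
  show "ll (part_mult n \<mu> (lab n (%_. None) (%y. Some (g y)))) x y = ll (zero n h g) x y"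
   unfolding R(3) by simp
 qed
 show "part_mult n (part_mult n de X) ep = zero n f g"
 proof (rule res[OF part_mult_in])
  have d: "ALL u v. uu X u v --> ?d u = ?d v" using X(3) unfolding saturated_def by auto
  note L = left_mult[OF X(1) d, of f, folded de_def]
  show "uu (part_mult n de X) x y <-> x : {1..n} & y : {1..n} & f x = f y" for x y by (rule L(1))
  fix x y assume "x : udom (part_mult n de X)" "y : udom (part_mult n de X)"
  then obtain u v where uv: "u : udom X" "v : udom X" "?d u = f x" "?d v = f y"
   unfolding mem_udom L(2) by blast
  then have "uu X u v" using X(2) rank_le_1_iff[OF X(1)] by blast
  then show "f x = f y" using d uv by metis
 qed
 show "part_mult n (part_mult n de Y) ep = zero n (%x. if f x = b then a else f x) g"
 proof (rule res[OF part_mult_in])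
  have r0: "u0 : {1..n}" "v0 : {1..n}" using uu_range[OF Y(1,2)] by blast+
  have mid: "(u, u0) : mid de Y" if u: "u : {1..n}" for u
  proof (cases "u : S")
   case True
   then have "ll de u u0" using u r0 Y unfolding rel_lab_simps de_def by simp
   then show ?thesis by (rule mid_ll)
  next
   case False
   then have "ll de u v0" using u r0 Y unfolding rel_lab_simps de_def by simp
   then show ?thesis using mid_ll mid_sym[OF mid_uu[OF Y(2)]] mid_trans by blast
  qed
  have h: "midh n de Y (%_. ())"
   unfolding midh_def using mid_trans[OF mid mid_sym[OF mid]] by simp
  have d: "de : partitions n" unfolding de_def by simp
  note p = prod_rel[OF d Y(1) h]
  have dom: "(EX u. ul de x u) <-> x : {1..n} & (f x = a | f x = b)" for x
   unfolding de_def rel_lab_simps using r0 Y(3,4) by (metis (full_types))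
  have "uu (part_mult n de Y) x y <-> uu de x y | (EX u. ul de x u) & (EX u. ul de y u)" for x y
   unfolding p(1) by simp
  then show "uu (part_mult n de Y) x y <-> x : {1..n} & y : {1..n} &
    (if f x = b then a else f x) = (if f y = b then a else f y)" for x y
   unfolding dom unfolding de_def rel_lab_simps by auto
  have "x : {1..n} & (f x = a | f x = b)" if "x : udom (part_mult n de Y)" for x
   using that dom[of x] unfolding mem_udom p(2) by blast
  then show "(if f x = b then a else f x) = (if f y = b then a else f y)"
   if "x : udom (part_mult n de Y)" "y : udom (part_mult n de Y)" for x y using that by auto
 qed
qed

context tcong
begin

lemma E_sandwich_ge:
 assumes "E i al j be" "de : partitions n" "ep : partitions n"
 shows "EX N N'. N >= i & N' >= j & E N (part_mult n (part_mult n de al) ep) N' (part_mult n (part_mult n de be) ep)"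
 using E_sandwich[OF assms] by (meson le_add1 le_trans)

lemma E_test:
 assumes e: "E i al j be" and z: "ze : partitions n" "rank ze = 1"
 shows "E (i + test_floats n al S c) (test_part al S c ze) (j + test_floats n be S c) (test_part be S c ze)"
proof -
 from two_block_test[OF n z, of S c] obtain de ep where d: "de : partitions n" "ep : partitions n"
  and o: "ALL ka:partitions n. part_mult n (part_mult n de ka) ep = test_part ka S c ze &
   floating n de ka + floating n (part_mult n de ka) ep = test_floats n ka S c" by blast
 from E_sandwich[OF e d] bspec[OF o E_in(1)[OF e]] bspec[OF o E_in(2)[OF e]] show ?thesis by (simp add: add.assoc)
qed

text \<open>With \<open>S = UNIV\<close> and everything attached below, nothing floats; the test
  only reveals whether a transversal exists.\<close>

lemma E_full:
 assumes "E i al j be" "ze : partitions n" "rank ze = 1"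
 shows "E i (if udom al = {} then hat ze else ze) j (if udom be = {} then hat ze else ze)"
 using E_test[OF assms, of UNIV True] unfolding test_part_def test_floats_def saturated_def by (simp split: if_splits)

text \<open>Without attachment below the transversal is destroyed, and the fused middle row floats
  precisely over elements of rank 0.\<close>

lemma E_kill:
 assumes "E i al j be" "ze : partitions n" "rank ze = 1"
 shows "E (i + (if udom al = {} then 1 else 0)) (hat ze) (j + (if udom be = {} then 1 else 0)) (hat ze)"
 using E_test[OF assms, of UNIV False] unfolding test_part_def test_floats_def saturated_def by (simp split: if_splits)

text \<open>The class of \<open>u\<close> in \<open>X\<close>, or its complement. As
  \<open>X\<close> has rank at most 1, its domain lies in a single class and hence inside one of the
  two sets; that one is taken for \<open>S\<close>.\<close>

lemma separating_set:
 assumes X: "X : partitions n" "rank X <= 1" and uv: "~uu X u v" "uu Y u v" and Y: "Y : partitions n"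
 obtains S where "saturated X S" "~saturated Y S" "saturated X (- S)" "~saturated Y (- S)"
  "udom X \<subseteq> S" "~{1..n} \<subseteq> S" "~{1..n} \<subseteq> - S"
proof -
 have r: "u : {1..n}" "v : {1..n}" using uu_range[OF Y uv(2)] by blast+
 define S0 where "S0 = {w. uu X u w}"
 have s: "saturated X S0" unfolding saturated_def S0_def using rel_trans[OF X(1)] rel_sym by blast
 have uS: "u : S0" "v ~: S0" using r X uv unfolding S0_def by auto
 have c: "saturated Z (- S) <-> saturated Z S" for Z S unfolding saturated_def by auto
 have ns: "~saturated Y S0" using uS uv(2) unfolding saturated_def by blast
 have "udom X \<subseteq> S0 | udom X \<subseteq> - S0"
 proof (cases "udom X \<inter> S0 = {}")
  case False
  then obtain w where w: "w : udom X" "w : S0" by blast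
  have "w' : S0" if "w' : udom X" for w'
  proof -
   have "uu X w w'" using X(2) rank_le_1_iff[OF X(1)] w(1) that by blast
   then show ?thesis using s w(2) unfolding saturated_def by blast
  qed
  then show ?thesis by blast
 qed blast
 then show ?thesis
 proof
  assume "udom X \<subseteq> S0"
  then show ?thesis using that[of S0] s ns c uS r by blast
 next
  assume "udom X \<subseteq> - S0"
  then show ?thesis by (intro that[of "- S0"]) (use s ns c uS r in auto)
 qed
qed

text \<open>If \<open>b < a\<close>, the chain runs from \<open>b\<close> to \<open>a\<close>, on to
  \<open>a + 1\<close>, and back to \<open>b + 1\<close> by a shift.\<close>

lemma E_min:
 assumes a: "E a gm (Suc a) gm" and b: "E a gm b gm"
 shows "E (min a b) gm (Suc (min a b)) gm"
proof (cases "a <= b")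
 case False
 have "E b gm a gm" using b by (rule E_sym)
 also note a
 also have "E (Suc a) gm (Suc b) gm" using E_shift[OF b, of 1] by simp
 finally show ?thesis using False by simp
qed (use a in simp)

text \<open>\<open>x\<close> and \<open>y\<close> are the levels of \<open>X\<close> and \<open>Y\<close>, and the kernel of \<open>Y\<close> is not contained in that of
 \<open>X\<close>.\<close>

lemma E_separate:
 assumes e: "E x X y Y" and r: "rank X <= 1" "rank Y <= 1" and uv: "~uu X u v" "uu Y u v"
  and z: "ze : partitions n" "rank ze = 1"
 shows "E (Suc x) (if udom X = {} then hat ze else ze) y (if udom Y = {} then hat ze else ze)"
  and "udom X ~= {} ==> E (Suc x) (hat ze) (y + (if udom Y = {} then 1 else 0)) (hat ze)"
  and "udom X ~= {} ==> E x (hat ze) y (if udom Y = {} then hat ze else ze)"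
proof -
 note XY = E_in[OF e]
 obtain S where S: "saturated X S" "~saturated Y S" "saturated X (- S)" "~saturated Y (- S)"
  "udom X \<subseteq> S" "~{1..n} \<subseteq> S" "~{1..n} \<subseteq> - S" using separating_set[OF XY(1) r(1) uv XY(2)] .
 have i: "udom X \<inter> S = udom X" "udom X \<inter> - S = {}" using S(5) by blast+
 \<comment> \<open>\<open>S\<close> cuts a block of \<open>Y\<close> but none of \<open>X\<close>:
   over \<open>X\<close> the points outside \<open>S\<close> float and add one level, over
   \<open>Y\<close> the two blocks fuse and nothing floats.\<close>
 show "E (Suc x) (if udom X = {} then hat ze else ze) y (if udom Y = {} then hat ze else ze)"
  using E_test[OF e z, of S True] unfolding test_part_def test_floats_def using S i by (simp split: if_splits)
 assume "udom X ~= {}"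
 then have "~udom X \<subseteq> - S" using i by blast
 then show "E x (hat ze) y (if udom Y = {} then hat ze else ze)"
  using E_test[OF e z, of "- S" True] unfolding test_part_def test_floats_def using S i by (simp split: if_splits)
 show "E (Suc x) (hat ze) (y + (if udom Y = {} then 1 else 0)) (hat ze)"
  using E_test[OF e z, of S False] unfolding test_part_def test_floats_def using S i \<open>udom X ~= {}\<close> by (simp split: if_splits)
qed

text \<open>A test that detects the differing kernels changes the level or the rank on one side
  only. Compared with a test that does not detect them, it relates consecutive levels. The three
  combinations of ranks differ in which tests keep the transversal.\<close>

lemma lambda_levels:
 assumes e: "E i al j be" and r: "rank al <= 1" "rank be <= rank al" and uv: "uu al u v ~= uu be u v"
  and z: "ze : partitions n" "rank ze = 1"
 shows "E (min i j) (hat ze) (Suc (min i j)) (hat ze)"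
  and "rank al = 1 ==> EX N>=min i j. E i ze N (hat ze)"
proof -
 note ab = E_in[OF e]
 have r': "rank be <= 1" using r by simp
 have u0: "udom al = {} <-> rank al = 0" "udom be = {} <-> rank be = 0" using rank_0_iff ab by simp_all
 from uv consider (a) "~uu al u v" "uu be u v" | (b) "~uu be u v" "uu al u v" by blast
 note cs = this
 from r consider "rank al = 0" "rank be = 0" | "rank al = 1" "rank be = 1" | "rank al = 1" "rank be = 0" by linarith
 then have "E (min i j) (hat ze) (Suc (min i j)) (hat ze) & (rank al = 1 --> (EX N>=min i j. E i ze N (hat ze)))"
 proof cases
  case 1
  then have ud: "udom al = {}" "udom be = {}" using u0 by blast+
  have f: "E i (hat ze) j (hat ze)" using E_full[OF e z] ud by simp
  show ?thesis using cs
  proof cases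
   case a
   have "E (Suc i) (hat ze) j (hat ze)" using E_separate(1)[OF e r(1) r' a z] ud by simp
   then have "E i (hat ze) (Suc i) (hat ze)" using f E_sym E_trans by blast
   from E_min[OF this f] show ?thesis using 1 by simp
  next
   case b
   have "E (Suc j) (hat ze) i (hat ze)" using E_separate(1)[OF E_sym[OF e] r' r(1) b z] ud by simp
   then have "E j (hat ze) (Suc j) (hat ze)" using f E_sym E_trans by blast
   from E_min[OF this E_sym[OF f]] show ?thesis using 1 by (simp add: min.commute)
  qed
 next
  case 2
  then have ud: "udom al ~= {}" "udom be ~= {}" using u0 by simp_all
  have f: "E i (hat ze) j (hat ze)" using E_kill[OF e z] ud by simp
  have g: "E i ze j ze" using E_full[OF e z] ud by simp
  show ?thesis using cs
  proof cases
   case a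
   have "E (Suc i) (hat ze) j (hat ze)" using E_separate(2)[OF e r(1) r' a z] ud by simp
   then have "E i (hat ze) (Suc i) (hat ze)" using f E_sym E_trans by blast
   note m = E_min[OF this f]
   have "E i (hat ze) j ze" using E_separate(3)[OF e r(1) r' a z] ud by simp
   then have "E i ze i (hat ze)" using g E_sym E_trans by blast
   then show ?thesis using m by (auto intro!: exI[of _ i])
  next
   case b
   have "E (Suc j) (hat ze) i (hat ze)" using E_separate(2)[OF E_sym[OF e] r' r(1) b z] ud by simp
   then have "E j (hat ze) (Suc j) (hat ze)" using f E_sym E_trans by blast
   note m = E_min[OF this E_sym[OF f]]
   have "E j (hat ze) i ze" using E_separate(3)[OF E_sym[OF e] r' r(1) b z] ud by simp
   then have "E i ze j (hat ze)" by (rule E_sym)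
   then show ?thesis using m by (auto simp: min.commute intro!: exI[of _ j])
  qed
 next
  case 3
  then have ud: "udom al ~= {}" "udom be = {}" using u0 by simp_all
  have g: "E i ze j (hat ze)" using E_full[OF e z] ud by simp
  have "E (min i j) (hat ze) (Suc (min i j)) (hat ze)" using cs
  proof cases
   case a
   have 1: "E i (hat ze) j (hat ze)" using E_separate(3)[OF e r(1) r' a z] ud by simp
   have "E (Suc i) ze j (hat ze)" using E_separate(1)[OF e r(1) r' a z] ud by simp
   then have 2: "E i ze (Suc i) ze" using g E_sym E_trans by blast
   have 3: "E i ze i (hat ze)" using g 1 E_sym E_trans by blast
   then have "E (Suc i) ze (Suc i) (hat ze)" using E_shift[OF 3, of 1] by simp
   then have "E i (hat ze) (Suc i) (hat ze)" using 2 3 E_sym E_trans by blast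
   from E_min[OF this 1] show ?thesis .
  next
   case b
   have "E (Suc j) (hat ze) i ze" using E_separate(1)[OF E_sym[OF e] r' r(1) b z] ud by simp
   then have 1: "E j (hat ze) (Suc j) (hat ze)" using g E_sym E_trans by blast
   have "E i (hat ze) (Suc j) (hat ze)" using E_kill[OF e z] ud by simp
   then have "E j (hat ze) i (hat ze)" using 1 E_sym E_trans by blast
   from E_min[OF 1 this] show ?thesis by (simp add: min.commute)
  qed
  then show ?thesis using g by (auto intro!: exI[of _ j])
 qed
 then show "E (min i j) (hat ze) (Suc (min i j)) (hat ze)" "rank al = 1 ==> EX N>=min i j. E i ze N (hat ze)" by blast+
qed

lemma lambda_merge:
 fixes f :: "nat => 'a" and g :: "nat => 'b" and a b :: 'a
 assumes e: "E i al j be" and r: "rank al <= 1" "rank be <= 1" and uv: "uu al u v ~= uu be u v"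
 shows "EX N N'. N >= min i j & N' >= min i j & E N (zero n f g) N' (zero n (%x. if f x = b then a else f x) g)"
proof -
 have *: "EX N N'. N >= x & N' >= y & E N (zero n f g) N' (zero n (%x. if f x = b then a else f x) g)"
  if e: "E x X y Y" and r: "rank X <= 1" and uv: "~uu X u v" "uu Y u v" for x y X Y
 proof -
  note XY = E_in[OF e]
  obtain S where S: "saturated X S" "~saturated Y S" using separating_set[OF XY(1) r uv XY(2)] .
  then obtain u v where "uu Y u v" "u : S" "v ~: S" unfolding saturated_def using rel_sym by blast
  note m = merge_test[OF XY(1) r S(1) XY(2) this, of f a b g]
  from E_sandwich_ge[OF e lab_in lab_in, of f "%u. if u : S then a else b" "%_. None" "%y. Some (g y)"]
  show ?thesis unfolding m .
 qed
 from uv consider (a) "~uu al u v" "uu be u v" | (b) "~uu be u v" "uu al u v" by blast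
 then show ?thesis
 proof cases
  case a
  from *[OF e r(1) a] show ?thesis by (meson min.coboundedI1 min.coboundedI2)
 next
  case b
  from *[OF E_sym[OF e] r(2) b] show ?thesis by (meson min.coboundedI1 min.coboundedI2)
 qed
qed

text \<open>Upper blocks are merged two at a time, by induction on their number.\<close>

lemma zero_collapse:
 fixes f :: "nat => 'a" and g :: "nat => 'b"
 assumes m: "!!(f :: nat => 'a) a b. E m (zero n f g) m (zero n (%x. if f x = b then a else f x) g)"
 shows "E m (zero n f g) m (zero n (%_. ()) g)"
proof (induction "card (f ` {1..n})" arbitrary: f rule: less_induct)
 case less
 show ?case
 proof (cases "EX a b. a : f ` {1..n} & b : f ` {1..n} & a ~= b")
  case True
  then obtain a b where ab: "a : f ` {1..n}" "b : f ` {1..n}" "a ~= b" by blast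
  let ?f = "%x. if f x = b then a else f x"
  have "?f ` {1..n} \<subseteq> f ` {1..n}" using ab(1) by (intro image_subsetI) simp
  moreover have "b ~: ?f ` {1..n}" using ab(3) by (auto split: if_splits)
  ultimately have "?f ` {1..n} \<subset> f ` {1..n}" using ab(2) by blast
  then have "card (?f ` {1..n}) < card (f ` {1..n})" by (intro psubset_card_mono) auto
  from less[OF this] m show ?thesis using E_trans by blast
 next
  case False
  then have "f x = f y <-> () = ()" if "x : {1..n}" "y : {1..n}" for x y using that by blast
  then have "zero n f g = zero n (%_. ()) g" by (rule zero_eqI[OF _ refl])
  then show ?thesis using E_refl by simp
 qed
qed

text \<open>From \<open>min i j\<close> on all levels of row 0 agree and upper kernels can be merged
  away, so that only the lower kernel distinguishes elements.\<close>

lemma E_lambda_zero: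
 assumes e: "E i al j be" and r: "rank al <= 1" "rank be <= rank al" and uv: "uu al u v ~= uu be u v"
  and z: "ze : partitions n" "ze' : partitions n" "rank ze = 0" "rank ze' = 0" "!!x y. ll ze x y <-> ll ze' x y"
  and l: "min i j <= l" "min i j <= l'"
 shows "E l ze l' ze'"
proof -
 let ?m = "min i j"
 have lev: "E a \<xi> b \<xi>" if x: "\<xi> : partitions n" "rank \<xi> = 0" and "?m <= a" "?m <= b" for \<xi> a b
 proof -
  obtain \<omega> where "\<omega> : partitions n" "rank \<omega> = 1" "hat \<omega> = \<xi>" using rank_1_cover[OF n x] .
  then have "E ?m \<xi> (?m + 1) \<xi>" using lambda_levels(1)[OF e r uv] by auto
  then show ?thesis using E_levels that by blast
 qed
 let ?g = "%x. {z. ll ze x z}"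
 have *: "E ?m \<xi> ?m (zero n (%_. ()) ?g)" if x: "\<xi> : partitions n" "rank \<xi> = 0" "!!x y. ll \<xi> x y <-> ll ze x y" for \<xi>
 proof -
  have "E ?m (zero n f ?g) ?m (zero n (%x. if f x = b then a else f x) ?g)" for f :: "nat => nat set" and a b
  proof -
   have "rank be <= 1" using r by simp
   from lambda_merge[OF e r(1) this uv, of f ?g b a] obtain N N' where "N >= ?m" "N' >= ?m"
    "E N (zero n f ?g) N' (zero n (%x. if f x = b then a else f x) ?g)" by blast
   then show ?thesis using lev[OF zero_in rank_zero] E_trans by (meson order_refl)
  qed
  from zero_collapse[OF this, of "%x. {z. uu \<xi> x z}"] show ?thesis
   using rank_0_eq_zero[OF x(1,2)] unfolding x(3) by simp
 qed
 have "E ?m ze ?m ze'" using *[OF z(1,3)] *[OF z(2,4)] z(5) E_sym E_trans by blast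
 then show ?thesis using lev[OF z(1,3) l(1) order_refl] lev[OF z(2,4) order_refl l(2)] E_trans by blast
qed

text \<open>Row 1 takes part only if \<open>al\<close> has rank 1, from its level \<open>i\<close>
  on. Row 0 starts at \<open>min i j\<close>, because an element of rank 0 lies at each generator's
  level or arises there by cutting the transversal.\<close>

definition reach :: "nat => nat => nat => nat => partition => bool" where
 "reach q i j l ze <-> ze : partitions n & (rank ze = 0 & min i j <= l | rank ze = 1 & q = 1 & i <= l)"

lemma E_lambda:
 assumes e: "E i al j be" and r: "rank al <= 1" "rank be <= rank al" and uv: "uu al u v ~= uu be u v"
  and z: "reach (rank al) i j l ze" "reach (rank al) i j l' ze'" "!!x y. ll ze x y <-> ll ze' x y"
 shows "E l ze l' ze'"
proof -
 have *: "EX N>=min i j. E l ze N (hat ze)" if "reach (rank al) i j l ze" for l ze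
 proof (cases "rank ze = 0")
  case True
  then have "ze : partitions n" "min i j <= l" "hat ze = ze" using that hat_rank_0 unfolding reach_def by auto
  then show ?thesis using E_refl by metis
 next
  case False
  then have z: "ze : partitions n" "rank ze = 1" "rank al = 1" "i <= l" using that unfolding reach_def by auto
  obtain N where "N >= min i j" "E i ze N (hat ze)" using lambda_levels(2)[OF e r uv z(1-3)] by blast
  then show ?thesis using E_shift_to[OF _ z(4)] trans_le_add1 by blast
 qed
 obtain N where N: "N >= min i j" "E l ze N (hat ze)" using *[OF z(1)] by blast
 obtain N' where N': "N' >= min i j" "E l' ze' N' (hat ze')" using *[OF z(2)] by blast
 have zz: "ze : partitions n" "ze' : partitions n" using z unfolding reach_def by blast+
 have "E N (hat ze) N' (hat ze')"
  by (rule E_lambda_zero[OF e r uv]) (use zz z(3) N N' in auto)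
 then show ?thesis using N N' E_sym E_trans by blast
qed

lemma E_rho:
 assumes e: "E i al j be" and r: "rank al <= 1" "rank be <= rank al" and uv: "ll al u v ~= ll be u v"
  and z: "reach (rank al) i j l ze" "reach (rank al) i j l' ze'" "!!x y. uu ze x y <-> uu ze' x y"
 shows "E l ze l' ze'"
proof -
 interpret f: tcong n "{((i, al), (j, be)). E i (flip al) j (flip be)}" by (rule tcong_flip)
 have fE: "f.E i al j be <-> E i (flip al) j (flip be)" for i al j be unfolding f.E_def by simp
 have "f.E l (flip ze) l' (flip ze')"
 proof (rule f.E_lambda)
  show "f.E i (flip al) j (flip be)" using e unfolding fE by simp
 qed (use E_in[OF e] r uv z in \<open>auto simp: reach_def f.reach_def\<close>)
 then show ?thesis unfolding fE by simp
qed

text \<open>An element of rank 0 with the upper kernel of \<open>ze'\<close> and the lower kernel of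
  \<open>ze\<close> connects the two.\<close>

lemma E_rees:
 assumes e: "E i al j be" and r: "rank al <= 1" "rank be <= rank al" and uv: "uu al u v ~= uu be u v" "ll al u' v' ~= ll be u' v'"
  and z: "reach (rank al) i j l ze" "reach (rank al) i j l' ze'"
 shows "E l ze l' ze'"
proof -
 have zz: "ze : partitions n" "ze' : partitions n" using z unfolding reach_def by blast+
 let ?w = "zero n (%x. blk ze' (Upper x)) (%x. blk ze (Lower x))"
 have w: "reach (rank al) i j (min i j) ?w" unfolding reach_def by simp
 have 1: "ll ze x y <-> ll ?w x y" for x y
  using blk_eq_iff[OF zz(1), of "Lower y" "Lower x"] ll_range[OF zz(1), of x y] by auto
 have 2: "uu ?w x y <-> uu ze' x y" for x y
  using blk_eq_iff[OF zz(2), of "Upper y" "Upper x"] uu_range[OF zz(2), of x y] by auto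
 show ?thesis using E_lambda[OF e r uv(1) z(1) w 1] E_rho[OF e r uv(2) w z(2) 2] E_trans by blast
qed

end

section \<open>Pairs of rank one with equal hats\<close>

lemma left_full:
 assumes a: "al : partitions n"
 shows "uu (part_mult n (lab n f (%_. c)) al) x y <-> x : {1..n} & y : {1..n} & f x = f y"
  and "ul (part_mult n (lab n f (%_. c)) al) x y <-> x : {1..n} & f x = c & y : ldom al"
  and "ll (part_mult n (lab n f (%_. c)) al) x y <-> ll al x y | x : ldom al & y : ldom al"
  and "c : f ` {1..n} ==> floating n (lab n f (%_. c)) al = 0"
proof -
 have g: "ALL u v. uu al u v --> (%_. c) u = (%_. c) v" by simp
 note L = left_mult[OF a g, of f]
 show "uu (part_mult n (lab n f (%_. c)) al) x y <-> x : {1..n} & y : {1..n} & f x = f y" by (rule L(1))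
 show "ul (part_mult n (lab n f (%_. c)) al) x y <-> x : {1..n} & f x = c & y : ldom al"
  unfolding L(2) mem_ldom by auto
 show "ll (part_mult n (lab n f (%_. c)) al) x y <-> ll al x y | x : ldom al & y : ldom al"
  unfolding L(3) mem_ldom by simp
 show "c : f ` {1..n} ==> floating n (lab n f (%_. c)) al = 0" unfolding L(4) by simp
qed

text \<open>The left factor attaches everything to the upper part of the transversal of \<open>ze\<close>; the right
 factor attaches the lower points of \<open>B\<close> to the block labelled \<open>b1\<close> and the others to \<open>b2\<close>.\<close>

lemma low_test:
 fixes B :: "nat set" and b1 b2 :: "vertex set"
 assumes k: "ka : partitions n" "rank ka = 1" and z: "ze : partitions n" "rank ze = 1"
  and B: "ALL u v. ll ka u v --> (u : B <-> v : B)" and x0: "x0 : udom ze"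
  and b: "ALL u:ldom ka. b = (if u : B then b1 else b2)"
  and t: "\<tau> : partitions n" "!!x y. uu \<tau> x y <-> uu ze x y" "!!x y. ll \<tau> x y <-> ll ze x y"
   "!!x y. ul \<tau> x y <-> x : udom ze & y : {1..n} & blk ze (Lower y) = b"
 defines "de == lab n (%x. blk ze (Upper x)) (%_. blk ze (Upper x0))"
  and "ep == lab n (%u. if u : B then b1 else b2) (%y. blk ze (Lower y))"
 shows "part_mult n (part_mult n de ka) ep = \<tau>" "floating n de ka = 0"
  "floating n (part_mult n de ka) ep =
    card ((%u. if u : B then b1 else b2) ` {u : {1..n}. (if u : B then b1 else b2) ~: (%y. blk ze (Lower y)) ` {1..n} & (if u : B then b1 else b2) ~= b})"
proof -
 note L = left_full[OF k(1), where f = "%x. blk ze (Upper x)" and c = "blk ze (Upper x0)", folded de_def]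
 have x0n: "x0 : {1..n}" using x0 udom_sub[OF z(1)] by blast
 then show "floating n de ka = 0" by (intro L(4)) blast
 let ?m = "part_mult n de ka" and ?f = "%u. if u : B then b1 else b2"
 have bu: "blk ze (Upper x) = blk ze (Upper y) <-> uu ze x y" if "y : {1..n}" for x y
  using blk_eq_iff[OF z(1), of "Upper y"] that by simp
 have bl: "blk ze (Lower x) = blk ze (Lower y) <-> ll ze x y" if "y : {1..n}" for x y
  using blk_eq_iff[OF z(1), of "Lower y"] that by simp
 have muu: "uu ?m x y <-> uu ze x y" for x y unfolding L(1) using bu[of y x] uu_range[OF z(1), of x y] by blast
 have d: "x : udom ze <-> x : {1..n} & uu ze x x0" for x
  using udom_rank_1(2)[OF z x0, of x] udom_sub[OF z(1)] rel_sym[of ze "Upper x" "Upper x0"] rel_sym[of ze "Upper x0" "Upper x"] by blast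
 have mul: "ul ?m x y <-> x : udom ze & y : ldom ka" for x y unfolding L(2) d using bu[of x0 x] x0n by blast
 have mll: "ll ?m x y <-> ll ka x y" for x y unfolding L(3) using ldom_rank_1(2)[OF k, of x y] by blast
 have ld: "ldom ?m = ldom ka" unfolding set_eq_iff mem_ldom[of _ ?m] mul using x0 by blast
 have f: "ALL u v. ll ?m u v --> ?f u = ?f v" unfolding mll using B by simp
 note R = right_mult[OF part_mult_in[of n de ka] f, of "%y. blk ze (Lower y)", folded ep_def]
 have kne: "ldom ka ~= {}" by (rule ldom_rank_1(1)[OF k])
 have "(ALL v:ldom ?m. ?f v ~= ?f u) <-> ?f u ~= b" for u
 proof -
  have "?f v = b" if "v : ldom ka" for v using bspec[OF b that] by simp
  then show ?thesis unfolding ld using kne by (metis (no_types, lifting) all_not_in_conv)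
 qed
 then show "floating n ?m ep =
   card (?f ` {u : {1..n}. ?f u ~: (%y. blk ze (Lower y)) ` {1..n} & ?f u ~= b})"
  unfolding R(4) by simp
 show "part_mult n ?m ep = \<tau>"
 proof (rule partition_eqI[OF part_mult_in t(1)])
  fix x y
  have "uu ze x y" if "x : udom ze" "y : udom ze" using udom_rank_1(2)[OF z that(1)] that(2) by blast
  then show "uu (part_mult n ?m ep) x y = uu \<tau> x y" unfolding R(1) muu t(2) mul by blast
  show "ll (part_mult n ?m ep) x y = ll \<tau> x y" unfolding R(3) t(3) using bl[of y x] ll_range[OF z(1), of x y] by blast
  have "(EX u. ul ?m x u & ?f u = blk ze (Lower y)) <-> x : udom ze & b = blk ze (Lower y)"
   unfolding mul using b kne by (metis (no_types, lifting) all_not_in_conv)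
  then show "ul (part_mult n ?m ep) x y = ul \<tau> x y" unfolding R(2) t(4) by metis
 qed
qed

context tcong
begin

lemma mu_hat:
 assumes "E i al j (hat al)" "rank al = 1" "ze : partitions n" "rank ze = 1"
 shows "E i ze j (hat ze)" "E i (hat ze) (j + 1) (hat ze)"
proof -
 have "udom al ~= {}" using rank_0_iff[OF E_in(1)[OF assms(1)]] assms(2) by simp
 then show "E i ze j (hat ze)" "E i (hat ze) (j + 1) (hat ze)"
  using E_full[OF assms(1,3,4)] E_kill[OF assms(1,3,4)] by simp_all
qed

text \<open>The transversals of \<open>al\<close> and \<open>be\<close> end in different blocks of a
  common lower kernel, so a right factor can treat the two blocks independently. If both are led to
  lower blocks of the target, elements with equal upper domain arise. If that of \<open>al\<close>
  is led nowhere, \<open>al\<close> loses its transversal, while over \<open>be\<close> the block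
  floats and adds the 1.\<close>

lemma mu_up_pair:
 assumes e: "E i al j be" and r: "rank al = 1" "rank be = 1" and ll: "!!x y. ll al x y <-> ll be x y"
  and ne: "ldom al ~= ldom be"
 shows "[|ze : partitions n; ze' : partitions n; rank ze = 1; rank ze' = 1; hat ze = hat ze'; udom ze = udom ze'|] ==> E i ze j ze'"
  and "[|ze : partitions n; rank ze = 1|] ==> E i (hat ze) (j + 1) ze"
proof -
 note ab = E_in[OF e]
 define B where "B = ldom al"
 have Ba: "ALL u v. ll al u v --> (u : B <-> v : B)" unfolding B_def using ll_ldom[OF ab(1)] by blast
 have Bb: "ALL u v. ll be u v --> (u : B <-> v : B)" using Ba unfolding ll .
 have dis: "u ~: B" if u: "u : ldom be" for u
 proof
  assume "u : B"
  then have "v : ldom al <-> v : ldom be" for v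
   using ldom_rank_1(2)[OF ab(1) r(1)] ldom_rank_1(2)[OF ab(2) r(2)] u ll unfolding B_def by blast
  then show False using ne by blast
 qed
 have Bne: "EX u:{1..n}. u : B" unfolding B_def using ldom_rank_1(1)[OF ab(1) r(1)] ldom_sub[OF ab(1)] by blast
 have ul1: "ul \<tau> x y <-> x : udom ze & y : {1..n} & blk ze (Lower y) = blk ze (Lower y0)"
  if z: "ze : partitions n" and t: "\<tau> : partitions n" "rank \<tau> = 1" "hat ze = hat \<tau>" "udom ze = udom \<tau>" "y0 : ldom \<tau>" for \<tau> ze x y y0
 proof -
  have l: "ll \<tau> a b <-> ll ze a b" for a b using t(3) hat_eq_iff[OF z t(1)] by blast
  have y0: "y0 : {1..n}" using t(5) ldom_sub[OF t(1)] by blast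
  have "rank \<tau> <= 1" using t(2) by simp
  note ul_rank_1[OF t(1) this, of x y]
  moreover have "y : ldom \<tau> <-> y : {1..n} & ll \<tau> y0 y"
   using ldom_rank_1(2)[OF t(1,2,5)] ldom_sub[OF t(1)] by blast
  moreover have "ll \<tau> y0 y <-> ll \<tau> y y0" using rel_sym by blast
  moreover have "blk ze (Lower y) = blk ze (Lower y0) <-> ll ze y y0" using blk_eq_iff[OF z, of "Lower y0"] y0 by simp
  ultimately show ?thesis using t(4) l by simp
 qed
 { assume z: "ze : partitions n" "ze' : partitions n" "rank ze = 1" "rank ze' = 1" "hat ze = hat ze'" "udom ze = udom ze'"
  obtain x0 where x0: "x0 : udom ze" using udom_rank_1(1)[OF z(1,3)] by blast
  obtain y1 where y1: "y1 : ldom ze" using ldom_rank_1(1)[OF z(1,3)] by blast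
  obtain y2 where y2: "y2 : ldom ze'" using ldom_rank_1(1)[OF z(2,4)] by blast
  have y: "y1 : {1..n}" "y2 : {1..n}" using y1 y2 ldom_sub[OF z(1)] ldom_sub[OF z(2)] by blast+
  let ?b1 = "blk ze (Lower y1)" and ?b2 = "blk ze (Lower y2)"
  have 0: "{u : {1..n}. (if u : B then ?b1 else ?b2) ~: (%y. blk ze (Lower y)) ` {1..n} & (if u : B then ?b1 else ?b2) ~= b} = {}" for b
   using y by auto
  have h: "uu ze' x y <-> uu ze x y" "ll ze' x y <-> ll ze x y" for x y
   using z(5) hat_eq_iff[OF z(1,2)] by blast+
  note t1 = low_test[OF ab(1) r(1) z(1,3) Ba x0 _ z(1) refl refl ul1[OF z(1,1,3) refl refl y1], of ?b1 ?b2, unfolded 0]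
  note t2 = low_test[OF ab(2) r(2) z(1,3) Bb x0 _ z(2) h ul1[OF z(1,2,4-6) y2], of ?b1 ?b2, unfolded 0]
  have "ALL u:ldom al. ?b1 = (if u : B then ?b1 else ?b2)" "ALL u:ldom be. ?b2 = (if u : B then ?b1 else ?b2)"
   using dis unfolding B_def by auto
  note t = t1[OF this(1)] t2[OF this(2)]
  from E_sandwich[OF e lab_in lab_in, of "%x. blk ze (Upper x)" "%_. blk ze (Upper x0)" "%u. if u : B then ?b1 else ?b2" "%y. blk ze (Lower y)"]
  show "E i ze j ze'" unfolding t by simp }
 { assume z: "ze : partitions n" "rank ze = 1"
  obtain x0 where x0: "x0 : udom ze" using udom_rank_1(1)[OF z] by blast
  obtain y2 where y2: "y2 : ldom ze" using ldom_rank_1(1)[OF z] by blast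
  have y: "y2 : {1..n}" using y2 ldom_sub[OF z(1)] by blast
  \<comment> \<open>\<open>{}\<close> labels no lower point of \<open>ze\<close>, so the points of
    \<open>B\<close> are attached to nothing below.\<close>
  let ?b1 = "{} :: vertex set" and ?b2 = "blk ze (Lower y2)"
  have ne: "blk ze (Lower y) ~= {}" if "y : {1..n}" for y
  proof -
   have "Lower y : blk ze (Lower y)" using that z by simp
   then show ?thesis by blast
  qed
  have nei: "{} ~: (%y. blk ze (Lower y)) ` {1..n}" using ne by (metis imageE)
  have c: "(if u : B then ?b1 else ?b2) ~: (%y. blk ze (Lower y)) ` {1..n} <-> u : B" for u
   using y nei by auto
  have "{u : {1..n}. u : B & (if u : B then ?b1 else ?b2) ~= ?b1} = {}" by auto
  note 0 = this
  have "{u : {1..n}. u : B & (if u : B then ?b1 else ?b2) ~= ?b2} = {u : {1..n}. u : B}" using ne[OF y] by auto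
  moreover have "(%u. if u : B then ?b1 else ?b2) ` {u : {1..n}. u : B} = {?b1}" using Bne by auto
  ultimately have 1: "(%u. if u : B then ?b1 else ?b2) ` {u : {1..n}. u : B & (if u : B then ?b1 else ?b2) ~= ?b2} = {?b1}" by simp
  have h: "ul (hat ze) x y <-> x : udom ze & y : {1..n} & blk ze (Lower y) = ?b1" for x y
   using ne by simp
  note t1 = low_test[OF ab(1) r(1) z Ba x0 _ hat_in[OF z(1)] rel_hat_simps(1,3) h, of ?b1 ?b2, unfolded c 0]
  note t2 = low_test[OF ab(2) r(2) z Bb x0 _ z(1) refl refl ul1[OF z(1,1,2) refl refl y2], of ?b1 ?b2, unfolded c 1]
  have "ALL u:ldom al. ?b1 = (if u : B then ?b1 else ?b2)" "ALL u:ldom be. ?b2 = (if u : B then ?b1 else ?b2)"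
   using dis unfolding B_def by auto
  note t = t1[OF this(1)] t2[OF this(2)]
  from E_sandwich[OF e lab_in lab_in, of "%x. blk ze (Upper x)" "%_. blk ze (Upper x0)" "%u. if u : B then ?b1 else ?b2" "%y. blk ze (Lower y)"]
  show "E i (hat ze) (j + 1) ze" unfolding t by simp }
qed

lemma mu_down_pair:
 assumes e: "E i al j be" and r: "rank al = 1" "rank be = 1" and uu: "!!x y. uu al x y <-> uu be x y"
  and ne: "udom al ~= udom be"
 shows "[|ze : partitions n; ze' : partitions n; rank ze = 1; rank ze' = 1; hat ze = hat ze'; ldom ze = ldom ze'|] ==> E i ze j ze'"
  and "[|ze : partitions n; rank ze = 1|] ==> E i (hat ze) (j + 1) ze"
proof -
 interpret f: tcong n "{((i, al), (j, be)). E i (flip al) j (flip be)}" by (rule tcong_flip)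
 have fE: "f.E i al j be <-> E i (flip al) j (flip be)" for i al j be unfolding f.E_def by simp
 have e': "f.E i (flip al) j (flip be)" using e unfolding fE by simp
 note ab = E_in[OF e]
 have r': "rank (flip al) = 1" "rank (flip be) = 1" using r ab by simp_all
 have l': "ll (flip al) x y <-> ll (flip be) x y" for x y using uu by simp
 have n': "ldom (flip al) ~= ldom (flip be)" using ne by simp
 { assume z: "ze : partitions n" "ze' : partitions n" "rank ze = 1" "rank ze' = 1" "hat ze = hat ze'" "ldom ze = ldom ze'"
  have "f.E i (flip ze) j (flip ze')"
   by (rule f.mu_up_pair(1)[OF e' r' l' n']) (use z in \<open>simp_all add: flip_hat[symmetric]\<close>)
  then show "E i ze j ze'" unfolding fE by simp }
 { assume z: "ze : partitions n" "rank ze = 1"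
  have "f.E i (hat (flip ze)) (j + 1) (flip ze)"
   by (rule f.mu_up_pair(2)[OF e' r' l' n']) (use z in simp_all)
  then show "E i (hat ze) (j + 1) ze" unfolding fE using flip_hat[OF flip_in[OF z(1)]] by simp }
qed

end

subsection \<open>Comparing elements of one \<open>\<H>\<close>-class\<close>

text \<open>The coordinate form of \<open>is_diff_perm\<close>: both elements share the lower
  indexing \<open>s\<close>, and the upper indexing of \<open>be\<close> is twisted by
  \<open>\<pi>\<close>.\<close>

definition pdiff :: "nat => partition => partition => (nat => nat) => bool" where
 "pdiff n al be \<pi> <-> \<pi> permutes {1..rank al} & (ALL x y. uu al x y <-> uu be x y) & (ALL x y. ll al x y <-> ll be x y) &
   (EX t s. coords n al {1..rank al} t s & coords n be {1..rank al} (\<pi> o t) s)"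

lemma coords_surj_range:
 assumes "coords n al K t s" "k : K"
 shows "EX x y. x : {1..n} & t x = k & y : {1..n} & s y = k"
 using coords_surj[OF assms] by blast

definition trv :: "nat => (nat => nat) => (nat => nat) => nat => vertex set" where
 "trv n t s k = Upper ` {x : {1..n}. t x = k} \<union> Lower ` {y : {1..n}. s y = k}"

lemma trv_Upper [simp]: "Upper x : trv n t s k <-> x : {1..n} & t x = k"
 and trv_Lower [simp]: "Lower y : trv n t s k <-> y : {1..n} & s y = k"
 and trv_Middle [simp]: "Middle y ~: trv n t s k"
 by (auto simp: trv_def)

lemma blk_udom:
 assumes a: "al : partitions n" and c: "coords n al K t s" and x: "x : udom al"
 shows "blk al (Upper x) = trv n t s (t x)"
proof -
 have xn: "x : {1..n}" "t x : K" using coords_udom[OF a c] x by blast+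
 have "rel al (Upper x) v <-> v : trv n t s (t x)" for v
 proof (cases v)
  case (Upper y)
  have "uu al x y <-> y : {1..n} & t y = t x" using coords_uu[OF a c x, of y] uu_range[OF a, of x y] by metis
  then show ?thesis using Upper by simp
 next
  case (Middle y)
  then show ?thesis using rel_verts(2)[OF a, of "Upper x" v] by force
 next
  case (Lower y)
  have "ul al x y <-> y : {1..n} & s y = t x" using coords_ul[OF a c, of x y] xn by metis
  then show ?thesis using Lower by simp
 qed
 then show ?thesis unfolding blk_def by blast
qed

lemma coords_transversals:
 assumes a: "al : partitions n" and c: "coords n al K t s"
 shows "transversals al = trv n t s ` K" "inj_on (trv n t s) K"
proof -
 have "t ` udom al = K"
  unfolding set_eq_iff image_iff Bex_def coords_udom[OF a c] using c unfolding coords_def by blast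
 moreover have "transversals al = trv n t s ` t ` udom al"
  unfolding transversals_eq[OF a] image_image using blk_udom[OF a c] by (intro image_cong) auto
 ultimately show "transversals al = trv n t s ` K" by simp
 show "inj_on (trv n t s) K"
 proof (rule inj_onI)
  fix k k' assume k: "k : K" "k' : K" "trv n t s k = trv n t s k'"
  obtain x where "x : {1..n}" "t x = k" using coords_surj(1)[OF c k(1)] by blast
  then have "Upper x : trv n t s k" by simp
  then show "k = k'" using k(3) \<open>t x = k\<close> by simp
 qed
qed

lemma non_transversals:
 assumes a: "al : partitions n"
 shows "al - transversals al = (%x. Upper ` {y. uu al x y}) ` ({1..n} - udom al) \<union> (%x. Lower ` {y. ll al x y}) ` ({1..n} - ldom al)"
  (is "_ = ?U \<union> ?L")
proof -
 have U: "blk al (Upper x) = Upper ` {y. uu al x y}" if "x ~: udom al" for x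
 proof -
  have "rel al (Upper x) v <-> v : Upper ` {y. uu al x y}" for v
  proof (cases v)
   case (Middle y)
   then show ?thesis using rel_verts(2)[OF a, of "Upper x" v] by force
  qed (use that in \<open>auto simp: mem_udom\<close>)
  then show ?thesis unfolding blk_def by blast
 qed
 have L: "blk al (Lower x) = Lower ` {y. ll al x y}" if "x ~: ldom al" for x
 proof -
  have "rel al (Lower x) v <-> v : Lower ` {y. ll al x y}" for v
  proof (cases v)
   case (Middle y)
   then show ?thesis using rel_verts(2)[OF a, of "Lower x" v] by force
  qed (use that in \<open>auto simp: mem_ldom\<close>)
  then show ?thesis unfolding blk_def by blast
 qed
 have tu: "blk al (Upper x) : transversals al <-> x : udom al" if x: "x : {1..n}" for x
 proof
  assume "blk al (Upper x) : transversals al"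
  then obtain y where "Lower y : blk al (Upper x)" unfolding transversals_def by blast
  then show "x : udom al" unfolding mem_udom by auto
 next
  assume "x : udom al" then show "blk al (Upper x) : transversals al" unfolding transversals_eq[OF a] by blast
 qed
 have tl: "blk al (Lower x) : transversals al <-> x : ldom al" if x: "x : {1..n}" for x
 proof
  assume "blk al (Lower x) : transversals al"
  then obtain y where "Upper y : blk al (Lower x)" unfolding transversals_def by blast
  then show "x : ldom al" unfolding mem_ldom by auto
 next
  assume "x : ldom al"
  then obtain y where y: "ul al y x" unfolding mem_ldom by blast
  then have "blk al (Lower x) = blk al (Upper y)" using blk_eq_iff[OF a, of "Upper y" "Lower x"] ul_range[OF a y] by simp
  then show "blk al (Lower x) : transversals al" using tu[of y] ul_range[OF a y] y unfolding mem_udom by auto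
 qed
 show ?thesis
 proof (intro equalityI subsetI)
  fix A assume A: "A : al - transversals al"
  then obtain v where v: "v : verts n" "A = blk al v" using partition_eq_blks[OF a] by blast
  from v(1) show "A : ?U \<union> ?L"
  proof (cases rule: vertsE)
   case (1 x)
   then have "x ~: udom al" using A v(2) tu by blast
   then show ?thesis using U v(2) 1 by blast
  next
   case (2 x)
   then have "x ~: ldom al" using A v(2) tl by blast
   then show ?thesis using L v(2) 2 by blast
  qed
 next
  fix A assume "A : ?U \<union> ?L"
  then show "A : al - transversals al"
  proof
   assume "A : ?U"
   then obtain x where x: "x : {1..n}" "x ~: udom al" "A = Upper ` {y. uu al x y}" by blast
   then have "A = blk al (Upper x)" using U by simp
   then show ?thesis using blk_in[OF a, of "Upper x"] tu x by simp
  next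
   assume "A : ?L"
   then obtain x where x: "x : {1..n}" "x ~: ldom al" "A = Lower ` {y. ll al x y}" by blast
   then have "A = blk al (Lower x)" using L by simp
   then show ?thesis using blk_in[OF a, of "Lower x"] tl x by simp
  qed
 qed
qed

lemma transversals_sub: "transversals al \<subseteq> al"
 unfolding transversals_def by blast

lemma transversalI: "[|A : al; Upper x : A; Lower y : A|] ==> A : transversals al"
 unfolding transversals_def by blast

text \<open>An enumeration of the transversals and a pair of coordinate functions carry the same
  information: the transversal with index \<open>k\<close> consists of the fibres over
  \<open>k\<close>.\<close>

lemma is_diff_perm_iff:
 assumes a: "al : partitions n" and b: "be : partitions n"
 shows "is_diff_perm al be \<pi> <-> pdiff n al be \<pi>"
proof
 let ?K = "{1..rank al}"
 assume "is_diff_perm al be \<pi>"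
 then obtain T where p: "\<pi> permutes ?K" and nt: "al - transversals al = be - transversals be"
  and T: "bij_betw T ?K (transversals al)"
  and tb: "transversals be = (%k. (T k \<inter> range Upper) \<union> (T (\<pi> k) \<inter> range Lower)) ` ?K"
  unfolding is_diff_perm_def by blast
 define idx where "idx v = (if EX k:?K. v : T k then (THE k. k : ?K & v : T k) else 0)" for v
 have K: "?K \<subseteq> {1..}" by auto
 let ?t = "%x. idx (Upper x)" and ?s = "%y. idx (Lower y)"
 have c: "coords n al ?K ?t ?s" and ix: "!!v k. k : ?K ==> v : T k <-> idx v = k"
  using coords_enum[OF a T K, folded idx_def] by blast+
 have pK: "\<pi> k : ?K <-> k : ?K" for k by (rule permutes_in_image[OF p])
 have ta: "transversals al = T ` ?K" using T unfolding bij_betw_def by simp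
 have blk: "rel gm v w <-> (EX A:transversals gm. v : A & w : A) | (EX A:gm - transversals gm. v : A & w : A)" for gm v w
  unfolding rel_def using transversals_sub[of gm] by blast
 have ublk: "ul gm x y <-> (EX A:transversals gm. Upper x : A & Lower y : A)" for gm x y
  unfolding rel_def using transversals_sub[of gm] transversalI[of _ gm x y] by blast
 have uu: "uu al x y <-> uu be x y" for x y
 proof -
  have "(EX A:transversals al. Upper x : A & Upper y : A) <-> (EX A:transversals be. Upper x : A & Upper y : A)"
   unfolding ta tb by auto
  then show ?thesis unfolding blk nt by simp
 qed
 have ll: "ll al x y <-> ll be x y" for x y
 proof -
  have "(EX A:transversals be. Lower x : A & Lower y : A) <-> (EX k:?K. Lower x : T (\<pi> k) & Lower y : T (\<pi> k))"
   unfolding tb by auto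
  also have "\<dots> <-> (EX k:\<pi> ` ?K. Lower x : T k & Lower y : T k)" by simp
  also have "\<pi> ` ?K = ?K" by (rule permutes_image[OF p])
  finally have "(EX A:transversals al. Lower x : A & Lower y : A) <-> (EX A:transversals be. Lower x : A & Lower y : A)"
   unfolding ta by simp
  then show ?thesis unfolding blk nt by simp
 qed
 have ul: "ul be x y <-> ?t x : ?K & ?s y = \<pi> (?t x)" for x y
 proof -
  have "ul be x y <-> (EX k:?K. Upper x : T k & Lower y : T (\<pi> k))" unfolding ublk tb by auto
  also have "\<dots> <-> (EX k:?K. ?t x = k & ?s y = \<pi> k)" using ix pK by (intro bex_cong) simp_all
  finally show ?thesis by blast
 qed
 have "coords n be ?K (\<pi> o ?t) ?s" unfolding coords_def
 proof (intro conjI ballI)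
  show "ul be x y = ((\<pi> o ?t) x = ?s y & (\<pi> o ?t) x : ?K)" for x y unfolding ul comp_def pK by auto
  show "?K \<subseteq> ?s ` {1..n}" using c unfolding coords_def by blast
  have "\<pi> ` ?K \<subseteq> \<pi> ` ?t ` {1..n}" using c unfolding coords_def by (intro image_mono) blast
  then show "?K \<subseteq> (\<pi> o ?t) ` {1..n}" unfolding permutes_image[OF p] by (simp add: image_comp)
 qed
 then show "pdiff n al be \<pi>" unfolding pdiff_def using p uu ll c by blast
next
 let ?K = "{1..rank al}"
 assume "pdiff n al be \<pi>"
 then obtain t s where p: "\<pi> permutes ?K" and uu: "!!x y. uu al x y <-> uu be x y" and ll: "!!x y. ll al x y <-> ll be x y"
  and c: "coords n al ?K t s" "coords n be ?K (\<pi> o t) s" unfolding pdiff_def by blast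
 have pK: "\<pi> k : ?K <-> k : ?K" for k by (rule permutes_in_image[OF p])
 have d: "udom al = udom be" "ldom al = ldom be"
  unfolding set_eq_iff coords_udom[OF a c(1)] coords_udom[OF b c(2)] coords_ldom[OF a c(1)] coords_ldom[OF b c(2)] comp_def pK by blast+
 have nt: "al - transversals al = be - transversals be"
  unfolding non_transversals[OF a] non_transversals[OF b] d uu ll ..
 have T: "bij_betw (trv n t s) ?K (transversals al)"
  unfolding bij_betw_def using coords_transversals[OF a c(1)] by simp
 have e: "trv n (\<pi> o t) s (\<pi> k) = trv n t s k \<inter> range Upper \<union> trv n t s (\<pi> k) \<inter> range Lower" for k
 proof -
  have "\<pi> x = \<pi> k <-> x = k" for x using permutes_inj[OF p] by (simp add: inj_eq)
  then show ?thesis unfolding trv_def by auto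
 qed
 have "transversals be = trv n (\<pi> o t) s ` \<pi> ` ?K"
  using coords_transversals(1)[OF b c(2)] unfolding permutes_image[OF p] .
 also have "\<dots> = (%k. trv n t s k \<inter> range Upper \<union> trv n t s (\<pi> k) \<inter> range Lower) ` ?K"
  unfolding image_image e ..
 finally show "is_diff_perm al be \<pi>" unfolding is_diff_perm_def using p nt T by blast
qed

lemma pdiff_green_H:
 assumes "al : partitions n" "be : partitions n" "pdiff n al be \<pi>"
 shows "(al, be) : green_H (part_monoid n)" "rank be = rank al"
proof -
 let ?K = "{1..rank al}"
 obtain t s where p: "\<pi> permutes ?K" and uu: "!!x y. uu al x y <-> uu be x y" and ll: "!!x y. ll al x y <-> ll be x y"
  and c: "coords n al ?K t s" "coords n be ?K (\<pi> o t) s" using assms(3) unfolding pdiff_def by blast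
 have pK: "\<pi> k : ?K <-> k : ?K" for k by (rule permutes_in_image[OF p])
 have "udom al = udom be" "ldom al = ldom be"
  unfolding set_eq_iff coords_udom[OF assms(1) c(1)] coords_udom[OF assms(2) c(2)] coords_ldom[OF assms(1) c(1)]
   coords_ldom[OF assms(2) c(2)] comp_def pK by blast+
 then show "(al, be) : green_H (part_monoid n)" unfolding green_H_iff using assms uu ll by blast
 show "rank be = rank al" using coords_rank[OF assms(2) c(2)] by simp
qed

text \<open>The transversal of \<open>be\<close> starting in the upper block with index
  \<open>k\<close> ends in a lower block of \<open>al\<close>, and \<open>\<pi> k\<close> is the
  index of that block. Equal kernels and domains make this a permutation.\<close>

lemma coords_relabel:
 assumes a: "al : partitions n" "be : partitions n" and ll: "!!x y. ll al x y <-> ll be x y" and uu: "!!x y. uu al x y <-> uu be x y"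
  and d: "udom al = udom be" "ldom al = ldom be" and K: "finite K" and c: "coords n al K t s" "coords n be K t' s'"
 shows "EX \<pi>. \<pi> permutes K & coords n be K (\<pi> o t) s"
proof -
 have "EX x y. x : {1..n} & t x = k & ul be x y" if "k : K" for k
 proof -
  obtain x where x: "x : {1..n}" "t x = k" using coords_surj(1)[OF c(1) \<open>k : K\<close>] by blast
  then have "x : udom be" using coords_udom[OF a(1) c(1)] d \<open>k : K\<close> by blast
  then show ?thesis using x unfolding mem_udom by blast
 qed
 then obtain X Y where XY: "!!k. k : K ==> X k : {1..n} & t (X k) = k & ul be (X k) (Y k)" by metis
 define \<pi> where "\<pi> k = (if k : K then s (Y k) else k)" for k
 have ul: "ul be x y <-> x : {1..n} & y : {1..n} & \<pi> (t x) = s y & t x : K" for x y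
 proof
  assume u: "ul be x y"
  then have xy: "x : {1..n}" "y : {1..n}" using ul_range[OF a(2)] by blast+
  have xd: "x : udom al" using u d mem_udom by blast
  then have tK: "t x : K" using coords_udom[OF a(1) c(1)] by blast
  then have "uu al x (X (t x))" using coords_uu[OF a(1) c(1) xd] XY by metis
  then have "ul be (X (t x)) y" using uu_ul[OF a(2) _ u] uu by blast
  then have "ll al y (Y (t x))" using ul_ll[OF a(2)] XY[OF tK] ll by blast
  moreover have "y : ldom al" using u d mem_ldom by blast
  moreover have "Y (t x) : {1..n}" using XY[OF tK] ul_range[OF a(2)] by blast
  ultimately have "s y = s (Y (t x))" using coords_ll[OF a(1) c(1)] by blast
  then show "x : {1..n} & y : {1..n} & \<pi> (t x) = s y & t x : K" using xy tK unfolding \<pi>_def by simp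
 next
  assume *: "x : {1..n} & y : {1..n} & \<pi> (t x) = s y & t x : K"
  then have tK: "t x : K" and e: "s (Y (t x)) = s y" unfolding \<pi>_def by auto
  have "Y (t x) : ldom al" using XY[OF tK] d mem_ldom by blast
  then have "ll be (Y (t x)) y" using coords_ll[OF a(1) c(1)] e * ll by blast
  then have u: "ul be (X (t x)) y" using ll_ul[OF a(2)] XY[OF tK] by blast
  have "X (t x) : udom al" using u d mem_udom by blast
  then have "uu be (X (t x)) x" using coords_uu[OF a(1) c(1)] XY[OF tK] * uu by metis
  then show "ul be x y" using uu_ul[OF a(2) _ u] by blast
 qed
 have into: "\<pi> k : K" if "k : K" for k
 proof -
  have "Y k : ldom al" using XY[OF that] d mem_ldom by blast
  then show ?thesis using coords_ldom[OF a(1) c(1)] that unfolding \<pi>_def by simp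
 qed
 have "inj_on \<pi> K"
 proof (rule inj_onI)
  fix k k' assume k: "k : K" "k' : K" "\<pi> k = \<pi> k'"
  have "ul be (X k) (Y k')"
   unfolding ul using XY[OF k(1)] XY[OF k(2)] ul_range[OF a(2)] k unfolding \<pi>_def by auto
  then have "uu al (X k) (X k')" using ul_uu[OF a(2)] XY[OF k(2)] uu by blast
  moreover have "X k : udom al" using XY[OF k(1)] d mem_udom by blast
  ultimately show "k = k'" using coords_uu[OF a(1) c(1)] XY k by metis
 qed
 then have "bij_betw \<pi> K K" using K into by (simp add: bij_betw_def endo_inj_surj image_subset_iff)
 then have p: "\<pi> permutes K" by (rule bij_imp_permutes) (simp add: \<pi>_def)
 have "coords n be K (\<pi> o t) s" unfolding coords_def
 proof (intro conjI ballI)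
  show "ul be x y = ((\<pi> o t) x = s y & (\<pi> o t) x : K)" if "x : {1..n}" "y : {1..n}" for x y
   unfolding ul comp_def using that permutes_in_image[OF p] by auto
  show "K \<subseteq> s ` {1..n}" using c(1) unfolding coords_def by blast
  have "\<pi> ` K \<subseteq> \<pi> ` t ` {1..n}" using c(1) unfolding coords_def by (intro image_mono) blast
  then show "K \<subseteq> (\<pi> o t) ` {1..n}" unfolding permutes_image[OF p] by (simp add: image_comp)
 qed
 with p show ?thesis by blast
qed

lemma green_H_rank: "(al, be) : green_H (part_monoid n) ==> rank al = rank be"
 using green_R_rank unfolding green_H_def by blast

lemma green_H_coords:
 assumes h: "(al, be) : green_H (part_monoid n)" and c: "coords n al {1..rank al} t s"
 obtains \<pi> where "\<pi> permutes {1..rank al}" "coords n be {1..rank al} (\<pi> o t) s" "pdiff n al be \<pi>"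
proof -
 have ab: "al : partitions n" "be : partitions n" and e: "!!x y. ll al x y <-> ll be x y" "!!x y. uu al x y <-> uu be x y"
  "udom al = udom be" "ldom al = ldom be" using h unfolding green_H_iff by blast+
 obtain t' s' where c': "coords n be {1..rank al} t' s'" using coords_exist[OF ab(2)] green_H_rank[OF h] by metis
 obtain \<pi> where p: "\<pi> permutes {1..rank al}" "coords n be {1..rank al} (\<pi> o t) s"
  using coords_relabel[OF ab e _ c c'] by blast
 then show ?thesis using that c e unfolding pdiff_def by blast
qed

lemma pdiff_diff_perm:
 assumes h: "(al, be) : green_H (part_monoid n)"
 shows "pdiff n al be (diff_perm al be)"
proof -
 have ab: "al : partitions n" "be : partitions n" using h unfolding green_H_iff by blast+
 obtain t s where "coords n al {1..rank al} t s" using coords_exist[OF ab(1)] .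
 then obtain \<pi> where "pdiff n al be \<pi>" using green_H_coords[OF h] by blast
 then have "is_diff_perm al be (diff_perm al be)" unfolding diff_perm_def using is_diff_perm_iff[OF ab] by (metis someI)
 then show ?thesis using is_diff_perm_iff[OF ab] by blast
qed

lemma coords_perm_unique:
 assumes b: "be : partitions n" and p: "\<pi> permutes K" "rh permutes K"
  and c: "coords n be K (\<pi> o t) s" "coords n be K (rh o t) s"
 shows "\<pi> = rh"
proof
 fix k
 show "\<pi> k = rh k"
 proof (cases "k : K")
  case True
  then have "\<pi> k : K" using permutes_in_image[OF p(1)] by blast
  then obtain x y where xy: "x : {1..n}" "\<pi> (t x) = \<pi> k" "y : {1..n}" "s y = \<pi> k"
   using coords_surj_range[OF c(1)] by force
  then have t: "t x = k" using permutes_inj[OF p(1)] by (simp add: inj_eq)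
  have "ul be x y" using coords_ul[OF b c(1)] xy \<open>\<pi> k : K\<close> by simp
  then show ?thesis using coords_ul[OF b c(2)] xy t by simp
 qed (use p permutes_not_in in metis)
qed

text \<open>Passing to other coordinates of \<open>al\<close> conjugates the permutation; this is
  why only its conjugacy class is meaningful.\<close>

lemma pdiff_coords:
 assumes ab: "al : partitions n" "be : partitions n" and d: "pdiff n al be \<pi>" and c: "coords n al {1..rank al} t s"
 obtains \<tau> where "\<tau> permutes {1..rank al}" "coords n be {1..rank al} ((\<tau> o \<pi> o inv' \<tau>) o t) s"
proof -
 let ?K = "{1..rank al}"
 obtain t0 s0 where p: "\<pi> permutes ?K" and c0: "coords n al ?K t0 s0" "coords n be ?K (\<pi> o t0) s0"
  using d unfolding pdiff_def by blast
 \<comment> \<open>Translates the old index of a transversal into the new one.\<close>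
 define \<tau> where "\<tau> k = (if k : ?K then t (SOME x. x : {1..n} & t0 x = k) else k)" for k
 have tt: "\<tau> (t0 x) = t x" if "x : udom al" for x
 proof -
  let ?x = "SOME x'. x' : {1..n} & t0 x' = t0 x"
  have x: "x : {1..n}" "t0 x : ?K" using that coords_udom[OF ab(1) c0(1)] by blast+
  have "?x : {1..n} & t0 ?x = t0 x" by (rule someI[of _ x]) (use x in simp)
  then have "uu al x ?x" "?x : {1..n}" using coords_uu[OF ab(1) c0(1) that] by simp_all
  then have "t ?x = t x" using coords_uu[OF ab(1) c that] by simp
  then show ?thesis unfolding \<tau>_def using x by simp
 qed
 have im: "\<tau> k : ?K" if k: "k : ?K" for k
 proof -
  obtain x where "x : {1..n}" "t0 x = k" using coords_surj(1)[OF c0(1) k] by blast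
  then have "x : udom al" using coords_udom[OF ab(1) c0(1)] k by blast
  then show ?thesis using tt coords_udom[OF ab(1) c] \<open>t0 x = k\<close> by metis
 qed
 have "?K \<subseteq> \<tau> ` ?K"
 proof
  fix k assume k: "k : ?K"
  obtain x where "x : {1..n}" "t x = k" using coords_surj(1)[OF c k] by blast
  then have x: "x : udom al" using coords_udom[OF ab(1) c] k by blast
  then have "t0 x : ?K" using coords_udom[OF ab(1) c0(1)] by blast
  then show "k : \<tau> ` ?K" using tt[OF x] \<open>t x = k\<close> by (metis imageI)
 qed
 then have "\<tau> ` ?K = ?K" using im by blast
 then have "bij_betw \<tau> ?K ?K" by (simp add: bij_betw_def eq_card_imp_inj_on)
 then have pt: "\<tau> permutes ?K" by (rule bij_imp_permutes) (simp only: \<tau>_def if_False)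
 have ss: "\<tau> (s0 y) = s y" if yl: "y : ldom al" for y
 proof -
  obtain x where x: "ul al x y" using yl unfolding mem_ldom by blast
  then have "x : udom al" unfolding mem_udom by blast
  moreover have "t0 x = s0 y" "t x = s y" using x coords_ul[OF ab(1) c0(1)] coords_ul[OF ab(1) c] by blast+
  ultimately show ?thesis using tt by metis
 qed
 have H: "udom al = udom be" "ldom al = ldom be" using pdiff_green_H(1)[OF ab d] unfolding green_H_iff by blast+
 have inv: "inv' \<tau> (\<tau> k) = k" for k by (rule permutes_inverses(2)[OF pt])
 have inj: "\<tau> x = \<tau> y <-> x = y" for x y using permutes_inj[OF pt] by (simp add: inj_eq)
 let ?p = "\<tau> o \<pi> o inv' \<tau>"
 have pp: "?p permutes ?K" using pt p by (intro permutes_compose permutes_inv)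
 have ul: "ul be x y <-> x : {1..n} & y : {1..n} & ?p (t x) = s y & t x : ?K" for x y
 proof
  assume u: "ul be x y"
  then have d: "x : udom al" "y : ldom al" unfolding H mem_udom mem_ldom by blast+
  have "\<pi> (t0 x) = s0 y" using u coords_ul[OF ab(2) c0(2)] by simp
  then have "?p (t x) = s y" using tt[OF d(1)] ss[OF d(2)] inv by (metis comp_apply)
  moreover have "x : {1..n}" "t x : ?K" using coords_udom[OF ab(1) c] d(1) by blast+
  moreover have "y : {1..n}" using ul_range[OF ab(2) u] by blast
  ultimately show "x : {1..n} & y : {1..n} & ?p (t x) = s y & t x : ?K" by blast
 next
  assume *: "x : {1..n} & y : {1..n} & ?p (t x) = s y & t x : ?K"
  then have xd: "x : udom al" using coords_udom[OF ab(1) c] by blast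
  have "s y : ?K" using * permutes_in_image[OF pp] by metis
  then have yd: "y : ldom al" using coords_ldom[OF ab(1) c] * by blast
  have "\<tau> (\<pi> (t0 x)) = \<tau> (s0 y)" using * tt[OF xd] ss[OF yd] inv by (metis comp_apply)
  then have "\<pi> (t0 x) = s0 y" using inj by blast
  moreover have "s0 y : ?K" using coords_ldom[OF ab(1) c0(1)] yd by blast
  ultimately show "ul be x y" using coords_ul[OF ab(2) c0(2)] * by simp
 qed
 have "coords n be ?K (?p o t) s" unfolding coords_def
 proof (intro conjI ballI)
  show "ul be x y = ((?p o t) x = s y & (?p o t) x : ?K)" if "x : {1..n}" "y : {1..n}" for x y
   unfolding ul using that permutes_in_image[OF pp, of "t x"] by auto
  show "?K \<subseteq> s ` {1..n}" using c unfolding coords_def by blast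
  have "?p ` ?K \<subseteq> ?p ` t ` {1..n}" using c unfolding coords_def by (intro image_mono) blast
  then show "?K \<subseteq> (?p o t) ` {1..n}" unfolding permutes_image[OF pp] by (simp add: image_comp comp_assoc)
 qed
 with pt that show ?thesis by blast
qed

text \<open>Supplies the intermediate element when two permutations are composed.\<close>

lemma coords_exists_perm:
 assumes a: "al : partitions n" and c: "coords n al K t s" and p: "\<pi> permutes K"
 shows "EX be:partitions n. (ALL x y. uu be x y <-> uu al x y) & (ALL x y. ll be x y <-> ll al x y) & coords n be K (\<pi> o t) s"
proof -
 define f where "f x = (if t x : K then Inl (\<pi> (t x)) else Inr (blk al (Upper x)))" for x
 define g where "g y = (if s y : K then Inl (s y) else Inr (blk al (Lower y)))" for y
 have pK: "\<pi> k : K <-> k : K" for k by (rule permutes_in_image[OF p])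
 have inj: "\<pi> k = \<pi> k' <-> k = k'" for k k' using permutes_inj[OF p] by (simp add: inj_eq)
 have u: "f x = f y <-> uu al x y" if xy: "x : {1..n}" "y : {1..n}" for x y
 proof (cases "x : udom al")
  case True
  have 1: "t x : K" using coords_udom[OF a c] True by blast
  have 2: "uu al x y <-> t x = t y" by (rule coords_uu[OF a c True xy(2)])
  show ?thesis unfolding 2 f_def using 1 inj by (cases "t y : K") auto
 next
  case False
  then have 1: "t x ~: K" using coords_udom[OF a c] xy by blast
  show ?thesis
  proof (cases "y : udom al")
   case True
   then have "t y : K" using coords_udom[OF a c] by blast
   moreover have "~uu al x y" using False True uu_udom[OF a, of x y] by blast
   ultimately show ?thesis using 1 unfolding f_def by simp
  next
   case F: False
   then have "t y ~: K" using coords_udom[OF a c] xy by blast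
   then show ?thesis using 1 blk_eq_iff[OF a, of "Upper y" "Upper x"] xy unfolding f_def by simp
  qed
 qed
 have l: "g x = g y <-> ll al x y" if xy: "x : {1..n}" "y : {1..n}" for x y
 proof (cases "x : ldom al")
  case True
  have 1: "s x : K" using coords_ldom[OF a c] True by blast
  have 2: "ll al x y <-> s x = s y" by (rule coords_ll[OF a c True xy(2)])
  show ?thesis unfolding 2 g_def using 1 by (cases "s y : K") auto
 next
  case False
  then have 1: "s x ~: K" using coords_ldom[OF a c] xy by blast
  show ?thesis
  proof (cases "y : ldom al")
   case True
   then have "s y : K" using coords_ldom[OF a c] by blast
   moreover have "~ll al x y" using False True ll_ldom[OF a, of x y] by blast
   ultimately show ?thesis using 1 unfolding g_def by simp
  next
   case F: False
   then have "s y ~: K" using coords_ldom[OF a c] xy by blast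
   then show ?thesis using 1 blk_eq_iff[OF a, of "Lower y" "Lower x"] xy unfolding g_def by simp
  qed
 qed
 have ul: "f x = g y <-> \<pi> (t x) = s y & \<pi> (t x) : K" if xy: "x : {1..n}" "y : {1..n}" for x y
 proof (cases "t x : K")
  case False
  have "blk al (Upper x) ~= blk al (Lower y)"
   using blk_eq_iff[OF a, of "Lower y" "Upper x"] xy coords_ul[OF a c] False by simp
  then show ?thesis using False pK unfolding f_def g_def by auto
 next
  case True
  then have "\<pi> (t x) : K" using pK by blast
  then show ?thesis using True by (cases "s y : K") (auto simp: f_def g_def)
 qed
 have "coords n (lab n f g) K (\<pi> o t) s" unfolding coords_def
 proof (intro conjI ballI)
  show "ul (lab n f g) x y = ((\<pi> o t) x = s y & (\<pi> o t) x : K)" if "x : {1..n}" "y : {1..n}" for x y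
   using ul[OF that] that by simp
  show "K \<subseteq> s ` {1..n}" using c unfolding coords_def by blast
  have "\<pi> ` K \<subseteq> \<pi> ` t ` {1..n}" using c unfolding coords_def by (intro image_mono) blast
  then show "K \<subseteq> (\<pi> o t) ` {1..n}" unfolding permutes_image[OF p] by (simp add: image_comp)
 qed
 moreover have "uu (lab n f g) x y <-> uu al x y" for x y using u[of x y] uu_range[OF a, of x y] unfolding rel_lab_simps by blast
 moreover have "ll (lab n f g) x y <-> ll al x y" for x y using l[of x y] ll_range[OF a, of x y] unfolding rel_lab_simps by blast
 ultimately show ?thesis by blast
qed

lemma coords_relabel_perm:
 assumes c: "coords n al K t s" and p: "\<tau> permutes K"
 shows "coords n al K (\<tau> o t) (\<tau> o s)"
proof -
 have "\<tau> ` K \<subseteq> \<tau> ` t ` {1..n}" "\<tau> ` K \<subseteq> \<tau> ` s ` {1..n}" using c unfolding coords_def by (intro image_mono; blast)+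
 then have "K \<subseteq> (\<tau> o t) ` {1..n}" "K \<subseteq> (\<tau> o s) ` {1..n}" unfolding permutes_image[OF p] by (simp_all add: image_comp)
 moreover have "\<tau> k = \<tau> k' <-> k = k'" for k k' using permutes_inj[OF p] by (simp add: inj_eq)
 ultimately show ?thesis using c permutes_in_image[OF p] unfolding coords_def by simp
qed

lemma coords_flip_perm:
 assumes c: "coords n be K (\<pi> o t) s" and p: "\<pi> permutes K"
 shows "coords n (flip be) K (inv' \<pi> o s) t"
proof -
 from coords_relabel_perm[OF c permutes_inv[OF p]] have "coords n be K (inv' \<pi> o (\<pi> o t)) (inv' \<pi> o s)" .
 moreover have "inv' \<pi> o (\<pi> o t) = t" using permutes_inv_o(2)[OF p] by (simp add: comp_assoc[symmetric])
 ultimately show ?thesis using coords_flip by metis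
qed

text \<open>\<open>q >= 2\<close> provides a second transversal, on which the points off the
  transversals are hung to keep them from floating.\<close>

lemma kill_transversal:
 assumes a: "al : partitions n" and c: "coords n al {1..q} t s" and q: "q >= 2" and k: "k : {1..q}"
 shows "EX de:partitions n. ALL ka:partitions n. (ALL x y. uu ka x y <-> uu al x y) --> udom ka = udom al -->
  floating n de ka = 0 & (ALL x y. uu (part_mult n de ka) x y <-> uu al x y) &
  (ALL x y. ll (part_mult n de ka) x y <-> ll ka x y) & (ALL x y. ul (part_mult n de ka) x y <-> ul ka x y & t x ~= k)"
proof -
 obtain k' where k': "k' : {1..q}" "k' ~= k"
 proof (cases "k = 1")
  case True then show ?thesis using that[of 2] q by simp
 next
  case False then show ?thesis using that[of 1] q by simp
 qed
 obtain w where w: "w : {1..n}" "t w = k'" using coords_surj(1)[OF c k'(1)] by blast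
 obtain v0 where v0: "v0 : {1..n}" "t v0 = k" using coords_surj(1)[OF c k] by blast
 define f where "f x = blk al (Upper x)" for x
 \<comment> \<open>Points on transversal \<open>k\<close> get \<open>{}\<close>, which labels no
   upper point, so this transversal ends in the middle row; it does not float because
   \<open>ka\<close> continues it downwards. Points off the transversals follow
   \<open>w\<close>.\<close>
 define d where "d u = (if t u = k then {} else if t u : {1..q} then f u else f w)" for u
 have f: "f x = f y <-> uu al x y" if "y : {1..n}" for x y
  using blk_eq_iff[OF a, of "Upper y"] that unfolding f_def by simp
 have fne: "f x ~= {}" if "x : {1..n}" for x
 proof -
  have "Upper x : f x" using that a unfolding f_def by simp
  then show ?thesis by blast
 qed
 let ?de = "lab n f d"
 show ?thesis
 proof (rule bexI[of _ ?de], intro ballI impI)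
  fix ka assume kp: "ka : partitions n" and uu: "ALL x y. uu ka x y <-> uu al x y" and ud: "udom ka = udom al"
  have dk: "x : udom ka <-> x : {1..n} & t x : {1..q}" for x unfolding ud by (rule coords_udom[OF a c])
  have ut: "uu al u v <-> t u = t v" if "u : udom ka" "v : {1..n}" for u v
   using coords_uu[OF a c _ that(2)] that(1) unfolding ud by blast
  have dd: "d u = d v" if uv: "uu ka u v" for u v
  proof -
   have r: "u : {1..n}" "v : {1..n}" using uu_range[OF kp uv] by blast+
   show ?thesis
   proof (cases "u : udom ka")
    case True
    then have "t u = t v" using ut r uv uu by blast
    moreover have "f u = f v" using f r uv uu by blast
    ultimately show ?thesis unfolding d_def by simp
   next
    case False
    then have "v ~: udom ka" using uu_udom[OF kp uv] by blast
    then have "t u ~: {1..q}" "t v ~: {1..q}" using False r unfolding dk by blast+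
    then show ?thesis using k unfolding d_def by auto
   qed
  qed
  then have g: "ALL u v. uu ka u v --> d u = d v" by blast
  note L = left_mult[OF kp g, of f]
  let ?m = "part_mult n ?de ka"
  have "{u : {1..n}. d u ~: f ` {1..n} & (ALL v:udom ka. d v ~= d u)} = {}"
  proof -
   have "d u : f ` {1..n} | (EX v:udom ka. d v = d u)" if "u : {1..n}" for u
   proof (cases "t u = k")
    case True
    then have "d u = d v0" unfolding d_def using v0 by simp
    moreover have "v0 : udom ka" unfolding dk using v0 k by simp
    ultimately show ?thesis by metis
   next
    case False
    then show ?thesis using that w(1) unfolding d_def by simp
   qed
   then show ?thesis by blast
  qed
  then have fl: "floating n ?de ka = 0" unfolding L(4) by simp
  have muu: "uu ?m x y <-> uu al x y" for x y unfolding L(1) using f[of y x] uu_range[OF a, of x y] by blast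
  have df: "d u = f x <-> t x ~= k & uu al u x" if u: "u : udom ka" and x: "x : {1..n}" for u x
  proof (cases "t u = k")
   case True
   then show ?thesis using fne[OF x] ut[OF u x] unfolding d_def by auto
  next
   case False
   have "t u : {1..q}" using u unfolding dk by blast
   then have "d u = f u" using False unfolding d_def by simp
   then show ?thesis using f[OF x, of u] ut[OF u x] False by auto
  qed
  have mul: "ul ?m x y <-> ul ka x y & t x ~= k" for x y
  proof
   assume "ul ?m x y"
   then obtain u where u: "x : {1..n}" "ul ka u y" "d u = f x" unfolding L(2) by blast
   then have "u : udom ka" unfolding mem_udom by blast
   then have "t x ~= k" "uu ka u x" using df u uu by blast+
   then show "ul ka x y & t x ~= k" using uu_ul[OF kp _ u(2)] by blast
  next
   assume x: "ul ka x y & t x ~= k"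
   then have xn: "x : {1..n}" "x : udom ka" using ul_range[OF kp, of x y] unfolding mem_udom by blast+
   then have "uu al x x" using a by simp
   then have "d x = f x" using df xn x by blast
   then show "ul ?m x y" unfolding L(2) using xn x by blast
  qed
  have mll: "ll ?m x y <-> ll ka x y" for x y
  proof -
   have "ll ka x y" if u: "ul ka u x" and v: "ul ka v y" and e: "d u = d v" for u v
   proof -
    have uv: "u : udom ka" "v : udom ka" using u v unfolding mem_udom by blast+
    then have r: "u : {1..n}" "v : {1..n}" "t u : {1..q}" "t v : {1..q}" unfolding dk by blast+
    have "t u = t v"
    proof (cases "t u = k | t v = k")
     case True
     then show ?thesis using e fne[OF r(1)] fne[OF r(2)] r unfolding d_def by (auto split: if_splits)
    next
     case False
     then have "f u = f v" using e r unfolding d_def by simp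
     then show ?thesis using f[OF r(2), of u] ut[OF uv(1) r(2)] by blast
    qed
    then have "uu ka v u" using ut[OF uv(1) r(2)] uu rel_sym by blast
    then have "ul ka u y" using uu_ul[OF kp _ v] by blast
    then show ?thesis using ul_ll[OF kp u] by blast
   qed
   then show ?thesis unfolding L(3) by blast
  qed
  show "floating n ?de ka = 0 & (ALL x y. uu ?m x y <-> uu al x y) &
   (ALL x y. ll ?m x y <-> ll ka x y) & (ALL x y. ul ?m x y <-> ul ka x y & t x ~= k)"
   using fl muu mll mul by blast
 qed simp
qed

section \<open>The permutations that relate two levels\<close>

context tcong
begin

lemma E_transport:
 assumes e: "E i al j be" and q: "q >= 1" and p: "\<pi> permutes {1..q}"
  and c: "coords n al {1..q} t s" "coords n be {1..q} (\<pi> o t) s"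
  and ab: "al' : partitions n" "be' : partitions n" "!!x y. uu be' x y <-> uu al' x y" "!!x y. ll be' x y <-> ll al' x y"
  and c': "coords n al' {1..q} t' s'" "coords n be' {1..q} (\<pi> o t') s'"
 shows "E i al' j be'"
proof -
 have 1: "coords n al {1..q} (id o t) s" "coords n al' {1..q} (id o t') s'" using c c' by simp_all
 note A = transport_exact[OF refl q order_refl permutes_id disjI1[OF refl] E_in(1)[OF e] 1(1) ab(1,1) 1(2) refl refl]
 note B = transport_exact[OF refl q order_refl p disjI2[OF refl] E_in(2)[OF e] c(2) ab(1,2) c'(2) ab(3,4)]
 from E_sandwich[OF e lab_in lab_in,
   of "%x. if t' x : {1..q} then Inl (t' x) else Inr (blk al' (Upper x))" "%y. Inl (if t y : {1..q} then t y else 1)"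
     "%u. Inl (if s u : {1..q} then s u else 1)" "%y. if s' y : {1..q} then Inl (s' y) else Inr (blk al' (Lower y))"]
 show ?thesis unfolding A B by simp
qed

text \<open>For \<open>q >= 1\<close>, one related pair with permutation \<open>\<pi>\<close>
  suffices for the universal quantifier, by \<open>E_transport\<close>. These sets therefore record
  all that happens inside the H-classes of rank \<open>q\<close>.\<close>

definition G :: "nat => nat => nat => (nat => nat) set" where
 "G q i j = {\<pi>. \<pi> permutes {1..q} & (ALL al be t s. al : partitions n & be : partitions n & coords n al {1..q} t s &
   coords n be {1..q} (\<pi> o t) s & (ALL x y. uu be x y <-> uu al x y) & (ALL x y. ll be x y <-> ll al x y) --> E i al j be)}"

lemma G_permutes: "\<pi> : G q i j ==> \<pi> permutes {1..q}"
 unfolding G_def by blast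

lemma G_D:
 "[|\<pi> : G q i j; al : partitions n; be : partitions n; coords n al {1..q} t s; coords n be {1..q} (\<pi> o t) s;
  ALL x y. uu be x y <-> uu al x y; ALL x y. ll be x y <-> ll al x y|] ==> E i al j be"
 unfolding G_def by blast

lemma G_pdiffI: "[|E i al j be; pdiff n al be \<pi>; rank al = q; q >= 1|] ==> \<pi> : G q i j"
 unfolding G_def pdiff_def using E_transport by blast

lemma G_pdiffD:
 assumes "\<pi> : G q i j" "al : partitions n" "be : partitions n" "pdiff n al be \<pi>" "rank al = q"
 shows "E i al j be"
proof -
 obtain t s where "coords n al {1..q} t s" "coords n be {1..q} (\<pi> o t) s"
  "ALL x y. uu be x y <-> uu al x y" "ALL x y. ll be x y <-> ll al x y" using assms(4,5) unfolding pdiff_def by metis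
 then show ?thesis using assms(1-3) unfolding G_def by blast
qed

lemma G_id: "id : G q i i"
proof -
 have "E i al i be" if "al : partitions n" "be : partitions n" "coords n al {1..q} t s"
   "coords n be {1..q} (id o t) s" "ALL x y. uu be x y <-> uu al x y" "ALL x y. ll be x y <-> ll al x y" for al be t s
 proof -
  have "al = be" by (rule partition_eqI[OF that(1,2)])
   (use that(5,6) coords_ul[OF that(1,3)] coords_ul[OF that(2,4)] in auto)
  then show ?thesis using E_refl that by blast
 qed
 then show ?thesis unfolding G_def using permutes_id by blast
qed

lemma G_comp:
 assumes p: "\<pi> : G q i j" and r: "rh : G q j k"
 shows "rh o \<pi> : G q i k"
proof -
 have "E i al k gm" if ac: "al : partitions n" "gm : partitions n" "coords n al {1..q} t s"
   "coords n gm {1..q} (rh o \<pi> o t) s" "ALL x y. uu gm x y <-> uu al x y" "ALL x y. ll gm x y <-> ll al x y" for al gm t s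
 proof -
  obtain be where b: "be : partitions n" "ALL x y. uu be x y <-> uu al x y" "ALL x y. ll be x y <-> ll al x y"
   "coords n be {1..q} (\<pi> o t) s" using coords_exists_perm[OF ac(1,3) G_permutes[OF p]] by blast
  have "E i al j be" by (rule G_D[OF p ac(1) b(1) ac(3) b(4,2,3)])
  moreover have "coords n gm {1..q} (rh o (\<pi> o t)) s" using ac(4) by (simp add: comp_assoc)
  then have "E j be k gm" by (rule G_D[OF r b(1) ac(2) b(4)]) (use ac b in simp_all)
  ultimately show ?thesis by (rule E_trans)
 qed
 then show ?thesis unfolding G_def using permutes_compose[OF G_permutes[OF p] G_permutes[OF r]] by blast
qed

lemma G_inv:
 assumes p: "\<pi> : G q i j"
 shows "inv' \<pi> : G q j i"
proof -
 note pp = G_permutes[OF p]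
 have "E j al i be" if ac: "al : partitions n" "be : partitions n" "coords n al {1..q} t s"
   "coords n be {1..q} (inv' \<pi> o t) s" "ALL x y. uu be x y <-> uu al x y" "ALL x y. ll be x y <-> ll al x y" for al be t s
 proof -
  have "\<pi> o (inv' \<pi> o t) = t" using permutes_inv_o(1)[OF pp] by (simp add: comp_assoc[symmetric])
  then have "coords n al {1..q} (\<pi> o (inv' \<pi> o t)) s" using ac(3) by simp
  then have "E i be j al" by (rule G_D[OF p ac(2,1,4)]) (use ac in simp_all)
  then show ?thesis by (rule E_sym)
 qed
 then show ?thesis unfolding G_def using permutes_inv[OF pp] by blast
qed

lemma G_conj:
 assumes p: "\<pi> : G q i j" and t: "\<tau> permutes {1..q}"
 shows "\<tau> o \<pi> o inv' \<tau> : G q i j"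
proof -
 note pp = G_permutes[OF p]
 have "E i al j be" if ac: "al : partitions n" "be : partitions n" "coords n al {1..q} t s"
   "coords n be {1..q} (\<tau> o \<pi> o inv' \<tau> o t) s" "ALL x y. uu be x y <-> uu al x y" "ALL x y. ll be x y <-> ll al x y" for al be t s
 proof -
  note c1 = coords_relabel_perm[OF ac(3) permutes_inv[OF t]] and c2 = coords_relabel_perm[OF ac(4) permutes_inv[OF t]]
  have "inv' \<tau> o (\<tau> o \<pi> o inv' \<tau> o t) = \<pi> o (inv' \<tau> o t)" using permutes_inverses(2)[OF t] by (simp add: fun_eq_iff)
  then show ?thesis using G_D[OF p ac(1,2) c1 _ ac(5,6)] c2 by simp
 qed
 moreover have "\<tau> o \<pi> o inv' \<tau> permutes {1..q}"
  using permutes_compose[OF permutes_inv[OF t] permutes_compose[OF pp t]] by (simp add: comp_assoc)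
 ultimately show ?thesis unfolding G_def by blast
qed

lemma G_shift: "\<pi> : G q i j ==> \<pi> : G q (i + k) (j + k)"
 unfolding G_def using E_shift by blast

lemma G_normal: "G q i i \<lhd> sym_group q"
proof -
 interpret group "sym_group q" by (rule sym_group_is_group)
 have sub: "G q i i \<subseteq> carrier (sym_group q)" using G_permutes sym_group_carrier by blast
 have "subgroup (G q i i) (sym_group q)"
 proof (rule subgroupI)
  show "G q i i \<subseteq> carrier (sym_group q)" by (rule sub)
  show "G q i i ~= {}" using G_id by blast
  show "inv\<^bsub>sym_group q\<^esub> a : G q i i" if "a : G q i i" for a
   using G_inv[OF that] sub that by auto
  show "a \<otimes>\<^bsub>sym_group q\<^esub> b : G q i i" if "a : G q i i" "b : G q i i" for a b
   using G_comp[OF that(2,1)] by (simp add: sym_group_mult)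
 qed
 then show ?thesis unfolding normal_inv_iff
  using G_conj by (simp add: sym_group_mult sym_group_carrier)
qed

text \<open>The upper block of an index \<open>k\<close> moved by \<open>\<pi>\<close> is detached.
  This frees the lower block \<open>k\<close> of \<open>al\<close> but the lower block
  \<open>\<pi> k\<close> of \<open>be\<close>, so the lower domains separate while the lower kernels
  still agree.\<close>

lemma E_kill_transversal:
 assumes e: "E i al j be" and d: "pdiff n al be \<pi>" and q: "rank al >= 2" and p: "\<pi> ~= id"
 shows "EX al' be'. E i al' j be' & rank al' = rank al - 1 & rank be' = rank al - 1 & ldom al' ~= ldom be' &
  (ALL x y. ll al' x y <-> ll be' x y)"
proof -
 let ?K = "{1..rank al}"
 note ab = E_in[OF e]
 obtain t s where pp: "\<pi> permutes ?K" and uu: "ALL x y. uu be x y <-> uu al x y" and ll: "ALL x y. ll al x y <-> ll be x y"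
  and c: "coords n al ?K t s" "coords n be ?K (\<pi> o t) s" using d unfolding pdiff_def by metis
 obtain k where k: "\<pi> k ~= k" using p by (metis ext id_apply)
 then have kK: "k : ?K" using permutes_not_in[OF pp] by blast
 have pK: "\<pi> k' : ?K <-> k' : ?K" for k' by (rule permutes_in_image[OF pp])
 have inj: "\<pi> x = \<pi> y <-> x = y" for x y using permutes_inj[OF pp] by (simp add: inj_eq)
 have ud: "udom be = udom al"
  unfolding set_eq_iff coords_udom[OF ab(1) c(1)] coords_udom[OF ab(2) c(2)] comp_def pK by blast
 obtain de where dl: "de : partitions n" and
  K: "!!ka. ka : partitions n ==> (ALL x y. uu ka x y <-> uu al x y) ==> udom ka = udom al ==>
  floating n de ka = 0 & (ALL x y. uu (part_mult n de ka) x y <-> uu al x y) &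
  (ALL x y. ll (part_mult n de ka) x y <-> ll ka x y) & (ALL x y. ul (part_mult n de ka) x y <-> ul ka x y & t x ~= k)"
  using kill_transversal[OF ab(1) c(1) q kK] by metis
 let ?a = "part_mult n de al" and ?b = "part_mult n de be"
 have Ka: "floating n de al = 0" "!!x y. ll ?a x y <-> ll al x y" "!!x y. ul ?a x y <-> ul al x y & t x ~= k" using K[OF ab(1)] by blast+
 have Kb: "floating n de be = 0" "!!x y. ll ?b x y <-> ll be x y" "!!x y. ul ?b x y <-> ul be x y & t x ~= k" using K[OF ab(2) uu ud] by blast+
 have "E i ?a j ?b" using E_left[OF e dl] Ka(1) Kb(1) by simp
 moreover have ca: "coords n ?a (?K - {k}) t s"
  using c(1) unfolding coords_def Ka by auto
 moreover have cb: "coords n ?b (?K - {\<pi> k}) (\<pi> o t) s"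
  using c(2) inj unfolding coords_def Kb by auto
 moreover have "card (?K - {k}) = rank al - 1" "card (?K - {\<pi> k}) = rank al - 1"
  using kK pK by simp_all
 moreover have "ldom ?a ~= ldom ?b"
 proof -
  obtain y where y: "y : {1..n}" "s y = k" using coords_surj(2)[OF c(1) kK] by blast
  then have "y ~: ldom ?a" "y : ldom ?b"
   using coords_ldom[OF part_mult_in ca] coords_ldom[OF part_mult_in cb] kK k by auto
  then show ?thesis by blast
 qed
 moreover have "ll ?a x y <-> ll ?b x y" for x y unfolding Ka Kb using ll by blast
 ultimately show ?thesis using coords_rank[OF part_mult_in ca] coords_rank[OF part_mult_in cb] by metis
qed

end

subsection \<open>Normal subgroups of the symmetric groups\<close>

lemma conj_transpose:
 assumes "bij \<tau>" shows "\<tau> o transpose a b o inv' \<tau> = transpose (\<tau> a) (\<tau> b)"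
proof
 fix x
 have "\<tau> (inv' \<tau> x) = x" using assms by (simp add: bij_is_surj surj_f_inv_f)
 moreover have "inv' \<tau> x = a <-> x = \<tau> a" "inv' \<tau> x = b <-> x = \<tau> b"
  using bij_inv_eq_iff[OF assms] by metis+
 ultimately show "(\<tau> o transpose a b o inv' \<tau>) x = transpose (\<tau> a) (\<tau> b) x"
  by (auto simp: transpose_def)
qed

lemma permutes_transpose: "[|a : S; b : S|] ==> transpose a b permutes S"
 by (rule permutes_swap_id)

locale conj_closed =
 fixes q :: nat and M :: "(nat => nat) set"
 assumes id_mem: "id : M" and comp_mem: "[|\<pi> : M; rh : M|] ==> \<pi> o rh : M"
  and conj_mem: "[|\<pi> : M; \<tau> permutes {1..q}|] ==> \<tau> o \<pi> o inv' \<tau> : M"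
begin

lemma two_transposes:
 assumes "transpose a b o transpose c d : M" "\<tau> permutes {1..q}"
 shows "transpose (\<tau> a) (\<tau> b) o transpose (\<tau> c) (\<tau> d) : M"
proof -
 have b: "bij \<tau>" using assms(2) by (rule permutes_bij)
 have "\<tau> o (transpose a b o transpose c d) o inv' \<tau> = (\<tau> o transpose a b o inv' \<tau>) o (\<tau> o transpose c d o inv' \<tau>)"
  using permutes_inv_o(2)[OF assms(2)] by (simp add: comp_assoc[symmetric]) (simp add: comp_assoc)
 then show ?thesis using conj_mem[OF assms] conj_transpose[OF b] by simp
qed

text \<open>Conjugation by transpositions moves the entries of the given three-cycle one at a time
  to any prescribed places, and the three-cycles generate the alternating group.\<close>

lemma three_cycle_alt:
 assumes abc: "a : {1..q}" "b : {1..q}" "c : {1..q}" "a ~= b" "b ~= c" "a ~= c" and m: "transpose a b o transpose b c : M"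
 shows "Alt q \<subseteq> M"
proof -
 have move: "transpose x y o transpose y z : M" if x: "x : {1..q}" "y : {1..q}" "z : {1..q}" "x ~= y" "y ~= z" "x ~= z" for x y z
 proof -
  let ?t1 = "transpose a x"
  let ?b1 = "?t1 b" and ?c1 = "?t1 c"
  have 1: "?b1 : {1..q}" "?c1 : {1..q}" "x ~= ?b1" "?b1 ~= ?c1" "x ~= ?c1"
   using abc x by (auto simp: transpose_def)
  have m1: "transpose x ?b1 o transpose ?b1 ?c1 : M"
   using two_transposes[OF m permutes_transpose[OF abc(1) x(1)]] by simp
  let ?t2 = "transpose ?b1 y"
  let ?c2 = "?t2 ?c1"
  have 2: "?t2 x = x" "?t2 ?b1 = y" "?c2 : {1..q}" "y ~= ?c2" "x ~= ?c2"
   using 1 x by (auto simp: transpose_def split: if_splits)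
  have m2: "transpose x y o transpose y ?c2 : M"
   using two_transposes[OF m1 permutes_transpose[OF 1(1) x(2)]] 2 by simp
  let ?t3 = "transpose ?c2 z"
  have 3: "?t3 x = x" "?t3 y = y" "?t3 ?c2 = z" using 2 x by (auto simp: transpose_def)
  show ?thesis using two_transposes[OF m2 permutes_transpose[OF 2(3) x(3)]] 3 by simp
 qed
 have tc: "three_cycles q \<subseteq> M"
 proof
  fix p assume "p : three_cycles q"
  then obtain cs where cs: "p = cycle_of_list cs" "cycle cs" "length cs = 3" "set cs \<subseteq> {1..q}" by auto
  then obtain x y z where xyz: "cs = [x, y, z]" using stupid_lemma[OF cs(3)] by blast
  then have "p = transpose x y o transpose y z" using cs(1) by simp
  then show "p : M" using move[of x y z] cs(2,4) xyz by auto
 qed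
 have fin: "p : M" if "p : generate (alt_group q) (three_cycles q)" for p
  using that
 proof (induction rule: generate.induct)
  case one
  show ?case unfolding alt_group_one by (rule id_mem)
 next
  case (incl h)
  then show ?case using tc by blast
 next
  case (inv h)
  then obtain cs where cs: "h = cycle_of_list cs" "cycle cs" "length cs = 3" "set cs \<subseteq> {1..q}" by auto
  then obtain x y z where xyz: "cs = [x, y, z]" using stupid_lemma[OF cs(3)] by blast
  have h: "h = transpose x y o transpose y z" using cs(1) xyz by simp
  have "inv\<^bsub>alt_group q\<^esub> h = inv' h" using alt_group_inv_equality three_cycles_incl inv by blast
  also have "\<dots> = transpose z y o transpose y x"
   unfolding h by (rule inv_unique_comp) (auto simp: fun_eq_iff transpose_def)
  finally have e: "inv\<^bsub>alt_group q\<^esub> h = transpose z y o transpose y x" .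
  have "transpose z y o transpose y x : M" using move[of z y x] cs(2,4) xyz by auto
  then show ?case unfolding e .
 next
  case (eng h1 h2)
  show ?case unfolding alt_group_mult by (rule comp_mem) fact+
 qed
 then show ?thesis using alt_group_carrier_as_three_cycles[of q] by blast
qed

text \<open>The commutator with a transposition \<open>(x y)\<close> is the product of
  \<open>(x y)\<close> and its image under the inverse of \<open>\<pi>\<close>. A suitable choice of
  \<open>x\<close> and \<open>y\<close>, or a product of two such elements, is a three-cycle unless
  \<open>\<pi>\<close> is a double transposition of four points; this accounts for the second
  alternative.\<close>

lemma commutators_mem:
 assumes q: "q >= 3" and p: "\<pi> permutes {1..q}" "\<pi> ~= id"
  and m: "!!\<tau>. \<tau> permutes {1..q} ==> \<tau> o inv' \<pi> o inv' \<tau> o \<pi> : M"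
 shows "Alt q \<subseteq> M | \<pi> : Alt q & \<pi> : M"
proof -
 let ?f = "inv' \<pi>"
 have fp: "?f permutes {1..q}" by (rule permutes_inv[OF p(1)])
 have fi: "?f x : {1..q} <-> x : {1..q}" for x by (rule permutes_in_image[OF fp])
 have finj: "?f x = ?f y <-> x = y" for x y using permutes_inj[OF fp] by (simp add: inj_eq)
 have mm: "transpose x y o transpose (?f x) (?f y) : M" if "x : {1..q}" "y : {1..q}" for x y
 proof -
  have "inv' ?f = \<pi>" by (rule permutes_inv_inv[OF p(1)])
  then have "?f o transpose x y o \<pi> = transpose (?f x) (?f y)"
   using conj_transpose[OF permutes_bij[OF fp], of x y] by simp
  moreover have "transpose x y o ?f o inv' (transpose x y) o \<pi> : M" by (rule m[OF permutes_transpose[OF that]])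
  ultimately show ?thesis by (simp add: comp_assoc)
 qed
 have "?f ~= id"
 proof
  assume "?f = id"
  then have "inv' ?f = id" by simp
  then show False using permutes_inv_inv[OF p(1)] p(2) by simp
 qed
 then obtain a where a: "?f a ~= a" by (metis ext id_apply)
 then have aq: "a : {1..q}" using permutes_not_in[OF fp] by blast
 show ?thesis
 proof (cases "EX x. ?f x ~= x & ?f (?f x) ~= x")
  case True
  then obtain x where x: "?f x ~= x" "?f (?f x) ~= x" by blast
  then have xq: "x : {1..q}" using permutes_not_in[OF fp] by blast
  \<comment> \<open>The points \<open>x\<close>, \<open>?f x\<close> and \<open>?f (?f x)\<close>
    are distinct, so the two overlapping transpositions make a three-cycle.\<close>
  have "transpose x (?f x) o transpose (?f x) (?f (?f x)) : M" using mm[OF xq] fi xq by blast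
  then have "Alt q \<subseteq> M" using three_cycle_alt[of x "?f x" "?f (?f x)"] x xq fi finj by metis
  then show ?thesis ..
 next
  case inv: False
  let ?b = "?f a"
  have bq: "?b : {1..q}" using fi aq by blast
  have fb: "?f ?b = a" using inv a by blast
  show ?thesis
  proof (cases "EX c:{1..q}. ?f c = c")
   case True
   then obtain c where c: "c : {1..q}" "?f c = c" by blast
   have "transpose a c o transpose ?b c : M" using mm[OF aq c(1)] c(2) by simp
   then have "transpose a c o transpose c ?b : M" by (simp add: transpose_commute)
   moreover have "a ~= c" "c ~= ?b" using c a fb by metis+
   ultimately have "Alt q \<subseteq> M" using three_cycle_alt[of a c ?b] a aq bq c by metis
   then show ?thesis ..
  next
   case nofix: False
   have "{1..q} - {a, ?b} ~= {}"
   proof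
    assume "{1..q} - {a, ?b} = {}"
    then have "{1..q} \<subseteq> {a, ?b}" by blast
    then have "card {1..q} <= card {a, ?b}" by (intro card_mono) auto
    also have "\<dots> <= 2" by (simp add: card_insert_if)
    finally show False using q by simp
   qed
   then obtain c where c: "c : {1..q}" "c ~= a" "c ~= ?b" by blast
   let ?d = "?f c"
   have dq: "?d : {1..q}" using fi c by blast
   have d: "?d ~= c" "?f ?d = c" "?d ~= a" "?d ~= ?b" using c nofix inv fb finj by metis+
   have acbd: "transpose a c o transpose ?b ?d : M" using mm[OF aq c(1)] .
   show ?thesis
   proof (cases "EX e:{1..q}. e ~: {a, ?b, c, ?d}")
    case True
    then obtain e where e: "e : {1..q}" "e ~= a" "e ~= ?b" "e ~= c" "e ~= ?d" by blast
    let ?t = "transpose ?b e"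
    have "?t a = a" "?t c = c" "?t ?b = e" "?t ?d = ?d" using e a c d by (auto simp: transpose_def)
    then have "transpose a c o transpose e ?d : M"
     using two_transposes[OF acbd permutes_transpose[OF bq e(1)]] by simp
    from comp_mem[OF acbd this] have "(transpose a c o transpose ?b ?d) o (transpose a c o transpose e ?d) : M" .
    \<comment> \<open>The common factor \<open>transpose a c\<close> cancels, and two overlapping
      transpositions remain.\<close>
    moreover have "(transpose a c o transpose ?b ?d) o (transpose a c o transpose e ?d) = transpose ?b ?d o transpose ?d e"
     using e a c d by (auto simp: fun_eq_iff transpose_def)
    ultimately have "Alt q \<subseteq> M" using three_cycle_alt[of ?b ?d e] bq dq e d(4) by metis
    then show ?thesis ..
   next
    case False
    \<comment> \<open>No fifth point is left, so \<open>q = 4\<close> and the argument reaches only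
      double transpositions; but \<open>\<pi>\<close> is one of them.\<close>
    let ?t = "transpose ?b c"
    have "?t a = a" "?t c = ?b" "?t ?b = c" "?t ?d = ?d" using a c d by (auto simp: transpose_def)
    then have m2: "transpose a ?b o transpose c ?d : M"
     using two_transposes[OF acbd permutes_transpose[OF bq c(1)]] by simp
    have pi: "\<pi> x = ?f x" for x
    proof -
     have "\<pi> (?f (?f x)) = ?f x" by (rule permutes_inverses(1)[OF p(1)])
     moreover have "?f (?f x) = x" using inv by metis
     ultimately show ?thesis by simp
    qed
    have "\<pi> = transpose a ?b o transpose c ?d"
    proof
     fix x
     consider "x ~: {1..q}" | "x = a" | "x = ?b" | "x = c" | "x = ?d" using False by blast
     then show "\<pi> x = (transpose a ?b o transpose c ?d) x"
     proof cases
      case 1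
      then show ?thesis using permutes_not_in[OF p(1) 1] aq bq c(1) dq by (auto simp: transpose_def)
     qed (use a c d fb pi in \<open>auto simp: transpose_def\<close>)
    qed
    moreover have "evenperm (transpose a ?b o transpose c ?d)"
     using a d(1) by (subst evenperm_comp) (auto simp: permutation_swap_id evenperm_swap)
    ultimately have "\<pi> : M" "\<pi> : Alt q" using m2 p(1) unfolding alt_group_carrier by simp_all
    then show ?thesis by blast
   qed
  qed
 qed
qed

end

subsection \<open>Pairs of rank at least two outside one \<open>\<H>\<close>-class\<close>

lemma floating_0:
 assumes "de : partitions n" "ka : partitions n" "!!u. u : {1..n} ==> u : ldom de | u : udom ka"
 shows "floating n de ka = 0"
proof -
 have "{u : {1..n}. ALL v:{1..n}. mid de ka `` {v} = mid de ka `` {u} --> (ALL x. ~ul de x v & ~ul ka v x)} = {}"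
  using assms(3) unfolding mem_ldom mem_udom by blast
 then show ?thesis unfolding prod_rel(4)[OF assms(1,2) midh_classes] by (simp only: image_empty card.empty)
qed

lemma lab_coords: "c ` {1..n} = K ==> coords n (lab n c c) K c c"
 unfolding coords_def by auto

lemma rank_lab:
 fixes c :: "nat => nat" shows "c ` {1..n} = K ==> rank (lab n c c) = card K"
 using coords_rank[OF lab_in lab_coords[of c n K]] .

text \<open>\<open>lab n c c\<close> acts as a right identity on elements whose lower labels are
  constant on the classes of \<open>c\<close>.\<close>

lemma lab_mult_lab:
 assumes c: "ALL u:{1..n}. ALL v:{1..n}. c u = c v --> g u = g v"
 shows "part_mult n (lab n f g) (lab n c c) = lab n f g" "floating n (lab n f g) (lab n c c) = 0"
proof -
 have g: "ALL u v. uu (lab n c c) u v --> g u = g v" using c unfolding rel_lab_simps by blast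
 note L = left_mult[OF lab_in g, of f]
 show "part_mult n (lab n f g) (lab n c c) = lab n f g"
 proof (rule partition_eqI[OF part_mult_in lab_in])
  fix x y
  show "uu (part_mult n (lab n f g) (lab n c c)) x y = uu (lab n f g) x y" unfolding L(1) by simp
  show "ul (part_mult n (lab n f g) (lab n c c)) x y = ul (lab n f g) x y"
   unfolding L(2) rel_lab_simps using c by metis
  show "ll (part_mult n (lab n f g) (lab n c c)) x y = ll (lab n f g) x y"
   unfolding L(3) rel_lab_simps using c by metis
 qed
 show "floating n (lab n f g) (lab n c c) = 0"
  by (rule floating_0) (auto simp: mem_udom)
qed

lemma lab_flip_mult:
 assumes "ALL u:{1..n}. ALL v:{1..n}. c u = c v --> f u = f v"
 shows "part_mult n (lab n c c) (lab n f g) = lab n f g" "floating n (lab n c c) (lab n f g) = 0"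
 using lab_mult_lab[OF assms, of g] flip_mult[of "lab n g f" n "lab n c c", OF lab_in lab_in, unfolded flip_lab]
 by (simp_all add: flip_lab)

definition merge2 :: "(nat => nat) => nat => nat" where
 "merge2 c x = (if c x = 2 then 1 else c x)"

text \<open>Where this is used \<open>c\<close> takes values in \<open>{1..q}\<close>, so 0 is a
  fresh label and detaches class 2 from the other row.\<close>

definition cut2 :: "(nat => nat) => nat => nat" where
 "cut2 c x = (if c x = 2 then 0 else c x)"

context tcong
begin

definition collapse :: "nat => nat => bool" where
 "collapse q i <-> (ALL l l' ze ze'. i <= l & i <= l' & ze : partitions n & ze' : partitions n & rank ze <= q & rank ze' <= q --> E l ze l' ze')"

text \<open>Factoring through \<open>al\<close> relates every element of rank at most
  \<open>s + 1\<close> to one of rank at most \<open>s\<close>, where the collapse has already taken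
  place.\<close>

lemma collapse_Suc:
 assumes c: "collapse s i" and e: "E i al i be" and r: "rank al = Suc s" "rank be <= s"
 shows "collapse (Suc s) i"
proof -
 have *: "EX N \<xi>. N >= i & \<xi> : partitions n & rank \<xi> <= s & E l ze N \<xi>"
  if z: "i <= l" "ze : partitions n" "rank ze <= Suc s" for l ze
 proof -
  obtain j' \<xi> where x: "i <= j'" "\<xi> : partitions n" "rank \<xi> <= rank be" "E i ze j' \<xi>"
   using E_factor[OF e z(2)] r z by auto
  from E_shift_to[OF x(4) z(1)] x r show ?thesis by (meson le_add1 le_trans)
 qed
 show ?thesis unfolding collapse_def
 proof (intro allI impI; elim conjE)
  fix l l' ze ze' assume a: "i <= l" "i <= l'" "ze : partitions n" "ze' : partitions n" "rank ze <= Suc s" "rank ze' <= Suc s"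
  from *[OF a(1,3,5)] *[OF a(2,4,6)] c show "E l ze l' ze'" unfolding collapse_def using E_sym E_trans by metis
 qed
qed

text \<open>The collapse climbs from rank 1 to rank \<open>q\<close>: at each rank the given pair
  yields an element related to one of smaller rank, as \<open>collapse_Suc\<close> asks for.\<close>

lemma collapse_merge:
 assumes e: "E i (lab n c c) i (lab n (merge2 c) (cut2 c))" and c: "c ` {1..n} = {1..q}" and q: "q >= 2"
 shows "collapse q i"
proof -
 let ?m = "merge2 c" and ?k = "cut2 c"
 have cn: "c x ~= 0" if "x : {1..n}" for x using c that by force
 obtain x1 where x1: "x1 : {1..n}" "c x1 = 1" using c q by (metis atLeastAtMost_iff imageE le_refl one_le_numeral order_trans)
 obtain x2 where x2: "x2 : {1..n}" "c x2 = 2" using c q by (metis atLeastAtMost_iff imageE one_le_numeral)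
 have ck: "c u = c v" if "u : {1..n}" "v : {1..n}" "?k u = ?k v" for u v
  using that cn[OF that(1)] cn[OF that(2)] unfolding cut2_def by (auto split: if_splits)
 have mk: "EX u:{1..n}. ?k u = ?m x & c u ~= 2" if "x : {1..n}" for x
 proof (cases "c x = 2")
  case True
  then show ?thesis using x1 unfolding merge2_def cut2_def by (intro bexI[of _ x1]) auto
 next
  case False
  then show ?thesis using that unfolding merge2_def cut2_def by (intro bexI[of _ x]) auto
 qed
 have ld: "y : ldom (lab n ?m ?k) <-> y : {1..n} & c y ~= 2" for y
 proof -
  have "EX x:{1..n}. ?m x = ?k y" if "y : {1..n}" "c y ~= 2"
   using that unfolding merge2_def cut2_def by (intro bexI[of _ y]) auto
  moreover have "?m x ~= ?k y" if "x : {1..n}" "c y = 2" for x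
   using that cn[OF that(1)] unfolding merge2_def cut2_def by auto
  ultimately show ?thesis unfolding mem_ldom rel_lab_simps by blast
 qed
 \<comment> \<open>\<open>?u\<close> has a single block, \<open>?u'\<close> splits off the lower
   points of class 2, and \<open>?w\<close> splits off class 2 in both rows. Multiplying the given
   pair by \<open>?u\<close> relates \<open>?u\<close> and \<open>?u'\<close>; multiplying by
   \<open>?w\<close> relates \<open>?w\<close> and, one level up, \<open>?u'\<close>. So
   \<open>?w\<close> and \<open>?u\<close> are related although both kernels differ, and
   \<open>E_rees\<close> collapses ranks 0 and 1.\<close>
 let ?u = "lab n (%_. 1 :: nat) (%_. 1)"
 let ?u' = "lab n (%_. 1 :: nat) (%y. if c y = 2 then 0 else 1)"
 let ?wu = "%x. if c x = 2 then 2 else (1::nat)" and ?wl = "%x. if c x = 2 then 3 else (1::nat)"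
 let ?w = "lab n ?wu ?wl"
 have "E i ?u i ?u'"
 proof -
  have 1: "part_mult n ?u (lab n c c) = ?u" "floating n ?u (lab n c c) = 0" using lab_mult_lab[of n c "%_. 1 :: nat" "%_. 1 :: nat"] by simp_all
  have a: "lab n ?m ?k : partitions n" by simp
  note L = left_full[OF a, where f = "%_. 1 :: nat" and c = 1]
  have "part_mult n ?u (lab n ?m ?k) = ?u'"
  proof (rule partition_eqI[OF part_mult_in lab_in])
   fix x y
   show "uu (part_mult n ?u (lab n ?m ?k)) x y = uu ?u' x y" unfolding L(1) by simp
   show "ul (part_mult n ?u (lab n ?m ?k)) x y = ul ?u' x y" unfolding L(2) ld rel_lab_simps by auto
   have "c x = 2 <-> c y = 2" if "x : {1..n}" "y : {1..n}" "?k x = ?k y" using ck[OF that] by simp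
   moreover have "?k x = ?k y" if "c x = 2" "c y = 2" using that unfolding cut2_def by simp
   ultimately show "ll (part_mult n ?u (lab n ?m ?k)) x y = ll ?u' x y" unfolding L(3) ld rel_lab_simps by auto
  qed
  moreover have "floating n ?u (lab n ?m ?k) = 0" by (rule L(4)) (use x1 in auto)
  ultimately show ?thesis using E_left[OF e, of ?u] 1 by simp
 qed
 then have uu': "E (i + 1) ?u (i + 1) ?u'" by (rule E_shift)
 have "E i ?w (i + 1) ?u'"
 proof -
  have 1: "part_mult n (lab n c c) ?w = ?w" "floating n (lab n c c) ?w = 0" using lab_flip_mult[of n c ?wu ?wl] by simp_all
  have a: "lab n ?m ?k : partitions n" by simp
  have f: "ALL u v. ll (lab n ?m ?k) u v --> ?wu u = ?wu v"
  proof (intro allI impI)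
   fix u v assume "ll (lab n ?m ?k) u v"
   then have "c u = c v" unfolding rel_lab_simps using ck by blast
   then show "?wu u = ?wu v" by simp
  qed
  note R = right_mult[OF a f, of ?wl]
  have "part_mult n (lab n ?m ?k) ?w = ?u'"
  proof (rule partition_eqI[OF part_mult_in lab_in])
   fix x y
   have *: "EX u. ul (lab n ?m ?k) x u & ?wu u = 1" if x: "x : {1..n}" for x
   proof -
    obtain u where "u : {1..n}" "?k u = ?m x" "c u ~= 2" using mk[OF x] by blast
    then have "ul (lab n ?m ?k) x u" "?wu u = 1" using x unfolding rel_lab_simps by simp_all
    then show ?thesis by blast
   qed
   have 2: "?wu u = 1" if xu: "ul (lab n ?m ?k) x u" for x u
   proof -
    have "u : ldom (lab n ?m ?k)" using xu unfolding mem_ldom by blast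
    then show ?thesis unfolding ld by simp
   qed
   have "uu (part_mult n (lab n ?m ?k) ?w) x y ==> x : {1..n} & y : {1..n}" by (rule uu_range[OF part_mult_in])
   moreover have "uu (part_mult n (lab n ?m ?k) ?w) x y" if xy: "x : {1..n}" "y : {1..n}"
   proof -
    obtain u v where "ul (lab n ?m ?k) x u" "?wu u = 1" "ul (lab n ?m ?k) y v" "?wu v = 1"
     using *[OF xy(1)] *[OF xy(2)] by blast
    then show ?thesis unfolding R(1) by metis
   qed
   ultimately show "uu (part_mult n (lab n ?m ?k) ?w) x y = uu ?u' x y" unfolding rel_lab_simps by blast
   have "(EX u. ul (lab n ?m ?k) x u & ?wu u = ?wl y) <-> x : {1..n} & c y ~= 2"
   proof
    assume "EX u. ul (lab n ?m ?k) x u & ?wu u = ?wl y"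
    then obtain u where u: "ul (lab n ?m ?k) x u" "?wu u = ?wl y" by blast
    then have "?wl y = 1" using 2 by metis
    then have "c y ~= 2" by (cases "c y = 2") simp_all
    then show "x : {1..n} & c y ~= 2" using u(1) unfolding rel_lab_simps by blast
   next
    assume "x : {1..n} & c y ~= 2"
    then show "EX u. ul (lab n ?m ?k) x u & ?wu u = ?wl y" using *[of x] by simp
   qed
   moreover have "ul ?u' x y <-> x : {1..n} & y : {1..n} & c y ~= 2" unfolding rel_lab_simps by simp
   ultimately show "ul (part_mult n (lab n ?m ?k) ?w) x y = ul ?u' x y" unfolding R(2) by blast
   show "ll (part_mult n (lab n ?m ?k) ?w) x y = ll ?u' x y" unfolding R(3) rel_lab_simps by simp
  qed
  \<comment> \<open>The middle points of class 2 are cut off above by \<open>cut2\<close> and below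
    by \<open>?w\<close>; they form the one floating component.\<close>
  moreover have "floating n (lab n ?m ?k) ?w = 1"
  proof -
   have "{u : {1..n}. ?wu u ~: ?wl ` {1..n} & (ALL v:ldom (lab n ?m ?k). ?wu v ~= ?wu u)} = {u : {1..n}. c u = 2}"
   proof (intro equalityI subsetI)
    fix u assume u: "u : {u : {1..n}. ?wu u ~: ?wl ` {1..n} & (ALL v:ldom (lab n ?m ?k). ?wu v ~= ?wu u)}"
    have "x1 : ldom (lab n ?m ?k)" using ld x1 by simp
    then have "?wu x1 ~= ?wu u" using u by blast
    then have "c u = 2" using x1 by (cases "c u = 2") simp_all
    then show "u : {u : {1..n}. c u = 2}" using u by blast
   next
    fix u assume u: "u : {u : {1..n}. c u = 2}"
    then have "?wu u ~: ?wl ` {1..n}" by auto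
    moreover have "?wu v ~= ?wu u" if v: "v : ldom (lab n ?m ?k)" for v
    proof -
     have "c v ~= 2" using v unfolding ld by blast
     then show ?thesis using u by simp
    qed
    ultimately show "u : {u : {1..n}. ?wu u ~: ?wl ` {1..n} & (ALL v:ldom (lab n ?m ?k). ?wu v ~= ?wu u)}" using u by blast
   qed
   moreover have "?wu ` {u : {1..n}. c u = 2} = {2}" using x2 by auto
   ultimately show ?thesis unfolding R(4) by simp
  qed
  ultimately show ?thesis using E_right[OF e, of ?w] 1 by simp
 qed
 then have wu: "E i ?w (i + 1) ?u" using uu' E_sym E_trans by blast
 have "collapse 1 i"
 proof -
  have ud: "x : udom ?w <-> x : {1..n} & c x ~= 2" for x
  proof -
   have "?wu x = ?wl y <-> c x ~= 2 & c y ~= 2" for y by simp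
   then show ?thesis unfolding mem_udom rel_lab_simps using x1 by auto
  qed
  have "rank ?w <= 1" unfolding rank_le_1_iff[OF lab_in] Ball_def ud by auto
  moreover have "rank ?w ~= 0" unfolding rank_0_iff[OF lab_in] using ud[of x1] x1 by auto
  ultimately have rw: "rank ?w = 1" by simp
  have ru: "rank ?u <= 1" unfolding rank_le_1_iff[OF lab_in] rel_lab_simps
   using subsetD[OF udom_sub[OF lab_in[of n "%_. 1 :: nat" "%_. 1 :: nat"]]] by blast
  have 1: "uu ?w x1 x2 ~= uu ?u x1 x2" "ll ?w x1 x2 ~= ll ?u x1 x2" using x1 x2 by auto
  have "E l ze l' ze'" if "i <= l" "i <= l'" "ze : partitions n" "ze' : partitions n" "rank ze <= 1" "rank ze' <= 1" for l l' ze ze'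
   by (rule E_rees[OF wu _ _ 1]) (use rw ru that in \<open>auto simp: reach_def\<close>)
  then show ?thesis unfolding collapse_def by blast
 qed
 \<comment> \<open>\<open>?e\<close> below has rank \<open>s + 1\<close>. Multiplied into the given
   pair it is kept on one side and loses rank on the other, where the classes 1 and 2 are
   merged.\<close>
 moreover have "collapse (Suc s) i" if "collapse s i" "1 <= s" "Suc s <= q" for s
 proof -
  let ?c = "%x. min (c x) (Suc s)"
  have im: "?c ` {1..n} = {1..Suc s}"
  proof (intro equalityI subsetI)
   fix k assume k: "k : {1..Suc s}"
   have "k : c ` {1..n}" unfolding c using k that(3) by simp
   then obtain x where "x : {1..n}" "c x = k" by blast
   then show "k : ?c ` {1..n}" using k by (intro image_eqI[of _ _ x]) auto
  qed (use cn in \<open>fastforce simp: Suc_le_eq\<close>)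
  let ?e = "lab n ?c ?c"
  let ?b = "part_mult n ?e (lab n ?m ?k)"
  have re: "rank ?e = Suc s" using rank_lab[OF im] by simp
  have dom: "ul ?e x x" if "x : {1..n}" for x using that by simp
  have "part_mult n ?e (lab n c c) = ?e" "floating n ?e (lab n c c) = 0" using lab_mult_lab[of n c ?c ?c] by simp_all
  moreover have "floating n ?e (lab n ?m ?k) = 0"
   by (rule floating_0) (use dom in \<open>auto simp: mem_ldom\<close>)
  ultimately have E: "E i ?e i ?b" using E_left[OF e, of ?e] by simp
  have "rank ?b ~= rank ?e"
  proof
   assume r: "rank ?b = rank ?e"
   have "uu (lab n ?m ?k) x1 x2" using x1 x2 unfolding rel_lab_simps merge2_def by simp
   then have "uu ?b x1 x2"
    unfolding prod_rel(1)[OF lab_in lab_in midh_classes] mid_classes_iff using dom x1(1) x2(1) mid_uu by blast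
   then have "uu ?e x1 x2" using rank_mult(3)[OF lab_in lab_in r] dom x1(1) x2(1) unfolding mem_udom by blast
   then show False using x1 x2 that by simp
  qed
  moreover have "rank ?b <= rank ?e" by (rule rank_mult(1)[OF lab_in lab_in])
  ultimately show ?thesis using collapse_Suc[OF that(1) E re] re by simp
 qed
 ultimately have "collapse (Suc s) i" if "Suc s <= q" for s
  using that by (induction s) auto
 from this[of "q - 1"] q show ?thesis by simp
qed

end

lemma relabel_surj:
 fixes c :: "nat => nat"
 assumes c: "c ` {1..n} = {1..q}" and k: "k1 : {1..q}" "k2 : {1..q}" "k1 ~= k2"
 shows "EX c'. c' ` {1..n} = {1..q} & lab n c' c' = lab n c c & (ALL x. c' x = 1 <-> c x = k1) & (ALL x. c' x = 2 <-> c x = k2) &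
  (ALL x y. c' x = c' y <-> c x = c y)"
proof -
 have q: "1 : {1..q}" "2 : {1..q}" using k by auto
 \<comment> \<open>The first transposition takes \<open>k1\<close> to 1 and \<open>k2\<close> to a
   place other than 1, which the second one exchanges with 2.\<close>
 define t where "t = transpose (transpose k1 1 k2) 2 o transpose k1 1"
 have "transpose k1 1 k2 : {1..q}" using k q by (auto simp: transpose_def)
 then have p: "t permutes {1..q}" unfolding t_def using k q by (intro permutes_compose permutes_transpose) auto
 have inj: "t x = t y <-> x = y" for x y using permutes_inj[OF p] by (simp only: inj_eq)
 have 1: "t k1 = 1" "t k2 = 2" unfolding t_def using k by (auto simp: transpose_def split: if_splits)
 have "(t o c) ` {1..n} = {1..q}" using permutes_image[OF p] c by (metis image_comp)
 moreover have "lab n (t o c) (t o c) = lab n c c"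
  by (rule partition_eqI[OF lab_in lab_in]) (simp_all only: rel_lab_simps comp_apply inj)
 moreover have "(t o c) x = 1 <-> c x = k1" for x using inj[of "c x" k1] 1(1) by simp
 moreover have "(t o c) x = 2 <-> c x = k2" for x using inj[of "c x" k2] 1(2) by simp
 moreover have "(t o c) x = (t o c) y <-> c x = c y" for x y using inj by simp
 ultimately show ?thesis by blast
qed

context tcong
begin

lemma collapse_flip:
 assumes "tcong.collapse n {((i, al), (j, be)). E i (flip al) j (flip be)} q i"
 shows "collapse q i"
proof -
 interpret f: tcong n "{((i, al), (j, be)). E i (flip al) j (flip be)}" by (rule tcong_flip)
 have fE: "f.E i al j be <-> E i (flip al) j (flip be)" for i al j be unfolding f.E_def by simp
 show ?thesis unfolding collapse_def
 proof (intro allI impI; elim conjE)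
  fix l l' ze ze' assume a: "i <= l" "i <= l'" "ze : partitions n" "ze' : partitions n" "rank ze <= q" "rank ze' <= q"
  then have "f.E l (flip ze) l' (flip ze')" using assms unfolding f.collapse_def by simp
  then show "E l ze l' ze'" unfolding fE by simp
 qed
qed

text \<open>Having smaller rank, \<open>gm\<close> either joins two classes of \<open>c\<close> or
  leaves a class without transversal. In both cases there is an element that fixes \<open>gm\<close>
  from the left without floats and has the shape treated by \<open>collapse_merge\<close>, up to a
  flip in the second case.\<close>

lemma collapse_drop:
 assumes e: "E i (lab n c c) k gm" and c: "c ` {1..n} = {1..q}" and q: "q >= 2" and r: "rank gm < q"
  and sat: "!!u v. [|u : {1..n}; v : {1..n}; c u = c v|] ==> uu gm u v"
 shows "collapse q i"
proof (cases "EX x y. uu gm x y & c x ~= c y")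
 case True
 then obtain x1 x2 where xy: "uu gm x1 x2" "c x1 ~= c x2" by blast
 have g: "gm : partitions n" using E_in[OF e] by blast
 have xn: "x1 : {1..n}" "x2 : {1..n}" using uu_range[OF g xy(1)] by blast+
 then have "c x1 : {1..q}" "c x2 : {1..q}" using c by blast+
 then obtain d where d: "d ` {1..n} = {1..q}" "lab n d d = lab n c c" "!!x. d x = 1 <-> c x = c x1"
  "!!x. d x = 2 <-> c x = c x2" "!!x y. d x = d y <-> c x = c y" using relabel_surj[OF c _ _ xy(2)] by blast
 have sat': "uu gm u v" if "u : {1..n}" "v : {1..n}" "d u = d v" for u v using sat that d(5) by blast
 have d1: "d x1 = 1" "d x2 = 2" using d by blast+
 have dn: "d x ~= 0" if "x : {1..n}" for x using d(1) that by force
 let ?m = "merge2 d" and ?k = "cut2 d"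
 have ksat: "uu gm u v" if "u : {1..n}" "v : {1..n}" "?k u = ?k v" for u v
  using that dn[OF that(1)] dn[OF that(2)] sat'[OF that(1,2)] unfolding cut2_def by (auto split: if_splits)
 note tr = rel_trans[OF g] and sy = rel_sym[of gm]
 have to1: "uu gm u x1" if "u : {1..n}" "d u = 1 | d u = 2" for u
 proof -
  have "uu gm u x1 | uu gm u x2" using sat'[OF that(1) xn(1)] sat'[OF that(1) xn(2)] d1 that(2) by auto
  then show ?thesis using tr sy[OF xy(1)] by blast
 qed
 have msat: "uu gm u v" if "u : {1..n}" "v : {1..n}" "?m u = ?m v" for u v
 proof (cases "d u = d v")
  case False
  then have "d u = 1 | d u = 2" "d v = 1 | d v = 2" using that(3) unfolding merge2_def by (auto split: if_splits)
  then show ?thesis using to1[OF that(1)] sy[OF to1[OF that(2)]] tr by blast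
 qed (use sat' that in blast)
 have mksat: "uu gm x u" if "x : {1..n}" "u : {1..n}" "?m x = ?k u" for x u
 proof -
  have "?m x = ?m u" using that dn[OF that(1)] unfolding merge2_def cut2_def by (auto split: if_splits)
  then show ?thesis using msat that by blast
 qed
 have mk: "EX u:{1..n}. ?m x = ?k u" if "x : {1..n}" for x
 proof (cases "d x = 2")
  case True
  then show ?thesis using xn d1 unfolding merge2_def cut2_def by (intro bexI[of _ x1]) auto
 next
  case False
  then show ?thesis using that unfolding merge2_def cut2_def by (intro bexI[of _ x]) auto
 qed
 let ?d = "lab n ?m ?k"
 have bi: "blk gm (Upper u) = blk gm (Upper v) <-> uu gm u v" if "v : {1..n}" for u v
  using blk_eq_iff[OF g, of "Upper v"] that by simp
 have h: "midh n ?d gm (%u. blk gm (Upper u))"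
 proof (rule midhI)
  fix u v
  show "ll ?d u v ==> blk gm (Upper u) = blk gm (Upper v)" using ksat bi by simp
  show "uu gm u v ==> blk gm (Upper u) = blk gm (Upper v)" using bi uu_range[OF g] by blast
  show "[|u : {1..n}; v : {1..n}; blk gm (Upper u) = blk gm (Upper v)|] ==> (u, v) : mid ?d gm" using bi mid_uu by blast
 qed
 note p = prod_rel[OF lab_in g h]
 have dg: "part_mult n ?d gm = gm"
 proof (rule partition_eqI[OF part_mult_in g])
  fix x y
  have ur: "uu gm x u" if "ul ?d x u" for x u using that mksat unfolding rel_lab_simps by blast
  have uex: "EX u. ul ?d x u" if "x : {1..n}" for x using mk[OF that] that unfolding rel_lab_simps by blast
  have uvg: "uu gm u v" if "blk gm (Upper u) = blk gm (Upper v)" "v : {1..n}" for u v using bi that by blast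
  show "uu (part_mult n ?d gm) x y = uu gm x y"
  proof
   assume "uu (part_mult n ?d gm) x y"
   then consider "uu ?d x y" | u v where "ul ?d x u" "ul ?d y v" "blk gm (Upper u) = blk gm (Upper v)" unfolding p(1) by blast
   then show "uu gm x y"
   proof cases
    case 1 then show ?thesis using msat unfolding rel_lab_simps by blast
   next
    case 2
    have "uu gm u v" using uvg 2 ul_range[OF lab_in 2(2)] by blast
    then show ?thesis using tr[OF ur[OF 2(1)]] tr sy[OF ur[OF 2(2)]] by blast
   qed
  next
   assume a: "uu gm x y"
   then have "x : {1..n}" "y : {1..n}" using uu_range[OF g] by blast+
   then obtain u v where uv: "ul ?d x u" "ul ?d y v" using uex by blast
   then have "uu gm u v" using tr[OF sy[OF ur[OF uv(1)]]] tr[OF a ur[OF uv(2)]] by blast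
   then show "uu (part_mult n ?d gm) x y" unfolding p(1) using uv bi uu_range[OF g] by blast
  qed
  show "ul (part_mult n ?d gm) x y = ul gm x y"
  proof
   assume "ul (part_mult n ?d gm) x y"
   then obtain u v where uv: "ul ?d x u" "ul gm v y" "blk gm (Upper u) = blk gm (Upper v)" unfolding p(2) by blast
   have "uu gm u v" using uvg uv(3) ul_range[OF g uv(2)] by blast
   then show "ul gm x y" using tr[OF tr[OF ur[OF uv(1)]] uv(2)] by blast
  next
   assume a: "ul gm x y"
   then have "x : {1..n}" using ul_range[OF g] by blast
   then obtain u where u: "ul ?d x u" using uex by blast
   have "blk gm (Upper u) = blk gm (Upper x)" using bi[OF \<open>x : {1..n}\<close>] sy[OF ur[OF u]] by blast
   then show "ul (part_mult n ?d gm) x y" unfolding p(2) using u a by blast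
  qed
  show "ll (part_mult n ?d gm) x y = ll gm x y"
  proof -
   have "ll gm x y" if "ul gm u x" "ul gm v y" "blk gm (Upper u) = blk gm (Upper v)" for u v
    using tr[OF sy[OF that(1)] tr[OF uvg[OF that(3)] that(2)]] ul_range[OF g that(2)] by blast
   then show ?thesis unfolding p(3) by blast
  qed
 qed
 have "EX v:{1..n}. blk gm (Upper v) = blk gm (Upper u) & (EX x. ul ?d x v)" if u: "u : {1..n}" for u
 proof (cases "d u = 2")
  case True
  then have "uu gm x1 u" using sy[OF to1[OF u]] by blast
  moreover have "ul ?d x1 x1" using xn d1 unfolding rel_lab_simps merge2_def cut2_def by simp
  ultimately show ?thesis using bi[OF u] xn by blast
 next
  case False
  then have "ul ?d u u" using u unfolding rel_lab_simps merge2_def cut2_def by simp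
  then show ?thesis using u by blast
 qed
 then have "{u : {1..n}. ALL v:{1..n}. blk gm (Upper v) = blk gm (Upper u) --> (ALL x. ~ul ?d x v & ~ul gm v x)} = {}" by blast
 then have fl: "floating n ?d gm = 0" unfolding p(4) by (simp only: image_empty card.empty)
 have dd: "part_mult n ?d (lab n d d) = ?d" "floating n ?d (lab n d d) = 0"
  using lab_mult_lab[of n d ?k ?m] unfolding cut2_def by simp_all
 \<comment> \<open>Left multiplication by \<open>?d\<close> fixes \<open>gm\<close> and turns
   \<open>lab n d d\<close> into \<open>?d\<close>, so both are related to the same element and end
   up on level \<open>i\<close>.\<close>
 have "E i ?d k gm" using E_left[OF e[folded d(2)] lab_in, of ?m ?k] dg fl dd by simp
 then have "E i (lab n d d) i ?d" using e d(2) E_sym E_trans by metis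
 from collapse_merge[OF this d(1) q] show ?thesis .
next
 case False
 have g: "gm : partitions n" using E_in[OF e] by blast
 have uc: "uu gm x y <-> x : {1..n} & y : {1..n} & c x = c y" for x y
  using False sat uu_range[OF g] by blast
 \<comment> \<open>Now \<open>gm\<close> has exactly the upper kernel of \<open>lab n c c\<close>
   but smaller rank, so some class carries no transversal.\<close>
 have "c ` udom gm ~= {1..q}"
 proof
  assume a: "c ` udom gm = {1..q}"
  have "rank gm = card (c ` udom gm)"
   by (rule rank_eq_card[OF g]) (use uc udom_sub[OF g] in blast)
  then show False using a r by simp
 qed
 moreover have "c ` udom gm \<subseteq> {1..q}" using c udom_sub[OF g] by blast
 ultimately obtain k2 where k2: "k2 : {1..q}" "k2 ~: c ` udom gm" by blast
 obtain k1 where k1: "k1 : {1..q}" "k1 ~= k2"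
 proof (cases "k2 = 1")
  case True then show ?thesis using that[of 2] q by simp
 next
  case False then show ?thesis using that[of 1] q by simp
 qed
 obtain d where d: "d ` {1..n} = {1..q}" "lab n d d = lab n c c" "!!x. d x = 1 <-> c x = k1"
  "!!x. d x = 2 <-> c x = k2" "!!x y. d x = d y <-> c x = c y"
  using relabel_surj[OF c k1(1) k2(1) k1(2)] by blast
 have ud: "uu gm x y <-> x : {1..n} & y : {1..n} & d x = d y" for x y using uc d(5) by simp
 have d2: "d x ~= 2" if "x : udom gm" for x using that d(4)[of x] k2(2) by auto
 have dn: "d x ~= 0" if "x : {1..n}" for x using d(1) that by force
 let ?m = "merge2 d" and ?k = "cut2 d"
 \<comment> \<open>The mirror image of the element of the first case; class 2 is cut in the upper
   row, where \<open>gm\<close> has no transversal.\<close>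
 let ?d = "lab n ?k ?m"
 have m: "ALL u v. uu gm u v --> ?m u = ?m v" unfolding ud merge2_def by simp
 note L = left_mult[OF g m, of ?k]
 have ku: "?k x = ?k y <-> d x = d y" if "x : {1..n}" "y : {1..n}" for x y
  using dn[OF that(1)] dn[OF that(2)] unfolding cut2_def by (cases "d x = 2"; cases "d y = 2") simp_all
 have dg: "part_mult n ?d gm = gm"
 proof (rule partition_eqI[OF part_mult_in g])
  fix x y
  show "uu (part_mult n ?d gm) x y = uu gm x y" unfolding L(1) ud using ku by blast
  show "ul (part_mult n ?d gm) x y = ul gm x y"
  proof
   assume "ul (part_mult n ?d gm) x y"
   then obtain u where u: "x : {1..n}" "ul gm u y" "?m u = ?k x" unfolding L(2) by blast
   have "u : {1..n}" "d u ~= 2" using d2[of u] ul_range[OF g u(2)] u(2) unfolding mem_udom by blast+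
   then have "d u = d x" using u(3) dn[of u] unfolding merge2_def cut2_def by (simp split: if_splits)
   then have "uu gm u x" unfolding ud using u \<open>u : {1..n}\<close> by blast
   then show "ul gm x y" using uu_ul[OF g _ u(2)] by blast
  next
   assume a: "ul gm x y"
   then have "x : {1..n}" "d x ~= 2" using d2[of x] ul_range[OF g a] unfolding mem_udom by blast+
   then show "ul (part_mult n ?d gm) x y" unfolding L(2) using a unfolding merge2_def cut2_def by (intro conjI exI[of _ x]) auto
  qed
  have "ll gm x y" if uv: "ul gm u x" "ul gm v y" "?m u = ?m v" for u v
  proof -
   have "u : {1..n}" "v : {1..n}" "d u ~= 2" "d v ~= 2"
    using d2[of u] d2[of v] ul_range[OF g uv(1)] ul_range[OF g uv(2)] uv(1,2) unfolding mem_udom by blast+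
   then have "uu gm v u" unfolding ud using uv(3) unfolding merge2_def by simp
   then have "ul gm u y" using uu_ul[OF g _ uv(2)] by blast
   then show ?thesis using ul_ll[OF g uv(1)] by blast
  qed
  then show "ll (part_mult n ?d gm) x y = ll gm x y" unfolding L(3) by blast
 qed
 have "?m u : ?k ` {1..n}" if "u : {1..n}" for u
 proof (cases "d u = 2")
  case True
  have "1 : d ` {1..n}" unfolding d(1) using q by simp
  then obtain x where "x : {1..n}" "d x = 1" by (metis imageE)
  then show ?thesis using True unfolding merge2_def cut2_def by (intro image_eqI[of _ _ x]) auto
 next
  case False
  then show ?thesis using that unfolding merge2_def cut2_def by (intro image_eqI[of _ _ u]) auto
 qed
 then have "{u : {1..n}. ?m u ~: ?k ` {1..n} & (ALL v:udom gm. ?m v ~= ?m u)} = {}" by blast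
 then have fl: "floating n ?d gm = 0" unfolding L(4) by (simp only: image_empty card.empty)
 have dd: "part_mult n ?d (lab n d d) = ?d" "floating n ?d (lab n d d) = 0"
  using lab_mult_lab[of n d ?m ?k] unfolding merge2_def by simp_all
 have "E i ?d k gm" using E_left[OF e[folded d(2)] lab_in, of ?k ?m] dg fl dd by simp
 then have e': "E i (lab n d d) i ?d" using e d(2) E_sym E_trans by metis
 interpret f: tcong n "{((i, al), (j, be)). E i (flip al) j (flip be)}" by (rule tcong_flip)
 have "f.E i (lab n d d) i (lab n ?m ?k)" unfolding f.E_def using e' by (simp add: flip_lab)
 from collapse_flip[OF f.collapse_merge[OF this d(1) q]] show ?thesis .
qed

text \<open>\<open>al\<close> is first replaced by \<open>lab n c c\<close> of the same rank. One
  more left multiplication by this element keeps it and makes the upper kernel of the other member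
  contain that of \<open>c\<close>, as \<open>collapse_drop\<close> requires.\<close>

lemma collapse_rank_drop:
 assumes e: "E i al k gm" and q: "rank al >= 2" and r: "rank gm < rank al"
 shows "collapse (rank al) i"
proof -
 let ?q = "rank al" and ?c = "%x. min x (rank al)"
 have "?q <= n" by (rule rank_le_n[OF E_in(1)[OF e]])
 then have c: "?c ` {1..n} = {1..?q}"
 proof (intro equalityI subsetI)
  fix k assume "?q <= n" "k : {1..?q}"
  then show "k : ?c ` {1..n}" by (intro image_eqI[of _ _ k]) auto
 qed (use q in auto)
 let ?e = "lab n ?c ?c"
 have "rank ?e = ?q" using rank_lab[OF c] by simp
 then obtain j' \<xi> where x: "\<xi> : partitions n" "rank \<xi> <= rank gm" "E i ?e j' \<xi>" using E_factor[OF e lab_in, of ?c ?c] by auto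
 let ?x = "part_mult n ?e \<xi>"
 have dom: "ul ?e x x" if "x : {1..n}" for x using that by simp
 have "part_mult n ?e ?e = ?e" "floating n ?e ?e = 0" using lab_mult_lab[of n ?c ?c ?c] by simp_all
 moreover have "floating n ?e \<xi> = 0" by (rule floating_0) (use x dom in \<open>auto simp: mem_ldom\<close>)
 ultimately have "E i ?e j' ?x" using E_left[OF x(3) lab_in, of ?c ?c] by simp
 moreover have "rank ?x < ?q" using rank_mult_right(1)[OF lab_in x(1), of ?c ?c] x(2) r by linarith
 moreover have "uu ?x u v" if "u : {1..n}" "v : {1..n}" "?c u = ?c v" for u v
  using uu_mult[OF lab_in x(1), of ?c ?c u v] that by simp
 ultimately show ?thesis using collapse_drop[OF _ c q] by blast
qed

end

text \<open>A left identity of \<open>al\<close> of the same rank: the upper blocks of \<open>al\<close> outside the domain are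
 attached to the transversals chosen by \<open>p\<close>.\<close>

lemma left_identity:
 assumes a: "al : partitions n" and c: "coords n al {1..q} t s"
  and p: "!!u. u : {1..n} ==> p u : {1..q}" "!!u v. uu al u v ==> p u = p v"
 defines "b == %u. if t u : {1..q} then t u else p u"
 defines "de == lab n (%x. if t x : {1..q} then Inl (t x) else Inr (blk al (Upper x))) (%u. Inl (b u))"
 shows "part_mult n de al = al" "floating n de al = 0" "coords n de {1..q} t b" "ldom de = {1..n}"
proof -
 define F :: "nat => nat + vertex set" where "F x = (if t x : {1..q} then Inl (t x) else Inr (blk al (Upper x)))" for x
 have d: "de = lab n F (%u. Inl (b u))" unfolding de_def F_def ..
 have bq: "b u : {1..q}" if "u : {1..n}" for u using p(1)[OF that] unfolding b_def by simp
 have ud: "x : udom al <-> x : {1..n} & t x : {1..q}" for x by (rule coords_udom[OF a c])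
 have bb: "b u = b v" if uv: "uu al u v" for u v
 proof (cases "u : udom al")
  case True
  then have "t u = t v" using coords_uu[OF a c True, of v] uv uu_range[OF a uv] by blast
  then show ?thesis unfolding b_def using p(2)[OF uv] by simp
 next
  case False
  then have "v ~: udom al" using uu_udom[OF a uv] by blast
  then have *: "t u ~: {1..q}" "t v ~: {1..q}" using False uu_range[OF a uv] unfolding ud by blast+
  show ?thesis unfolding b_def if_not_P[OF *(1)] if_not_P[OF *(2)] using p(2)[OF uv] .
 qed
 have Finl: "F x = Inl k <-> t x : {1..q} & t x = k" for x k unfolding F_def by auto
 have FF: "F x = F y <-> uu al x y" if xy: "x : {1..n}" "y : {1..n}" for x y
 proof (cases "t x : {1..q}")
  case True
  then have "x : udom al" using xy ud by blast
  then have "uu al x y <-> t x = t y" using coords_uu[OF a c _ xy(2)] by blast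
  then show ?thesis using True unfolding F_def by auto
 next
  case False
  then have nx: "x ~: udom al" unfolding ud by blast
  show ?thesis
  proof (cases "t y : {1..q}")
   case True
   then have "y : udom al" using xy ud by blast
   then have "~uu al x y" using nx uu_udom[OF a] by blast
   moreover have "F x ~= F y" unfolding F_def if_P[OF True] if_not_P[OF False] by simp
   ultimately show ?thesis by blast
  next
   case F: False
   have "F x = F y <-> blk al (Upper x) = blk al (Upper y)" unfolding F_def if_not_P[OF False] if_not_P[OF F] by simp
   then show ?thesis using blk_eq_iff[OF a, of "Upper y" "Upper x"] xy by simp
  qed
 qed
 show cd: "coords n de {1..q} t b" unfolding coords_def
 proof (intro conjI ballI)
  show "ul de x y = (t x = b y & t x : {1..q})" if "x : {1..n}" "y : {1..n}" for x y
   unfolding d rel_lab_simps Finl using that by blast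
  show "{1..q} \<subseteq> t ` {1..n}" using c unfolding coords_def by blast
  show "{1..q} \<subseteq> b ` {1..n}"
  proof
   fix k assume k: "k : {1..q}"
   then obtain x where "x : {1..n}" "t x = k" using coords_surj(1)[OF c] by blast
   then show "k : b ` {1..n}" using k unfolding b_def by (intro image_eqI[of _ _ x]) simp_all
  qed
 qed
 have dP: "de : partitions n" unfolding d by simp
 show ld: "ldom de = {1..n}" unfolding set_eq_iff coords_ldom[OF dP cd] using bq by blast
 show "floating n de al = 0" by (rule floating_0[OF dP a]) (use ld in blast)
 have g: "ALL u v. uu al u v --> (Inl (b u) :: nat + vertex set) = Inl (b v)" using bb by simp
 note L = left_mult[OF a g, of F, folded d]
 show "part_mult n de al = al"
 proof (rule partition_eqI[OF part_mult_in a])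
  fix x y
  show "uu (part_mult n de al) x y = uu al x y" unfolding L(1) using FF[of x y] uu_range[OF a, of x y] by blast
  have bt: "b u = t u" if "u : udom al" for u using that unfolding ud b_def by simp
  show "ul (part_mult n de al) x y = ul al x y"
  proof
   assume "ul (part_mult n de al) x y"
   then obtain u where u: "x : {1..n}" "ul al u y" "F x = Inl (b u)" unfolding L(2) by metis
   have ux: "u : udom al" using u(2) unfolding mem_udom by blast
   then have "t u = t x" using u(3) bt[OF ux] unfolding Finl by simp
   then have "uu al u x" using coords_uu[OF a c ux u(1)] by blast
   then show "ul al x y" using uu_ul[OF a _ u(2)] by blast
  next
   assume xy: "ul al x y"
   then have x: "x : udom al" unfolding mem_udom by blast
   then have "F x = Inl (b x)" using bt[OF x] unfolding Finl ud by simp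
   then show "ul (part_mult n de al) x y" unfolding L(2) using xy x unfolding ud by metis
  qed
  have "ll al x y" if uv: "ul al u x" "ul al v y" "b u = b v" for u v
  proof -
   have uvd: "u : udom al" "v : udom al" using uv unfolding mem_udom by blast+
   then have "uu al v u" using coords_uu[OF a c uvd(2), of u] bt uv(3) unfolding ud by simp
   then show ?thesis using ul_ll[OF a uv(1)] uu_ul[OF a _ uv(2)] by blast
  qed
  then show "ll (part_mult n de al) x y = ll al x y" unfolding L(3) by (metis sum.inject(1))
 qed
qed

text \<open>\<open>de\<close> fixes \<open>al\<close> but leads \<open>u\<close> and
  \<open>v\<close> to different transversals; \<open>be\<close> joins these two, so the rank of the
  other product drops.\<close>

lemma separate_kernels:
 assumes a: "al : partitions n" "rank al = q" and b: "be : partitions n" and q: "q >= 2"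
  and uv: "uu be u v" "~uu al u v"
 shows "EX de:partitions n. part_mult n de al = al & floating n de al = 0 & rank (part_mult n de be) < q"
proof -
 obtain t s where c: "coords n al {1..q} t s" using coords_exist[OF a(1)] a(2) by metis
 have r: "u : {1..n}" "v : {1..n}" using uu_range[OF b uv(1)] by blast+
 \<comment> \<open>\<open>u\<close> and \<open>v\<close> need different labels. On transversals
   labels are forced, so \<open>k1\<close> is the index of \<open>u\<close> if there is one and
   otherwise avoids that of \<open>v\<close>; \<open>k2\<close> serves the stray points outside the
   block of \<open>u\<close>.\<close>
 define k1 where "k1 = (if t u : {1..q} then t u else if t v = 1 then 2 else 1)"
 define k2 where "k2 = (if k1 = 1 then 2 else (1::nat))"
 have k: "k1 : {1..q}" "k2 : {1..q}" "k1 ~= k2" using q unfolding k1_def k2_def by auto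
 define p where "p w = (if uu al u w then k1 else k2)" for w
 have p1: "p w : {1..q}" for w unfolding p_def using k by simp
 have p2: "p w = p w'" if "uu al w w'" for w w'
  unfolding p_def using rel_trans[OF a(1) _ that] rel_trans[OF a(1) _ rel_sym[OF that]] by meson
 define lb where "lb w = (if t w : {1..q} then t w else p w)" for w
 let ?de = "lab n (%x. if t x : {1..q} then Inl (t x) else Inr (blk al (Upper x))) (%u. Inl (lb u))"
 have I: "part_mult n ?de al = al" "floating n ?de al = 0" "coords n ?de {1..q} t lb" "ldom ?de = {1..n}"
  unfolding lb_def by (rule left_identity[OF a(1) c]; use p1 p2 in blast)+
 have "uu al u u" using r a by simp
 then have lu: "lb u = k1" unfolding lb_def p_def k1_def by simp
 have lv: "lb v ~= k1"
 proof (cases "t v : {1..q}")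
  case True
  show ?thesis
  proof (cases "t u : {1..q}")
   case tu: True
   then have "u : udom al" using coords_udom[OF a(1) c] r by blast
   then have "t u ~= t v" using coords_uu[OF a(1) c _ r(2)] uv(2) by blast
   then show ?thesis using True tu unfolding lb_def k1_def by simp
  next
   case False
   then show ?thesis using True unfolding lb_def k1_def by auto
  qed
 next
  case False
  have "lb v = k2" unfolding lb_def if_not_P[OF False] p_def if_not_P[OF uv(2)] ..
  then show ?thesis using k(3) by metis
 qed
 have lb: "lb w : {1..q}" for w unfolding lb_def using p1 by simp
 have rd: "rank ?de = q" using coords_rank[OF lab_in I(3)] by simp
 have "rank (part_mult n ?de be) ~= rank ?de"
 proof
  assume e: "rank (part_mult n ?de be) = rank ?de"
  obtain x where x: "x : {1..n}" "t x = lb u" using coords_surj(1)[OF c lb] by blast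
  obtain y where y: "y : {1..n}" "t y = lb v" using coords_surj(1)[OF c lb] by blast
  have ux: "ul ?de x u" "ul ?de y v" using coords_ul[OF lab_in I(3)] x y r lb by simp_all
  then have "uu (part_mult n ?de be) x y"
   unfolding prod_rel(1)[OF lab_in b midh_classes] mid_classes_iff using mid_uu[OF uv(1)] by blast
  moreover have d: "x : udom ?de" "y : udom ?de" using ux unfolding mem_udom by blast+
  ultimately have "uu ?de x y" using rank_mult(3)[OF lab_in b e] by blast
  then have "t x = t y" using coords_uu[OF lab_in I(3) d(1) y(1)] by blast
  then show False using x y lu lv by simp
 qed
 moreover have "rank (part_mult n ?de be) <= rank ?de" by (rule rank_mult(1)[OF lab_in b])
 ultimately have "rank (part_mult n ?de be) < q" using rd by linarith
 then show ?thesis by (intro bexI[of _ ?de] conjI I(1,2) lab_in)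
qed

text \<open>All stray points are hung on a transversal other than that of \<open>x\<close>, so the
  middle component of \<open>x\<close> is just its block. As \<open>be\<close> does not continue
  this block, the transversal is lost.\<close>

lemma separate_domains:
 assumes a: "al : partitions n" "rank al = q" and b: "be : partitions n" and q: "q >= 2"
  and uu: "!!x y. uu al x y <-> uu be x y" and x: "x : udom al" "x ~: udom be"
 shows "EX de:partitions n. part_mult n de al = al & floating n de al = 0 & rank (part_mult n de be) < q"
proof -
 obtain t s where c: "coords n al {1..q} t s" using coords_exist[OF a(1)] a(2) by metis
 have xn: "x : {1..n}" "t x : {1..q}" using coords_udom[OF a(1) c] x(1) by blast+
 define k where "k = (if t x = 1 then 2 else (1::nat))"
 have k: "k : {1..q}" "k ~= t x" using q unfolding k_def by auto
 define lb where "lb w = (if t w : {1..q} then t w else k)" for w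
 let ?de = "lab n (%x. if t x : {1..q} then Inl (t x) else Inr (blk al (Upper x))) (%u. Inl (lb u))"
 have I: "part_mult n ?de al = al" "floating n ?de al = 0" "coords n ?de {1..q} t lb" "ldom ?de = {1..n}"
  unfolding lb_def by (rule left_identity[OF a(1) c, of "%_. k"]; use k in blast)+
 have lbx: "lb w = t x <-> uu al x w" if "w : {1..n}" for w
  using coords_uu[OF a(1) c x(1) that] xn k unfolding lb_def by auto
 have rd: "rank ?de = q" using coords_rank[OF lab_in I(3)] by simp
 have "rank (part_mult n ?de be) ~= rank ?de"
 proof
  assume e: "rank (part_mult n ?de be) = rank ?de"
  have "x : udom ?de" using coords_udom[OF lab_in I(3)] xn by blast
  then have "x : udom (part_mult n ?de be)" using rank_mult(2)[OF lab_in b e] by blast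
  then obtain y where "ul (part_mult n ?de be) x y" unfolding mem_udom by blast
  then obtain u v where uv: "ul ?de x u" "ul be v y" "(u, v) : mid ?de be"
   unfolding prod_rel(2)[OF lab_in b midh_classes] mid_classes_iff by blast
  have "u : {1..n}" using ul_range[OF lab_in uv(1)] by blast
  then have "uu al x u" using coords_ul[OF lab_in I(3), of x u] uv(1) lbx[of u] by simp
  have "uu al x v" using uv(3) unfolding mid_def
  proof (induction rule: rtrancl_induct)
   case base
   show ?case by fact
  next
   case (step y z)
   then consider "ll ?de y z" | "uu be y z" by blast
   then show ?case
   proof cases
    case 1
    then have "lb y = lb z" "y : {1..n}" "z : {1..n}" unfolding rel_lab_simps by simp_all
    then show ?thesis using step(3) lbx[of y] lbx[of z] by simp
   next
    case 2
    then show ?thesis using step(3) uu rel_trans[OF a(1)] by blast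
   qed
  qed
  then have "uu be v x" using uu rel_sym by blast
  then have "ul be x y" using uu_ul[OF b _ uv(2)] by blast
  then show False using x(2) unfolding mem_udom by blast
 qed
 moreover have "rank (part_mult n ?de be) <= rank ?de" by (rule rank_mult(1)[OF lab_in b])
 ultimately have "rank (part_mult n ?de be) < q" using rd by linarith
 then show ?thesis by (intro bexI[of _ ?de] conjI I(1,2) lab_in)
qed

lemma pdiff_flip:
 assumes "al : partitions n" "be : partitions n" "pdiff n al be \<pi>"
 shows "pdiff n (flip al) (flip be) (inv' \<pi>)"
proof -
 obtain t s where p: "\<pi> permutes {1..rank al}" and c: "coords n al {1..rank al} t s" "coords n be {1..rank al} (\<pi> o t) s"
  and e: "ALL x y. uu al x y <-> uu be x y" "ALL x y. ll al x y <-> ll be x y" using assms(3) unfolding pdiff_def by blast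
 show ?thesis unfolding pdiff_def rank_flip[OF assms(1)]
  using permutes_inv[OF p] coords_flip[OF c(1)] coords_flip_perm[OF c(2) p] e by auto
qed

context tcong
begin

lemma drop_not_R:
 assumes e: "E i al j be" and r: "rank al = q" "rank be = q" "q >= 2" and R: "(al, be) ~: green_R (part_monoid n)"
 shows "EX k gm. E i al k gm & rank gm < q"
proof -
 note ab = E_in[OF e]
 have *: "EX k gm. E i al k gm & rank gm < q"
  if h: "EX de:partitions n. part_mult n de al = al & floating n de al = 0 & rank (part_mult n de be) < q"
   and e: "E i al j be" for i j al be
 using h
 proof (elim bexE conjE)
  fix de assume d: "de : partitions n" "part_mult n de al = al" "floating n de al = 0" "rank (part_mult n de be) < q"
  have "E i al (j + floating n de be) (part_mult n de be)" using E_left[OF e d(1)] unfolding d(2,3) by simp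
  then show ?thesis using d(4) by blast
 qed
 have **: "EX k gm. E i al k gm & rank gm < q"
  if "EX de:partitions n. part_mult n de be = be & floating n de be = 0 & rank (part_mult n de al) < q"
  using *[OF that E_sym[OF e]] by (blast intro: E_trans[OF e])
 from R ab have "~((ALL x y. uu al x y <-> uu be x y) & udom al = udom be)" unfolding green_R_iff by blast
 then consider u v where "uu be u v" "~uu al u v" | u v where "uu al u v" "~uu be u v"
  | x where "ALL x y. uu al x y <-> uu be x y" "x : udom al" "x ~: udom be"
  | x where "ALL x y. uu al x y <-> uu be x y" "x : udom be" "x ~: udom al"
  by blast
 then show ?thesis
 proof cases
  case 1
  show ?thesis by (rule *[OF separate_kernels[OF ab(1) r(1) ab(2) r(3) 1] e])
 next
  case 2
  show ?thesis by (rule **[OF separate_kernels[OF ab(2) r(2) ab(1) r(3) 2]])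
 next
  case 3
  show ?thesis by (rule *[OF separate_domains[OF ab(1) r(1) ab(2) r(3) _ 3(2,3)] e]) (use 3(1) in blast)
 next
  case 4
  show ?thesis by (rule **[OF separate_domains[OF ab(2) r(2) ab(1) r(3) _ 4(2,3)]]) (use 4(1) in blast)
 qed
qed

text \<open>If the ranks are equal, a pair that is not R-related drops in rank by a left factor, and
  one that is not L-related does so after flipping. Any drop collapses all ranks up to
  \<open>rank al\<close> from level \<open>i\<close> on. Elements that only \<open>be\<close>
  reaches are brought into this region by factoring through \<open>be\<close>.\<close>

lemma E_not_H:
 assumes e: "E i al j be" and q: "rank al >= 2" "rank be <= rank al" and H: "(al, be) ~: green_H (part_monoid n)"
  and z: "ze : partitions n" "rank ze <= rank al & i <= l | rank ze <= rank be & j <= l"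
  and z': "ze' : partitions n" "rank ze' <= rank al & i <= l' | rank ze' <= rank be & j <= l'"
 shows "E l ze l' ze'"
proof -
 let ?q = "rank al"
 note ab = E_in[OF e]
 have "EX k gm. (E i al k gm | E i (flip al) k (flip gm) & gm : partitions n) & rank gm < ?q"
 proof (cases "rank be = ?q")
  case True
  show ?thesis
  proof (cases "(al, be) : green_R (part_monoid n)")
   case False
   then show ?thesis using drop_not_R[OF e refl True q(1)] by blast
  next
   case R: True
   then have L: "(flip al, flip be) ~: green_R (part_monoid n)" using H R unfolding green_H_def Int_iff green_L_flip by blast
   interpret f: tcong n "{((i, al), (j, be)). E i (flip al) j (flip be)}" by (rule tcong_flip)
   have fE: "f.E i al j be <-> E i (flip al) j (flip be)" for i al j be unfolding f.E_def by simp
   have "f.E i (flip al) j (flip be)" unfolding fE using e by simp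
   then obtain k gm where g: "f.E i (flip al) k gm" "rank gm < ?q"
    using f.drop_not_R[of i "flip al" j "flip be" ?q] L q(1) True ab by auto
   then have "gm : partitions n" using f.E_in by blast
   then show ?thesis using g unfolding fE by (intro exI[of _ k] exI[of _ "flip gm"]) simp
  qed
 next
  case False
  then show ?thesis using e q(2) by (intro exI[of _ j] exI[of _ be]) simp
 qed
 then obtain k gm where g: "E i al k gm | E i (flip al) k (flip gm) & gm : partitions n" "rank gm < ?q" by blast
 from g(1) have c: "collapse ?q i"
 proof
  assume "E i al k gm"
  then show ?thesis using collapse_rank_drop q(1) g(2) by blast
 next
  assume a: "E i (flip al) k (flip gm) & gm : partitions n"
  have r: "rank (flip gm) = rank gm" "rank (flip al) = ?q" using a ab rank_flip by blast+
  have "collapse (rank (flip al)) i"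
   by (rule collapse_rank_drop[of i "flip al" k "flip gm"]) (use q(1) g(2) a r in simp_all)
  then show ?thesis using ab by simp
 qed
 have *: "EX N \<xi>. i <= N & \<xi> : partitions n & rank \<xi> <= ?q & E l ze N \<xi>"
  if z: "ze : partitions n" "rank ze <= rank al & i <= l | rank ze <= rank be & j <= l" for l ze
  using z(2)
 proof
  assume "rank ze <= rank al & i <= l"
  then show ?thesis using z(1) E_refl by blast
 next
  assume r: "rank ze <= rank be & j <= l"
  obtain j' \<xi> where x: "i <= j'" "\<xi> : partitions n" "rank \<xi> <= rank al" "E j ze j' \<xi>"
   using E_factor[OF E_sym[OF e] z(1)] r by blast
  have "E l ze (j' + (l - j)) \<xi>" using E_shift_to[OF x(4)] r by blast
  then show ?thesis using x(1-3) by (meson trans_le_add1)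
 qed
 from *[OF z] *[OF z'] c show ?thesis unfolding collapse_def using E_sym E_trans by metis
qed

text \<open>After removal of a transversal the pair has rank \<open>q - 1 >= 2\<close> and is not
  H-related, so \<open>E_not_H\<close> applies to it.\<close>

lemma E_H_below:
 assumes e: "E i al j be" and d: "pdiff n al be \<pi>" and q: "rank al >= 3" and p: "\<pi> ~= id"
  and z: "ze : partitions n" "ze' : partitions n" "rank ze < rank al" "rank ze' < rank al" "i <= l" "i <= l'"
 shows "E l ze l' ze'"
proof -
 obtain al' be' where ab: "E i al' j be'" "rank al' = rank al - 1" "rank be' = rank al - 1" "ldom al' ~= ldom be'"
  using E_kill_transversal[OF e d _ p] q by auto
 then have "(al', be') ~: green_H (part_monoid n)" using green_H_iff by blast
 moreover have "2 <= rank al'" "rank be' <= rank al'" "rank ze <= rank al'" "rank ze' <= rank al'" using ab q z by linarith+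
 ultimately show ?thesis using E_not_H[OF ab(1) _ _ _ z(1) _ z(2)] z(5,6) by blast
qed

text \<open>Here removal of a transversal leads to rank 1. One kernel is shared and the domains on
  its side differ, which is the situation of \<open>mu_up_pair\<close> and, flipped, of
  \<open>mu_down_pair\<close>.\<close>

lemma E_H_rank_2:
 assumes e: "E i al j be" and d: "pdiff n al be \<pi>" and q: "rank al = 2" and p: "\<pi> ~= id"
 shows "[|ze : partitions n; ze' : partitions n; rank ze = 1; rank ze' = 1; hat ze = hat ze'; udom ze = udom ze'|] ==> E i ze j ze'"
  and "[|ze : partitions n; ze' : partitions n; rank ze = 1; rank ze' = 1; hat ze = hat ze'; ldom ze = ldom ze'|] ==> E i ze j ze'"
  and "[|ze : partitions n; rank ze = 1|] ==> E i (hat ze) (j + 1) ze"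
proof -
 obtain al' be' where ab: "E i al' j be'" "rank al' = 1" "rank be' = 1" "ldom al' ~= ldom be'" "ALL x y. ll al' x y <-> ll be' x y"
  using E_kill_transversal[OF e d _ p] q by auto
 note u = mu_up_pair[OF ab(1-3) _ ab(4)]
 show "[|ze : partitions n; ze' : partitions n; rank ze = 1; rank ze' = 1; hat ze = hat ze'; udom ze = udom ze'|] ==> E i ze j ze'"
  by (rule u(1)) (use ab(5) in blast)
 show "[|ze : partitions n; rank ze = 1|] ==> E i (hat ze) (j + 1) ze"
  by (rule u(2)) (use ab(5) in blast)
 note PP = E_in[OF e]
 interpret f: tcong n "{((i, al), (j, be)). E i (flip al) j (flip be)}" by (rule tcong_flip)
 have fE: "f.E i al j be <-> E i (flip al) j (flip be)" for i al j be unfolding f.E_def by simp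
 have e': "f.E i (flip al) j (flip be)" unfolding fE using e by simp
 have "\<pi> permutes {1..2}" using d q unfolding pdiff_def by simp
 then have "inv' \<pi> ~= id" using p permutes_inv_inv by fastforce
 then obtain al' be' where ab: "f.E i al' j be'" "rank al' = 1" "rank be' = 1" "ldom al' ~= ldom be'" "ALL x y. ll al' x y <-> ll be' x y"
  using f.E_kill_transversal[OF e' pdiff_flip[OF PP d]] q PP by auto
 note fa = f.E_in[OF ab(1)]
 have "E i (flip al') j (flip be')" using ab(1) unfolding fE .
 note dn = mu_down_pair(1)[OF this]
 show "[|ze : partitions n; ze' : partitions n; rank ze = 1; rank ze' = 1; hat ze = hat ze'; ldom ze = ldom ze'|] ==> E i ze j ze'"
  by (rule dn) (use ab fa in simp_all)
qed

end

subsection \<open>Congruences on the twisted partition monoid\<close>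

text \<open>Equality is built in, so \<open>P\<close> has to describe the non-trivial pairs only and
  need not be reflexive.\<close>

definition reln :: "nat => (nat => partition => nat => partition => bool) => ((nat \<times> partition) \<times> (nat \<times> partition)) set" where
 "reln n P = {((i, al), (j, be)). al : partitions n & be : partitions n & (i = j & al = be | P i al j be)}"

lemma mem_reln [simp]:
 "((i, al), (j, be)) : reln n P <-> al : partitions n & be : partitions n & (i = j & al = be | P i al j be)"
 unfolding reln_def by simp

definition right_compat :: "nat => (nat => partition => nat => partition => bool) => bool" where
 "right_compat n P <-> (ALL i al j be k gm. al : partitions n --> be : partitions n --> gm : partitions n --> P i al j be -->
   P (i + k + floating n al gm) (part_mult n al gm) (j + k + floating n be gm) (part_mult n be gm))"

lemma congruence_reln:
 assumes r: "right_compat n P" and l: "right_compat n (%i al j be. P i (flip al) j (flip be))"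
  and s: "!!i al j be. [|al : partitions n; be : partitions n; P i al j be|] ==> P j be i al"
  and t: "!!i al j be k gm. [|al : partitions n; be : partitions n; gm : partitions n; P i al j be; P j be k gm|] ==> P i al k gm"
 shows "congruence (twisted_monoid n) (reln n P)"
proof -
 have left: "P (k + i + floating n gm al) (part_mult n gm al) (k + j + floating n gm be) (part_mult n gm be)"
  if p: "al : partitions n" "be : partitions n" "gm : partitions n" "P i al j be" for i al j be k gm
 proof -
  have "P (i + k + floating n (flip al) (flip gm)) (flip (part_mult n (flip al) (flip gm)))
    (j + k + floating n (flip be) (flip gm)) (flip (part_mult n (flip be) (flip gm)))"
   using l[unfolded right_compat_def, rule_format, of "flip al" "flip be" "flip gm" i j k] p by simp
  then show ?thesis
   unfolding flip_mult'[OF p(3,1)] flip_mult'[OF p(3,2)] flip_mult(2)[OF p(3,1)] flip_mult(2)[OF p(3,2)]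
   by (simp only: add.commute[of k])
 qed
 have "equiv (UNIV \<times> partitions n) (reln n P)"
 proof (rule equivI)
  show "reln n P \<subseteq> (UNIV \<times> partitions n) \<times> UNIV \<times> partitions n" unfolding reln_def by blast
  show "refl_on (UNIV \<times> partitions n) (reln n P)" unfolding refl_on_def reln_def by blast
  show "sym (reln n P)" using s unfolding sym_def by (auto simp: reln_def)
  show "trans (reln n P)" unfolding trans_def reln_def using t by blast
 qed
 then show ?thesis unfolding congruence_twisted_iff mem_reln
  using left r[unfolded right_compat_def] part_mult_in by (metis (no_types, lifting))
qed

text \<open>A right factor sees of the left one only the lower kernel and the lower domain: L is a
  right congruence, and it also determines the float count.\<close>

lemma L_right:
 assumes ab: "al : partitions n" "be : partitions n" "gm : partitions n"
  and ll: "ALL x y. ll al x y <-> ll be x y" and ld: "ldom al = ldom be"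
 shows "ll (part_mult n al gm) x y <-> ll (part_mult n be gm) x y" "ldom (part_mult n al gm) = ldom (part_mult n be gm)"
  "floating n al gm = floating n be gm" "rank (part_mult n al gm) = rank (part_mult n be gm)"
proof -
 have m: "mid be gm = mid al gm" unfolding mid_def using ll by simp
 define h where "h u = mid al gm `` {u}" for u
 have h: "midh n al gm h" "midh n be gm h" using midh_classes[of n al gm] midh_classes[of n be gm] unfolding m h_def by auto
 note A = prod_rel[OF ab(1,3) h(1)] and B = prod_rel[OF ab(2,3) h(2)]
 have nl: "(ALL x. ~ul al x v & ~ul gm v x) <-> v ~: ldom al & v ~: udom gm"
  "(ALL x. ~ul be x v & ~ul gm v x) <-> v ~: ldom be & v ~: udom gm" for v
  unfolding mem_ldom mem_udom by blast+
 show 1: "ll (part_mult n al gm) x y <-> ll (part_mult n be gm) x y" for x y unfolding A(3) B(3) ..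
 have "y : ldom (part_mult n al gm) <-> (EX u v. u : ldom al & ul gm v y & h u = h v)" for y
  unfolding mem_ldom A(2) by blast
 moreover have "y : ldom (part_mult n be gm) <-> (EX u v. u : ldom be & ul gm v y & h u = h v)" for y
  unfolding mem_ldom B(2) by blast
 ultimately show 2: "ldom (part_mult n al gm) = ldom (part_mult n be gm)" using ld by blast
 show "floating n al gm = floating n be gm" unfolding A(4) B(4) nl ld ..
 have "(part_mult n al gm, part_mult n be gm) : green_L (part_monoid n)"
  unfolding green_L_iff using 1 2 part_mult_in ab by blast
 then have "rank (flip (part_mult n al gm)) = rank (flip (part_mult n be gm))"
  unfolding green_L_flip by (rule green_R_rank)
 then show "rank (part_mult n al gm) = rank (part_mult n be gm)"
  by (simp add: rank_flip[OF part_mult_in])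
qed

text \<open>For rank at most 1 the hat of the product depends on the hat of the left factor alone,
  to which \<open>L_right\<close> applies with empty domains.\<close>

lemma ll_right_low:
 assumes ab: "al : partitions n" "be : partitions n" "gm : partitions n" "rank al <= 1" "rank be <= 1"
  and ll: "ALL x y. ll al x y <-> ll be x y"
 shows "ll (part_mult n al gm) x y <-> ll (part_mult n be gm) x y"
proof -
 have "ll (hat (part_mult n al gm)) x y <-> ll (hat (part_mult n be gm)) x y"
  unfolding low_rank_mult(1)[OF ab(1,3,4)] low_rank_mult(1)[OF ab(2,3,5)]
  by (rule L_right(1)) (use ab ll in simp_all)
 then show ?thesis by simp
qed

lemma uu_right_low:
 assumes a: "al : partitions n" "gm : partitions n" "rank al <= 1"
 shows "uu (part_mult n al gm) x y <-> uu al x y"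
proof -
 have "uu (hat (part_mult n al gm)) x y <-> uu (hat al) x y"
  unfolding low_rank_mult(1)[OF a] using prod_rel(1)[OF hat_in[OF a(1)] a(2) midh_classes] by auto
 then show ?thesis by simp
qed

text \<open>The relations of Rees, \<open>\<lambda>\<close> and \<open>rh\<close> type: all pairs with levels and ranks in a region \<open>S\<close> and, if \<open>u\<close> or \<open>v\<close> is set,
 with the same upper or lower kernel.\<close>

definition block_rel :: "bool => bool => (nat => nat => bool) => nat => partition => nat => partition => bool" where
 "block_rel u v S i al j be <-> S i (rank al) & S j (rank be) &
   (u --> (ALL x y. uu al x y <-> uu be x y)) & (v --> (ALL x y. ll al x y <-> ll be x y))"

lemma right_compat_block_rel:
 assumes S: "!!i q i' q'. [|S i q; i <= i'; q' <= q|] ==> S i' q'" and low: "u | v ==> (!!i q. S i q ==> q <= 1)"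
 shows "right_compat n (block_rel u v S)"
 unfolding right_compat_def
proof (intro allI impI)
 fix i al j be k gm assume p: "al : partitions n" "be : partitions n" "gm : partitions n" and P: "block_rel u v S i al j be"
 have s: "S i (rank al)" "S j (rank be)" using P unfolding block_rel_def by blast+
 have 1: "S (i + k + floating n al gm) (rank (part_mult n al gm))"
  by (rule S[OF s(1)]) (use rank_mult(1)[OF p(1,3)] in simp_all)
 have 2: "S (j + k + floating n be gm) (rank (part_mult n be gm))"
  by (rule S[OF s(2)]) (use rank_mult(1)[OF p(2,3)] in simp_all)
 have 3: "ALL x y. uu (part_mult n al gm) x y <-> uu (part_mult n be gm) x y" if u
  using P uu_right_low[OF p(1,3) low[OF _ s(1)]] uu_right_low[OF p(2,3) low[OF _ s(2)]] that unfolding block_rel_def by simp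
 have 4: "ALL x y. ll (part_mult n al gm) x y <-> ll (part_mult n be gm) x y" if v
  using P ll_right_low[OF p low[OF _ s(1)] low[OF _ s(2)]] that unfolding block_rel_def by blast
 show "block_rel u v S (i + k + floating n al gm) (part_mult n al gm) (j + k + floating n be gm) (part_mult n be gm)"
  unfolding block_rel_def using 1 2 3 4 by blast
qed

lemma block_rel_flip:
 "[|al : partitions n; be : partitions n|] ==> block_rel u v S i (flip al) j (flip be) <-> block_rel v u S i al j be"
 unfolding block_rel_def by auto

lemma right_compat_cong:
 assumes "right_compat n P" "!!i al j be. [|al : partitions n; be : partitions n|] ==> Q i al j be <-> P i al j be"
 shows "right_compat n Q"
 using assms unfolding right_compat_def by (simp add: part_mult_in)

lemma congruence_block_rel:
 assumes S: "!!i q i' q'. [|S i q; i <= i'; q' <= q|] ==> S i' q'" and low: "u | v ==> (!!i q. S i q ==> q <= 1)"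
 shows "congruence (twisted_monoid n) (reln n (block_rel u v S))"
proof (rule congruence_reln)
 show "right_compat n (block_rel u v S)" by (rule right_compat_block_rel[OF S]) (use low in auto)
 have "right_compat n (block_rel v u S)" by (rule right_compat_block_rel[OF S]) (use low in auto)
 then show "right_compat n (%i al j be. block_rel u v S i (flip al) j (flip be))"
  by (rule right_compat_cong) (rule block_rel_flip)
qed (auto simp: block_rel_def)

text \<open>The relations of \<open>\<mu>\<close> type on ranks \<open>0\<close> and \<open>1\<close>, starting at level \<open>b\<close> in row \<open>0\<close> and at level \<open>a\<close> in row \<open>1\<close>.  By
 \<open>low_rank_mult\<close>, multiplication shifts the weight \<open>l + 1 - q\<close> of a pair of level \<open>l\<close> and rank \<open>q\<close> by an amount that
 depends on its hat only.  Weights count modulo \<open>d\<close> (exactly, if \<open>d = 0\<close>); the first \<open>h\<close> levels of the two rows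
 are only related to each other, and \<open>u\<close>, \<open>v\<close> impose \<open>\<R>\<close> or \<open>\<L>\<close> on the first level of row \<open>1\<close>.\<close>

definition mu_type :: "nat => nat => nat => nat => bool => bool => nat => partition => nat => partition => bool" where
 "mu_type a b h d u v i al j be <-> rank al <= 1 & rank be <= 1 & hat al = hat be &
   (if rank al = 0 then b else a) <= i & (if rank be = 0 then b else a) <= j &
   (i + 1 - rank al) mod d = (j + 1 - rank be) mod d &
   ((if rank al = 0 then b else a) + h <= i <-> (if rank be = 0 then b else a) + h <= j) &
   (rank al = 1 & i = a --> (u --> udom al = udom be) & (v --> ldom al = ldom be))"

lemma mod_add_eq': "(a::nat) mod d = b mod d ==> (a + c) mod d = (b + c) mod d"
 by (metis mod_add_left_eq)

lemma right_compat_mu_type: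
 assumes ab: "b + h <= a" "h <= 1" and uv: "u | v ==> d = 0 & h = 0 & a = b"
 shows "right_compat n (mu_type a b h d u v)"
 unfolding right_compat_def
proof (intro allI impI)
 fix i al j be k gm assume p: "al : partitions n" "be : partitions n" "gm : partitions n" and P: "mu_type a b h d u v i al j be"
 have r: "rank al <= 1" "rank be <= 1" "hat al = hat be" using P unfolding mu_type_def by blast+
 define F where "F = floating n (hat al) gm"
 define q' r' where "q' = rank (part_mult n al gm)" and "r' = rank (part_mult n be gm)"
 define i' j' where "i' = i + k + floating n al gm" and "j' = j + k + floating n be gm"
 have f: "F + q' = floating n al gm + rank al" "F + r' = floating n be gm + rank be"
  using low_rank_mult(2)[OF p(1,3) r(1)] low_rank_mult(2)[OF p(2,3) r(2)] unfolding F_def q'_def r'_def r(3) by simp_all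
 have le: "q' <= rank al" "r' <= rank be" unfolding q'_def r'_def using rank_mult(1) p by blast+
 have h: "hat (part_mult n al gm) = hat (part_mult n be gm)"
  unfolding low_rank_mult(1)[OF p(1,3) r(1)] low_rank_mult(1)[OF p(2,3) r(2)] r(3) ..
 \<comment> \<open>Both weights grow by the same amount, as the hats coincide.\<close>
 have w: "i' + 1 - q' = (i + 1 - rank al) + (k + F)" "j' + 1 - r' = (j + 1 - rank be) + (k + F)"
  using f le r unfolding i'_def j'_def by linarith+
 have m: "(i' + 1 - q') mod d = (j' + 1 - r') mod d" unfolding w by (rule mod_add_eq') (use P in \<open>simp add: mu_type_def\<close>)
 have ri: "(if rank al = 0 then b else a) <= i" "(if rank be = 0 then b else a) <= j" using P unfolding mu_type_def by blast+
 have hh: "(if rank al = 0 then b else a) + h <= i <-> (if rank be = 0 then b else a) + h <= j" using P unfolding mu_type_def by blast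
 have A: "(if q' = 0 then b else a) <= i'" "(if r' = 0 then b else a) <= j'"
  using ri ab le unfolding i'_def j'_def by (auto split: if_splits)
 \<comment> \<open>As \<open>h <= 1\<close>, any growth of the weight leaves the first
   \<open>h\<close> levels. If the rank drops, the element falls from row 1 into row 0, beyond its
   first levels because of \<open>b + h <= a\<close>, and then \<open>F\<close> is positive.\<close>
 have hi: "(if q' = 0 then b else a) + h <= i' <-> (if rank al = 0 then b else a) + h <= i | 0 < k + F"
  using ri ab le f r unfolding i'_def by (auto split: if_splits)
 have hj: "(if r' = 0 then b else a) + h <= j' <-> (if rank be = 0 then b else a) + h <= j | 0 < k + F"
  using ri ab le f r unfolding j'_def by (auto split: if_splits)
 \<comment> \<open>A product on the first level of row 1 has lost neither level nor rank, so both
   factors stem from that same entry.\<close>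
 have B: "(u --> udom (part_mult n al gm) = udom (part_mult n be gm)) & (v --> ldom (part_mult n al gm) = ldom (part_mult n be gm))"
  if z: "q' = 1" "i' = a"
 proof (cases "u | v")
  case True
  then have d: "d = 0" "h = 0" "a = b" using uv by blast+
  have q: "rank al = 1" using z le r by simp
  then have "i = a" using ri z unfolding i'_def by simp
  then have e: "(u --> udom al = udom be) & (v --> ldom al = ldom be)" using P q unfolding mu_type_def by blast
  have "i + 1 - rank al = j + 1 - rank be" using P d unfolding mu_type_def by simp
  then have rb: "rank be = 1" using ri \<open>i = a\<close> q d r by (cases "rank be = 0") auto
  have "j = i" using \<open>i + 1 - rank al = j + 1 - rank be\<close> q rb by simp
  have "j' + 1 - r' = i' + 1 - q'" using m d by simp
  then have r1: "r' = 1" using z A(2) d le rb by (cases "r' = 0") auto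
  have U: "udom (part_mult n al gm) = udom al" "udom (part_mult n be gm) = udom be"
   using rank_mult(2)[OF p(1,3)] rank_mult(2)[OF p(2,3)] q rb z r1 unfolding q'_def r'_def by simp_all
  have "ALL x y. ll al x y <-> ll be x y" using hat_eq_iff[OF p(1,2)] r(3) by blast
  then have "v --> ldom (part_mult n al gm) = ldom (part_mult n be gm)" using e L_right(2)[OF p] by blast
  then show ?thesis using e U by simp
 qed blast
 show "mu_type a b h d u v (i + k + floating n al gm) (part_mult n al gm) (j + k + floating n be gm) (part_mult n be gm)"
  unfolding mu_type_def i'_def[symmetric] j'_def[symmetric] q'_def[symmetric] r'_def[symmetric]
  using le r h A m hi hj hh B by (intro conjI) (linarith | blast)+
qed

lemma mu_type_flip:
 assumes "al : partitions n" "be : partitions n"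
 shows "mu_type a b h d u v i (flip al) j (flip be) <-> mu_type a b h d v u i al j be"
proof -
 have "hat (flip al) = hat (flip be) <-> hat al = hat be"
  using flip_hat assms by (metis flip_flip)
 then show ?thesis unfolding mu_type_def rank_flip[OF assms(1)] rank_flip[OF assms(2)] udom_flip ldom_flip by blast
qed

text \<open>Weights are compared exactly. The first level of row 1 has weight \<open>a\<close>,
  every other element of the region a larger one, so this entry is related only to itself.\<close>

lemma mu_type_special:
 assumes "mu_type a b h d u v i al j be" "d = 0" "a = b"
 shows "rank al = 1 & i = a <-> rank be = 1 & j = a"
 using assms unfolding mu_type_def by (auto split: if_splits)

lemma mu_type_sym:
 assumes uv: "u | v ==> d = 0 & a = b" and P: "mu_type a b h d u v i al j be"
 shows "mu_type a b h d u v j be i al"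
 using P uv mu_type_special[OF P] unfolding mu_type_def by argo

lemma mu_type_trans:
 assumes uv: "u | v ==> d = 0 & a = b" and P: "mu_type a b h d u v i al j be" "mu_type a b h d u v j be k gm"
 shows "mu_type a b h d u v i al k gm"
 using P uv mu_type_special[OF P(1)] unfolding mu_type_def by (smt (verit))

lemma congruence_mu_type:
 assumes ab: "b + h <= a" "h <= 1" and uv: "u | v ==> d = 0 & h = 0 & a = b"
 shows "congruence (twisted_monoid n) (reln n (mu_type a b h d u v))"
proof (rule congruence_reln)
 show "right_compat n (mu_type a b h d u v)" by (rule right_compat_mu_type) (use assms in auto)
 have "right_compat n (mu_type a b h d v u)" by (rule right_compat_mu_type) (use assms in auto)
 then show "right_compat n (%i al j be. mu_type a b h d u v i (flip al) j (flip be))"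
  by (rule right_compat_cong) (rule mu_type_flip)
 show "mu_type a b h d u v j be i al" if "mu_type a b h d u v i al j be" for i al j be
  using mu_type_sym[OF _ that] uv by blast
 show "mu_type a b h d u v i al k gm" if "mu_type a b h d u v i al j be" "mu_type a b h d u v j be k gm" for i al j be k gm
  using mu_type_trans[OF _ that] uv by blast
qed

text \<open>While the rank is kept, right multiplication only replaces the lower ends of the
  transversals, in the same way for \<open>al\<close> and \<open>be\<close>; the upper indices and
  hence the permutation stay.\<close>

lemma pdiff_right:
 assumes ab: "al : partitions n" "be : partitions n" "gm : partitions n" and d: "pdiff n al be \<pi>"
  and r: "rank (part_mult n al gm) = rank al"
 shows "pdiff n (part_mult n al gm) (part_mult n be gm) \<pi>"
proof -
 let ?K = "{1..rank al}"
 obtain t s where p: "\<pi> permutes ?K" and c: "coords n al ?K t s" "coords n be ?K (\<pi> o t) s"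
  and e: "ALL x y. uu al x y <-> uu be x y" "ALL x y. ll al x y <-> ll be x y" using d unfolding pdiff_def by blast
 have H: "udom al = udom be" "ldom al = ldom be" using pdiff_green_H(1)[OF ab(1,2) d] unfolding green_H_iff by blast+
 note L = L_right[OF ab e(2) H(2)]
 have rb: "rank (part_mult n be gm) = rank be" using L(4) r pdiff_green_H(2)[OF ab(1,2) d] by simp
 have m: "mid be gm = mid al gm" unfolding mid_def using e by simp
 note A = prod_rel[OF ab(1,3) midh_classes, unfolded mid_classes_iff] and B = prod_rel[OF ab(2,3) midh_classes, unfolded mid_classes_iff m]
 \<comment> \<open>The lower point \<open>y\<close> of the product is reached from the lower block
   of \<open>al\<close> with index \<open>k\<close>.\<close>
 define C where "C k y <-> (EX u v. u : {1..n} & s u = k & (u, v) : mid al gm & ul gm v y)" for k y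
 have pk: "\<pi> k : ?K <-> k : ?K" for k by (rule permutes_in_image[OF p])
 have ula: "ul (part_mult n al gm) x y <-> x : {1..n} & t x : ?K & C (t x) y" for x y
  unfolding A(2) C_def coords_ul[OF ab(1) c(1)] by metis
 have ulb: "ul (part_mult n be gm) x y <-> x : {1..n} & t x : ?K & C (\<pi> (t x)) y" for x y
  unfolding B(2) C_def coords_ul[OF ab(2) c(2)] comp_apply pk by metis
 \<comment> \<open>Joining two of these lower blocks would lower the rank.\<close>
 have uniq: "k = k'" if k: "k : ?K" "k' : ?K" "C k y" "C k' y" for k k' y
 proof -
  obtain x where x: "x : {1..n}" "t x = k" using coords_surj(1)[OF c(1) k(1)] by blast
  obtain x' where x': "x' : {1..n}" "t x' = k'" using coords_surj(1)[OF c(1) k(2)] by blast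
  have "ul (part_mult n al gm) x y" "ul (part_mult n al gm) x' y" unfolding ula using x x' k by blast+
  then have uu: "uu (part_mult n al gm) x x'" by (rule ul_uu[OF part_mult_in])
  have d: "x : udom al" "x' : udom al" using coords_udom[OF ab(1) c(1)] x x' k by blast+
  have "uu al x x'" by (rule rank_mult(3)[OF ab(1,3) r d uu])
  then show ?thesis using coords_uu[OF ab(1) c(1) d(1) x'(1)] x x' by blast
 qed
 define s' where "s' y = (if EX k:?K. C k y then SOME k. k : ?K & C k y else 0)" for y
 have s': "s' y = k <-> C k y" if k: "k : ?K" for k y
 proof
  assume C: "C k y"
  then have "s' y = (SOME k. k : ?K & C k y)" unfolding s'_def using k by metis
  moreover have "(SOME k. k : ?K & C k y) : ?K & C (SOME k. k : ?K & C k y) y" by (rule someI[of _ k]) (use k C in blast)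
  ultimately show "s' y = k" using uniq[OF k _ C] by metis
 next
  assume e: "s' y = k"
  have ex: "EX k:?K. C k y"
  proof (rule ccontr)
   assume n: "~?thesis"
   have "s' y = 0" unfolding s'_def if_not_P[OF n] ..
   then show False using e k by simp
  qed
  then have "EX k. k : ?K & C k y" by blast
  from someI_ex[OF this] show "C k y" using e unfolding s'_def if_P[OF ex] by metis
 qed
 have sur: "?K \<subseteq> s' ` {1..n}"
 proof
  fix k assume k: "k : ?K"
  obtain x where x: "x : {1..n}" "t x = k" using coords_surj(1)[OF c(1) k] by blast
  then have "x : udom (part_mult n al gm)" using rank_mult(2)[OF ab(1,3) r] coords_udom[OF ab(1) c(1)] k by blast
  then obtain y where y: "ul (part_mult n al gm) x y" unfolding mem_udom by blast
  then have "y : {1..n}" "C k y" using ul_range[OF part_mult_in y] y x unfolding ula by blast+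
  then show "k : s' ` {1..n}" using s'[OF k, of y] by (metis imageI)
 qed
 have t: "?K \<subseteq> t ` {1..n}" using c(1) unfolding coords_def by blast
 have ca: "coords n (part_mult n al gm) ?K t s'" unfolding coords_def
 proof (intro conjI ballI sur t)
  show "ul (part_mult n al gm) x y <-> t x = s' y & t x : ?K" if "x : {1..n}" "y : {1..n}" for x y
   unfolding ula using that s' by metis
 qed
 have cb: "coords n (part_mult n be gm) ?K (\<pi> o t) s'" unfolding coords_def
 proof (intro conjI ballI sur)
  show "ul (part_mult n be gm) x y <-> (\<pi> o t) x = s' y & (\<pi> o t) x : ?K" if "x : {1..n}" "y : {1..n}" for x y
   unfolding ulb comp_apply pk using that s' pk by metis
  show "?K \<subseteq> (\<pi> o t) ` {1..n}" using c(2) unfolding coords_def by blast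
 qed
 have ua: "uu (part_mult n al gm) x y <-> uu al x y" for x y
 proof
  assume u: "uu (part_mult n al gm) x y"
  show "uu al x y"
  proof (cases "uu al x y")
   case False
   then have "x : udom al" "y : udom al" using u unfolding A(1) mem_udom by blast+
   then show ?thesis using rank_mult(3)[OF ab(1,3) r _ _ u] by blast
  qed
 qed (rule uu_mult[OF ab(1,3)])
 have ub: "uu (part_mult n be gm) x y <-> uu be x y" for x y
 proof
  assume u: "uu (part_mult n be gm) x y"
  show "uu be x y"
  proof (cases "uu be x y")
   case False
   then have "x : udom be" "y : udom be" using u unfolding B(1) mem_udom by blast+
   then show ?thesis using rank_mult(3)[OF ab(2,3) rb _ _ u] by blast
  qed
 qed (rule uu_mult[OF ab(2,3)])
 show ?thesis unfolding pdiff_def r ua ub using p e(1) L(1) ca cb by blast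
qed

text \<open>With two transversals the only pair that can be fused consists of both, and every
  permutation preserves it. So the upper kernels agree even if the rank drops. With three
  transversals this fails, which is why rank 2 leads to \<open>mu\<close> and larger ranks to a
  collapse.\<close>

lemma pdiff_right_2:
 assumes ab: "al : partitions n" "be : partitions n" "gm : partitions n" and d: "pdiff n al be \<pi>" and r: "rank al = 2"
 shows "uu (part_mult n al gm) x y <-> uu (part_mult n be gm) x y"
proof -
 let ?K = "{1..rank al}"
 obtain t s where p: "\<pi> permutes ?K" and c: "coords n al ?K t s" "coords n be ?K (\<pi> o t) s"
  and e: "ALL x y. uu al x y <-> uu be x y" "ALL x y. ll al x y <-> ll be x y" using d unfolding pdiff_def by blast
 have K: "?K = {1, 2}" using r by auto
 have m: "mid be gm = mid al gm" unfolding mid_def using e by simp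
 note A = prod_rel[OF ab(1,3) midh_classes, unfolded mid_classes_iff] and B = prod_rel[OF ab(2,3) midh_classes, unfolded mid_classes_iff m]
 define C where "C k l <-> (EX u v. u : {1..n} & v : {1..n} & s u = k & s v = l & (u, v) : mid al gm)" for k l
 have pk: "\<pi> k : ?K <-> k : ?K" for k by (rule permutes_in_image[OF p])
 have Cs: "C k l <-> C l k" for k l unfolding C_def using mid_sym[of _ _ al gm] by blast
 have Cr: "C k k" if "k : ?K" for k unfolding C_def using coords_surj(2)[OF c(1) that] mid_refl by blast
 have CC: "C (\<pi> k) (\<pi> l) <-> C k l" if kl: "k : ?K" "l : ?K" for k l
 proof (cases "k = l")
  case True
  then show ?thesis using Cr kl pk by blast
 next
  case False
  then have "\<pi> k ~= \<pi> l" using permutes_inj[OF p] by (simp add: inj_eq)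
  moreover have "\<pi> k : ?K" "\<pi> l : ?K" using kl pk by blast+
  ultimately have "\<pi> k = k & \<pi> l = l | \<pi> k = l & \<pi> l = k" using False kl unfolding K by auto
  then show ?thesis using Cs by metis
 qed
 have ua: "uu (part_mult n al gm) x y <-> uu al x y | x : {1..n} & y : {1..n} & t x : ?K & t y : ?K & C (t x) (t y)"
  unfolding A(1) C_def coords_ul[OF ab(1) c(1)] by metis
 have ub: "uu (part_mult n be gm) x y <-> uu be x y | x : {1..n} & y : {1..n} & t x : ?K & t y : ?K & C (\<pi> (t x)) (\<pi> (t y))"
  unfolding B(1) C_def coords_ul[OF ab(2) c(2)] comp_apply pk by metis
 show ?thesis unfolding ua ub using CC e(1) by blast
qed

lemma pdiff_refl: "al : partitions n ==> pdiff n al al id"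
 unfolding pdiff_def using coords_exist[of al n] permutes_id by (metis comp_id id_comp)

lemma pdiff_sym:
 assumes "al : partitions n" "be : partitions n" "pdiff n al be \<pi>"
 shows "pdiff n be al (inv' \<pi>)"
proof -
 obtain t s where p: "\<pi> permutes {1..rank al}" and c: "coords n al {1..rank al} t s" "coords n be {1..rank al} (\<pi> o t) s"
  and e: "ALL x y. uu al x y <-> uu be x y" "ALL x y. ll al x y <-> ll be x y" using assms(3) unfolding pdiff_def by blast
 have "inv' \<pi> o (\<pi> o t) = t" using permutes_inv_o(2)[OF p] by (metis comp_assoc id_comp)
 then show ?thesis unfolding pdiff_def pdiff_green_H(2)[OF assms]
  using permutes_inv[OF p] c e by metis
qed

lemma pdiff_trans:
 assumes ab: "al : partitions n" "be : partitions n" "gm : partitions n" and d: "pdiff n al be \<pi>" "pdiff n be gm rh"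
 shows "EX \<tau>. \<tau> permutes {1..rank al} & pdiff n al gm ((\<tau> o rh o inv' \<tau>) o \<pi>)"
proof -
 obtain t s where p: "\<pi> permutes {1..rank al}" and c: "coords n al {1..rank al} t s" "coords n be {1..rank al} (\<pi> o t) s"
  and e: "ALL x y. uu al x y <-> uu be x y" "ALL x y. ll al x y <-> ll be x y" using d(1) unfolding pdiff_def by blast
 have r: "rank be = rank al" by (rule pdiff_green_H(2)[OF ab(1,2) d(1)])
 have f: "ALL x y. uu be x y <-> uu gm x y" "ALL x y. ll be x y <-> ll gm x y" "rh permutes {1..rank al}"
  using d(2) unfolding pdiff_def r by blast+
 obtain \<tau> where t: "\<tau> permutes {1..rank al}" "coords n gm {1..rank al} ((\<tau> o rh o inv' \<tau>) o (\<pi> o t)) s"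
  using pdiff_coords[OF ab(2,3) d(2)] c(2) unfolding r by blast
 have "(\<tau> o rh o inv' \<tau>) o \<pi> permutes {1..rank al}" using t(1) f(3) p by (intro permutes_compose permutes_inv)
 then show ?thesis unfolding pdiff_def using t c(1) e f by (auto simp: comp_assoc)
qed

definition perm_rel :: "nat => nat => nat => (nat => nat => (nat => nat) => bool) => nat => partition => nat => partition => bool" where
 "perm_rel n q m Q i al j be <-> rank al = q & m <= i & m <= j & (EX \<pi>. pdiff n al be \<pi> & Q i j \<pi>)"

text \<open>\<open>Q i j \<pi>\<close> is an abstract condition on two levels and a permutation. Its
  two instances are membership in a normal subgroup with congruent levels, and the parity rule
  \<open>sign_levels\<close>.\<close>

locale perm_system =
 fixes q :: nat and Q :: "nat => nat => (nat => nat) => bool"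
 assumes Q_comp: "[|\<pi> permutes {1..q}; rh permutes {1..q}; Q i j \<pi>; Q j k rh|] ==> Q i k (rh o \<pi>)"
  and Q_inv: "[|\<pi> permutes {1..q}; Q i j \<pi>|] ==> Q j i (inv' \<pi>)"
  and Q_conj: "[|\<pi> permutes {1..q}; \<tau> permutes {1..q}; Q i j \<pi>|] ==> Q i j (\<tau> o \<pi> o inv' \<tau>)"
  and Q_shift: "Q i j \<pi> ==> Q (i + k) (j + k) \<pi>"

text \<open>What \<open>B\<close> has to contain to absorb the products of \<open>perm_rel\<close>
  pairs whose rank drops: such products have equal ranks, and equal hats if
  \<open>q = 2\<close>.\<close>

definition below_rel :: "nat => nat => nat => (nat => nat => (nat => nat) => bool) => (nat => partition => nat => partition => bool) => bool" where
 "below_rel n q m Q B <-> (ALL i al j be \<pi>. al : partitions n --> be : partitions n --> rank al = rank be --> rank al < q -->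
   m <= i --> m <= j --> Q i j \<pi> --> (q = 2 --> hat al = hat be) --> B i al j be)"

lemma right_compat_perm_rel:
 assumes B: "right_compat n B" "below_rel n q m Q B" and shift: "!!i j \<pi> k. Q i j \<pi> ==> Q (i + k) (j + k) \<pi>"
 shows "right_compat n (%i al j be. perm_rel n q m Q i al j be | B i al j be)"
 unfolding right_compat_def
proof (intro allI impI)
 fix i al j be k gm assume p: "al : partitions n" "be : partitions n" "gm : partitions n" and P: "perm_rel n q m Q i al j be | B i al j be"
 let ?i = "i + k + floating n al gm" and ?j = "j + k + floating n be gm"
 from P show "perm_rel n q m Q ?i (part_mult n al gm) ?j (part_mult n be gm) | B ?i (part_mult n al gm) ?j (part_mult n be gm)"
 proof
  assume "B i al j be"
  then show ?thesis using B(1) p unfolding right_compat_def by blast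
 next
  assume *: "perm_rel n q m Q i al j be"
  then obtain \<pi> where d: "rank al = q" "m <= i" "m <= j" "pdiff n al be \<pi>" "Q i j \<pi>" unfolding perm_rel_def by blast
  have H: "ALL x y. ll al x y <-> ll be x y" "ldom al = ldom be" using pdiff_green_H(1)[OF p(1,2) d(4)] unfolding green_H_iff by blast+
  note L = L_right[OF p H]
  have Q: "Q ?i ?j \<pi>" using shift[OF d(5), of "k + floating n be gm"] unfolding L(3) by (simp add: add.assoc)
  show ?thesis
  proof (cases "rank (part_mult n al gm) = q")
   case True
   then have "pdiff n (part_mult n al gm) (part_mult n be gm) \<pi>" using pdiff_right[OF p d(4)] d(1) by simp
   then show ?thesis unfolding perm_rel_def using True Q d(2,3) by (intro disjI1 conjI exI[of _ \<pi>]) auto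
  next
   case False
   then have lt: "rank (part_mult n al gm) < q" using rank_mult(1)[OF p(1,3)] d(1) by simp
   have h: "q = 2 --> hat (part_mult n al gm) = hat (part_mult n be gm)"
    using hat_eq_iff[OF part_mult_in part_mult_in] pdiff_right_2[OF p d(4)] d(1) L(1) by simp
   have "B ?i (part_mult n al gm) ?j (part_mult n be gm)"
    by (rule B(2)[unfolded below_rel_def, rule_format, OF part_mult_in part_mult_in L(4) lt _ _ Q]) (use d h in auto)
   then show ?thesis ..
  qed
 qed
qed

lemma perm_rel_flip:
 assumes "al : partitions n" "be : partitions n"
 shows "perm_rel n q m Q i (flip al) j (flip be) <-> perm_rel n q m (%i j \<pi>. Q i j (inv' \<pi>)) i al j be"
proof -
 have "(EX \<pi>. pdiff n (flip al) (flip be) \<pi> & Q i j \<pi>) <-> (EX \<pi>. pdiff n al be \<pi> & Q i j (inv' \<pi>))"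
 proof
  assume "EX \<pi>. pdiff n (flip al) (flip be) \<pi> & Q i j \<pi>"
  then obtain \<pi> where d: "pdiff n (flip al) (flip be) \<pi>" "Q i j \<pi>" by blast
  have "\<pi> permutes {1..rank (flip al)}" using d(1) unfolding pdiff_def by blast
  then have "inv' (inv' \<pi>) = \<pi>" by (metis permutes_inv_inv)
  then show "EX \<pi>. pdiff n al be \<pi> & Q i j (inv' \<pi>)" using pdiff_flip[of "flip al" n "flip be" \<pi>] d assms by auto
 next
  assume "EX \<pi>. pdiff n al be \<pi> & Q i j (inv' \<pi>)"
  then show "EX \<pi>. pdiff n (flip al) (flip be) \<pi> & Q i j \<pi>" using pdiff_flip[OF assms] by blast
 qed
 then show ?thesis unfolding perm_rel_def rank_flip[OF assms(1)] by simp
qed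

lemma (in perm_system) congruence_perm_rel:
 assumes B: "right_compat n B" "right_compat n (%i al j be. B i (flip al) j (flip be))" and below: "below_rel n q m Q B"
  and r: "!!i al j be. B i al j be ==> rank al < q & rank be < q"
  and s: "!!i al j be. B i al j be ==> B j be i al"
  and t: "!!i al j be k gm. [|B i al j be; B j be k gm|] ==> B i al k gm"
 shows "congruence (twisted_monoid n) (reln n (%i al j be. perm_rel n q m Q i al j be | B i al j be))"
proof (rule congruence_reln)
 show "right_compat n (%i al j be. perm_rel n q m Q i al j be | B i al j be)"
  by (rule right_compat_perm_rel[OF B(1) below Q_shift])
 have below': "below_rel n q m (%i j \<pi>. Q i j (inv' \<pi>)) (%i al j be. B i (flip al) j (flip be))"
  unfolding below_rel_def
 proof (intro allI impI)
  fix i al j be \<pi> assume p: "al : partitions n" "be : partitions n" "rank al = rank be" "rank al < q" "m <= i" "m <= j" "Q i j (inv' \<pi>)"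
   "q = 2 --> hat al = hat be"
  have h: "q = 2 --> hat (flip al) = hat (flip be)" using p flip_hat by metis
  show "B i (flip al) j (flip be)"
   by (rule below[unfolded below_rel_def, rule_format, OF _ _ _ _ p(5,6,7)]) (use p h rank_flip[OF p(1)] rank_flip[OF p(2)] in auto)
 qed
 have "right_compat n (%i al j be. perm_rel n q m (%i j \<pi>. Q i j (inv' \<pi>)) i al j be | B i (flip al) j (flip be))"
  by (rule right_compat_perm_rel[OF B(2) below' Q_shift])
 then show "right_compat n (%i al j be. perm_rel n q m Q i (flip al) j (flip be) | B i (flip al) j (flip be))"
  by (rule right_compat_cong) (simp only: perm_rel_flip)
next
 fix i al j be assume p: "al : partitions n" "be : partitions n" and P: "perm_rel n q m Q i al j be | B i al j be"
 from P show "perm_rel n q m Q j be i al | B j be i al"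
 proof
  assume *: "perm_rel n q m Q i al j be"
  then obtain \<pi> where d: "rank al = q" "m <= i" "m <= j" "pdiff n al be \<pi>" "Q i j \<pi>" unfolding perm_rel_def by blast
  have "\<pi> permutes {1..q}" using d(1,4) unfolding pdiff_def by blast
  then have "Q j i (inv' \<pi>)" by (rule Q_inv) fact
  then show ?thesis unfolding perm_rel_def using pdiff_sym[OF p d(4)] pdiff_green_H(2)[OF p d(4)] d by blast
 qed (use s in blast)
next
 fix i al j be k gm assume p: "al : partitions n" "be : partitions n" "gm : partitions n"
  and P: "perm_rel n q m Q i al j be | B i al j be" "perm_rel n q m Q j be k gm | B j be k gm"
 show "perm_rel n q m Q i al k gm | B i al k gm"
 proof (cases "perm_rel n q m Q i al j be")
  case True
  then obtain \<pi> where d: "rank al = q" "m <= i" "m <= j" "pdiff n al be \<pi>" "Q i j \<pi>" unfolding perm_rel_def by blast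
  have rb: "rank be = q" using pdiff_green_H(2)[OF p(1,2) d(4)] d(1) by simp
  then have "perm_rel n q m Q j be k gm" using P(2) r by (metis less_irrefl)
  then obtain rh where d': "m <= k" "pdiff n be gm rh" "Q j k rh" unfolding perm_rel_def by blast
  obtain \<tau> where t: "\<tau> permutes {1..q}" "pdiff n al gm ((\<tau> o rh o inv' \<tau>) o \<pi>)"
   using pdiff_trans[OF p d(4) d'(2)] d(1) by blast
  have pr: "\<pi> permutes {1..q}" "rh permutes {1..q}" using d(1,4) d'(2)[unfolded pdiff_def rb] unfolding pdiff_def by blast+
  have "Q i k ((\<tau> o rh o inv' \<tau>) o \<pi>)"
   by (rule Q_comp[OF pr(1) _ d(5) Q_conj[OF pr(2) t(1) d'(3)]]) (use t pr in \<open>intro permutes_compose permutes_inv\<close>)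
  then show ?thesis unfolding perm_rel_def using t d d' by blast
 next
  case False
  then have b: "B i al j be" using P(1) by blast
  \<comment> \<open>Pairs of \<open>perm_rel\<close> have rank \<open>q\<close> and pairs of
    \<open>B\<close> smaller ranks, so the two kinds never meet at \<open>be\<close>.\<close>
  then have "~perm_rel n q m Q j be k gm" unfolding perm_rel_def using r by (metis less_irrefl)
  then show ?thesis using P(2) t[OF b] by blast
 qed
qed

subsection \<open>Principal congruences\<close>

lemma mod_add_cancel: "((a::nat) + c) mod d = (b + c) mod d <-> a mod d = b mod d"
proof (induction a b rule: linorder_wlog)
 case (le a b)
 have "(b + c) mod d = (a + c) mod d <-> d dvd (b + c) - (a + c)" using le by (intro mod_eq_dvd_iff_nat) simp
 moreover have "b mod d = a mod d <-> d dvd b - a" using le by (rule mod_eq_dvd_iff_nat)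
 ultimately show ?case by (metis diff_cancel2)
qed metis

lemma principal_reln:
 assumes n: "n >= 1" and c: "congruence (twisted_monoid n) (reln n P)"
  and ab: "al : partitions n" "be : partitions n" "i = j & al = be | P i al j be"
  and sub: "!!\<sigma> k gm l de. [|tcong n \<sigma>; tcong.E \<sigma> i al j be; gm : partitions n; de : partitions n; P k gm l de|] ==> tcong.E \<sigma> k gm l de"
 shows "principal_cong (twisted_monoid n) (i, al) (j, be) = reln n P"
proof (rule principal_cong_eqI[OF c])
 show "((i, al), j, be) : reln n P" using ab by simp
 fix \<sigma> assume s: "congruence (twisted_monoid n) \<sigma>" "((i, al), j, be) : \<sigma>"
 interpret tcong n \<sigma> by unfold_locales (use n s in auto)
 have e: "E i al j be" unfolding E_def by (rule s(2))
 have "((k, gm), (l, de)) : \<sigma>" if m: "((k, gm), (l, de)) : reln n P" for k gm l de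
  using m E_refl sub[OF tcong_axioms e] unfolding mem_reln E_def by blast
 then show "reln n P \<subseteq> \<sigma>" by auto
qed

lemma principal_same:
 assumes n: "n >= 1" and a: "al : partitions n"
 shows "principal_cong (twisted_monoid n) (i, al) (i, al) = reln n (%_ _ _ _. False)"
 by (rule principal_reln[OF n congruence_reln]) (use a in \<open>auto simp: right_compat_def\<close>)

lemma principal_levels:
 assumes n: "n >= 1" and a: "al : partitions n" and ij: "i < j"
 shows "principal_cong (twisted_monoid n) (i, al) (j, al) =
  reln n (%k gm l de. gm = de & rank gm <= rank al & (k, l) : nat_cong i j)"
proof (rule principal_reln[OF n congruence_reln])
 have 1: "right_compat n (%k gm l de. gm = de & rank gm <= rank al & (k, l) : nat_cong i j)"
  unfolding right_compat_def
 proof (intro allI impI)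
  fix k gm l de m ep assume p: "gm : partitions n" "de : partitions n" "ep : partitions n" "gm = de & rank gm <= rank al & (k, l) : nat_cong i j"
  have "(k + (m + floating n gm ep)) mod (j - i) = (l + (m + floating n gm ep)) mod (j - i) <-> k mod (j - i) = l mod (j - i)"
   by (rule mod_add_cancel)
  then have "(k + m + floating n gm ep, l + m + floating n de ep) : nat_cong i j"
   using p(4) unfolding nat_cong_iff'[OF ij] by (auto simp: add.assoc)
  then show "part_mult n gm ep = part_mult n de ep & rank (part_mult n gm ep) <= rank al &
   (k + m + floating n gm ep, l + m + floating n de ep) : nat_cong i j"
   using p rank_mult(1)[OF p(1,3)] by auto
 qed
 then show "right_compat n (%k gm l de. gm = de & rank gm <= rank al & (k, l) : nat_cong i j)" .
 show "right_compat n (%k gm l de. flip gm = flip de & rank (flip gm) <= rank al & (k, l) : nat_cong i j)"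
  by (rule right_compat_cong[OF 1]) (metis rank_flip flip_flip)
 show "tcong.E \<sigma> k gm l de" if h: "tcong n \<sigma>" "tcong.E \<sigma> i al j al" "gm : partitions n" "de : partitions n"
   "gm = de & rank gm <= rank al & (k, l) : nat_cong i j" for \<sigma> k gm l de
  using tcong.E_level[OF h(1) tcong.E_factor_same[OF h(1,2,3)]] h(5) by blast
 show "i = j & al = al | al = al & rank al <= rank al & (i, j) : nat_cong i j" using ij unfolding nat_cong_iff'[OF ij]
  by (metis less_imp_le le_add_diff_inverse mod_add_self2 order_refl)
qed (use a in \<open>auto simp: nat_cong_iff'[OF ij]\<close>)

lemma principal_rees:
 assumes n: "n >= 1" and ab: "al : partitions n" "be : partitions n" and q: "rank al >= 2" "rank be <= rank al"
  and H: "(al, be) ~: green_H (part_monoid n)"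
 shows "principal_cong (twisted_monoid n) (i, al) (j, be) =
  reln n (block_rel False False (%k s. s <= rank al & i <= k | s <= rank be & j <= k))"
proof (rule principal_reln[OF n congruence_block_rel ab])
 show "tcong.E \<sigma> k gm l de" if h: "tcong n \<sigma>" "tcong.E \<sigma> i al j be" "gm : partitions n" "de : partitions n"
   "block_rel False False (%k s. s <= rank al & i <= k | s <= rank be & j <= k) k gm l de" for \<sigma> k gm l de
  using tcong.E_not_H[OF h(1,2) q H h(3) _ h(4)] h(5) unfolding block_rel_def by blast
qed (auto simp: block_rel_def)

definition low_region :: "nat => nat => nat => nat => nat => bool" where
 "low_region q i j k s <-> s = 0 & min i j <= k | s = 1 & q = 1 & i <= k"

lemma principal_low:
 assumes n: "n >= 1" and ab: "al : partitions n" "be : partitions n" and q: "rank al <= 1" "rank be <= rank al" "rank be = rank al ==> i <= j"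
  and uv: "u <-> (ALL x y. uu al x y <-> uu be x y)" "v <-> (ALL x y. ll al x y <-> ll be x y)" "~(u & v)"
 shows "principal_cong (twisted_monoid n) (i, al) (j, be) = reln n (block_rel u v (low_region (rank al) i j))"
proof (rule principal_reln[OF n congruence_block_rel ab])
 have "low_region (rank al) i j i (rank al)" "low_region (rank al) i j j (rank be)" unfolding low_region_def using q by auto
 then show "i = j & al = be | block_rel u v (low_region (rank al) i j) i al j be" unfolding block_rel_def using uv by blast
 fix \<sigma> k gm l de
 assume h: "tcong n \<sigma>" "tcong.E \<sigma> i al j be" "gm : partitions n" "de : partitions n" "block_rel u v (low_region (rank al) i j) k gm l de"
 have r: "tcong.reach n (rank al) i j k gm" "tcong.reach n (rank al) i j l de"
  using h(3-5) unfolding tcong.reach_def[OF h(1)] block_rel_def low_region_def by blast+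
 show "tcong.E \<sigma> k gm l de"
 proof (cases u)
  case True
  then obtain x y where "ll al x y ~= ll be x y" using uv by blast
  then show ?thesis using tcong.E_rho[OF h(1,2) q(1,2) _ r] h(5) True unfolding block_rel_def by blast
 next
  case False
  then obtain x y where xy: "uu al x y ~= uu be x y" using uv by blast
  show ?thesis
  proof (cases v)
   case True
   then show ?thesis using tcong.E_lambda[OF h(1,2) q(1,2) xy r] h(5) unfolding block_rel_def by blast
  next
   case F: False
   then obtain x' y' where "ll al x' y' ~= ll be x' y'" using uv by blast
   then show ?thesis using tcong.E_rees[OF h(1,2) q(1,2) xy _ r] by blast
  qed
 qed
qed (auto simp: low_region_def)

lemma exists_rank_1:
 assumes n: "n >= 1" and g: "gm : partitions n" "rank gm = 0"
 obtains ze where "ze : partitions n" "rank ze = 1" "hat ze = gm"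
proof -
 define f where "f x = blk gm (Upper x)" for x
 define g' where "g' x = blk gm (Lower x)" for x
 define ze where "ze = lab n (%x. if f x = f 1 then Inl () else Inr (Inl (f x))) (%y. if g' y = g' 1 then Inl () else Inr (Inr (g' y)))"
 have P: "ze : partitions n" unfolding ze_def by simp
 have ff: "uu gm x y <-> x : {1..n} & y : {1..n} & f x = f y" for x y
  using blk_eq_iff[OF g(1), of "Upper y" "Upper x"] uu_range[OF g(1), of x y] unfolding f_def by auto
 have gg: "ll gm x y <-> x : {1..n} & y : {1..n} & g' x = g' y" for x y
  using blk_eq_iff[OF g(1), of "Lower y" "Lower x"] ll_range[OF g(1), of x y] unfolding g'_def by auto
 have uu: "uu ze x y <-> uu gm x y" for x y unfolding ze_def rel_lab_simps ff by auto
 have ll: "ll ze x y <-> ll gm x y" for x y unfolding ze_def rel_lab_simps gg by auto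
 have ul: "ul ze x y <-> x : {1..n} & y : {1..n} & f x = f 1 & g' y = g' 1" for x y
  unfolding ze_def rel_lab_simps by auto
 have "1 : udom ze" unfolding mem_udom ul using n by (intro exI[of _ 1]) simp
 then have "rank ze ~= 0" using rank_0_iff[OF P] by blast
 moreover have "rank ze <= 1"
  unfolding rank_le_1_iff[OF P] Ball_def mem_udom ul uu ff by metis
 ultimately have "rank ze = 1" by simp
 moreover have "hat ze = gm"
  using hat_eq_iff[OF P g(1)] uu ll hat_rank_0[OF g] by simp
 ultimately show ?thesis using that P by blast
qed

section \<open>Lower bounds for the relations of mu type\<close>

context tcong
begin

lemma E_mod:
 assumes "E i gm j gm" "i <= j" "i <= k" "i <= l" "k mod (j - i) = l mod (j - i)"
 shows "E k gm l gm"
proof (cases "i = j")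
 case True
 then show ?thesis using assms E_refl E_in by auto
next
 case False
 then show ?thesis using E_level[OF assms(1)] assms nat_cong_iff'[of i j k l] by simp
qed

text \<open>Every element of the region is moved into row \<open>0\<close>.\<close>

lemma mu_type_sub:
 assumes A: "!!ze k. [|ze : partitions n; rank ze = 1; a <= k|] ==>
   EX k'. E k ze k' (hat ze) & b <= k' & (k' + 1) mod d = k mod d & (b + h <= k' <-> a + h <= k)"
  and B: "!!ze k l. [|ze : partitions n; rank ze = 1; b <= k; b <= l; k mod d = l mod d; b + h <= k <-> b + h <= l|] ==> E k (hat ze) l (hat ze)"
  and p: "gm : partitions n" "de : partitions n" and P: "mu_type a b h d False False k gm l de"
 shows "E k gm l de"
proof -
 have *: "EX k'. E k gm k' (hat gm) & b <= k' & (k' + 1) mod d = (k + 1 - rank gm) mod d & (b + h <= k' <-> (if rank gm = 0 then b else a) + h <= k)"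
  if g: "gm : partitions n" "rank gm <= 1" "(if rank gm = 0 then b else a) <= k" for gm k
 proof (cases "rank gm = 0")
  case True
  then show ?thesis using g hat_rank_0[OF g(1) True] E_refl[OF g(1)] by (intro exI[of _ k]) simp
 next
  case False
  then have 1: "rank gm = 1" using g(2) by linarith
  show ?thesis using A[OF g(1) 1, of k] g(3) unfolding 1 by simp
 qed
 have hat: "hat gm = hat de" using P unfolding mu_type_def by blast
 have low: "rank gm <= 1" "rank de <= 1" "(if rank gm = 0 then b else a) <= k" "(if rank de = 0 then b else a) <= l"
  using P unfolding mu_type_def by blast+
 obtain k' where k': "E k gm k' (hat gm)" "b <= k'" "(k' + 1) mod d = (k + 1 - rank gm) mod d" "b + h <= k' <-> (if rank gm = 0 then b else a) + h <= k"
  using *[OF p(1) low(1,3)] by blast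
 obtain l' where l': "E l de l' (hat de)" "b <= l'" "(l' + 1) mod d = (l + 1 - rank de) mod d" "b + h <= l' <-> (if rank de = 0 then b else a) + h <= l"
  using *[OF p(2) low(2,4)] by blast
 have "(k' + 1) mod d = (l' + 1) mod d" using k'(3) l'(3) P unfolding mu_type_def by simp
 then have m: "k' mod d = l' mod d" unfolding mod_add_cancel .
 have hh: "b + h <= k' <-> b + h <= l'" using k'(4) l'(4) P unfolding mu_type_def by blast
 obtain ze where z: "ze : partitions n" "rank ze = 1" "hat ze = hat gm" using exists_rank_1[OF n hat_in[OF p(1)]] p(1) by auto
 have "E k' (hat gm) l' (hat de)" using B[OF z(1,2) k'(2) l'(2) m hh] z(3) hat by simp
 then show ?thesis using k'(1) E_sym[OF l'(1)] E_trans by blast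
qed

text \<open>The exact case, where row \<open>1\<close> at level \<open>i\<close> does not reach row \<open>0\<close>.\<close>

lemma mu_type_sub_level:
 assumes A: "!!ze ze'. [|ze : partitions n; ze' : partitions n; rank ze = 1; rank ze' = 1; hat ze = hat ze'; u --> udom ze = udom ze'; v --> ldom ze = ldom ze'|] ==> E i ze i ze'"
  and B: "!!ze. [|ze : partitions n; rank ze = 1|] ==> E i (hat ze) (i + 1) ze"
  and p: "gm : partitions n" "de : partitions n" and P: "mu_type i i 0 0 u v k gm l de"
 shows "E k gm l de"
proof -
 have r: "rank gm <= 1" "rank de <= 1" "hat gm = hat de" "i <= k" "i <= l" "k + 1 - rank gm = l + 1 - rank de"
  "rank gm = 1 & k = i --> (u --> udom gm = udom de) & (v --> ldom gm = ldom de)"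
  using P unfolding mu_type_def by (simp_all split: if_splits)
 show ?thesis
 proof (cases "rank gm = 1 & k = i")
  case True
  then have "rank de = 1 & l = i" using mu_type_special[OF P] by simp
  then show ?thesis using A[OF p] True r by simp
 next
  case False
  have *: "E (k - rank gm) (hat gm) k gm" if "gm : partitions n" "rank gm <= 1" "i <= k" "~(rank gm = 1 & k = i)" for k gm
  proof (cases "rank gm = 0")
   case True
   then show ?thesis using hat_rank_0 that E_refl by simp
  next
   case False
   then have 1: "rank gm = 1" "i + 1 <= k" using that by auto
   show ?thesis using E_shift[OF B[OF that(1) 1(1)], of "k - 1 - i"] 1 by simp
  qed
  have F: "~(rank de = 1 & l = i)" using mu_type_special[OF P] False by simp
  have "k - rank gm = l - rank de" using r False F by linarith
  then show ?thesis using *[OF p(1) r(1,4) False] *[OF p(2) r(2,5) F] r(3) E_sym E_trans by metis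
 qed
qed

text \<open>The case \<open>i < j\<close> of two elements of rank \<open>1\<close>.\<close>

lemma mu_type_sub_mod:
 assumes A: "!!ze. [|ze : partitions n; rank ze = 1|] ==> E i ze j ze" and ij: "i < j"
  and B: "!!ze. [|ze : partitions n; rank ze = 1|] ==> E i (hat ze) (j + 1) ze"
  and p: "gm : partitions n" "de : partitions n" and P: "mu_type i i 0 (j - i) False False k gm l de"
 shows "E k gm l de"
proof -
 have M: "E k ze l ze" if "ze : partitions n" "rank ze = 1" "i <= k" "i <= l" "k mod (j - i) = l mod (j - i)" for ze k l
  by (rule E_mod[OF A[OF that(1,2)]]) (use that ij in auto)
 have m: "(j + x) mod (j - i) = (i + x) mod (j - i)" for x
 proof -
  have "j + x = (i + x) + (j - i)" using ij by simp
  then show ?thesis by (metis mod_add_self2)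
 qed
 have B': "E k (hat ze) (k + 1) ze" if z: "ze : partitions n" "rank ze = 1" "i <= k" for ze k
 proof -
  have "E k (hat ze) (j + 1 + (k - i)) ze" by (rule E_shift_to[OF B[OF z(1,2)] z(3)])
  moreover have "E (j + 1 + (k - i)) ze (k + 1) ze"
   by (rule M[OF z(1,2)]) (use z ij m[of "1 + (k - i)"] in auto)
  ultimately show ?thesis by (rule E_trans)
 qed
 show ?thesis
 proof (rule mu_type_sub[OF _ _ p P])
  fix ze k assume z: "ze : partitions n" "rank ze = 1" "i <= k"
  \<comment> \<open>\<open>?k + 1\<close> has to be congruent to \<open>k\<close>, but
    \<open>k - 1\<close> may lie below \<open>i\<close>; therefore a period is added before
    subtracting 1.\<close>
  let ?k = "j + (k - i) - 1"
  have k: "i <= ?k" "?k + 1 = j + (k - i)" using ij by simp_all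
  have mm: "(j + (k - i)) mod (j - i) = k mod (j - i)" using m[of "k - i"] z by simp
  have "E ?k (hat ze) (j + (k - i)) ze" using B'[OF z(1,2) k(1)] k(2) by simp
  moreover have "E (j + (k - i)) ze k ze" by (rule M[OF z(1,2)]) (use z ij mm in auto)
  ultimately have "E k ze ?k (hat ze)" using E_sym E_trans by blast
  then show "EX k'. E k ze k' (hat ze) & i <= k' & (k' + 1) mod (j - i) = k mod (j - i) & (i + 0 <= k' <-> i + 0 <= k)"
   using k mm z by (intro exI[of _ ?k]) simp
 next
  fix ze k l assume z: "ze : partitions n" "rank ze = 1" and kl: "i <= k" "i <= l" "k mod (j - i) = l mod (j - i)"
  have "E (k + 1) ze (l + 1) ze" by (rule M[OF z]) (use kl mod_add_cancel[of k 1 "j - i" l] in auto)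
  then show "E k (hat ze) l (hat ze)" using B'[OF z kl(1)] B'[OF z kl(2)] E_sym E_trans by meson
 qed
qed

end

section \<open>Normal subgroups and parity as conditions on levels and permutations\<close>

lemma normal_sym_iff:
 "N \<lhd> sym_group q <-> (ALL \<pi>:N. \<pi> permutes {1..q}) & id : N & (ALL \<pi>:N. ALL rh:N. \<pi> o rh : N) & (ALL \<pi>:N. inv' \<pi> : N) &
   (ALL \<pi>:N. ALL \<tau>. \<tau> permutes {1..q} --> \<tau> o \<pi> o inv' \<tau> : N)" (is "_ <-> ?R")
proof
 assume N: "N \<lhd> sym_group q"
 interpret group "sym_group q" by (rule sym_group_is_group)
 have s: "subgroup N (sym_group q)" and c: "ALL \<tau>:carrier (sym_group q). ALL \<pi>:N. \<tau> \<otimes>\<^bsub>sym_group q\<^esub> \<pi> \<otimes>\<^bsub>sym_group q\<^esub> inv\<^bsub>sym_group q\<^esub> \<tau> : N"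
  using N unfolding normal_inv_iff by blast+
 have sub: "N \<subseteq> carrier (sym_group q)" by (rule subgroup.subset[OF s])
 have iv: "inv' \<pi> : N" if "\<pi> : N" for \<pi>
  using subgroup.m_inv_closed[OF s that] sym_group_inv_equality[of \<pi> q] sub that by auto
 have cj: "\<tau> o \<pi> o inv' \<tau> : N" if "\<pi> : N" "\<tau> permutes {1..q}" for \<pi> \<tau>
  using c[rule_format, of \<tau> \<pi>] that by (simp add: sym_group_mult sym_group_carrier)
 show ?R
 proof (intro conjI ballI allI impI)
  show "\<pi> permutes {1..q}" if "\<pi> : N" for \<pi> using subsetD[OF sub that] unfolding sym_group_carrier .
  show "id : N" using subgroup.one_closed[OF s] unfolding sym_group_one .
  show "\<pi> o rh : N" if "\<pi> : N" "rh : N" for \<pi> rh using subgroup.m_closed[OF s that] unfolding sym_group_mult .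
 qed (use iv cj in simp_all)
next
 assume R: ?R
 interpret group "sym_group q" by (rule sym_group_is_group)
 have sub: "N \<subseteq> carrier (sym_group q)" using R sym_group_carrier by blast
 have "subgroup N (sym_group q)"
 proof (rule subgroupI)
  show "N \<subseteq> carrier (sym_group q)" by (rule sub)
  show "N ~= {}" using R by blast
  show "inv\<^bsub>sym_group q\<^esub> a : N" if "a : N" for a
   using R sub that by auto
  show "a \<otimes>\<^bsub>sym_group q\<^esub> b : N" if "a : N" "b : N" for a b
   using R that by (simp add: sym_group_mult)
 qed
 then show "N \<lhd> sym_group q" unfolding normal_inv_iff
  using R by (simp add: sym_group_mult sym_group_carrier)
qed

lemma normal_Sym: "Sym q \<lhd> sym_group q"
 unfolding normal_sym_iff Ball_def sym_group_carrier
 by (intro conjI allI impI permutes_compose permutes_inv permutes_id) assumption+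

lemma permutation_Icc: "\<pi> permutes {1..q::nat} ==> permutation \<pi>"
 using permutes_imp_permutation[of "{1..q}"] by simp

lemma evenperm_rules:
 assumes "\<pi> permutes {1..q::nat}" "rh permutes {1..q}"
 shows "evenperm (\<pi> o rh) <-> evenperm \<pi> = evenperm rh" "evenperm (inv' \<pi>) <-> evenperm \<pi>" "evenperm (\<pi> o rh o inv' \<pi>) <-> evenperm rh"
proof -
 note p = permutation_Icc[OF assms(1)] permutation_Icc[OF assms(2)]
 show 1: "evenperm (\<pi> o rh) <-> evenperm \<pi> = evenperm rh" using evenperm_comp[OF p] .
 show 2: "evenperm (inv' \<pi>) <-> evenperm \<pi>" using evenperm_inv[OF p(1)] .
 show "evenperm (\<pi> o rh o inv' \<pi>) <-> evenperm rh"
  unfolding evenperm_comp[OF permutation_compose[OF p] permutation_inverse[OF p(1)]] 1 2 by argo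
qed

lemma normal_closure_normal:
 assumes "\<pi> permutes {1..q}"
 shows "normal_closure (sym_group q) \<pi> \<lhd> sym_group q" "\<pi> : normal_closure (sym_group q) \<pi>"
  "!!N. N \<lhd> sym_group q ==> \<pi> : N ==> normal_closure (sym_group q) \<pi> \<subseteq> N"
proof -
 have m: "rh : normal_closure (sym_group q) \<pi> <-> (ALL N. N \<lhd> sym_group q --> \<pi> : N --> rh : N)" for rh
  unfolding normal_closure_def by blast
 have 1: "rh permutes {1..q}" if "rh : normal_closure (sym_group q) \<pi>" for rh
  using that normal_Sym assms unfolding m sym_group_carrier[symmetric] by blast
 have 2: "id : N" if "N \<lhd> sym_group q" for N using that unfolding normal_sym_iff by (elim conjE)
 have 3: "rh o \<tau> : N" if "N \<lhd> sym_group q" "rh : N" "\<tau> : N" for N rh \<tau> using that unfolding normal_sym_iff by simp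
 have 4: "inv' rh : N" if "N \<lhd> sym_group q" "rh : N" for N rh using that unfolding normal_sym_iff by simp
 have 5: "\<tau> o rh o inv' \<tau> : N" if "N \<lhd> sym_group q" "rh : N" "\<tau> permutes {1..q}" for N rh \<tau>
  using that unfolding normal_sym_iff by blast
 show "normal_closure (sym_group q) \<pi> \<lhd> sym_group q" unfolding normal_sym_iff
 proof (intro conjI ballI allI impI)
  show "rh permutes {1..q}" if "rh : normal_closure (sym_group q) \<pi>" for rh using 1[OF that] .
  show "id : normal_closure (sym_group q) \<pi>" unfolding m using 2 by blast
  show "rh o \<tau> : normal_closure (sym_group q) \<pi>" if "rh : normal_closure (sym_group q) \<pi>" "\<tau> : normal_closure (sym_group q) \<pi>" for rh \<tau>
   using that 3 unfolding m by simp
  show "inv' rh : normal_closure (sym_group q) \<pi>" if "rh : normal_closure (sym_group q) \<pi>" for rh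
   using that 4 unfolding m by simp
  show "\<tau> o rh o inv' \<tau> : normal_closure (sym_group q) \<pi>" if "rh : normal_closure (sym_group q) \<pi>" "\<tau> permutes {1..q}" for rh \<tau>
   using that 5 unfolding m by simp
 qed
qed (auto simp: normal_closure_def)

text \<open>The case \<open>d = 0\<close> expresses equality of levels, because
  \<open>k mod 0 = k\<close>.\<close>

lemma perm_system_normal:
 assumes "N \<lhd> sym_group q"
 shows "perm_system q (%k l \<pi>. k mod d = l mod d & \<pi> : N)"
proof
 note N = assms[unfolded normal_sym_iff]
 show "i mod d = k mod d & rh o \<pi> : N" if "i mod d = j mod d & \<pi> : N" "j mod d = k mod d & rh : N" for i j k \<pi> rh
  using that N by simp
 show "j mod d = i mod d & inv' \<pi> : N" if "i mod d = j mod d & \<pi> : N" for i j \<pi>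
  using that N by simp
 show "i mod d = j mod d & \<tau> o \<pi> o inv' \<tau> : N" if "\<tau> permutes {1..q}" "i mod d = j mod d & \<pi> : N" for i j \<pi> \<tau>
  using that N by blast
 show "(i + k) mod d = (j + k) mod d & \<pi> : N" if "i mod d = j mod d & \<pi> : N" for i j k \<pi>
  using that unfolding mod_add_cancel .
qed

lemma mod_double:
 assumes "d >= 1" "k mod d = (l::nat) mod d"
 shows "k mod (2 * d) = l mod (2 * d) <-> (even (k div d) <-> even (l div d))"
proof -
 have "m mod (2 * d) = d * (m div d mod 2) + m mod d" for m
  using mod_mult2_eq[of m d 2] by (simp add: mult.commute)
 then have "k mod (2 * d) = l mod (2 * d) <-> k div d mod 2 = l div d mod 2" using assms by simp
 then show ?thesis by (metis even_iff_mod_2_eq_zero not_mod_2_eq_0_eq_1)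
qed

text \<open>Even permutations keep levels modulo \<open>2 * d\<close>, odd ones move them by
  \<open>d\<close> modulo \<open>2 * d\<close>. This is one condition for what the exceptional
  congruence states in two clauses.\<close>

definition sign_levels :: "nat => nat => nat => (nat => nat) => bool" where
 "sign_levels d k l \<pi> <-> k mod d = l mod d & (evenperm \<pi> <-> k mod (2 * d) = l mod (2 * d))"

lemma sign_levels_iff:
 "d >= 1 ==> sign_levels d k l \<pi> <-> k mod d = l mod d & (evenperm \<pi> <-> (even (k div d) <-> even (l div d)))"
 unfolding sign_levels_def using mod_double by blast

lemma perm_system_sign:
 assumes d: "d >= 1"
 shows "perm_system q (sign_levels d)"
proof
 show "sign_levels d i k (rh o \<pi>)" if "\<pi> permutes {1..q}" "rh permutes {1..q}" "sign_levels d i j \<pi>" "sign_levels d j k rh" for i j k \<pi> rh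
  using that evenperm_rules(1)[OF that(2,1)] unfolding sign_levels_iff[OF d] by metis
 show "sign_levels d j i (inv' \<pi>)" if "\<pi> permutes {1..q}" "sign_levels d i j \<pi>" for i j \<pi>
  using that evenperm_rules(2)[OF that(1,1)] unfolding sign_levels_iff[OF d] by metis
 show "sign_levels d i j (\<tau> o \<pi> o inv' \<tau>)" if "\<pi> permutes {1..q}" "\<tau> permutes {1..q}" "sign_levels d i j \<pi>" for i j \<pi> \<tau>
  using that evenperm_rules(3)[OF that(2,1)] unfolding sign_levels_iff[OF d] by metis
 show "sign_levels d (i + k) (j + k) \<pi>" if "sign_levels d i j \<pi>" for i j k \<pi>
  using that unfolding sign_levels_def mod_add_cancel .
qed

context tcong
begin

lemma E_id: "[|id : G q i j; gm : partitions n; rank gm = q|] ==> E i gm j gm"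
 using G_pdiffD[OF _ _ _ pdiff_refl] by blast

text \<open>\<open>\<pi>\<close> leads from level \<open>i\<close> to \<open>j\<close> and a
  conjugate of its inverse leads back, so commutators act on level \<open>i\<close> alone.\<close>

lemma G_commutators:
 assumes p: "\<pi> : G q i j" "\<pi> ~= id" and q: "q >= 3"
 shows "Alt q \<subseteq> G q i i | \<pi> : Alt q & \<pi> : G q i i"
proof -
 interpret conj_closed q "G q i i"
 proof
  show "\<pi> o rh : G q i i" if "\<pi> : G q i i" "rh : G q i i" for \<pi> rh by (rule G_comp[OF that(2,1)])
 qed (rule G_id, rule G_conj)
 show ?thesis
 proof (rule commutators_mem[OF q G_permutes[OF p(1)] p(2)])
  show "\<tau> o inv' \<pi> o inv' \<tau> o \<pi> : G q i i" if "\<tau> permutes {1..q}" for \<tau>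
   by (rule G_comp[OF p(1) G_conj[OF G_inv[OF p(1)] that]])
 qed
qed

lemma perm_rel_normal_sub:
 assumes p: "\<pi> : G q i j" "i <= j" and c: "i = j | q >= 3 & \<pi> : Alt q & \<pi> ~= id"
  and N: "!!M. [|M \<lhd> sym_group q; \<pi> : M|] ==> N \<subseteq> M"
  and g: "gm : partitions n" "de : partitions n" and P: "perm_rel n q i (%k l \<pi>. k mod (j - i) = l mod (j - i) & \<pi> : N) k gm l de"
 shows "E k gm l de"
proof -
 have m: "\<pi> : G q i i" using c p G_commutators by blast
 then have NG: "N \<subseteq> G q i i" by (rule N[OF G_normal])
 \<comment> \<open>Undoing \<open>\<pi>\<close> on level \<open>j\<close> leaves a passage from
   \<open>i\<close> to \<open>j\<close> that changes nothing but the level.\<close>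
 have "inv' \<pi> : G q j j" using G_shift[OF G_inv[OF m], of "j - i"] p(2) by simp
 then have "inv' \<pi> o \<pi> : G q i j" by (rule G_comp[OF p(1)])
 then have id: "id : G q i j" using permutes_inv_o(2)[OF G_permutes[OF m]] by simp
 obtain rh where r: "rank gm = q" "i <= k" "i <= l" "pdiff n gm de rh" "k mod (j - i) = l mod (j - i)" "rh : N"
  using P unfolding perm_rel_def by blast
 have "E k gm l gm" by (rule E_mod[OF E_id[OF id g(1) r(1)] p(2) r(2,3,5)])
 moreover have "rh : G q l l" using G_shift[of rh q i i "l - i"] NG r(3,6) by auto
 then have "E l gm l de" by (rule G_pdiffD[OF _ g r(4,1)])
 ultimately show ?thesis by (rule E_trans)
qed

lemma perm_rel_sign_sub:
 assumes p: "\<pi> : G q i j" "i < j" "\<pi> ~: Alt q" and A: "Alt q \<subseteq> G q i i"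
  and g: "gm : partitions n" "de : partitions n" and P: "perm_rel n q i (sign_levels (j - i)) k gm l de"
 shows "E k gm l de"
proof -
 let ?d = "j - i"
 have pp: "\<pi> permutes {1..q}" by (rule G_permutes[OF p(1)])
 have op: "~evenperm \<pi>" using p(3) pp unfolding alt_group_carrier by blast
 \<comment> \<open>Any odd \<open>\<tau>\<close> is \<open>\<pi>\<close> followed by an even
   permutation, and the even permutations act on level \<open>j\<close>.\<close>
 have odd: "\<tau> : G q i j" if t: "\<tau> permutes {1..q}" "~evenperm \<tau>" for \<tau>
 proof -
  have "evenperm (\<tau> o inv' \<pi>)" unfolding evenperm_rules(1)[OF t(1) permutes_inv[OF pp]] evenperm_rules(2)[OF pp pp] using op t by simp
  then have "\<tau> o inv' \<pi> : Alt q" unfolding alt_group_carrier using permutes_compose[OF permutes_inv[OF pp] t(1)] by simp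
  then have "\<tau> o inv' \<pi> : G q j j" using G_shift[of _ q i i ?d] A p(2) by auto
  then have "(\<tau> o inv' \<pi>) o \<pi> : G q i j" by (rule G_comp[OF p(1)])
  then show ?thesis using permutes_inv_o(2)[OF pp] by (simp add: comp_assoc)
 qed
 \<comment> \<open>The inverse is odd as well and, shifted, leads from \<open>j\<close> to
   \<open>i + 2 * ?d\<close>; composed with \<open>\<pi>\<close> it gives the identity over two
   periods.\<close>
 have "inv' \<pi> : G q i j" by (rule odd) (use permutes_inv[OF pp] evenperm_rules(2)[OF pp pp] op in auto)
 then have "inv' \<pi> : G q (i + ?d) (j + ?d)" by (rule G_shift)
 moreover have "i + ?d = j" "j + ?d = i + 2 * ?d" using p(2) by simp_all
 ultimately have "inv' \<pi> : G q j (i + 2 * ?d)" by metis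
 then have "inv' \<pi> o \<pi> : G q i (i + 2 * ?d)" by (rule G_comp[OF p(1)])
 then have id: "id : G q i (i + 2 * ?d)" using permutes_inv_o(2)[OF pp] by simp
 have lev: "E k ep l ep" if "ep : partitions n" "rank ep = q" "i <= k" "i <= l" "k mod (2 * ?d) = l mod (2 * ?d)" for ep k l
  using E_mod[OF E_id[OF id that(1,2)] _ that(3,4)] that(5) by simp
 obtain rh where r: "rank gm = q" "i <= k" "i <= l" "pdiff n gm de rh" "sign_levels ?d k l rh"
  using P unfolding perm_rel_def by blast
 have pr: "rh permutes {1..q}" using r(1,4) unfolding pdiff_def by blast
 have rd: "rank de = q" using pdiff_green_H(2)[OF g r(4)] r(1) by simp
 show ?thesis
 proof (cases "evenperm rh")
  case True
  then have "k mod (2 * ?d) = l mod (2 * ?d)" using r(5) unfolding sign_levels_def by blast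
  then have "E k gm l gm" by (rule lev[OF g(1) r(1-3)])
  moreover have "rh : Alt q" unfolding alt_group_carrier using True pr by blast
  then have "rh : G q l l" using G_shift[of rh q i i "l - i"] A r(3) by auto
  then have "E l gm l de" by (rule G_pdiffD[OF _ g r(4,1)])
  ultimately show ?thesis by (rule E_trans)
 next
  case False
  have "rh : G q k (k + ?d)" using G_shift[OF odd[OF pr False], of "k - i"] r(2) p(2) by (simp add: add.commute)
  then have "E k gm (k + ?d) de" by (rule G_pdiffD[OF _ g r(4,1)])
  moreover have "(k + ?d) mod (2 * ?d) = l mod (2 * ?d)"
  proof -
   have d: "?d >= 1" using p(2) by simp
   have m: "(k + ?d) mod ?d = l mod ?d" "even (k div ?d) ~= even (l div ?d)" using r(5) False unfolding sign_levels_iff[OF d] by auto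
   have "(k + ?d) div ?d = k div ?d + 1" by (rule div_add_self2) (use d in simp)
   then have "even ((k + ?d) div ?d) <-> even (l div ?d)" using m(2) by (metis even_plus_one_iff)
   then show ?thesis using mod_double[OF d m(1)] by blast
  qed
  then have "E (k + ?d) de l de" by (rule lev[OF g(2) rd trans_le_add1[OF r(2)] r(3)])
  ultimately show ?thesis by (rule E_trans)
 qed
qed

end

lemma pdiff_id_iff:
 assumes "al : partitions n" "be : partitions n" "pdiff n al be \<pi>"
 shows "\<pi> = id <-> al = be"
proof
 obtain t s where p: "\<pi> permutes {1..rank al}" and c: "coords n al {1..rank al} t s" "coords n be {1..rank al} (\<pi> o t) s"
  and e: "ALL x y. uu al x y <-> uu be x y" "ALL x y. ll al x y <-> ll be x y" using assms(3) unfolding pdiff_def by blast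
 { assume "\<pi> = id"
  then have "ul al x y <-> ul be x y" for x y
   using coords_ul[OF assms(1) c(1), of x y] coords_ul[OF assms(2) c(2), of x y] by simp
  then show "al = be" using partition_eqI[OF assms(1,2)] e by blast }
 { assume "al = be"
  then have "coords n be {1..rank al} (id o t) s" using c(1) by simp
  then show "\<pi> = id" by (rule coords_perm_unique[OF assms(2) p permutes_id c(2)]) }
qed

definition low_rees :: "nat => nat => nat => nat => bool" where
 "low_rees q i k s <-> s < q & i <= k"

lemma below_rees: "below_rel n q i Q (block_rel False False (low_rees q i))"
 unfolding below_rel_def block_rel_def low_rees_def by simp

lemma congruence_perm_rees:
 assumes "perm_system q Q"
 shows "congruence (twisted_monoid n) (reln n (%k gm l de. perm_rel n q i Q k gm l de | block_rel False False (low_rees q i) k gm l de))"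
proof (rule perm_system.congruence_perm_rel[OF assms _ _ below_rees])
 show "right_compat n (block_rel False False (low_rees q i))"
  by (rule right_compat_block_rel) (auto simp: low_rees_def)
 then show "right_compat n (%k gm l de. block_rel False False (low_rees q i) k (flip gm) l (flip de))"
  by (rule right_compat_cong) (rule block_rel_flip)
qed (auto simp: block_rel_def low_rees_def)

lemma congruence_perm_mu:
 assumes "perm_system 2 Q" and Q: "!!k l \<pi>. Q k l \<pi> ==> k mod d = l mod d"
 shows "congruence (twisted_monoid n) (reln n (%k gm l de. perm_rel n 2 i Q k gm l de | mu_type i i 0 d False False k gm l de))"
proof (rule perm_system.congruence_perm_rel[OF assms(1)])
 show "right_compat n (mu_type i i 0 d False False)"
  by (rule right_compat_mu_type) auto
 then show "right_compat n (%k gm l de. mu_type i i 0 d False False k (flip gm) l (flip de))"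
  by (rule right_compat_cong) (rule mu_type_flip)
 show "below_rel n 2 i Q (mu_type i i 0 d False False)"
  unfolding below_rel_def
 proof (intro allI impI)
  fix k gm l de \<pi> assume h: "rank gm = rank de" "rank gm < 2" "i <= k" "i <= l" "Q k l \<pi>" "(2::nat) = 2 --> hat gm = hat de"
  have "(k + 1 - rank gm) mod d = (l + 1 - rank de) mod d"
  proof (cases "rank gm = 0")
   case True
   then show ?thesis using h(1) Q[OF h(5)] mod_add_cancel[of k 1 d l] by simp
  next
   case False
   then have "rank gm = 1" "rank de = 1" using h by linarith+
   then show ?thesis using Q[OF h(5)] by simp
  qed
  then show "mu_type i i 0 d False False k gm l de" unfolding mu_type_def using h by simp
 qed
 show "mu_type i i 0 d False False l de k gm" if "mu_type i i 0 d False False k gm l de" for k gm l de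
  by (rule mu_type_sym[OF _ that]) simp
 show "mu_type i i 0 d False False k gm m ep" if "mu_type i i 0 d False False k gm l de" "mu_type i i 0 d False False l de m ep" for k gm l de m ep
  by (rule mu_type_trans[OF _ that]) simp
qed (auto simp: mu_type_def)

lemma principal_perm_normal:
 assumes n: "n >= 1" and ab: "al : partitions n" "be : partitions n" and q: "rank al = q" "q >= 3"
  and d: "pdiff n al be \<pi>" "\<pi> ~= id" and c: "i <= j" "i = j | \<pi> : Alt q"
  and N: "N = normal_closure (sym_group q) \<pi>"
 shows "principal_cong (twisted_monoid n) (i, al) (j, be) =
  reln n (%k gm l de. perm_rel n q i (%k l \<pi>. k mod (j - i) = l mod (j - i) & \<pi> : N) k gm l de |
   block_rel False False (low_rees q i) k gm l de)"
proof -
 have p: "\<pi> permutes {1..q}" using d(1) q(1) unfolding pdiff_def by blast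
 note NC = normal_closure_normal[OF p, folded N]
 show ?thesis
 proof (rule principal_reln[OF n congruence_perm_rees[OF perm_system_normal[OF NC(1)]] ab])
  have "j mod (j - i) = i mod (j - i)" using c(1) by (metis le_add_diff_inverse mod_add_self2)
  then have "perm_rel n q i (%k l \<pi>. k mod (j - i) = l mod (j - i) & \<pi> : N) i al j be"
   unfolding perm_rel_def using q c d NC(2) by (intro conjI exI[of _ \<pi>]) auto
  then show "i = j & al = be | (perm_rel n q i (%k l \<pi>. k mod (j - i) = l mod (j - i) & \<pi> : N) i al j be |
   block_rel False False (low_rees q i) i al j be)" by blast
  fix \<sigma> k gm l de
  assume t: "tcong n \<sigma>" and e: "tcong.E \<sigma> i al j be" and g: "gm : partitions n" "de : partitions n"
   and P: "perm_rel n q i (%k l \<pi>. k mod (j - i) = l mod (j - i) & \<pi> : N) k gm l de | block_rel False False (low_rees q i) k gm l de"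
  interpret tcong n \<sigma> by (rule t)
  have "\<pi> : G q i j" by (rule G_pdiffI[OF e d(1) q(1)]) (use q in simp)
  then have 1: "E k gm l de" if "perm_rel n q i (%k l \<pi>. k mod (j - i) = l mod (j - i) & \<pi> : N) k gm l de"
   using perm_rel_normal_sub[OF _ c(1) _ NC(3) g that] c(2) q(2) d(2) by blast
  have 2: "E k gm l de" if "block_rel False False (low_rees q i) k gm l de"
   using E_H_below[OF e d(1) _ d(2) g] that q unfolding block_rel_def low_rees_def by auto
  show "E k gm l de" using P 1 2 by blast
 qed
qed

lemma principal_perm_sign:
 assumes n: "n >= 1" and ab: "al : partitions n" "be : partitions n" and q: "rank al = q" "q >= 3"
  and d: "pdiff n al be \<pi>" "\<pi> ~: Alt q" and c: "i < j"
 shows "principal_cong (twisted_monoid n) (i, al) (j, be) =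
  reln n (%k gm l de. perm_rel n q i (sign_levels (j - i)) k gm l de | block_rel False False (low_rees q i) k gm l de)"
proof -
 have p: "\<pi> permutes {1..q}" using d(1) q(1) unfolding pdiff_def by blast
 then have ev: "~evenperm \<pi>" using d(2) unfolding alt_group_carrier by blast
 then have id: "\<pi> ~= id" using evenperm_id by blast
 have c1: "j - i >= 1" using c by simp
 show ?thesis
 proof (rule principal_reln[OF n congruence_perm_rees[OF perm_system_sign[OF c1]] ab])
  have ji: "j = i + (j - i)" using c by simp
  have m: "j mod (j - i) = i mod (j - i)" using ji by (metis mod_add_self2)
  have "j div (j - i) = i div (j - i) + 1"
   by (subst ji, rule div_add_self2) (use c in simp)
  then have "even (j div (j - i)) ~= even (i div (j - i))" by simp
  then have "sign_levels (j - i) i j \<pi>" unfolding sign_levels_iff[OF c1] using m ev by simp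
  then have "perm_rel n q i (sign_levels (j - i)) i al j be"
   unfolding perm_rel_def using q c d by (intro conjI exI[of _ \<pi>]) auto
  then show "i = j & al = be | (perm_rel n q i (sign_levels (j - i)) i al j be | block_rel False False (low_rees q i) i al j be)" by blast
  fix \<sigma> k gm l de
  assume t: "tcong n \<sigma>" and e: "tcong.E \<sigma> i al j be" and g: "gm : partitions n" "de : partitions n"
   and P: "perm_rel n q i (sign_levels (j - i)) k gm l de | block_rel False False (low_rees q i) k gm l de"
  interpret tcong n \<sigma> by (rule t)
  have G: "\<pi> : G q i j" by (rule G_pdiffI[OF e d(1) q(1)]) (use q in simp)
  have A: "Alt q \<subseteq> G q i i" using G_commutators[OF G id q(2)] d(2) by blast
  have 1: "E k gm l de" if "perm_rel n q i (sign_levels (j - i)) k gm l de"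
   by (rule perm_rel_sign_sub[OF G c d(2) A g that])
  have 2: "E k gm l de" if "block_rel False False (low_rees q i) k gm l de"
   using E_H_below[OF e d(1) _ id g] that q unfolding block_rel_def low_rees_def by auto
  show "E k gm l de" using P 1 2 by blast
 qed
qed

text \<open>Elements of rank 1 with a given hat behave like a rectangle, with coordinates
  \<open>udom\<close> and \<open>ldom\<close>. The third corner allows both coordinates to be
  changed one after the other.\<close>

lemma exists_mixed:
 assumes z: "ze : partitions n" "ze' : partitions n" "rank ze = 1" "rank ze' = 1" "hat ze = hat ze'"
 obtains \<xi> where "\<xi> : partitions n" "rank \<xi> = 1" "hat \<xi> = hat ze" "udom \<xi> = udom ze" "ldom \<xi> = ldom ze'"
proof -
 define f where "f x = blk ze (Upper x)" for x
 define g where "g x = blk ze' (Lower x)" for x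
 define F :: "nat => unit + vertex set + vertex set" where "F x = (if x : udom ze then Inl () else Inr (Inl (f x)))" for x
 define F' :: "nat => unit + vertex set + vertex set" where "F' y = (if y : ldom ze' then Inl () else Inr (Inr (g y)))" for y
 define \<xi> where "\<xi> = lab n F F'"
 have FF: "F x = F y <-> x : udom ze & y : udom ze | x ~: udom ze & y ~: udom ze & f x = f y"
  "F' x = F' y <-> x : ldom ze' & y : ldom ze' | x ~: ldom ze' & y ~: ldom ze' & g x = g y"
  "F x = F' y <-> x : udom ze & y : ldom ze'" for x y
  unfolding F_def F'_def by simp_all
 have P: "\<xi> : partitions n" unfolding \<xi>_def by simp
 note H = hat_eq_iff[THEN iffD1, OF z(1,2,5)]
 have ff: "uu ze x y <-> x : {1..n} & y : {1..n} & f x = f y" for x y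
  using blk_eq_iff[OF z(1), of "Upper y" "Upper x"] uu_range[OF z(1), of x y] unfolding f_def by auto
 have gg: "ll ze' x y <-> x : {1..n} & y : {1..n} & g x = g y" for x y
  using blk_eq_iff[OF z(2), of "Lower y" "Lower x"] ll_range[OF z(2), of x y] unfolding g_def by auto
 have u1: "uu ze x y" if "x : udom ze" "y : udom ze" for x y using rank_le_1_iff[OF z(1)] z(3) that by simp
 have fz: "rank (flip ze') <= 1" using rank_flip[OF z(2)] z(4) by simp
 have l1: "ll ze' x y" if "x : ldom ze'" "y : ldom ze'" for x y
  using rank_le_1_iff[OF flip_in[OF z(2)]] fz that by simp
 have uu: "uu \<xi> x y <-> uu ze x y" for x y
  using u1[of x y] uu_udom[OF z(1), of x y] ff[of x y] unfolding \<xi>_def rel_lab_simps FF by blast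
 have ll: "ll \<xi> x y <-> ll ze' x y" for x y
  using l1[of x y] ll_ldom[OF z(2), of x y] gg[of x y] unfolding \<xi>_def rel_lab_simps FF by blast
 have ul: "ul \<xi> x y <-> x : udom ze & y : ldom ze'" for x y
  using udom_sub[OF z(1)] ldom_sub[OF z(2)] unfolding \<xi>_def rel_lab_simps FF by blast
 have ne: "udom ze ~= {}" "ldom ze' ~= {}" using rank_0_iff[OF z(1)] rank_0_ldom[OF z(2)] z(3,4) by simp_all
 have d: "udom \<xi> = udom ze" "ldom \<xi> = ldom ze'" unfolding set_eq_iff mem_udom[of _ \<xi>] mem_ldom[of _ \<xi>] ul using ne by blast+
 have "rank \<xi> ~= 0" using rank_0_iff[OF P] d ne by simp
 moreover have "rank \<xi> <= 1" unfolding rank_le_1_iff[OF P] d uu using u1 by blast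
 ultimately have "rank \<xi> = 1" by simp
 moreover have "hat \<xi> = hat ze" using hat_eq_iff[OF P z(1)] uu ll H by simp
 ultimately show ?thesis using that P d by blast
qed

lemma principal_mu_level:
 assumes n: "n >= 1" and ab: "al : partitions n" "be : partitions n" "rank al = 1" "rank be = 1" "hat al = hat be"
  and uv: "u <-> udom al = udom be" "v <-> ldom al = ldom be" "~(u & v)"
 shows "principal_cong (twisted_monoid n) (i, al) (i, be) = reln n (mu_type i i 0 0 u v)"
proof (rule principal_reln[OF n congruence_mu_type ab(1,2)])
 show "i = i & al = be | mu_type i i 0 0 u v i al i be" unfolding mu_type_def using ab uv by simp
 fix \<sigma> k gm l de
 assume t: "tcong n \<sigma>" and e: "tcong.E \<sigma> i al i be" and g: "gm : partitions n" "de : partitions n" and P: "mu_type i i 0 0 u v k gm l de"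
 interpret tcong n \<sigma> by (rule t)
 have k: "!!x y. uu al x y <-> uu be x y" "!!x y. ll al x y <-> ll be x y" using hat_eq_iff[OF ab(1,2)] ab(5) by simp_all
 note U = mu_up_pair[OF e ab(3,4) k(2)] and D = mu_down_pair[OF e ab(3,4) k(1)]
 have B: "E i (hat ze) (i + 1) ze" if "ze : partitions n" "rank ze = 1" for ze
  using U(2)[OF _ that] D(2)[OF _ that] uv by blast
 show "E k gm l de"
 proof (rule mu_type_sub_level[OF _ B g P])
  fix ze ze' assume z: "ze : partitions n" "ze' : partitions n" "rank ze = 1" "rank ze' = 1" "hat ze = hat ze'"
   and uv': "u --> udom ze = udom ze'" "v --> ldom ze = ldom ze'"
  consider "u" "~v" | "v" "~u" | "~u" "~v" using uv(3) by blast
  then show "E i ze i ze'"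
  proof cases
   case 1
   then show ?thesis using U(1)[OF _ z] uv uv' by blast
  next
   case 2
   then show ?thesis using D(1)[OF _ z] uv uv' by blast
  next
   case 3
   obtain \<xi> where x: "\<xi> : partitions n" "rank \<xi> = 1" "hat \<xi> = hat ze" "udom \<xi> = udom ze" "ldom \<xi> = ldom ze'"
    using exists_mixed[OF z] by blast
   have "E i ze i \<xi>" by (rule U(1)) (use 3 uv x z in auto)
   moreover have "E i \<xi> i ze'" by (rule D(1)) (use 3 uv x z in auto)
   ultimately show ?thesis by (rule E_trans)
  qed
 qed
qed auto

lemma principal_mu_levels:
 assumes n: "n >= 1" and ab: "al : partitions n" "be : partitions n" "rank al = 1" "rank be = 1" "hat al = hat be" "al ~= be"
  and ij: "i < j"
 shows "principal_cong (twisted_monoid n) (i, al) (j, be) = reln n (mu_type i i 0 (j - i) False False)"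
proof (rule principal_reln[OF n congruence_mu_type ab(1,2)])
 have "j mod (j - i) = i mod (j - i)" using ij by (metis less_imp_le le_add_diff_inverse mod_add_self2)
 then show "i = j & al = be | mu_type i i 0 (j - i) False False i al j be" unfolding mu_type_def using ab ij by simp
 fix \<sigma> k gm l de
 assume t: "tcong n \<sigma>" and e: "tcong.E \<sigma> i al j be" and g: "gm : partitions n" "de : partitions n"
  and P: "mu_type i i 0 (j - i) False False k gm l de"
 interpret tcong n \<sigma> by (rule t)
 have k: "!!x y. uu al x y <-> uu be x y" "!!x y. ll al x y <-> ll be x y" using hat_eq_iff[OF ab(1,2)] ab(5) by simp_all
 have ne: "udom al ~= udom be | ldom al ~= ldom be"
 proof (rule ccontr)
  assume "~?thesis"
  then have "(al, be) : green_H (part_monoid n)" unfolding green_H_iff using ab k by blast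
  then have "pdiff n al be (diff_perm al be)" by (rule pdiff_diff_perm)
  moreover from this have "diff_perm al be = id" unfolding pdiff_def ab(3) by simp
  ultimately show False using pdiff_id_iff[OF ab(1,2)] ab(6) by blast
 qed
 note U = mu_up_pair[OF e ab(3,4) k(2)] and D = mu_down_pair[OF e ab(3,4) k(1)]
 have A: "E i ze j ze" if z: "ze : partitions n" "rank ze = 1" for ze
  using U(1)[OF _ z(1,1) z(2,2) refl refl] D(1)[OF _ z(1,1) z(2,2) refl refl] ne by blast
 have B: "E i (hat ze) (j + 1) ze" if "ze : partitions n" "rank ze = 1" for ze
  using U(2)[OF _ that] D(2)[OF _ that] ne by blast
 show "E k gm l de" by (rule mu_type_sub_mod[OF A ij B g P])
qed auto

text \<open>The generators have weights \<open>i\<close> and \<open>j + 1\<close>, and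
  \<open>d\<close> is their distance. If \<open>i <= j\<close>, cutting the transversal brings level
  \<open>i\<close> into row 0, which therefore starts at \<open>i\<close>. If
  \<open>i > j + 1\<close>, the generators are the lowest elements of their rows and the period sets
  in one level later, whence \<open>h = 1\<close>.\<close>

lemma principal_mu_hat:
 assumes n: "n >= 1" and a: "al : partitions n" "rank al = 1"
  and c: "b = (if i <= j then i else j)" "h = (if i > j + 1 then 1 else 0)" "d = (if i <= j then j + 1 - i else i - j - 1)"
 shows "principal_cong (twisted_monoid n) (i, al) (j, hat al) = reln n (mu_type i b h d False False)"
proof (rule principal_reln[OF n congruence_mu_type a(1) hat_in[OF a(1)]])
 have dd: "i + d = j + 1 | j + 1 + d = i" using c(3) by (cases "i <= j") auto
 then have m: "(j + 1) mod d = i mod d" by (metis mod_add_self2)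
 show "i = j & al = hat al | mu_type i b h d False False i al j (hat al)"
  unfolding mu_type_def using a m c(1,2) rank_hat[OF a(1)] hat_hat[OF a(1)] by simp
 fix \<sigma> k gm l de
 assume t: "tcong n \<sigma>" and e: "tcong.E \<sigma> i al j (hat al)" and g: "gm : partitions n" "de : partitions n" and P: "mu_type i b h d False False k gm l de"
 interpret tcong n \<sigma> by (rule t)
 note M = mu_hat[OF e a(2)]
 show "E k gm l de"
 proof (rule mu_type_sub[OF _ _ g P])
  fix ze k assume z: "ze : partitions n" "rank ze = 1" and k: "i <= k"
  have "E k ze (j + (k - i)) (hat ze)" by (rule E_shift_to[OF M(1)[OF z] k])
  moreover have "(j + (k - i) + 1) mod d = k mod d"
  proof -
   have "(j + 1 + (k - i)) mod d = (i + (k - i)) mod d" unfolding mod_add_cancel by (rule m)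
   then show ?thesis using k by (simp add: ac_simps)
  qed
  ultimately show "EX k'. E k ze k' (hat ze) & b <= k' & (k' + 1) mod d = k mod d & (b + h <= k' <-> i + h <= k)"
   using c(1,2) k by (intro exI[of _ "j + (k - i)"]) auto
 next
  fix ze k l assume z: "ze : partitions n" "rank ze = 1" and kl: "b <= k" "b <= l" "k mod d = l mod d" "b + h <= k <-> b + h <= l"
  consider "i <= j" | "i = j + 1" | "i > j + 1" "b + 1 <= k" | "i > j + 1" "k = b" using kl(1) by linarith
  then show "E k (hat ze) l (hat ze)"
  proof cases
   case 1
   then show ?thesis using E_mod[OF M(2)[OF z]] kl c by simp
  next
   case 2
   then show ?thesis using kl c z E_refl by simp
  next
   case 3
   then show ?thesis using E_mod[OF E_sym[OF M(2)[OF z]], of k l] kl c by simp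
  next
   case 4
   then have "l = k" using kl c by simp
   then show ?thesis using z E_refl by simp
  qed
 qed
qed (use c in auto)

text \<open>In degree 2 the only non-identity permutation is a transposition, so
  \<open>\<pi>\<close> is odd and the alternating group is trivial; commutators give nothing here.
  Below rank 2 the \<open>mu\<close> relations take the place of the collapse.\<close>

lemma principal_rank_2:
 assumes n: "n >= 1" and ab: "al : partitions n" "be : partitions n" and q: "rank al = 2"
  and d: "pdiff n al be \<pi>" "\<pi> ~= id"
 shows "principal_cong (twisted_monoid n) (i, al) (i, be) =
   reln n (%k gm l de. perm_rel n 2 i (%k l \<pi>. k mod 0 = l mod 0 & \<pi> : Sym 2) k gm l de | mu_type i i 0 0 False False k gm l de)"
  and "i < j ==> principal_cong (twisted_monoid n) (i, al) (j, be) =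
   reln n (%k gm l de. perm_rel n 2 i (sign_levels (j - i)) k gm l de | mu_type i i 0 (j - i) False False k gm l de)"
proof -
 have p: "\<pi> permutes {1..2}" using d(1) q unfolding pdiff_def by simp
 have K: "{1..2} = {1, 2::nat}" by auto
 have two: "rh = id | rh = transpose 1 2" if r: "rh permutes {1..2::nat}" for rh
 proof -
  have i: "rh k : {1, 2} <-> k : {1, 2}" for k using permutes_in_image[OF r] unfolding K .
  have ne: "rh 1 ~= rh 2" using permutes_inj[OF r] by (simp add: inj_eq)
  have o: "rh k = k" if "k ~: {1, 2}" for k using r that unfolding K permutes_def by blast
  show ?thesis
  proof (cases "rh 1 = 1")
   case True
   then have "rh 2 = 2" using i[of 2] ne by auto
   then have "rh k = k" for k using True o[of k] by (cases "k : {1, 2}") auto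
   then show ?thesis by auto
  next
   case False
   then have a: "rh 1 = 2" using i[of 1] by auto
   then have "rh 2 = 1" using i[of 2] ne by auto
   then have "rh k = transpose 1 2 k" for k using a o[of k] by (cases "k = 1"; cases "k = 2") (auto simp: transpose_apply_other)
   then show ?thesis by auto
  qed
 qed
 have ev: "~evenperm \<pi>" using two[OF p] d(2) evenperm_swap[of "1::nat" 2] by auto
 have nA: "\<pi> ~: Alt 2" using ev unfolding alt_group_carrier by blast
 have A2: "rh = id" if "rh : Alt 2" for rh
  using two[of rh] that evenperm_swap[of "1::nat" 2] unfolding alt_group_carrier by auto
 show "principal_cong (twisted_monoid n) (i, al) (i, be) =
   reln n (%k gm l de. perm_rel n 2 i (%k l \<pi>. k mod 0 = l mod 0 & \<pi> : Sym 2) k gm l de | mu_type i i 0 0 False False k gm l de)"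
 proof (rule principal_reln[OF n congruence_perm_mu[OF perm_system_normal[OF normal_Sym]] ab])
  have "\<pi> : Sym 2" using p unfolding sym_group_carrier .
  then show "i = i & al = be | (perm_rel n 2 i (%k l \<pi>. k mod 0 = l mod 0 & \<pi> : Sym 2) i al i be | mu_type i i 0 0 False False i al i be)"
   unfolding perm_rel_def using d q by blast
  fix \<sigma> k gm l de
  assume t: "tcong n \<sigma>" and e: "tcong.E \<sigma> i al i be" and g: "gm : partitions n" "de : partitions n"
   and P: "perm_rel n 2 i (%k l \<pi>. k mod 0 = l mod 0 & \<pi> : Sym 2) k gm l de | mu_type i i 0 0 False False k gm l de"
  interpret tcong n \<sigma> by (rule t)
  have G: "\<pi> : G 2 i i" by (rule G_pdiffI[OF e d(1) q]) simp
  have N: "Sym 2 \<subseteq> M" if M: "M \<lhd> sym_group 2" "\<pi> : M" for M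
  proof
   fix rh assume "rh : Sym 2"
   then have "rh = id | rh = \<pi>" using two[of rh] two[OF p] d(2) unfolding sym_group_carrier by auto
   then show "rh : M" using M unfolding normal_sym_iff by blast
  qed
  have 1: "E k gm l de" if "perm_rel n 2 i (%k l \<pi>. k mod 0 = l mod 0 & \<pi> : Sym 2) k gm l de"
   by (rule perm_rel_normal_sub[OF G _ _ N g]) (use that in simp_all)
  note R = E_H_rank_2[OF e d(1) q d(2)]
  have 2: "E k gm l de" if P: "mu_type i i 0 0 False False k gm l de"
  proof (rule mu_type_sub_level[OF _ R(3) g P])
   fix ze ze' assume z: "ze : partitions n" "ze' : partitions n" "rank ze = 1" "rank ze' = 1" "hat ze = hat ze'"
   obtain \<xi> where x: "\<xi> : partitions n" "rank \<xi> = 1" "hat \<xi> = hat ze" "udom \<xi> = udom ze" "ldom \<xi> = ldom ze'"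
    using exists_mixed[OF z] by blast
   have "E i ze i \<xi>" by (rule R(1)) (use x z in auto)
   moreover have "E i \<xi> i ze'" by (rule R(2)) (use x z in auto)
   ultimately show "E i ze i ze'" by (rule E_trans)
  qed
  show "E k gm l de" using P 1 2 by blast
 qed simp
 assume ij: "i < j"
 then have c1: "j - i >= 1" by simp
 show "principal_cong (twisted_monoid n) (i, al) (j, be) =
   reln n (%k gm l de. perm_rel n 2 i (sign_levels (j - i)) k gm l de | mu_type i i 0 (j - i) False False k gm l de)"
 proof (rule principal_reln[OF n congruence_perm_mu[OF perm_system_sign[OF c1]] ab])
  show "k mod (j - i) = l mod (j - i)" if "sign_levels (j - i) k l \<pi>" for k l \<pi> using that unfolding sign_levels_def by blast
  have ji: "j = i + (j - i)" using ij by simp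
  have m: "j mod (j - i) = i mod (j - i)" using ji by (metis mod_add_self2)
  have "j div (j - i) = i div (j - i) + 1"
   by (subst ji, rule div_add_self2) (use ij in simp)
  then have "even (j div (j - i)) ~= even (i div (j - i))" by simp
  then have "sign_levels (j - i) i j \<pi>" unfolding sign_levels_iff[OF c1] using m ev by simp
  then have "perm_rel n 2 i (sign_levels (j - i)) i al j be"
   unfolding perm_rel_def using q ij d by (intro conjI exI[of _ \<pi>]) auto
  then show "i = j & al = be | (perm_rel n 2 i (sign_levels (j - i)) i al j be | mu_type i i 0 (j - i) False False i al j be)" by blast
  fix \<sigma> k gm l de
  assume t: "tcong n \<sigma>" and e: "tcong.E \<sigma> i al j be" and g: "gm : partitions n" "de : partitions n"
   and P: "perm_rel n 2 i (sign_levels (j - i)) k gm l de | mu_type i i 0 (j - i) False False k gm l de"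
  interpret tcong n \<sigma> by (rule t)
  have G: "\<pi> : G 2 i j" by (rule G_pdiffI[OF e d(1) q]) simp
  have A: "Alt 2 \<subseteq> G 2 i i" using A2 G_id by blast
  have 1: "E k gm l de" if "perm_rel n 2 i (sign_levels (j - i)) k gm l de"
   by (rule perm_rel_sign_sub[OF G ij nA A g that])
  note R = E_H_rank_2[OF e d(1) q d(2)]
  have 2: "E k gm l de" if P: "mu_type i i 0 (j - i) False False k gm l de"
   by (rule mu_type_sub_mod[OF R(1) ij R(3) g P]) auto
  show "E k gm l de" using P 1 2 by blast
 qed
qed

subsection \<open>The congruences of chains and matrices\<close>

text \<open>The entry of the first element selects the only clause that can hold, and Green's
  relations between hats reduce to equality of kernels.\<close>

lemma cg_iff:
 "((i, al), (j, be)) : cg n \<Theta> M <-> al : partitions n & be : partitions n &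
  (case M (rank al) i of
   E_Delta => M (rank be) j = E_Delta & (i, j) : \<Theta> (rank al) & al = be
  | E_R => M (rank be) j = E_R
  | E_N N => M (rank be) j = E_N N & (i, j) : \<Theta> (rank al) & (al, be) : green_H (part_monoid n) & diff_perm al be : N
  | E_lambda => M (rank be) j = E_lambda & (ALL x y. ll al x y <-> ll be x y)
  | E_rho => M (rank be) j = E_rho & (ALL x y. uu al x y <-> uu be x y)
  | E_mu_down => M (rank be) j = E_mu_down & hat al = hat be & ldom al = ldom be
  | E_mu_up => M (rank be) j = E_mu_up & hat al = hat be & udom al = udom be
  | E_mu => M (rank be) j = E_mu & hat al = hat be &
      ((rank al = rank be & (i, j) : \<Theta> (rank al))
      | (rank al ~= rank be & (i + rank be, j + rank al) : \<Theta> 0 &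
        enat i < min_cong (\<Theta> (rank al)) & enat j < min_cong (\<Theta> (rank be)))
      | (rank al ~= rank be & (i + rank be, j + rank al) : \<Theta> 0 &
        enat i >= min_cong (\<Theta> (rank al)) & enat j >= min_cong (\<Theta> (rank be)))))"
proof (cases "al : partitions n & be : partitions n")
 case True
 then have p: "al : partitions n" "be : partitions n" by blast+
 have 1: "(hat al, hat be) : green_L (part_monoid n) <-> (ALL x y. ll al x y <-> ll be x y)"
  "(hat al, hat be) : green_R (part_monoid n) <-> (ALL x y. uu al x y <-> uu be x y)"
  unfolding green_L_iff green_R_iff using p by simp_all
 have 2: "hat al = hat be & (al, be) : green_L (part_monoid n) <-> hat al = hat be & ldom al = ldom be"
  "hat al = hat be & (al, be) : green_R (part_monoid n) <-> hat al = hat be & udom al = udom be"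
  unfolding green_L_iff green_R_iff hat_eq_iff[OF p] using p by blast+
 show ?thesis unfolding cg_def Let_def using p 1 2 by (cases "M (rank al) i") simp_all
next
 case False
 then show ?thesis unfolding cg_def by auto
qed

lemma eq_relnI:
 assumes "!!i al j be. ((i, al), (j, be)) : C ==> al : partitions n & be : partitions n"
  "!!i al j be. [|al : partitions n; be : partitions n|] ==> ((i, al), (j, be)) : C <-> i = j & al = be | P i al j be"
 shows "C = reln n P"
proof -
 have "((i, al), (j, be)) : C <-> ((i, al), (j, be)) : reln n P" for i al j be
  unfolding mem_reln using assms by blast
 then show ?thesis by (auto simp: set_eq_iff split_paired_all)
qed

lemma cg_in: "((i, al), (j, be)) : cg n \<Theta> M ==> al : partitions n & be : partitions n"
 unfolding cg_def by blast

text \<open>The chain enters through the \<open>E_Delta\<close> entries, that is outside the region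
  \<open>S\<close>, where it has to be equality.\<close>

lemma cg_block:
 assumes X: "X = E_R & ~u & ~v | X = E_lambda & ~u & v | X = E_rho & u & ~v"
  and M: "!!s l. s <= n ==> M s l = (if S l s then X else E_Delta)"
  and T: "!!s k l. [|s <= n; ~S k s; ~S l s|] ==> (k, l) : \<Theta> s <-> k = l"
 shows "cg n \<Theta> M = reln n (block_rel u v S)"
proof (rule eq_relnI[OF cg_in])
 fix i al j be assume p: "al : partitions n" "be : partitions n"
 have m: "M (rank al) l = (if S l (rank al) then X else E_Delta)" "M (rank be) l = (if S l (rank be) then X else E_Delta)" for l
  using M rank_le_n p by blast+
 have t: "[|~S k (rank al); ~S l (rank al)|] ==> (k, l) : \<Theta> (rank al) <-> k = l" for k l
  using T rank_le_n p by blast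
 show "((i, al), (j, be)) : cg n \<Theta> M <-> i = j & al = be | block_rel u v S i al j be"
 proof (cases "S i (rank al)")
  case True
  show ?thesis using X
  proof (elim disjE conjE)
   assume "X = E_R" "~u" "~v"
   then show ?thesis unfolding cg_iff block_rel_def m using True p by auto
  next
   assume "X = E_lambda" "~u" "v"
   then show ?thesis unfolding cg_iff block_rel_def m using True p by auto
  next
   assume "X = E_rho" "u" "~v"
   then show ?thesis unfolding cg_iff block_rel_def m using True p by auto
  qed
 next
  case False
  have "X ~= E_Delta" using X by auto
  then have "((i, al), (j, be)) : cg n \<Theta> M <-> ~S j (rank be) & (i, j) : \<Theta> (rank al) & al = be"
   unfolding cg_iff m using False p by simp
  then show ?thesis unfolding block_rel_def using False t by auto
 qed
qed

text \<open>\<open>diff_perm\<close> is an arbitrary representative, but all representatives are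
  conjugate by \<open>pdiff_coords\<close>, so membership in a conjugation-closed set does not
  depend on the choice.\<close>

lemma pdiff_class:
 assumes ab: "al : partitions n" "be : partitions n"
  and X: "!!\<pi> \<tau>. [|\<pi> permutes {1..rank al}; \<tau> permutes {1..rank al}; \<pi> : X|] ==> \<tau> o \<pi> o inv' \<tau> : X"
 shows "(EX \<pi>. pdiff n al be \<pi> & \<pi> : X) <-> (al, be) : green_H (part_monoid n) & diff_perm al be : X"
proof
 assume "(al, be) : green_H (part_monoid n) & diff_perm al be : X"
 then show "EX \<pi>. pdiff n al be \<pi> & \<pi> : X" using pdiff_diff_perm by blast
next
 assume "EX \<pi>. pdiff n al be \<pi> & \<pi> : X"
 then obtain \<pi> where d: "pdiff n al be \<pi>" "\<pi> : X" by blast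
 have H: "(al, be) : green_H (part_monoid n)" by (rule pdiff_green_H(1)[OF ab d(1)])
 let ?rh = "diff_perm al be"
 have pp: "\<pi> permutes {1..rank al}" using d(1) unfolding pdiff_def by blast
 obtain t s where c: "?rh permutes {1..rank al}" "coords n al {1..rank al} t s" "coords n be {1..rank al} (?rh o t) s"
  using pdiff_diff_perm[OF H] unfolding pdiff_def by blast
 obtain \<tau> where t: "\<tau> permutes {1..rank al}" "coords n be {1..rank al} ((\<tau> o \<pi> o inv' \<tau>) o t) s"
  using pdiff_coords[OF ab d(1) c(2)] by blast
 have "\<tau> o \<pi> o inv' \<tau> permutes {1..rank al}" using t(1) pp by (intro permutes_compose permutes_inv)
 then have "?rh = \<tau> o \<pi> o inv' \<tau>" using coords_perm_unique[OF ab(2) c(1) _ c(3) t(2)] by blast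
 then show "(al, be) : green_H (part_monoid n) & ?rh : X" using H X[OF pp t(1) d(2)] by simp
qed

lemma pdiff_normal:
 assumes "al : partitions n" "be : partitions n" "N \<lhd> sym_group (rank al)"
 shows "(EX \<pi>. pdiff n al be \<pi> & \<pi> : N) <-> (al, be) : green_H (part_monoid n) & diff_perm al be : N"
proof (rule pdiff_class[OF assms(1,2)])
 fix \<pi> \<tau> assume "\<tau> permutes {1..rank al}" "\<pi> : N"
 moreover have "ALL \<pi>:N. ALL \<tau>. \<tau> permutes {1..rank al} --> \<tau> o \<pi> o inv' \<tau> : N"
  using assms(3) unfolding normal_sym_iff by (elim conjE)
 ultimately show "\<tau> o \<pi> o inv' \<tau> : N" by blast
qed

lemma normal_Alt: "Alt q \<lhd> sym_group q"
 unfolding normal_sym_iff alt_group_carrier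
proof (intro conjI ballI allI impI)
 show "\<pi> permutes {1..q}" if "\<pi> : Alt q" for \<pi> using that unfolding alt_group_carrier by blast
 show "\<pi> o rh permutes {1..q}" "evenperm (\<pi> o rh)" if "\<pi> : Alt q" "rh : Alt q" for \<pi> rh
  using that permutes_compose[of rh "{1..q}" \<pi>] evenperm_rules(1)[of \<pi> q rh] unfolding alt_group_carrier by blast+
 show "inv' \<pi> permutes {1..q}" "evenperm (inv' \<pi>)" if "\<pi> : Alt q" for \<pi>
  using that permutes_inv[of \<pi> "{1..q}"] evenperm_rules(2)[of \<pi> q \<pi>] unfolding alt_group_carrier by blast+
 show "\<tau> o \<pi> o inv' \<tau> permutes {1..q}" if "\<pi> : Alt q" "\<tau> permutes {1..q}" for \<pi> \<tau>
  using that unfolding alt_group_carrier by (intro permutes_compose permutes_inv) simp_all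
 show "evenperm (\<tau> o \<pi> o inv' \<tau>)" if "\<pi> : Alt q" "\<tau> permutes {1..q}" for \<pi> \<tau>
  using that evenperm_rules(3)[of \<tau> q \<pi>] unfolding alt_group_carrier by blast
qed (simp_all add: permutes_id)

lemma cg_perm_rees:
 assumes N: "N \<lhd> sym_group q" and \<theta>: "!!k l. (k, l) : \<theta> <-> k = l | i <= k & i <= l & k mod d = l mod d"
  and T: "\<Theta> = (%s. if s = q then \<theta> else if s < q then nat_cong i (i + 1) else Id)"
  and M: "M = (%s l. if s = q & l >= i then E_N N else if s < q & l >= i then E_R else E_Delta)"
 shows "cg n \<Theta> M = reln n (%k gm l de. perm_rel n q i (%k l \<pi>. k mod d = l mod d & \<pi> : N) k gm l de |
   block_rel False False (low_rees q i) k gm l de)"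
proof (rule eq_relnI[OF cg_in])
 fix k gm l de assume p: "gm : partitions n" "de : partitions n"
 show "((k, gm), (l, de)) : cg n \<Theta> M <-> k = l & gm = de | perm_rel n q i (%k l \<pi>. k mod d = l mod d & \<pi> : N) k gm l de |
   block_rel False False (low_rees q i) k gm l de"
 proof (cases "rank gm = q & i <= k")
  case True
  then have m: "M (rank gm) k = E_N N" unfolding M by simp
  have m': "M (rank de) l = E_N N <-> rank de = q & i <= l" unfolding M by simp
  have c: "((k, gm), (l, de)) : cg n \<Theta> M <-> rank de = q & i <= l & (k, l) : \<theta> & (gm, de) : green_H (part_monoid n) & diff_perm gm de : N"
   unfolding cg_iff m entry.case m' using p True T by simp
  have "perm_rel n q i (%k l \<pi>. k mod d = l mod d & \<pi> : N) k gm l de <-> i <= l & k mod d = l mod d & (EX \<pi>. pdiff n gm de \<pi> & \<pi> : N)"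
   unfolding perm_rel_def using True by auto
  also have "\<dots> <-> rank de = q & i <= l & (k, l) : \<theta> & (gm, de) : green_H (part_monoid n) & diff_perm gm de : N"
   using pdiff_normal[OF p] N True green_H_rank[of gm de n] \<theta>[of k l] by auto
  finally have 1: "perm_rel n q i (%k l \<pi>. k mod d = l mod d & \<pi> : N) k gm l de <-> ((k, gm), (l, de)) : cg n \<Theta> M" unfolding c .
  have 2: "~block_rel False False (low_rees q i) k gm l de" unfolding block_rel_def low_rees_def using True by simp
  have 3: "perm_rel n q i (%k l \<pi>. k mod d = l mod d & \<pi> : N) k gm l de" if "k = l & gm = de"
   unfolding perm_rel_def using that True pdiff_refl[OF p(1)] N unfolding normal_sym_iff by auto
  show ?thesis using 1 2 3 by blast
 next
  case False
  then have 1: "~perm_rel n q i (%k l \<pi>. k mod d = l mod d & \<pi> : N) k gm l de" unfolding perm_rel_def by blast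
  show ?thesis
  proof (cases "rank gm < q & i <= k")
   case True
   then have m: "M (rank gm) k = E_R" unfolding M by auto
   have m': "M (rank de) l = E_R <-> rank de < q & i <= l" unfolding M by auto
   show ?thesis unfolding cg_iff m entry.case m' using p 1 True unfolding block_rel_def low_rees_def by auto
  next
   case F: False
   then have m: "M (rank gm) k = E_Delta" using False unfolding M by auto
   have 2: "~block_rel False False (low_rees q i) k gm l de" unfolding block_rel_def low_rees_def using F by blast
   have 3: "(k, l) : \<Theta> (rank gm) <-> k = l" if "M (rank gm) l = E_Delta"
    using that False F \<theta>[of k l] nat_cong_1[of k l i] unfolding M T by (auto split: if_splits)
   show ?thesis unfolding cg_iff m entry.case using 1 2 3 p m by auto
  qed
 qed
qed

text \<open>Split by parity: even permutations have levels congruent modulo \<open>2 * d\<close> and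
  give the subgroup clause for \<open>Alt q\<close>; odd ones have levels congruent modulo
  \<open>d\<close> but not \<open>2 * d\<close> and give the exceptional clause.\<close>

lemma perm_rel_sign:
 assumes p: "gm : partitions n" "de : partitions n" and d: "d >= 1"
 shows "perm_rel n q i (sign_levels d) k gm l de <-> perm_rel n q i (%k l \<pi>. k mod (2 * d) = l mod (2 * d) & \<pi> : Alt q) k gm l de |
  gm : D_class n q & de : D_class n q & (k, l) : nat_cong i (i + d) - nat_cong i (i + 2 * d) &
  (gm, de) : green_H (part_monoid n) & diff_perm gm de : Sym q - Alt q"
proof (cases "rank gm = q")
 case True
 have d2: "2 * d >= 1" using d by simp
 have "(EX \<pi>. pdiff n gm de \<pi> & \<pi> : Sym q - Alt q) <-> (gm, de) : green_H (part_monoid n) & diff_perm gm de : Sym q - Alt q"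
 proof (rule pdiff_class[OF p])
  fix \<pi> \<tau> assume h: "\<pi> permutes {1..rank gm}" "\<tau> permutes {1..rank gm}" "\<pi> : Sym q - Alt q"
  have "\<tau> o \<pi> o inv' \<tau> permutes {1..q}" using h(1,2) unfolding True by (intro permutes_compose permutes_inv)
  moreover have "~evenperm (\<tau> o \<pi> o inv' \<tau>)" using evenperm_rules(3)[OF h(2,1)] h unfolding alt_group_carrier True Diff_iff by blast
  ultimately show "\<tau> o \<pi> o inv' \<tau> : Sym q - Alt q" unfolding alt_group_carrier sym_group_carrier Diff_iff by blast
 qed
 moreover have "pdiff n gm de \<pi> & \<pi> : Sym q - Alt q <-> pdiff n gm de \<pi> & ~evenperm \<pi>" for \<pi>
  unfolding pdiff_def True Diff_iff sym_group_carrier alt_group_carrier by blast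
 ultimately have 1: "(EX \<pi>. pdiff n gm de \<pi> & ~evenperm \<pi>) <-> (gm, de) : green_H (part_monoid n) & diff_perm gm de : Sym q - Alt q" by simp
 have 2: "pdiff n gm de \<pi> & \<pi> : Alt q <-> pdiff n gm de \<pi> & evenperm \<pi>" for \<pi>
  unfolding pdiff_def True alt_group_carrier by blast
 have 3: "gm : D_class n q & de : D_class n q <-> rank de = q" unfolding D_class_def using p True by simp
 have 4: "(k, l) : nat_cong i (i + d) - nat_cong i (i + 2 * d) <-> i <= k & i <= l & k mod d = l mod d & k mod (2 * d) ~= l mod (2 * d)"
  unfolding Diff_iff nat_cong_iff[OF d] nat_cong_iff[OF d2] by auto
 have 5: "k mod d = l mod d" if "k mod (2 * d) = l mod (2 * d)" for k l :: nat
  using that by (metis mod_mod_cancel dvd_triv_right)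
 have 6: "(gm, de) : green_H (part_monoid n) ==> rank de = q" using green_H_rank True by metis
 show ?thesis unfolding perm_rel_def sign_levels_def 4 using 1 2 3 5[of k l] 6 True by blast
next
 case False
 then show ?thesis unfolding perm_rel_def D_class_def by blast
qed

lemma nat_cong_id: "(k, l) : Id <-> k = l | i <= k & i <= l & k mod 0 = (l::nat) mod 0"
 by auto

lemma cgx_perm_rees:
 assumes d: "d >= 1" and T: "\<Theta> = (%s. if s = q then nat_cong i (i + 2 * d) else if s < q then nat_cong i (i + 1) else Id)"
  and M: "M = (%s l. if s = q & l >= i then E_N (Alt q) else if s < q & l >= i then E_R else E_Delta)"
 shows "cgx n q \<Theta> M = reln n (%k gm l de. perm_rel n q i (sign_levels d) k gm l de | block_rel False False (low_rees q i) k gm l de)"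
proof (rule eq_relnI)
 have d2: "2 * d >= 1" using d by simp
 have cg: "cg n \<Theta> M = reln n (%k gm l de. perm_rel n q i (%k l \<pi>. k mod (2 * d) = l mod (2 * d) & \<pi> : Alt q) k gm l de |
   block_rel False False (low_rees q i) k gm l de)"
  by (rule cg_perm_rees[OF normal_Alt nat_cong_iff[OF d2] T M])
 have x: "exceptional_cong (nat_cong i (i + 2 * d)) = nat_cong i (i + d)" "\<Theta> q = nat_cong i (i + 2 * d)"
  unfolding T using exceptional_cong_nat_cong[OF d] by simp_all
 fix k gm l de
 show "((k, gm), (l, de)) : cgx n q \<Theta> M ==> gm : partitions n & de : partitions n"
  unfolding cgx_def using cg_in[of k gm l de] unfolding D_class_def by blast
 assume p: "gm : partitions n" "de : partitions n"
 show "((k, gm), (l, de)) : cgx n q \<Theta> M <-> k = l & gm = de | perm_rel n q i (sign_levels d) k gm l de | block_rel False False (low_rees q i) k gm l de"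
  unfolding cgx_def cg x Un_iff mem_reln mem_Collect_eq case_prod_conv perm_rel_sign[OF p d] using p by blast
qed

text \<open>\<open>d = 0\<close> encodes the equality relation, whose minimum is infinite; otherwise
  the minimum is \<open>x + h\<close>, where \<open>x\<close> is the first level of the row.\<close>

definition mu_chain :: "nat => nat => nat => (nat \<times> nat) set" where
 "mu_chain x h d = (if d = 0 then Id else nat_cong (x + h) (x + h + d))"

lemma mem_mu_chain: "(k, l) : mu_chain x h d <-> k = l | d >= 1 & x + h <= k & x + h <= l & k mod d = l mod d"
proof (cases "d = 0")
 case False
 then have "d >= 1" by simp
 then show ?thesis unfolding mu_chain_def if_not_P[OF False] using nat_cong_iff[of d k l "x + h"] by blast
qed (simp add: mu_chain_def)

lemma min_mu_chain:
 "enat k < min_cong (mu_chain x h d) <-> d = 0 | k < x + h"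
 "min_cong (mu_chain x h d) <= enat k <-> d >= 1 & x + h <= k"
proof -
 have m: "min_cong (mu_chain x h d) = (if d = 0 then \<infinity> else enat (x + h))"
  unfolding mu_chain_def using min_cong_nat_cong[of d "x + h"] by (cases "d = 0") simp_all
 show "enat k < min_cong (mu_chain x h d) <-> d = 0 | k < x + h" unfolding m by simp
 show "min_cong (mu_chain x h d) <= enat k <-> d >= 1 & x + h <= k" unfolding m by (cases "d = 0") simp_all
qed

text \<open>As \<open>h <= 1\<close>, at most one level of each row lies below its minimum, so being
  below on both sides already fixes the levels. For equal ranks this turns membership in the chain
  into a congruence with a threshold, for different ranks the two alternatives of (C8).\<close>

lemma mu_chain_levels:
 assumes ab: "b + h <= a" "h <= 1" "d = 0 ==> h = 0"
 shows "[|x <= i; x <= j|] ==> (i, j) : mu_chain x h d <-> i mod d = j mod d & (x + h <= i <-> x + h <= j)"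
  and "[|a <= i; b <= j|] ==> (i, j + 1) : mu_chain b h d & ((d = 0 | i < a + h) & (d = 0 | j < b + h) | (d >= 1 & a + h <= i) & (d >= 1 & b + h <= j)) <->
   i mod d = (j + 1) mod d & (a + h <= i <-> b + h <= j)"
proof -
 show "(i, j) : mu_chain x h d <-> i mod d = j mod d & (x + h <= i <-> x + h <= j)" if "x <= i" "x <= j"
 proof (cases "d = 0")
  case False
  then have "i = j" if "i < x + h" "j < x + h" using that \<open>x <= i\<close> \<open>x <= j\<close> ab(2) by linarith
  then show ?thesis unfolding mem_mu_chain using False by auto
 qed (use ab(3) that in \<open>auto simp: mem_mu_chain\<close>)
 assume r: "a <= i" "b <= j"
 show "(i, j + 1) : mu_chain b h d & ((d = 0 | i < a + h) & (d = 0 | j < b + h) | (d >= 1 & a + h <= i) & (d >= 1 & b + h <= j)) <->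
   i mod d = (j + 1) mod d & (a + h <= i <-> b + h <= j)"
 proof (cases "d = 0")
  case False
  have "b + h <= i" "b + h <= j + 1" using r ab by linarith+
  then have "(i, j + 1) : mu_chain b h d <-> i mod d = (j + 1) mod d" unfolding mem_mu_chain using False by auto
  then show ?thesis using False by auto
 qed (use ab(3) r in \<open>auto simp: mem_mu_chain\<close>)
qed

text \<open>The rows \<open>0\<close> and \<open>1\<close> of a matrix of \<open>\<mu>\<close> type.\<close>

lemma cg_mu_low:
 assumes ab: "b + h <= a" "h <= 1" "d = 0 ==> h = 0"
  and T: "\<Theta> 0 = mu_chain b h d" "\<Theta> 1 = mu_chain a h d"
  and M: "M (rank al) i = (if (if rank al = 0 then b else a) <= i then E_mu else E_Delta)"
   "M (rank be) j = (if (if rank be = 0 then b else a) <= j then E_mu else E_Delta)"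
  and p: "al : partitions n" "be : partitions n" "rank al <= 1" "rank be <= 1"
 shows "((i, al), (j, be)) : cg n \<Theta> M <-> i = j & al = be | mu_type a b h d False False i al j be"
proof (cases "(if rank al = 0 then b else a) <= i")
 case True
 note i = this
 then have m: "M (rank al) i = E_mu" unfolding M(1) by simp
 show ?thesis
 proof (cases "(if rank be = 0 then b else a) <= j")
  case True
  then have m': "M (rank be) j = E_mu" unfolding M(2) by simp
  have r: "rank al = 0 | rank al = 1" "rank be = 0 | rank be = 1" using p by linarith+
  have c1: "(i', j') : mu_chain x h d <-> i' mod d = j' mod d & (x + h <= i' <-> x + h <= j')" if "x <= i'" "x <= j'" for x i' j'
   by (rule mu_chain_levels(1)[OF ab that])
  have c2: "(i', j' + 1) : mu_chain b h d & ((d = 0 | i' < a + h) & (d = 0 | j' < b + h) | (d >= 1 & a + h <= i') & (d >= 1 & b + h <= j')) <->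
   i' mod d = (j' + 1) mod d & (a + h <= i' <-> b + h <= j')" if "a <= i'" "b <= j'" for i' j'
   by (rule mu_chain_levels(2)[OF ab that])
  have "((i, al), (j, be)) : cg n \<Theta> M <-> mu_type a b h d False False i al j be"
  proof (cases "rank al = rank be")
   case e: True
   have "((i, al), (j, be)) : cg n \<Theta> M <-> hat al = hat be & (i, j) : \<Theta> (rank al)"
    unfolding cg_iff m entry.case m' using p e by simp
   also have "(i, j) : \<Theta> (rank al) <-> i mod d = j mod d & ((if rank al = 0 then b else a) + h <= i <-> (if rank al = 0 then b else a) + h <= j)"
    using r(1) c1[of b i j] c1[of a i j] True i e T by auto
   also have "hat al = hat be & \<dots> <-> mu_type a b h d False False i al j be"
   proof -
    have "(i + 1 - rank al) mod d = (j + 1 - rank be) mod d <-> i mod d = j mod d"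
     using r(1) e mod_add_cancel[of i 1 d j] by auto
    then show ?thesis unfolding mu_type_def using True i e p by simp
   qed
   finally show ?thesis .
  next
   case ne: False
   from r ne consider "rank al = 1" "rank be = 0" | "rank al = 0" "rank be = 1" by auto
   then show ?thesis
   proof cases
    case 1
    \<comment> \<open>For ranks 1 and 0 the pair tested against the bottom congruence is
      \<open>(i, j + 1)\<close>, that is, the two weights.\<close>
    have "((i, al), (j, be)) : cg n \<Theta> M <-> hat al = hat be & (i, j + 1) : mu_chain b h d &
     ((d = 0 | i < a + h) & (d = 0 | j < b + h) | (d >= 1 & a + h <= i) & (d >= 1 & b + h <= j))"
     unfolding cg_iff 1 m[unfolded 1] entry.case m'[unfolded 1] T min_mu_chain using p by auto
    also have "\<dots> <-> mu_type a b h d False False i al j be"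
     using c2[of i j] True i unfolding mu_type_def 1 by simp
    finally show ?thesis .
   next
    case 2
    have "((i, al), (j, be)) : cg n \<Theta> M <-> hat al = hat be & (j, i + 1) : mu_chain b h d &
     ((d = 0 | j < a + h) & (d = 0 | i < b + h) | (d >= 1 & a + h <= j) & (d >= 1 & b + h <= i))"
     unfolding cg_iff 2 m[unfolded 2] entry.case m'[unfolded 2] T min_mu_chain mem_mu_chain using p by auto
    also have "\<dots> <-> mu_type a b h d False False i al j be"
     using c2[of j i] True i unfolding mu_type_def 2 by auto
    finally show ?thesis .
   qed
  qed
  moreover have "mu_type a b h d False False i al j be" if "i = j & al = be" unfolding mu_type_def using that i p by simp
  ultimately show ?thesis by blast
 next
  case False
  then have "((i, al), (j, be)) ~: cg n \<Theta> M" unfolding cg_iff m entry.case M(2) by simp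
  moreover have "~mu_type a b h d False False i al j be" unfolding mu_type_def using False by blast
  ultimately show ?thesis using False i by auto
 qed
next
 case False
 then have m: "M (rank al) i = E_Delta" unfolding M(1) by simp
 have "(i, l) : \<Theta> (rank al) <-> i = l" for l
  using False p(3) T by (cases "rank al = 0") (auto simp: mem_mu_chain le_Suc_eq)
 then have "((i, al), (j, be)) : cg n \<Theta> M <-> i = j & al = be" unfolding cg_iff m entry.case M(2) using p False by auto
 moreover have "~mu_type a b h d False False i al j be" unfolding mu_type_def using False by blast
 ultimately show ?thesis by blast
qed

lemma cg_mu:
 assumes ab: "b + h <= a" "h <= 1" "d = 0 ==> h = 0"
  and T: "\<Theta> 0 = mu_chain b h d" "\<Theta> 1 = mu_chain a h d" "!!s. s >= 2 ==> \<Theta> s = Id"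
  and M: "!!s l. M s l = (if s = 0 & b <= l | s = 1 & a <= l then E_mu else E_Delta)"
 shows "cg n \<Theta> M = reln n (mu_type a b h d False False)"
proof (rule eq_relnI[OF cg_in])
 fix k gm l de assume p: "gm : partitions n" "de : partitions n"
 show "((k, gm), (l, de)) : cg n \<Theta> M <-> k = l & gm = de | mu_type a b h d False False k gm l de"
 proof (cases "rank gm <= 1 & rank de <= 1")
  case True
  then have r: "rank gm = 0 | rank gm = 1" "rank de = 0 | rank de = 1" by linarith+
  have "M (rank gm) k = (if (if rank gm = 0 then b else a) <= k then E_mu else E_Delta)"
   using r(1) by (elim disjE) (simp_all add: M)
  moreover have "M (rank de) l = (if (if rank de = 0 then b else a) <= l then E_mu else E_Delta)"
   using r(2) by (elim disjE) (simp_all add: M)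
  ultimately show ?thesis using cg_mu_low[OF ab T(1,2) _ _ p] True by blast
 next
  case False
  then have 1: "~mu_type a b h d False False k gm l de" unfolding mu_type_def by blast
  show ?thesis
  proof (cases "rank gm >= 2")
   case True
   then have m: "M (rank gm) k = E_Delta" "\<Theta> (rank gm) = Id" by (simp_all add: M T(3))
   have "M (rank de) l = E_Delta" if "gm = de" using True that by (simp add: M)
   then show ?thesis using 1 p unfolding cg_iff m entry.case by blast
  next
   case F: False
   then have "M (rank de) l = E_Delta" "gm ~= de" using False by (auto simp: M)
   then show ?thesis using 1 unfolding cg_iff by (auto split: entry.splits)
  qed
 qed
qed

text \<open>The entry \<open>(1, i)\<close> is isolated by \<open>mu_type_special\<close>, so away
  from it the matrix can be replaced by the matrix \<open>M'\<close> without special entry.\<close>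

lemma cg_mu_special:
 assumes X: "X = E_mu & ~u & ~v | X = E_mu_up & u & ~v | X = E_mu_down & ~u & v"
  and M: "!!s l. M s l = (if s = 1 & l = i then X else if s = 1 & l > i | s = 0 & l >= i then E_mu else E_Delta)"
 shows "cg n (%s. Id) M = reln n (mu_type i i 0 0 u v)"
proof -
 define M' :: entry_matrix where "M' s l = (if s = 0 & i <= l | s = 1 & i <= l then E_mu else E_Delta)" for s l
 have cg': "cg n (%s. Id) M' = reln n (mu_type i i 0 0 False False)"
  by (rule cg_mu) (auto simp: M'_def mu_chain_def)
 show ?thesis
 proof (cases "u | v")
  case False
  then have "M = M'" using X unfolding fun_eq_iff M M'_def by auto
  then show ?thesis using cg' False by simp
 next
  case uv: True
  show ?thesis
  proof (rule eq_relnI[OF cg_in])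
   fix k gm l de assume p: "gm : partitions n" "de : partitions n"
   have MM: "M s l = M' s l" if "~(s = 1 & l = i)" for s l unfolding M M'_def using that by auto
   have X': "M s l = X <-> s = 1 & l = i" for s l using X uv unfolding M by auto
   have mt: "mu_type i i 0 0 u v k gm l de <-> mu_type i i 0 0 False False k gm l de &
     (rank gm = 1 & k = i --> (u --> udom gm = udom de) & (v --> ldom gm = ldom de))"
    unfolding mu_type_def by blast
   show "((k, gm), (l, de)) : cg n (%s. Id) M <-> k = l & gm = de | mu_type i i 0 0 u v k gm l de"
   proof (cases "rank gm = 1 & k = i")
    case True
    have "((k, gm), (l, de)) : cg n (%s. Id) M <-> rank de = 1 & l = i & hat gm = hat de & (u --> udom gm = udom de) & (v --> ldom gm = ldom de)"
    proof -
     have m: "M (rank gm) k = X" using True X' by blast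
     from X uv consider "X = E_mu_up" "u" "~v" | "X = E_mu_down" "~u" "v" by blast
     then show ?thesis
     proof cases
      case 1
      then show ?thesis unfolding cg_iff m using X'[of "rank de" l] p by simp
     next
      case 2
      then show ?thesis unfolding cg_iff m using X'[of "rank de" l] p by simp
     qed
    qed
    moreover have "mu_type i i 0 0 False False k gm l de <-> rank de = 1 & l = i & hat gm = hat de"
     using mu_type_special[of i i 0 0 False False k gm l de] True unfolding mu_type_def by auto
    ultimately show ?thesis using True unfolding mt by auto
   next
    case False
    have "((k, gm), (l, de)) : cg n (%s. Id) M <-> ((k, gm), (l, de)) : cg n (%s. Id) M'"
    proof (cases "rank de = 1 & l = i")
     case True
     have "M (rank gm) k ~= M (rank de) l" using X' True False by metis
     then have 1: "((k, gm), (l, de)) ~: cg n (%s. Id) M" unfolding cg_iff by (auto split: entry.splits)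
     have "~mu_type i i 0 0 False False k gm l de" using mu_type_special[of i i 0 0 False False k gm l de] True False by blast
     moreover have "~(k = l & gm = de)" using True False by blast
     ultimately show ?thesis using 1 unfolding cg' mem_reln by blast
    next
     case F: False
     show ?thesis unfolding cg_iff MM[OF False] MM[OF F] ..
    qed
    then show ?thesis unfolding cg' mem_reln mt using False p by blast
   qed
  qed
 qed
qed

lemma cg_perm_mu:
 assumes T: "\<Theta> = (%s. Id)"
  and M: "M = (%s l. if s = 2 & l >= i then E_N (Sym 2) else if s <= 1 & l >= i then E_mu else E_Delta)"
 shows "cg n \<Theta> M = reln n (%k gm l de. perm_rel n 2 i (%k l \<pi>. k mod 0 = l mod 0 & \<pi> : Sym 2) k gm l de | mu_type i i 0 0 False False k gm l de)"
proof (rule eq_relnI[OF cg_in])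
 fix k gm l de assume p: "gm : partitions n" "de : partitions n"
 let ?P = "perm_rel n 2 i (%k l \<pi>. k mod 0 = l mod 0 & \<pi> : Sym 2) k gm l de"
 show "((k, gm), (l, de)) : cg n \<Theta> M <-> k = l & gm = de | ?P | mu_type i i 0 0 False False k gm l de"
 proof (cases "rank gm <= 1 & rank de <= 1")
  case True
  then have "~?P" unfolding perm_rel_def by auto
  moreover have "((k, gm), (l, de)) : cg n \<Theta> M <-> k = l & gm = de | mu_type i i 0 0 False False k gm l de"
   by (rule cg_mu_low[OF _ _ _ _ _ _ _ p]) (use True in \<open>auto simp: T M mu_chain_def\<close>)
  ultimately show ?thesis by blast
 next
  case False
  then have 1: "~mu_type i i 0 0 False False k gm l de" unfolding mu_type_def by blast
  show ?thesis
  proof (cases "rank gm = 2 & i <= k")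
   case True
   then have m: "M (rank gm) k = E_N (Sym 2)" unfolding M by simp
   have m': "M (rank de) l = E_N (Sym 2) <-> rank de = 2 & i <= l" unfolding M by simp
   have "?P <-> k = l & (EX \<pi>. pdiff n gm de \<pi> & \<pi> : Sym 2)" unfolding perm_rel_def using True by auto
   also have "\<dots> <-> k = l & (gm, de) : green_H (part_monoid n) & diff_perm gm de : Sym 2"
    using pdiff_normal[OF p] normal_Sym[of 2] True by simp
   also have "\<dots> <-> ((k, gm), (l, de)) : cg n \<Theta> M"
    unfolding cg_iff m entry.case m' using p True green_H_rank[of gm de n] by (auto simp: T)
   finally have 2: "?P <-> ((k, gm), (l, de)) : cg n \<Theta> M" .
   have "?P" if "k = l & gm = de" unfolding perm_rel_def using that True pdiff_refl[OF p(1)] permutes_id sym_group_carrier by blast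
   then show ?thesis using 1 2 by blast
  next
   case F: False
   then have 2: "~?P" unfolding perm_rel_def by blast
   have "((k, gm), (l, de)) : cg n \<Theta> M <-> k = l & gm = de"
   proof (cases "rank gm <= 1")
    case True
    then have "rank de >= 2" using False by simp
    then show ?thesis using True p unfolding cg_iff by (auto simp: T M split: if_splits)
   next
    case G: False
    then have "M (rank gm) k = E_Delta" using F unfolding M by auto
    then show ?thesis using p unfolding cg_iff by (auto simp: T)
   qed
   then show ?thesis using 1 2 by blast
  qed
 qed
qed

lemma Alt_2: "Alt 2 = {id}"
proof
 show "Alt 2 \<subseteq> {id}"
 proof
  fix rh :: "nat => nat" assume "rh : Alt 2"
  then have r: "rh permutes {1..2}" "evenperm rh" unfolding alt_group_carrier by blast+
  have K: "{1..2} = {1, 2::nat}" by auto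
  have i: "rh k : {1, 2} <-> k : {1, 2}" for k using permutes_in_image[OF r(1)] unfolding K .
  have ne: "rh 1 ~= rh 2" using permutes_inj[OF r(1)] by (simp add: inj_eq)
  have o: "rh k = k" if "k ~: {1, 2}" for k using r(1) that unfolding K permutes_def by blast
  show "rh : {id}"
  proof (cases "rh 1 = 1")
   case True
   then have "rh 2 = 2" using i[of 2] ne by auto
   then have "rh k = k" for k using True o[of k] by (cases "k : {1, 2}") auto
   then show ?thesis by auto
  next
   case False
   then have a: "rh 1 = 2" using i[of 1] by auto
   then have "rh 2 = 1" using i[of 2] ne by auto
   then have "rh k = transpose 1 2 k" for k using a o[of k] by (cases "k = 1"; cases "k = 2") (auto simp: transpose_apply_other)
   then have "rh = transpose 1 2" by auto
   then show ?thesis using r(2) evenperm_swap[of "1::nat" 2] by simp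
  qed
 qed
 show "{id} \<subseteq> Alt 2" using alt_group_carrier permutes_id evenperm_id by blast
qed

text \<open>Row 2 carries \<open>E_Delta\<close> because \<open>Alt 2\<close> is trivial: the even
  part of the parity rule is equality with levels modulo \<open>2 * d\<close>.\<close>

lemma cgx_perm_mu:
 assumes d: "d >= 1" and T: "\<Theta> = (%s. if s = 2 then nat_cong i (i + 2 * d) else if s <= 1 then nat_cong i (i + d) else Id)"
  and M: "M = (%s l. if s <= 1 & l >= i then E_mu else E_Delta)"
 shows "cgx n 2 \<Theta> M = reln n (%k gm l de. perm_rel n 2 i (sign_levels d) k gm l de | mu_type i i 0 d False False k gm l de)"
proof (rule eq_relnI)
 have d2: "2 * d >= 1" using d by simp
 have x: "exceptional_cong (nat_cong i (i + 2 * d)) = nat_cong i (i + d)" "\<Theta> 2 = nat_cong i (i + 2 * d)"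
  unfolding T using exceptional_cong_nat_cong[OF d] by simp_all
 fix k gm l de
 show "((k, gm), (l, de)) : cgx n 2 \<Theta> M ==> gm : partitions n & de : partitions n"
  unfolding cgx_def using cg_in[of k gm l de] unfolding D_class_def by blast
 assume p: "gm : partitions n" "de : partitions n"
 let ?P = "perm_rel n 2 i (%k l \<pi>. k mod (2 * d) = l mod (2 * d) & \<pi> : Alt 2) k gm l de"
 have P: "?P <-> rank gm = 2 & i <= k & i <= l & k mod (2 * d) = l mod (2 * d) & gm = de"
  unfolding perm_rel_def Alt_2 using pdiff_id_iff[OF p] pdiff_refl[OF p(1)] by blast
 have cg: "((k, gm), (l, de)) : cg n \<Theta> M <-> k = l & gm = de | ?P | mu_type i i 0 d False False k gm l de"
 proof (cases "rank gm <= 1 & rank de <= 1")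
  case True
  then have "~?P" unfolding P by auto
  moreover have "((k, gm), (l, de)) : cg n \<Theta> M <-> k = l & gm = de | mu_type i i 0 d False False k gm l de"
   by (rule cg_mu_low[OF _ _ _ _ _ _ _ p]) (use True d in \<open>auto simp: T M mu_chain_def\<close>)
  ultimately show ?thesis by blast
 next
  case False
  then have 1: "~mu_type i i 0 d False False k gm l de" unfolding mu_type_def by blast
  have "((k, gm), (l, de)) : cg n \<Theta> M <-> k = l & gm = de | ?P"
  proof (cases "rank gm <= 1")
   case True
   then have "rank de >= 2" using False by simp
   then show ?thesis using True p unfolding cg_iff P by (auto simp: M split: if_splits)
  next
   case G: False
   then have "M (rank gm) k = E_Delta" unfolding M by auto
   moreover have "(k, l) : \<Theta> (rank gm) <-> k = l | rank gm = 2 & i <= k & i <= l & k mod (2 * d) = l mod (2 * d)"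
    using G nat_cong_iff[OF d2, of k l i] unfolding T by auto
   ultimately show ?thesis using p G unfolding cg_iff P by (auto simp: M)
  qed
  then show ?thesis using 1 by blast
 qed
 show "((k, gm), (l, de)) : cgx n 2 \<Theta> M <-> k = l & gm = de | perm_rel n 2 i (sign_levels d) k gm l de | mu_type i i 0 d False False k gm l de"
  unfolding cgx_def x Un_iff mem_Collect_eq case_prod_conv perm_rel_sign[OF p d] cg by blast
qed

subsection \<open>The classification\<close>

lemma principal_cong_swap: "principal_cong S x y = principal_cong S y x"
proof -
 have "{\<sigma>. congruence S \<sigma> & (x, y) : \<sigma>} = {\<sigma>. congruence S \<sigma> & (y, x) : \<sigma>}"
  unfolding congruence_def equiv_def sym_def by blast
 then show ?thesis unfolding principal_cong_def by simp
qed

text \<open>Rows up to \<open>n\<close> are inhabited, so the inclusion of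
  \<open>D_twisted n s l\<close> in an ideal can be read off from a single element.\<close>

lemma exists_rank:
 assumes "s <= n" shows "EX gm:partitions n. rank gm = s"
proof
 let ?gm = "lab n (%x. Inl x) (%y. if y <= s then Inl y else Inr ())"
 show "?gm : partitions n" by simp
 have "coords n ?gm {1..s} id (%y. if y <= s then y else 0)"
  unfolding coords_def rel_lab_simps using assms by (auto simp: image_iff)
 then show "rank ?gm = s" using coords_rank[of ?gm n] by simp
qed

lemma lambda_rel_iff:
 "[|al : partitions n; be : partitions n; rank al <= q; rank be <= q|] ==> (al, be) : lambda_rel n q <-> (ALL x y. ll al x y <-> ll be x y)"
 "[|al : partitions n; be : partitions n; rank al <= q; rank be <= q|] ==> (al, be) : rho_rel n q <-> (ALL x y. uu al x y <-> uu be x y)"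
 "[|al : partitions n; be : partitions n; rank al <= q; rank be <= q|] ==> (al, be) : mu_rel n q <-> hat al = hat be"
 "[|al : partitions n; be : partitions n; rank al <= q; rank be <= q|] ==> (al, be) : rees_cong (part_monoid n) (I_ideal n q)"
 unfolding lambda_rel_def rho_rel_def mu_rel_def rees_cong_def I_ideal_def green_L_iff green_R_iff by auto

lemma item_i:
 assumes n: "n >= 1" and a: "al : partitions n"
 shows "principal_cong (twisted_monoid n) (i, al) (i, al) = Id_on (carrier (twisted_monoid n))"
  "principal_cong (twisted_monoid n) (i, al) (i, al) = cg n (%s. Id) (%s l. E_Delta)"
proof -
 have "reln n (%_ _ _ _. False) = Id_on (carrier (twisted_monoid n))"
  unfolding reln_def twisted_monoid_def by auto
 moreover have "cg n (%s. Id) (%s l. E_Delta) = reln n (%_ _ _ _. False)"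
  by (rule eq_relnI, erule cg_in) (auto simp: cg_iff)
 ultimately show "principal_cong (twisted_monoid n) (i, al) (i, al) = Id_on (carrier (twisted_monoid n))"
  "principal_cong (twisted_monoid n) (i, al) (i, al) = cg n (%s. Id) (%s l. E_Delta)"
  using principal_same[OF n a] by simp_all
qed

lemma item_ii:
 assumes n: "n >= 1" and a: "al : partitions n" "i < j"
 shows "principal_cong (twisted_monoid n) (i, al) (j, al) =
  cg n (%s. if s <= rank al then nat_cong i j else Id) (%s l. E_Delta)"
proof -
 have "(k, l) : nat_cong i j" if "k = l" for k l using that unfolding nat_cong_iff'[OF a(2)] by blast
 note * = this
 have "cg n (%s. if s <= rank al then nat_cong i j else Id) (%s l. E_Delta) =
  reln n (%k gm l de. gm = de & rank gm <= rank al & (k, l) : nat_cong i j)"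
  by (rule eq_relnI, erule cg_in) (use * in \<open>auto simp: cg_iff split: if_splits\<close>)
 then show ?thesis using principal_levels[OF n a] by simp
qed

lemma item_iii:
 assumes n: "n >= 1" and ab: "al : partitions n" "be : partitions n" and q: "rank al >= 2" "rank be <= rank al"
  and H: "(al, be) ~: green_H (part_monoid n)"
  and I: "I = I_twisted n (rank al) i \<union> I_twisted n (rank be) j" and M: "M = (%s l. if D_twisted n s l \<subseteq> I then E_R else E_Delta)"
  and m: "m = (%s. LEAST l. M s l = E_R)"
 shows "principal_cong (twisted_monoid n) (i, al) (j, be) = rees_cong (twisted_monoid n) I"
  "principal_cong (twisted_monoid n) (i, al) (j, be) = cg n (%s. if s <= rank al then nat_cong (m s) (m s + 1) else Id) M"
proof -
 define S where "S k s <-> s <= rank al & i <= k | s <= rank be & j <= k" for k s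
 have P: "principal_cong (twisted_monoid n) (i, al) (j, be) = reln n (block_rel False False S)"
  unfolding S_def using principal_rees[OF n ab q H] .
 have mI: "(k, gm) : I <-> S k (rank gm)" if "gm : partitions n" for k gm
  unfolding I I_twisted_def I_ideal_def S_def using that by auto
 have "rees_cong (twisted_monoid n) I = reln n (block_rel False False S)"
 proof (rule eq_relnI)
  show "gm : partitions n & de : partitions n" if "((k, gm), (l, de)) : rees_cong (twisted_monoid n) I" for k gm l de
   using that unfolding rees_cong_def I I_twisted_def I_ideal_def twisted_monoid_def by auto
  show "((k, gm), (l, de)) : rees_cong (twisted_monoid n) I <-> k = l & gm = de | block_rel False False S k gm l de"
   if p: "gm : partitions n" "de : partitions n" for k gm l de
   unfolding rees_cong_def Un_iff mem_Sigma_iff mI[OF p(1)] mI[OF p(2)] block_rel_def twisted_monoid_def using p by auto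
 qed
 then show "principal_cong (twisted_monoid n) (i, al) (j, be) = rees_cong (twisted_monoid n) I" using P by simp
 have Ms: "M s l = (if S l s then E_R else E_Delta)" if s: "s <= n" for s l
 proof -
  obtain gm where g: "gm : partitions n" "rank gm = s" using exists_rank[OF s] by blast
  have "D_twisted n s l \<subseteq> I <-> (ALL gm. gm : partitions n --> rank gm = s --> (l, gm) : I)"
   unfolding D_twisted_def D_class_def by auto
  also have "\<dots> <-> S l s" using g mI by metis
  finally show ?thesis unfolding M by simp
 qed
 have "cg n (%s. if s <= rank al then nat_cong (m s) (m s + 1) else Id) M = reln n (block_rel False False S)"
 proof (rule cg_block[of E_R])
  fix s k l assume h: "s <= n" "~S k s" "~S l s"
  show "(k, l) : (if s <= rank al then nat_cong (m s) (m s + 1) else Id) <-> k = l"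
  proof (cases "s <= rank al")
   case True
   then have "S i s" unfolding S_def by simp
   then have "M s i = E_R" using Ms[OF h(1)] by simp
   \<comment> \<open>The entry at level \<open>i\<close> witnesses that the least index
     exists.\<close>
   then have "M s (m s) = E_R" unfolding m by (rule LeastI)
   then have "S (m s) s" using Ms[OF h(1)] by (auto split: if_splits)
   then have "~m s <= k" using h(2) unfolding S_def by auto
   then show ?thesis using True unfolding if_P[OF True] nat_cong_1 by blast
  qed simp
 qed (use Ms in auto)
 then show "principal_cong (twisted_monoid n) (i, al) (j, be) = cg n (%s. if s <= rank al then nat_cong (m s) (m s + 1) else Id) M"
  using P by simp
qed

lemma item_iv_v:
 assumes n: "n >= 1" and q: "rank al = q" "q >= 3" and H: "(al, be) : green_H (part_monoid n)" and ne: "al ~= be"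
  and N: "N = normal_closure (sym_group q) (diff_perm al be)"
 shows "principal_cong (twisted_monoid n) (i, al) (i, be) = cg n (%s. if s < q then nat_cong i (i + 1) else Id)
   (%s l. if s = q & l >= i then E_N N else if s < q & l >= i then E_R else E_Delta)"
  and "[|i < j; diff_perm al be : Alt q|] ==> principal_cong (twisted_monoid n) (i, al) (j, be) =
   cg n (%s. if s = q then nat_cong i j else if s < q then nat_cong i (i + 1) else Id)
    (%s l. if s = q & l >= i then E_N N else if s < q & l >= i then E_R else E_Delta)"
proof -
 have ab: "al : partitions n" "be : partitions n" using H unfolding green_H_iff by blast+
 note d = pdiff_diff_perm[OF H]
 have id: "diff_perm al be ~= id" using pdiff_id_iff[OF ab d] ne by blast
 have "diff_perm al be permutes {1..q}" using d q unfolding pdiff_def by blast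
 then have NN: "N \<lhd> sym_group q" unfolding N by (rule normal_closure_normal(1))
 have "(%s. if s < q then nat_cong i (i + 1) else Id) = (%s. if s = q then Id else if s < q then nat_cong i (i + 1) else Id)"
  by (auto simp: fun_eq_iff)
 note * = this
 have "cg n (%s. if s < q then nat_cong i (i + 1) else Id)
   (%s l. if s = q & l >= i then E_N N else if s < q & l >= i then E_R else E_Delta) =
  reln n (%k gm l de. perm_rel n q i (%k l \<pi>. k mod 0 = l mod 0 & \<pi> : N) k gm l de | block_rel False False (low_rees q i) k gm l de)"
  by (subst *) (rule cg_perm_rees[OF NN nat_cong_id refl refl])
 then show "principal_cong (twisted_monoid n) (i, al) (i, be) = cg n (%s. if s < q then nat_cong i (i + 1) else Id)
   (%s l. if s = q & l >= i then E_N N else if s < q & l >= i then E_R else E_Delta)"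
  using principal_perm_normal[OF n ab q d id order_refl _ N, of i] by simp
 assume ij: "i < j" and A: "diff_perm al be : Alt q"
 show "principal_cong (twisted_monoid n) (i, al) (j, be) =
   cg n (%s. if s = q then nat_cong i j else if s < q then nat_cong i (i + 1) else Id)
    (%s l. if s = q & l >= i then E_N N else if s < q & l >= i then E_R else E_Delta)"
  using cg_perm_rees[OF NN nat_cong_iff'[OF ij] refl refl] principal_perm_normal[OF n ab q d id less_imp_le[OF ij] disjI2[OF A] N] by simp
qed

lemma item_vi:
 assumes n: "n >= 1" and q: "rank al = q" "q >= 3" and H: "(al, be) : green_H (part_monoid n)"
  and A: "diff_perm al be ~: Alt q" and ij: "i < j" and d: "d = j - i"
 shows "principal_cong (twisted_monoid n) (i, al) (j, be) =
   cgx n q (%s. if s = q then nat_cong i (i + 2 * d) else if s < q then nat_cong i (i + 1) else Id)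
   (%s l. if s = q & l >= i then E_N (Alt q) else if s < q & l >= i then E_R else E_Delta)"
proof -
 have ab: "al : partitions n" "be : partitions n" using H unfolding green_H_iff by blast+
 have "d >= 1" using ij d by simp
 then show ?thesis using cgx_perm_rees[OF _ refl refl] principal_perm_sign[OF n ab q pdiff_diff_perm[OF H] A ij] unfolding d by simp
qed

lemma item_vii_viii:
 assumes n: "n >= 1" and q: "rank al = 2" and H: "(al, be) : green_H (part_monoid n)" and ne: "al ~= be"
 shows "principal_cong (twisted_monoid n) (i, al) (i, be) =
   cg n (%s. Id) (%s l. if s = 2 & l >= i then E_N (Sym 2) else if s <= 1 & l >= i then E_mu else E_Delta)"
  and "[|i < j; d = j - i|] ==> principal_cong (twisted_monoid n) (i, al) (j, be) =
   cgx n 2 (%s. if s = 2 then nat_cong i (i + 2 * d) else if s <= 1 then nat_cong i (i + d) else Id)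
   (%s l. if s <= 1 & l >= i then E_mu else E_Delta)"
proof -
 have ab: "al : partitions n" "be : partitions n" using H unfolding green_H_iff by blast+
 note d = pdiff_diff_perm[OF H]
 have id: "diff_perm al be ~= id" using pdiff_id_iff[OF ab d] ne by blast
 note P = principal_rank_2[OF n ab q d id]
 show "principal_cong (twisted_monoid n) (i, al) (i, be) =
   cg n (%s. Id) (%s l. if s = 2 & l >= i then E_N (Sym 2) else if s <= 1 & l >= i then E_mu else E_Delta)"
  unfolding P(1) by (rule cg_perm_mu[OF refl refl, symmetric])
 assume ij: "i < j" "d = j - i"
 have "d >= 1" using ij by simp
 then show "principal_cong (twisted_monoid n) (i, al) (j, be) =
   cgx n 2 (%s. if s = 2 then nat_cong i (i + 2 * d) else if s <= 1 then nat_cong i (i + d) else Id)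
   (%s l. if s <= 1 & l >= i then E_mu else E_Delta)"
  unfolding P(2)[OF ij(1)] ij(2)[symmetric] by (rule cgx_perm_mu[OF _ refl refl, symmetric])
qed

text \<open>The differences of the Rees, \<open>\<lambda>\<close> and \<open>\<rho>\<close>
  relations only record which of the two kernels agree; this form serves rows 0 and 1 alike.\<close>

definition kind :: "partition => partition => entry => bool" where
 "kind al be X <-> (let u = (ALL x y. uu al x y <-> uu be x y); v = (ALL x y. ll al x y <-> ll be x y) in
   X = E_R & ~u & ~v | X = E_lambda & ~u & v | X = E_rho & u & ~v)"

lemma kind_1:
 assumes ab: "al : partitions n" "be : partitions n" "rank al <= 1" "rank be <= 1"
 shows "((al, be) : rees_cong (part_monoid n) (I_ideal n 1) - (lambda_rel n 1 \<union> rho_rel n 1) & X = E_R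
     | (al, be) : lambda_rel n 1 - mu_rel n 1 & X = E_lambda
     | (al, be) : rho_rel n 1 - mu_rel n 1 & X = E_rho) <-> kind al be X"
 unfolding Diff_iff Un_iff lambda_rel_iff[OF ab] hat_eq_iff[OF ab(1,2)] kind_def Let_def using lambda_rel_iff(4)[OF ab] by blast

lemma kind_0:
 assumes ab: "al : partitions n" "be : partitions n" "rank al <= 0" "rank be <= 0"
 shows "((al, be) : rees_cong (part_monoid n) (I_ideal n 0) - (lambda_rel n 0 \<union> rho_rel n 0) & X = E_R
     | (al, be) : lambda_rel n 0 - Id_on (D_class n 0) & X = E_lambda
     | (al, be) : rho_rel n 0 - Id_on (D_class n 0) & X = E_rho) <-> kind al be X"
proof -
 have "(al, be) : Id_on (D_class n 0) <-> al = be" using ab unfolding D_class_def by auto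
 also have "\<dots> <-> hat al = hat be" using hat_rank_0 ab by (metis le_zero_eq)
 finally have 1: "(al, be) : Id_on (D_class n 0) <-> hat al = hat be" .
 show ?thesis
  unfolding Diff_iff Un_iff 1 lambda_rel_iff[OF ab] hat_eq_iff[OF ab(1,2)] kind_def Let_def using lambda_rel_iff(4)[OF ab] by blast
qed

lemma principal_kind:
 assumes n: "n >= 1" and ab: "al : partitions n" "be : partitions n" and q: "rank al <= 1" "rank be <= rank al" "rank be = rank al ==> i <= j"
  and X: "kind al be X"
  and M: "!!s l. M s l = (if low_region (rank al) i j l s then X else E_Delta)"
  and T: "!!s k l. [|~low_region (rank al) i j k s; ~low_region (rank al) i j l s|] ==> (k, l) : \<Theta> s <-> k = l"
 shows "principal_cong (twisted_monoid n) (i, al) (j, be) = cg n \<Theta> M"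
proof -
 define u v where "u <-> (ALL x y. uu al x y <-> uu be x y)" and "v <-> (ALL x y. ll al x y <-> ll be x y)"
 have X': "X = E_R & ~u & ~v | X = E_lambda & ~u & v | X = E_rho & u & ~v"
  using X unfolding kind_def Let_def u_def[symmetric] v_def[symmetric] .
 then have uv: "~(u & v)" by blast
 have "principal_cong (twisted_monoid n) (i, al) (j, be) = reln n (block_rel u v (low_region (rank al) i j))"
  by (rule principal_low[OF n ab q u_def v_def uv])
 also have "\<dots> = cg n \<Theta> M" by (rule cg_block[OF X' M T, symmetric])
 finally show ?thesis .
qed

lemma item_ix:
 assumes n: "n >= 1" and ab: "al : partitions n" "be : partitions n" and q: "rank al = 1" "rank be <= 1" and ij: "i <= j" and X: "kind al be X"
 shows "principal_cong (twisted_monoid n) (i, al) (j, be) =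
  cg n (%s. if s <= 1 then nat_cong i (i + 1) else Id) (%s l. if s <= 1 & l >= i then X else E_Delta)"
proof -
 have L: "low_region (rank al) i j l s <-> s <= 1 & i <= l" for l s unfolding low_region_def q(1) using ij by auto
 show ?thesis
 proof (rule principal_kind[OF n ab _ _ _ X])
  show "(k, l) : (if s <= 1 then nat_cong i (i + 1) else Id) <-> k = l" if "~low_region (rank al) i j k s" "~low_region (rank al) i j l s" for s k l
   using that nat_cong_1[of k l i] nat_cong_1[of k l j] unfolding L by auto
 qed (use q ij in \<open>auto simp: low_region_def min_def\<close>)
qed

lemma item_x:
 assumes n: "n >= 1" and ab: "al : partitions n" "be : partitions n" and q: "rank al = 1" "rank be = 0" and ij: "i > j" and X: "kind al be X"
 shows "principal_cong (twisted_monoid n) (i, al) (j, be) =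
  cg n (%s. if s = 1 then nat_cong i (i + 1) else if s = 0 then nat_cong j (j + 1) else Id)
   (%s l. if s = 1 & l >= i | s = 0 & l >= j then X else E_Delta)"
proof -
 have L: "low_region (rank al) i j l s <-> s = 1 & l >= i | s = 0 & l >= j" for l s unfolding low_region_def q(1) using ij by auto
 show ?thesis
 proof (rule principal_kind[OF n ab _ _ _ X])
  show "(k, l) : (if s = 1 then nat_cong i (i + 1) else if s = 0 then nat_cong j (j + 1) else Id) <-> k = l" if "~low_region (rank al) i j k s" "~low_region (rank al) i j l s" for s k l
   using that nat_cong_1[of k l i] nat_cong_1[of k l j] unfolding L by auto
 qed (use q ij in \<open>auto simp: low_region_def min_def\<close>)
qed

lemma item_xi:
 assumes n: "n >= 1" and ab: "al : partitions n" "be : partitions n" and q: "rank al = 0" "rank be = 0" and ij: "i <= j" and X: "kind al be X"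
 shows "principal_cong (twisted_monoid n) (i, al) (j, be) =
  cg n (%s. if s = 0 then nat_cong i (i + 1) else Id) (%s l. if s = 0 & l >= i then X else E_Delta)"
proof -
 have L: "low_region (rank al) i j l s <-> s = 0 & l >= i" for l s unfolding low_region_def q(1) using ij by auto
 show ?thesis
 proof (rule principal_kind[OF n ab _ _ _ X])
  show "(k, l) : (if s = 0 then nat_cong i (i + 1) else Id) <-> k = l" if "~low_region (rank al) i j k s" "~low_region (rank al) i j l s" for s k l
   using that nat_cong_1[of k l i] nat_cong_1[of k l j] unfolding L by auto
 qed (use q ij in \<open>auto simp: low_region_def min_def\<close>)
qed

text \<open>For equal hats and rank 1, being R- or L-related amounts to having the same upper or
  lower domain.\<close>

definition mu_kind :: "partition => partition => entry => bool" where
 "mu_kind al be X <-> (let u = (udom al = udom be); v = (ldom al = ldom be) in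
   X = E_mu & ~u & ~v | X = E_mu_up & u & ~v | X = E_mu_down & ~u & v)"

lemma mu_kind_iff:
 assumes ab: "al : partitions n" "be : partitions n" "rank al = 1" "rank be = 1"
 shows "((al, be) : mu_rel n 1 - (mu_up_rel n \<union> mu_down_rel n) & X = E_mu
     | (al, be) : mu_up_rel n - Id_on (D_class n 1) & X = E_mu_up
     | (al, be) : mu_down_rel n - Id_on (D_class n 1) & X = E_mu_down) <-> hat al = hat be & mu_kind al be X"
  "(al, be) : mu_rel n 1 - Id_on (D_class n 1) <-> hat al = hat be & al ~= be"
proof -
 have r: "rank al <= 1" "rank be <= 1" using ab by simp_all
 have D: "al : D_class n 1" "be : D_class n 1" unfolding D_class_def using ab by simp_all
 have m: "(al, be) : mu_rel n 1 <-> hat al = hat be" by (rule lambda_rel_iff(3)[OF ab(1,2) r])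
 have u: "(al, be) : mu_up_rel n <-> hat al = hat be & udom al = udom be"
  "(al, be) : mu_down_rel n <-> hat al = hat be & ldom al = ldom be"
  unfolding mu_up_rel_def mu_down_rel_def green_R_iff green_L_iff using D ab hat_eq_iff[OF ab(1,2)] by auto
 have i: "(al, be) : Id_on (D_class n 1) <-> al = be" using D by auto
 have e: "al = be <-> hat al = hat be & udom al = udom be & ldom al = ldom be"
  using rank_1_eqI[OF ab(1,2) r] hat_eq_iff[OF ab(1,2)] by blast
 show "((al, be) : mu_rel n 1 - (mu_up_rel n \<union> mu_down_rel n) & X = E_mu
     | (al, be) : mu_up_rel n - Id_on (D_class n 1) & X = E_mu_up
     | (al, be) : mu_down_rel n - Id_on (D_class n 1) & X = E_mu_down) <-> hat al = hat be & mu_kind al be X"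
  unfolding Diff_iff Un_iff i m u mu_kind_def Let_def using e by argo
 show "(al, be) : mu_rel n 1 - Id_on (D_class n 1) <-> hat al = hat be & al ~= be" unfolding Diff_iff i m ..
qed

lemma item_xii:
 assumes n: "n >= 1" and ab: "al : partitions n" "be : partitions n" "rank al = 1" "rank be = 1" "hat al = hat be" and X: "mu_kind al be X"
 shows "principal_cong (twisted_monoid n) (i, al) (i, be) =
  cg n (%s. Id) (%s l. if s = 1 & l = i then X else if s = 1 & l > i | s = 0 & l >= i then E_mu else E_Delta)"
proof -
 define u v where "u <-> udom al = udom be" and "v <-> ldom al = ldom be"
 have X': "X = E_mu & ~u & ~v | X = E_mu_up & u & ~v | X = E_mu_down & ~u & v"
  using X unfolding mu_kind_def Let_def u_def[symmetric] v_def[symmetric] .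
 then have uv: "~(u & v)" by blast
 show ?thesis unfolding principal_mu_level[OF n ab u_def v_def uv] by (rule cg_mu_special[OF X' refl, symmetric])
qed

lemma item_xiii:
 assumes n: "n >= 1" and ab: "al : partitions n" "be : partitions n" "rank al = 1" "rank be = 1" "hat al = hat be" "al ~= be" and ij: "i < j"
 shows "principal_cong (twisted_monoid n) (i, al) (j, be) =
  cg n (%s. if s <= 1 then nat_cong i j else Id) (%s l. if s <= 1 & l >= i then E_mu else E_Delta)"
 unfolding principal_mu_levels[OF n ab ij]
 by (rule cg_mu[symmetric]) (use ij in \<open>auto simp: mu_chain_def\<close>)

lemma item_xiv_xv_xvi:
 assumes n: "n >= 1" and ab: "al : partitions n" "rank al = 1"
 shows "i <= j ==> principal_cong (twisted_monoid n) (i, al) (j, hat al) =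
   cg n (%s. if s <= 1 then nat_cong i (j + 1) else Id) (%s l. if s <= 1 & l >= i then E_mu else E_Delta)"
  and "i = j + 1 ==> principal_cong (twisted_monoid n) (i, al) (j, hat al) =
   cg n (%s. Id) (%s l. if s = 1 & l >= i | s = 0 & l >= j then E_mu else E_Delta)"
  and "[|i > j + 1; d = i - j - 1|] ==> principal_cong (twisted_monoid n) (i, al) (j, hat al) =
   cg n (%s. if s = 1 then nat_cong (i + 1) (i + 1 + d) else if s = 0 then nat_cong (j + 1) (j + 1 + d) else Id)
    (%s l. if s = 1 & l >= i | s = 0 & l >= j then E_mu else E_Delta)"
proof -
 note P = principal_mu_hat[OF n ab refl refl refl]
 { assume ij: "i <= j"
  have p: "principal_cong (twisted_monoid n) (i, al) (j, hat al) = reln n (mu_type i i 0 (j + 1 - i) False False)"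
   using P[of i j] ij by simp
  show "principal_cong (twisted_monoid n) (i, al) (j, hat al) =
   cg n (%s. if s <= 1 then nat_cong i (j + 1) else Id) (%s l. if s <= 1 & l >= i then E_mu else E_Delta)"
   unfolding p by (rule cg_mu[symmetric]) (use ij in \<open>auto simp: mu_chain_def\<close>) }
 { assume ij: "i = j + 1"
  have p: "principal_cong (twisted_monoid n) (i, al) (j, hat al) = reln n (mu_type i j 0 0 False False)"
   using P[of i j] ij by simp
  show "principal_cong (twisted_monoid n) (i, al) (j, hat al) =
   cg n (%s. Id) (%s l. if s = 1 & l >= i | s = 0 & l >= j then E_mu else E_Delta)"
   unfolding p by (rule cg_mu[symmetric]) (use ij in \<open>auto simp: mu_chain_def\<close>) }
 { assume ij: "i > j + 1" "d = i - j - 1"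
  have p: "principal_cong (twisted_monoid n) (i, al) (j, hat al) = reln n (mu_type i j 1 d False False)"
   using P[of i j] ij by simp
  show "principal_cong (twisted_monoid n) (i, al) (j, hat al) =
   cg n (%s. if s = 1 then nat_cong (i + 1) (i + 1 + d) else if s = 0 then nat_cong (j + 1) (j + 1 + d) else Id)
    (%s l. if s = 1 & l >= i | s = 0 & l >= j then E_mu else E_Delta)"
   unfolding p by (rule cg_mu[symmetric]) (use ij in \<open>auto simp: mu_chain_def\<close>) }
qed

text \<open>From rank 2 on, H-relatedness and the order of the levels decide. Below, the hats
  decide: if they differ, so does a kernel and \<open>kind\<close> applies; if they agree, either
  both ranks are 1 and \<open>mu_kind\<close> applies, or \<open>be\<close> is the hat of
  \<open>al\<close>.\<close>

lemma exhaustion: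
 fixes i j :: nat
 assumes ab: "al : partitions n" "be : partitions n" and o: "rank al > rank be | rank al = rank be & i <= j"
 shows "(al = be & i = j
    | al = be & i < j
    | rank al >= 2 & (al, be) ~: green_H (part_monoid n)
    | rank al >= 3 & i = j & (al, be) : green_H (part_monoid n) & al ~= be
    | rank al >= 3 & i < j & (al, be) : green_H (part_monoid n) & diff_perm al be : Alt (rank al) - {id}
    | rank al >= 3 & i < j & (al, be) : green_H (part_monoid n) & diff_perm al be ~: Alt (rank al)
    | rank al = 2 & i = j & (al, be) : green_H (part_monoid n) & al ~= be
    | rank al = 2 & i < j & (al, be) : green_H (part_monoid n) & al ~= be
    | rank al = 1 & i <= j &
      ((al, be) : rees_cong (part_monoid n) (I_ideal n 1) - (lambda_rel n 1 \<union> rho_rel n 1)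
       | (al, be) : lambda_rel n 1 - mu_rel n 1 | (al, be) : rho_rel n 1 - mu_rel n 1)
    | rank al = 1 & rank be = 0 & i > j &
      ((al, be) : rees_cong (part_monoid n) (I_ideal n 1) - (lambda_rel n 1 \<union> rho_rel n 1)
       | (al, be) : lambda_rel n 1 - mu_rel n 1 | (al, be) : rho_rel n 1 - mu_rel n 1)
    | rank al = 0 & i <= j &
      ((al, be) : rees_cong (part_monoid n) (I_ideal n 0) - (lambda_rel n 0 \<union> rho_rel n 0)
       | (al, be) : lambda_rel n 0 - Id_on (D_class n 0)
       | (al, be) : rho_rel n 0 - Id_on (D_class n 0))
    | rank al = 1 & rank be = 1 & i = j &
      ((al, be) : mu_rel n 1 - (mu_up_rel n \<union> mu_down_rel n)
       | (al, be) : mu_up_rel n - Id_on (D_class n 1)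
       | (al, be) : mu_down_rel n - Id_on (D_class n 1))
    | rank al = 1 & rank be = 1 & i < j & (al, be) : mu_rel n 1 - Id_on (D_class n 1)
    | rank al = 1 & rank be = 0 & i <= j & hat al = be
    | rank al = 1 & rank be = 0 & i = j + 1 & hat al = be
    | rank al = 1 & rank be = 0 & i > j + 1 & hat al = be)"
proof (cases "al = be")
 case True
 then have "i <= j" using o by simp
 then have "i = j | i < j" by linarith
 then show ?thesis using True by metis
next
 case ne: False
 consider "rank al >= 3" | "rank al = 2" | "rank al = 1" | "rank al = 0" by linarith
 then show ?thesis
 proof cases
  case 1
  show ?thesis
  proof (cases "(al, be) : green_H (part_monoid n)")
   case True
   then have "i <= j" using o green_H_rank[OF True] by simp
   then consider "i = j" | "i < j" by linarith
   then show ?thesis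
   proof cases
    case 1
    then show ?thesis using True \<open>rank al >= 3\<close> ne by metis
   next
    case 2
    have "diff_perm al be ~= id" using pdiff_id_iff[OF ab pdiff_diff_perm[OF True]] ne by blast
    then have "diff_perm al be : Alt (rank al) - {id} | diff_perm al be ~: Alt (rank al)" by blast
    then show ?thesis using True \<open>rank al >= 3\<close> 2 by metis
   qed
  next
   case False
   have "rank al >= 2" using 1 by simp
   then show ?thesis using False by metis
  qed
 next
  case 2
  show ?thesis
  proof (cases "(al, be) : green_H (part_monoid n)")
   case True
   then have "i <= j" using o green_H_rank[OF True] by simp
   then have "i = j | i < j" by linarith
   then show ?thesis using True 2 ne by metis
  next
   case False
   have "rank al >= 2" using 2 by simp
   then show ?thesis using False by metis
  qed
 next
  case q: 3
  have r: "rank al <= 1" "rank be <= 1" using q o by auto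
  show ?thesis
  proof (cases "hat al = hat be")
   case True
   consider "rank be = 1" "i <= j" | "rank be = 0" using q o by linarith
   then show ?thesis
   proof cases
    case 1
    have e: "~(udom al = udom be & ldom al = ldom be)" using rank_1_eqI[OF ab r] hat_eq_iff[OF ab] True ne by blast
    then have "EX X. mu_kind al be X" unfolding mu_kind_def Let_def by blast
    then have m: "(al, be) : mu_rel n 1 - (mu_up_rel n \<union> mu_down_rel n) | (al, be) : mu_up_rel n - Id_on (D_class n 1)
       | (al, be) : mu_down_rel n - Id_on (D_class n 1)" using mu_kind_iff(1)[OF ab q 1(1)] True by metis
    have m': "(al, be) : mu_rel n 1 - Id_on (D_class n 1)" using mu_kind_iff(2)[OF ab q 1(1)] True ne by blast
    have "i = j | i < j" using 1(2) by linarith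
    then show ?thesis using m m' q 1(1) by metis
   next
    case 2
    then have "hat al = be" using hat_rank_0[OF ab(2)] True by simp
    moreover have "i <= j | i = j + 1 | i > j + 1" by linarith
    ultimately show ?thesis using q 2 by metis
   qed
  next
   case False
   then have "EX X. kind al be X" unfolding hat_eq_iff[OF ab] kind_def Let_def by blast
   then have k: "(al, be) : rees_cong (part_monoid n) (I_ideal n 1) - (lambda_rel n 1 \<union> rho_rel n 1)
       | (al, be) : lambda_rel n 1 - mu_rel n 1 | (al, be) : rho_rel n 1 - mu_rel n 1" using kind_1[OF ab r] by metis
   have "i <= j | rank be = 0 & i > j" using q o by linarith
   then show ?thesis using k q by metis
  qed
 next
  case q: 4
  then have r: "rank al <= 0" "rank be <= 0" "i <= j" using o by auto
  have "hat al ~= hat be" using hat_rank_0 ab ne r by (metis le_zero_eq)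
  then have "EX X. kind al be X" unfolding hat_eq_iff[OF ab] kind_def Let_def by blast
  then have k: "(al, be) : rees_cong (part_monoid n) (I_ideal n 0) - (lambda_rel n 0 \<union> rho_rel n 0)
       | (al, be) : lambda_rel n 0 - Id_on (D_class n 0) | (al, be) : rho_rel n 0 - Id_on (D_class n 0)"
   using kind_0[OF ab r(1,2)] by metis
  then show ?thesis using q r(3) by metis
 qed
qed

theorem theorem5p2:
  fixes n :: nat
  assumes "n \<ge> 1"
  shows
   "(\<forall>i \<alpha> j \<beta>. \<forall>q r C.
       \<alpha> \<in> partitions n \<and> \<beta> \<in> partitions n \<and> q = rank \<alpha> \<and> r = rank \<beta> \<and>
       (q > r \<or> q = r \<and> i \<le> j) \<and>
       C = principal_cong (twisted_monoid n) (i, \<alpha>) (j, \<beta>) \<longrightarrow>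
    \<comment> \<open>(i)\<close>
     (\<alpha> = \<beta> \<and> i = j \<longrightarrow>
        C = Id_on (carrier (twisted_monoid n)) \<and>
        C = cg n (\<lambda>s. Id) (\<lambda>s l. E_Delta)) \<and>
    \<comment> \<open>(ii)\<close>
     (\<alpha> = \<beta> \<and> i < j \<longrightarrow>
        C = cg n (\<lambda>s. if s \<le> q then nat_cong i j else Id) (\<lambda>s l. E_Delta)) \<and>
    \<comment> \<open>(iii)\<close>
     (q \<ge> 2 \<and> (\<alpha>, \<beta>) \<notin> green_H (part_monoid n) \<longrightarrow>
        (let I = I_twisted n q i \<union> I_twisted n r j;
             M = (\<lambda>s l. if D_twisted n s l \<subseteq> I then E_R else E_Delta);
             m = (\<lambda>s. LEAST l. M s l = E_R)
         in C = rees_cong (twisted_monoid n) I \<and>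
            C = cg n (\<lambda>s. if s \<le> q then nat_cong (m s) (m s + 1) else Id) M)) \<and>
    \<comment> \<open>(iv)\<close>
     (q \<ge> 3 \<and> i = j \<and> (\<alpha>, \<beta>) \<in> green_H (part_monoid n) \<and> \<alpha> \<noteq> \<beta> \<longrightarrow>
        (let N = normal_closure (sym_group q) (diff_perm \<alpha> \<beta>)
         in C = cg n
              (\<lambda>s. if s < q then nat_cong i (i + 1) else Id)
              (\<lambda>s l. if s = q \<and> l \<ge> i then E_N N else if s < q \<and> l \<ge> i then E_R else E_Delta))) \<and>
    \<comment> \<open>(v)\<close>
     (q \<ge> 3 \<and> i < j \<and> (\<alpha>, \<beta>) \<in> green_H (part_monoid n) \<and> diff_perm \<alpha> \<beta> \<in> Alt q - {id} \<longrightarrow>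
        (let N = normal_closure (sym_group q) (diff_perm \<alpha> \<beta>)
         in C = cg n
              (\<lambda>s. if s = q then nat_cong i j else if s < q then nat_cong i (i + 1) else Id)
              (\<lambda>s l. if s = q \<and> l \<ge> i then E_N N else if s < q \<and> l \<ge> i then E_R else E_Delta))) \<and>
    \<comment> \<open>(vi)\<close>
     (q \<ge> 3 \<and> i < j \<and> (\<alpha>, \<beta>) \<in> green_H (part_monoid n) \<and> diff_perm \<alpha> \<beta> \<notin> Alt q \<longrightarrow>
        (let d = j - i
         in C = cgx n q
              (\<lambda>s. if s = q then nat_cong i (i + 2 * d) else if s < q then nat_cong i (i + 1) else Id)
              (\<lambda>s l. if s = q \<and> l \<ge> i then E_N (Alt q)
                     else if s < q \<and> l \<ge> i then E_R else E_Delta))) \<and>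
    \<comment> \<open>(vii)\<close>
     (q = 2 \<and> i = j \<and> (\<alpha>, \<beta>) \<in> green_H (part_monoid n) \<and> \<alpha> \<noteq> \<beta> \<longrightarrow>
        C = cg n
              (\<lambda>s. Id)
              (\<lambda>s l. if s = 2 \<and> l \<ge> i then E_N (Sym 2) else if s \<le> 1 \<and> l \<ge> i then E_mu else E_Delta)) \<and>
    \<comment> \<open>(viii)\<close>
     (q = 2 \<and> i < j \<and> (\<alpha>, \<beta>) \<in> green_H (part_monoid n) \<and> \<alpha> \<noteq> \<beta> \<longrightarrow>
        (let d = j - i
         in C = cgx n 2
              (\<lambda>s. if s = 2 then nat_cong i (i + 2 * d) else if s \<le> 1 then nat_cong i (i + d) else Id)
              (\<lambda>s l. if s \<le> 1 \<and> l \<ge> i then E_mu else E_Delta))) \<and>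
    \<comment> \<open>(ix)\<close>
     (\<forall>\<xi>. q = 1 \<and> i \<le> j \<and>
        ((\<alpha>, \<beta>) \<in> rees_cong (part_monoid n) (I_ideal n 1) - (lambda_rel n 1 \<union> rho_rel n 1) \<and> \<xi> = E_R
         \<or> (\<alpha>, \<beta>) \<in> lambda_rel n 1 - mu_rel n 1 \<and> \<xi> = E_lambda
         \<or> (\<alpha>, \<beta>) \<in> rho_rel n 1 - mu_rel n 1 \<and> \<xi> = E_rho) \<longrightarrow>
        C = cg n
              (\<lambda>s. if s \<le> 1 then nat_cong i (i + 1) else Id)
              (\<lambda>s l. if s \<le> 1 \<and> l \<ge> i then \<xi> else E_Delta)) \<and>
    \<comment> \<open>(x)\<close>
     (\<forall>\<xi>. q = 1 \<and> r = 0 \<and> i > j \<and>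
        ((\<alpha>, \<beta>) \<in> rees_cong (part_monoid n) (I_ideal n 1) - (lambda_rel n 1 \<union> rho_rel n 1) \<and> \<xi> = E_R
         \<or> (\<alpha>, \<beta>) \<in> lambda_rel n 1 - mu_rel n 1 \<and> \<xi> = E_lambda
         \<or> (\<alpha>, \<beta>) \<in> rho_rel n 1 - mu_rel n 1 \<and> \<xi> = E_rho) \<longrightarrow>
        C = cg n
              (\<lambda>s. if s = 1 then nat_cong i (i + 1) else if s = 0 then nat_cong j (j + 1) else Id)
              (\<lambda>s l. if s = 1 \<and> l \<ge> i \<or> s = 0 \<and> l \<ge> j then \<xi> else E_Delta)) \<and>
    \<comment> \<open>(xi)\<close>
     (\<forall>\<xi>. q = 0 \<and> i \<le> j \<and>
        ((\<alpha>, \<beta>) \<in> rees_cong (part_monoid n) (I_ideal n 0) - (lambda_rel n 0 \<union> rho_rel n 0) \<and> \<xi> = E_R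
         \<or> (\<alpha>, \<beta>) \<in> lambda_rel n 0 - Id_on (D_class n 0) \<and> \<xi> = E_lambda
         \<or> (\<alpha>, \<beta>) \<in> rho_rel n 0 - Id_on (D_class n 0) \<and> \<xi> = E_rho) \<longrightarrow>
        C = cg n
              (\<lambda>s. if s = 0 then nat_cong i (i + 1) else Id)
              (\<lambda>s l. if s = 0 \<and> l \<ge> i then \<xi> else E_Delta)) \<and>
    \<comment> \<open>(xii)\<close>
     (\<forall>\<zeta>. q = 1 \<and> r = 1 \<and> i = j \<and>
        ((\<alpha>, \<beta>) \<in> mu_rel n 1 - (mu_up_rel n \<union> mu_down_rel n) \<and> \<zeta> = E_mu
         \<or> (\<alpha>, \<beta>) \<in> mu_up_rel n - Id_on (D_class n 1) \<and> \<zeta> = E_mu_up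
         \<or> (\<alpha>, \<beta>) \<in> mu_down_rel n - Id_on (D_class n 1) \<and> \<zeta> = E_mu_down) \<longrightarrow>
        C = cg n
              (\<lambda>s. Id)
              (\<lambda>s l. if s = 1 \<and> l = i then \<zeta>
                     else if s = 1 \<and> l > i \<or> s = 0 \<and> l \<ge> i then E_mu else E_Delta)) \<and>
    \<comment> \<open>(xiii)\<close>
     (q = 1 \<and> r = 1 \<and> i < j \<and> (\<alpha>, \<beta>) \<in> mu_rel n 1 - Id_on (D_class n 1) \<longrightarrow>
        C = cg n
              (\<lambda>s. if s \<le> 1 then nat_cong i j else Id)
              (\<lambda>s l. if s \<le> 1 \<and> l \<ge> i then E_mu else E_Delta)) \<and>
    \<comment> \<open>(xiv)\<close>
     (q = 1 \<and> r = 0 \<and> i \<le> j \<and> hat \<alpha> = \<beta> \<longrightarrow>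
        C = cg n
              (\<lambda>s. if s \<le> 1 then nat_cong i (j + 1) else Id)
              (\<lambda>s l. if s \<le> 1 \<and> l \<ge> i then E_mu else E_Delta)) \<and>
    \<comment> \<open>(xv)\<close>
     (q = 1 \<and> r = 0 \<and> i = j + 1 \<and> hat \<alpha> = \<beta> \<longrightarrow>
        C = cg n
              (\<lambda>s. Id)
              (\<lambda>s l. if s = 1 \<and> l \<ge> i \<or> s = 0 \<and> l \<ge> j then E_mu else E_Delta)) \<and>
    \<comment> \<open>(xvi)\<close>
     (q = 1 \<and> r = 0 \<and> i > j + 1 \<and> hat \<alpha> = \<beta> \<longrightarrow>
        (let d = i - j - 1
         in C = cg n
              (\<lambda>s. if s = 1 then nat_cong (i + 1) (i + 1 + d)
                   else if s = 0 then nat_cong (j + 1) (j + 1 + d) else Id)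
              (\<lambda>s l. if s = 1 \<and> l \<ge> i \<or> s = 0 \<and> l \<ge> j then E_mu else E_Delta)))) \<and>
    \<comment> \<open>every principal congruence is one of those described in (i)--(xvi)\<close>
    (\<forall>a \<in> carrier (twisted_monoid n). \<forall>b \<in> carrier (twisted_monoid n).
      \<exists>i \<alpha> j \<beta> q r.
       \<alpha> \<in> partitions n \<and> \<beta> \<in> partitions n \<and> q = rank \<alpha> \<and> r = rank \<beta> \<and>
       (q > r \<or> q = r \<and> i \<le> j) \<and>
       principal_cong (twisted_monoid n) a b = principal_cong (twisted_monoid n) (i, \<alpha>) (j, \<beta>) \<and>
       (\<alpha> = \<beta> \<and> i = j
        \<or> \<alpha> = \<beta> \<and> i < j
        \<or> q \<ge> 2 \<and> (\<alpha>, \<beta>) \<notin> green_H (part_monoid n)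
        \<or> q \<ge> 3 \<and> i = j \<and> (\<alpha>, \<beta>) \<in> green_H (part_monoid n) \<and> \<alpha> \<noteq> \<beta>
        \<or> q \<ge> 3 \<and> i < j \<and> (\<alpha>, \<beta>) \<in> green_H (part_monoid n) \<and> diff_perm \<alpha> \<beta> \<in> Alt q - {id}
        \<or> q \<ge> 3 \<and> i < j \<and> (\<alpha>, \<beta>) \<in> green_H (part_monoid n) \<and> diff_perm \<alpha> \<beta> \<notin> Alt q
        \<or> q = 2 \<and> i = j \<and> (\<alpha>, \<beta>) \<in> green_H (part_monoid n) \<and> \<alpha> \<noteq> \<beta>
        \<or> q = 2 \<and> i < j \<and> (\<alpha>, \<beta>) \<in> green_H (part_monoid n) \<and> \<alpha> \<noteq> \<beta>
        \<or> q = 1 \<and> i \<le> j \<and>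
            ((\<alpha>, \<beta>) \<in> rees_cong (part_monoid n) (I_ideal n 1) - (lambda_rel n 1 \<union> rho_rel n 1)
             \<or> (\<alpha>, \<beta>) \<in> lambda_rel n 1 - mu_rel n 1 \<or> (\<alpha>, \<beta>) \<in> rho_rel n 1 - mu_rel n 1)
        \<or> q = 1 \<and> r = 0 \<and> i > j \<and>
            ((\<alpha>, \<beta>) \<in> rees_cong (part_monoid n) (I_ideal n 1) - (lambda_rel n 1 \<union> rho_rel n 1)
             \<or> (\<alpha>, \<beta>) \<in> lambda_rel n 1 - mu_rel n 1 \<or> (\<alpha>, \<beta>) \<in> rho_rel n 1 - mu_rel n 1)
        \<or> q = 0 \<and> i \<le> j \<and>
            ((\<alpha>, \<beta>) \<in> rees_cong (part_monoid n) (I_ideal n 0) - (lambda_rel n 0 \<union> rho_rel n 0)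
             \<or> (\<alpha>, \<beta>) \<in> lambda_rel n 0 - Id_on (D_class n 0)
             \<or> (\<alpha>, \<beta>) \<in> rho_rel n 0 - Id_on (D_class n 0))
        \<or> q = 1 \<and> r = 1 \<and> i = j \<and>
            ((\<alpha>, \<beta>) \<in> mu_rel n 1 - (mu_up_rel n \<union> mu_down_rel n)
             \<or> (\<alpha>, \<beta>) \<in> mu_up_rel n - Id_on (D_class n 1)
             \<or> (\<alpha>, \<beta>) \<in> mu_down_rel n - Id_on (D_class n 1))
        \<or> q = 1 \<and> r = 1 \<and> i < j \<and> (\<alpha>, \<beta>) \<in> mu_rel n 1 - Id_on (D_class n 1)
        \<or> q = 1 \<and> r = 0 \<and> i \<le> j \<and> hat \<alpha> = \<beta>
        \<or> q = 1 \<and> r = 0 \<and> i = j + 1 \<and> hat \<alpha> = \<beta>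
        \<or> q = 1 \<and> r = 0 \<and> i > j + 1 \<and> hat \<alpha> = \<beta>))"
proof (rule conjI, goal_cases)
 case 1
 show ?case
 proof (intro allI impI, elim conjE, goal_cases)
  case (1 i al j be q r C)
  note ab = 1(1,2) and q = 1(3) and r = 1(4) and C = 1(6)
  have le: "rank be <= rank al" "rank be = rank al ==> i <= j" using 1(5) unfolding q r by auto
  have k1: "(al, be) : rees_cong (part_monoid n) (I_ideal n 1) - (lambda_rel n 1 \<union> rho_rel n 1) & \<xi> = E_R
     | (al, be) : lambda_rel n 1 - mu_rel n 1 & \<xi> = E_lambda
     | (al, be) : rho_rel n 1 - mu_rel n 1 & \<xi> = E_rho <-> kind al be \<xi>" if "rank al = 1" for \<xi>
   by (rule kind_1[OF ab]) (use that le(1) in simp_all)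
  \<comment> \<open>Items (i) and (iii) assert two equations each, so the sixteen items give
    eighteen goals.\<close>
  show ?case unfolding q r C Let_def
  proof (intro conjI allI impI, goal_cases)
   case 1 then show ?case using item_i(1)[OF assms ab(1)] by simp
  next
   case 2 then show ?case using item_i(2)[OF assms ab(1)] by simp
  next
   case 3 then show ?case using item_ii[OF assms ab(1)] by simp
  next
   case 4 then show ?case using item_iii(1)[OF assms ab _ le(1) _ refl refl refl] by blast
  next
   case 5 then show ?case using item_iii(2)[OF assms ab _ le(1) _ refl refl refl] by blast
  next
   case 6 then show ?case using item_iv_v(1)[OF assms refl _ _ _ refl] by blast
  next
   case 7
   then have "al ~= be" using pdiff_id_iff[OF ab pdiff_diff_perm] by blast
   then show ?case using item_iv_v(2)[OF assms refl _ _ _ refl] 7 by blast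
  next
   case 8 then show ?case using item_vi[OF assms refl _ _ _ _ refl] by blast
  next
   case 9 then show ?case using item_vii_viii(1)[OF assms] by blast
  next
   case 10 then show ?case using item_vii_viii(2)[OF assms _ _ _ _ refl] by blast
  next
   case (11 \<xi>) then show ?case using item_ix[OF assms ab _ _ _ k1[THEN iffD1]] le(1) by auto
  next
   case (12 \<xi>) then show ?case using item_x[OF assms ab _ _ _ k1[THEN iffD1]] by blast
  next
   case (13 \<xi>)
   then have z: "rank al <= 0" "rank be <= 0" using le(1) by simp_all
   show ?case using item_xi[OF assms ab _ _ _ kind_0[OF ab z, THEN iffD1]] 13 z by blast
  next
   case (14 ze)
   then have z: "rank al = 1" "rank be = 1" "i = j" by blast+
   show ?case using item_xii[OF assms ab z(1,2), of ze i] mu_kind_iff(1)[OF ab z(1,2), of ze] 14 unfolding z(3) by blast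
  next
   case 15 then show ?case using item_xiii[OF assms ab] mu_kind_iff(2)[OF ab] by blast
  next
   case 16 then show ?case using item_xiv_xv_xvi(1)[OF assms ab(1)] by blast
  next
   case 17 then show ?case using item_xiv_xv_xvi(2)[OF assms ab(1)] by blast
  next
   case 18 then show ?case using item_xiv_xv_xvi(3)[OF assms ab(1) _ _ refl] by blast
  qed
 qed
next
 case 2
 show ?case
 proof (intro ballI)
  fix a b assume m: "a : carrier (twisted_monoid n)" "b : carrier (twisted_monoid n)"
  obtain i al j be where e: "a = (i, al)" "b = (j, be)" by (cases a; cases b)
  have ab: "al : partitions n" "be : partitions n" using m unfolding e twisted_monoid_def by auto
  \<comment> \<open>If the pair is not in the required order, its members are exchanged, which does
    not change the generated congruence.\<close>
  consider "rank al > rank be | rank al = rank be & i <= j" | "rank be > rank al | rank be = rank al & j <= i" by linarith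
  then show "EX i al j be q r. al : partitions n & be : partitions n & q = rank al & r = rank be &
    (q > r | q = r & i <= j) &
    principal_cong (twisted_monoid n) a b = principal_cong (twisted_monoid n) (i, al) (j, be) &
    (al = be & i = j
    | al = be & i < j
    | q >= 2 & (al, be) ~: green_H (part_monoid n)
    | q >= 3 & i = j & (al, be) : green_H (part_monoid n) & al ~= be
    | q >= 3 & i < j & (al, be) : green_H (part_monoid n) & diff_perm al be : Alt q - {id}
    | q >= 3 & i < j & (al, be) : green_H (part_monoid n) & diff_perm al be ~: Alt q
    | q = 2 & i = j & (al, be) : green_H (part_monoid n) & al ~= be
    | q = 2 & i < j & (al, be) : green_H (part_monoid n) & al ~= be
    | q = 1 & i <= j &
      ((al, be) : rees_cong (part_monoid n) (I_ideal n 1) - (lambda_rel n 1 \<union> rho_rel n 1)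
       | (al, be) : lambda_rel n 1 - mu_rel n 1 | (al, be) : rho_rel n 1 - mu_rel n 1)
    | q = 1 & r = 0 & i > j &
      ((al, be) : rees_cong (part_monoid n) (I_ideal n 1) - (lambda_rel n 1 \<union> rho_rel n 1)
       | (al, be) : lambda_rel n 1 - mu_rel n 1 | (al, be) : rho_rel n 1 - mu_rel n 1)
    | q = 0 & i <= j &
      ((al, be) : rees_cong (part_monoid n) (I_ideal n 0) - (lambda_rel n 0 \<union> rho_rel n 0)
       | (al, be) : lambda_rel n 0 - Id_on (D_class n 0)
       | (al, be) : rho_rel n 0 - Id_on (D_class n 0))
    | q = 1 & r = 1 & i = j &
      ((al, be) : mu_rel n 1 - (mu_up_rel n \<union> mu_down_rel n)
       | (al, be) : mu_up_rel n - Id_on (D_class n 1)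
       | (al, be) : mu_down_rel n - Id_on (D_class n 1))
    | q = 1 & r = 1 & i < j & (al, be) : mu_rel n 1 - Id_on (D_class n 1)
    | q = 1 & r = 0 & i <= j & hat al = be
    | q = 1 & r = 0 & i = j + 1 & hat al = be
    | q = 1 & r = 0 & i > j + 1 & hat al = be)"
  proof cases
   case 1
   show ?thesis
    by (rule exI[of _ i], rule exI[of _ al], rule exI[of _ j], rule exI[of _ be], rule exI[of _ "rank al"], rule exI[of _ "rank be"])
     (intro conjI refl ab 1 exhaustion[OF ab 1]; simp only: e)
  next
   case 2
   show ?thesis
    by (rule exI[of _ j], rule exI[of _ be], rule exI[of _ i], rule exI[of _ al], rule exI[of _ "rank be"], rule exI[of _ "rank al"])
     (intro conjI refl ab 2 exhaustion[OF ab(2,1) 2]; simp only: e principal_cong_swap[of _ "(i, al)"])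
  qed
 qed
qed

end
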